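(* The assignments $\Gamma$ and $\overline{(-)}$ provide a 2-equivalence of 2-categories $\mathrm{DISTMULT}\simeq\mathrm{PLMND}$.
   Context: **Enriched graphs.** For a category $V$, $\mathcal{G}V$ has as objects $V$-graphs $X$ (a set $X_0$ with $X(a,b)\in V$ for $a,b\in X_0$) and as morphisms functions on objects with maps $X(a,b)\to Y(fa,fb)$ on homs. $\mathcal{G}$ is a 2-functor, acting on functors and natural transformations homwise, and $\mathcal{G}V$ is regarded as an object of $\mathbf{CAT}/\mathbf{Set}$ via $X\mapsto X_0$. A functor, natural transformation or monad is *over $\mathbf{Set}$* if it lives in $\mathbf{CAT}/\mathbf{Set}$ (functors preserve object sets; components of transformations are identities on objects). If $V$ has an initial object $\emptyset$, a sequence $(Z_1,\dots,Z_n)$ is regarded as the $V$-graph with objects $\{0,\dots,n\}$, hom $Z_i$ from $i-1$ to $i$, and all other homs $\emptyset$. **DISTMULT.** $MV$ is the category of finite sequences from $V$ (morphisms between sequences of equal length). A multitensor on $V$ is a functor $E:MV\to V$ with natural $u_Z:Z\to E(Z)$, $\sigma:\mathop{E}_i\mathop{E}_jZ_{ij}\to\mathop{E}_{ij}Z_{ij}$ satisfying unit and associativity laws; $(V,E)$ is then a lax monoidal category. If $V$ has small coproducts, $E$ is distributive if it preserves coproducts in each variable. A lax monoidal functor $(H,\psi):(V,E)\to(W,F)$ is a functor $H$ with natural $\psi:\mathop{F}_iHX_i\to H\mathop{E}_iX_i$ such that $\psi u_{HX}=Hu_X$ and $\psi\circ\sigma H=H\sigma\circ\psi\circ\mathop{F}_i\psi$.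 A monoidal transformation $(H,\psi)\to(K,\kappa)$ is a natural $\phi:H\to K$ with $\phi\circ\psi=\kappa\circ\mathop{F}_i\phi$. $\mathrm{DISTMULT}$ is the 2-category of pairs $(V,E)$ with $V$ having coproducts and $E$ a distributive multitensor, lax monoidal functors and monoidal transformations. **PLMND.** For $T:\mathcal{G}V\to\mathcal{G}W$ over $\mathbf{Set}$ put $\overline{T}(Z_1,\dots,Z_n)=T(Z_1,\dots,Z_n)(0,n)$, giving $\overline{T}:MV\to W$. $T$ is *distributive* if $\overline{T}$ preserves coproducts in each variable. For $X\in\mathcal{G}V$ and $x=(x_0,\dots,x_n)$ in $X_0$ let $x^*X=(X(x_0,x_1),\dots,X(x_{n-1},x_n))$ and let $\overline{x}:x^*X\to X$ be $i\mapsto x_i$ on objects and the identity on each hom from $i-1$ to $i$. $T$ is *path-like* if for all $X$ and $a,b\in X_0$ the maps $T\overline{x}_{0,n}:Tx^*X(0,n)\to TX(a,b)$, over all $n$ and all $x$ with $x_0=a$, $x_n=b$, form a coproduct cocone in $W$. $\mathrm{PLMND}$ has as objects monads $(\mathcal{G}V,T)$ over $\mathbf{Set}$ with $V$ having coproducts and $T$ distributive and path-like. Arrows $(\mathcal{G}V,T)\to(\mathcal{G}W,S)$ are monad functors of the form $(\mathcal{G}H,\psi)$ with $H:V\to W$ a functor and $\psi:S\,\mathcal{G}H\to\mathcal{G}H\,T$ over $\mathbf{Set}$, compatible with units and multiplications. 2-cells $(\mathcal{G}H,\psi)\to(\mathcal{G}K,\kappa)$ are monad transformations of the form $\mathcal{G}\phi$,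 $\phi:H\to K$, i.e. $\mathcal{G}\phi T\circ\psi=\kappa\circ S\mathcal{G}\phi$. **$\Gamma$.** $\Gamma(V,E)=(\mathcal{G}V,\Gamma E)$ where $\Gamma E$ is the identity on objects and $\Gamma E X(a,b)=\coprod_{a=x_0,\dots,x_n=b}\mathop{E}_iX(x_{i-1},x_i)$. Its unit is $u$ followed by the coproduct inclusion at $(a,b)$. Its multiplication, after decomposing $(\Gamma E)^2X(a,b)$ by distributivity as a coproduct of objects $\mathop{E}_i\mathop{E}_jX(\dots)$, is given by $\sigma$ into the summand of the concatenated sequence. $\Gamma(H,\psi)=(\mathcal{G}H,\Gamma\psi)$, where the hom maps of $\Gamma\psi$ are $\coprod\psi:\coprod\mathop{F}_iHX(x_{i-1},x_i)\to\coprod H\mathop{E}_iX(x_{i-1},x_i)$ followed by the canonical map to $H\coprod\mathop{E}_iX(x_{i-1},x_i)$. $\Gamma\phi=\mathcal{G}\phi$. **$\overline{(-)}$.** It sends a monad $(\mathcal{G}V,T)$ to $(V,\overline{T})$ with unit $\overline{\eta}_Z=(\eta_{(Z)})_{0,1}$ and substitution $\mu_{0,n_\bullet}\circ(T\tilde\tau)_{0,k}$. Here $n_\bullet=n_1+\dots+n_k$ and $\tilde\tau:(\overline{T}_jZ_{1j},\dots,\overline{T}_jZ_{kj})\to T(Z_{11},\dots,Z_{kn_k})$ sends $i\mapsto n_1+\dots+n_i$ and has as hom map from $i-1$ to $i$ the one obtained by applying $T$ to the subsequence inclusion $(Z_{i1},\dots,Z_{in_i})\to(Z_{11},\dots,Z_{kn_k})$.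 It sends $(\mathcal{G}H,\psi)$ to $H$ with the coherence maps obtained from the hom from $0$ to $n$ of $\psi_{(X_1,\dots,X_n)}$ (precomposed with the hom map of $S$ applied to the canonical map $(HX_1,\dots,HX_n)\to\mathcal{G}H(X_1,\dots,X_n)$), and sends $\mathcal{G}\phi$ to $\phi$. *)

theory Defs
  imports "HOL-Library.FuncSet" "HOL-Library.Equipollence"
begin

section \<open>Categories, functors, natural transformations, monads\<close>

record ('o, 'a) cat =
  Obj :: "'o set"
  Arr :: "'a set"
  Dom :: "'a \<Rightarrow> 'o"
  Cod :: "'a \<Rightarrow> 'o"
  Idt :: "'o \<Rightarrow> 'a"
  Cmp :: "'a \<Rightarrow> 'a \<Rightarrow> 'a"

abbreviation cmp_in :: "'a \<Rightarrow> ('o, 'a) cat \<Rightarrow> 'a \<Rightarrow> 'a"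
    ("(_/ \<cdot>\<^bsub>_\<^esub>/ _)" [56, 0, 55] 55)
  where "g \<cdot>\<^bsub>C\<^esub> f \<equiv> Cmp C g f"

definition hom :: "('o, 'a) cat \<Rightarrow> 'o \<Rightarrow> 'o \<Rightarrow> 'a set" where
  "hom C a b = {f \<in> Arr C. Dom C f = a \<and> Cod C f = b}"

locale category =
  fixes C :: "('o, 'a) cat"
  assumes Dom_closed: "f \<in> Arr C \<Longrightarrow> Dom C f \<in> Obj C"
    and Cod_closed: "f \<in> Arr C \<Longrightarrow> Cod C f \<in> Obj C"
    and Idt_hom: "a \<in> Obj C \<Longrightarrow> Idt C a \<in> hom C a a"
    and Cmp_hom: "\<lbrakk>f \<in> hom C a b; g \<in> hom C b c\<rbrakk> \<Longrightarrow> g \<cdot>\<^bsub>C\<^esub> f \<in> hom C a c"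
    and Idt_left: "f \<in> hom C a b \<Longrightarrow> Idt C b \<cdot>\<^bsub>C\<^esub> f = f"
    and Idt_right: "f \<in> hom C a b \<Longrightarrow> f \<cdot>\<^bsub>C\<^esub> Idt C a = f"
    and Cmp_assoc: "\<lbrakk>f \<in> hom C a b; g \<in> hom C b c; h \<in> hom C c d\<rbrakk>
        \<Longrightarrow> (h \<cdot>\<^bsub>C\<^esub> g) \<cdot>\<^bsub>C\<^esub> f = h \<cdot>\<^bsub>C\<^esub> (g \<cdot>\<^bsub>C\<^esub> f)"

text \<open>
  Functors, natural transformations and all the structure below are extensional (undefined
  outside of their domain), so that equality of 1-cells and of 2-cells is equality in HOL.
\<close>

datatype ('o1, 'a1, 'o2, 'a2) ftor = Ftor (fob: "'o1 \<Rightarrow> 'o2") (far: "'a1 \<Rightarrow> 'a2")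

locale is_functor =
  fixes C :: "('o1, 'a1) cat" and D :: "('o2, 'a2) cat" and F :: "('o1, 'a1, 'o2, 'a2) ftor"
  assumes source_category: "category C"
    and target_category: "category D"
    and fob_closed: "fob F \<in> Obj C \<rightarrow>\<^sub>E Obj D"
    and far_extensional: "far F \<in> extensional (Arr C)"
    and far_hom: "f \<in> hom C a b \<Longrightarrow> far F f \<in> hom D (fob F a) (fob F b)"
    and far_Idt: "a \<in> Obj C \<Longrightarrow> far F (Idt C a) = Idt D (fob F a)"
    and far_Cmp: "\<lbrakk>f \<in> hom C a b; g \<in> hom C b c\<rbrakk>
        \<Longrightarrow> far F (g \<cdot>\<^bsub>C\<^esub> f) = far F g \<cdot>\<^bsub>D\<^esub> far F f"

definition fid :: "('o, 'a) cat \<Rightarrow> ('o, 'a, 'o, 'a) ftor" where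
  "fid C = Ftor (\<lambda>a\<in>Obj C. a) (\<lambda>f\<in>Arr C. f)"

definition fcomp :: "('o1, 'a1) cat \<Rightarrow> ('o2, 'a2, 'o3, 'a3) ftor \<Rightarrow> ('o1, 'a1, 'o2, 'a2) ftor
    \<Rightarrow> ('o1, 'a1, 'o3, 'a3) ftor" where
  "fcomp C G F = Ftor (\<lambda>a\<in>Obj C. fob G (fob F a)) (\<lambda>f\<in>Arr C. far G (far F f))"

locale nat_trans =
  fixes C :: "('o1, 'a1) cat" and D :: "('o2, 'a2) cat"
    and F G :: "('o1, 'a1, 'o2, 'a2) ftor" and \<tau> :: "'o1 \<Rightarrow> 'a2"
  assumes source_functor: "is_functor C D F"
    and target_functor: "is_functor C D G"
    and components_extensional: "\<tau> \<in> extensional (Obj C)"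
    and component_hom: "a \<in> Obj C \<Longrightarrow> \<tau> a \<in> hom D (fob F a) (fob G a)"
    and naturality: "f \<in> hom C a b \<Longrightarrow> \<tau> b \<cdot>\<^bsub>D\<^esub> far F f = far G f \<cdot>\<^bsub>D\<^esub> \<tau> a"

datatype ('o, 'a) monad =
  Monad (mnd_fun: "('o, 'a, 'o, 'a) ftor") (mnd_unit: "'o \<Rightarrow> 'a") (mnd_mult: "'o \<Rightarrow> 'a")

locale is_monad =
  fixes C :: "('o, 'a) cat" and T :: "('o, 'a) monad"
  assumes unit_natural: "nat_trans C C (fid C) (mnd_fun T) (mnd_unit T)"
    and mult_natural: "nat_trans C C (fcomp C (mnd_fun T) (mnd_fun T)) (mnd_fun T) (mnd_mult T)"
    and unit_left: "a \<in> Obj C \<Longrightarrow>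
        mnd_mult T a \<cdot>\<^bsub>C\<^esub> mnd_unit T (fob (mnd_fun T) a) = Idt C (fob (mnd_fun T) a)"
    and unit_right: "a \<in> Obj C \<Longrightarrow>
        mnd_mult T a \<cdot>\<^bsub>C\<^esub> far (mnd_fun T) (mnd_unit T a) = Idt C (fob (mnd_fun T) a)"
    and mult_assoc: "a \<in> Obj C \<Longrightarrow>
        mnd_mult T a \<cdot>\<^bsub>C\<^esub> far (mnd_fun T) (mnd_mult T a)
          = mnd_mult T a \<cdot>\<^bsub>C\<^esub> mnd_mult T (fob (mnd_fun T) a)"


section \<open>Coproducts\<close>

definition is_coproduct ::
    "('o, 'a) cat \<Rightarrow> 'i set \<Rightarrow> ('i \<Rightarrow> 'o) \<Rightarrow> 'o \<Rightarrow> ('i \<Rightarrow> 'a) \<Rightarrow> bool" where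
  "is_coproduct C I A c \<iota> \<longleftrightarrow>
     c \<in> Obj C \<and> (\<forall>i\<in>I. \<iota> i \<in> hom C (A i) c) \<and>
     (\<forall>d\<in>Obj C. \<forall>f. (\<forall>i\<in>I. f i \<in> hom C (A i) d) \<longrightarrow>
        (\<exists>!h. h \<in> hom C c d \<and> (\<forall>i\<in>I. h \<cdot>\<^bsub>C\<^esub> \<iota> i = f i)))"

text \<open>
  The category of sets over which graphs are formed is that of the small subsets of a type
  \<open>'u\<close>. Smallness is any notion with the closure properties below; for instance all subsets of
  an infinite type are small, or those of cardinality less than a given uncountable regular
  (in particular, inaccessible) cardinal.
\<close>

locale smallness =
  fixes small :: "'u set \<Rightarrow> bool"
  assumes small_infinite: "\<exists>A. small A \<and> infinite A"
    and small_lepoll: "\<lbrakk>small A; B \<lesssim> A\<rbrakk> \<Longrightarrow> small B"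
    and small_UN: "\<lbrakk>small I; \<And>i. i \<in> I \<Longrightarrow> small (J i)\<rbrakk> \<Longrightarrow> small (\<Union>i\<in>I. J i)"

definition has_coproducts :: "('u set \<Rightarrow> bool) \<Rightarrow> ('o, 'a) cat \<Rightarrow> bool" where
  "has_coproducts small C \<longleftrightarrow>
     (\<forall>(I :: 'u set) A. small I \<and> (\<forall>i\<in>I. A i \<in> Obj C) \<longrightarrow> (\<exists>c \<iota>. is_coproduct C I A c \<iota>))"

definition chosen_coproduct :: "('o, 'a) cat \<Rightarrow> 'i set \<Rightarrow> ('i \<Rightarrow> 'o) \<Rightarrow> 'o \<times> ('i \<Rightarrow> 'a)" where
  "chosen_coproduct C I A = (SOME p. is_coproduct C I A (fst p) (snd p))"

definition coprod :: "('o, 'a) cat \<Rightarrow> 'i set \<Rightarrow> ('i \<Rightarrow> 'o) \<Rightarrow> 'o" where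
  "coprod C I A = fst (chosen_coproduct C I A)"

definition coprod_in :: "('o, 'a) cat \<Rightarrow> 'i set \<Rightarrow> ('i \<Rightarrow> 'o) \<Rightarrow> 'i \<Rightarrow> 'a" where
  "coprod_in C I A = snd (chosen_coproduct C I A)"

definition copair :: "('o, 'a) cat \<Rightarrow> 'i set \<Rightarrow> ('i \<Rightarrow> 'o) \<Rightarrow> 'o \<Rightarrow> ('i \<Rightarrow> 'a) \<Rightarrow> 'a" where
  "copair C I A d f =
     (THE h. h \<in> hom C (coprod C I A) d \<and> (\<forall>i\<in>I. h \<cdot>\<^bsub>C\<^esub> coprod_in C I A i = f i))"

definition coprod_map ::
    "('o, 'a) cat \<Rightarrow> 'i set \<Rightarrow> ('i \<Rightarrow> 'o) \<Rightarrow> ('i \<Rightarrow> 'o) \<Rightarrow> ('i \<Rightarrow> 'a) \<Rightarrow> 'a" where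
  "coprod_map C I A B f = copair C I A (coprod C I B) (\<lambda>i. coprod_in C I B i \<cdot>\<^bsub>C\<^esub> f i)"

definition initial_ob :: "('o, 'a) cat \<Rightarrow> 'o" where
  "initial_ob C = (SOME c. c \<in> Obj C \<and> (\<forall>d\<in>Obj C. \<exists>!f. f \<in> hom C c d))"

definition from_initial :: "('o, 'a) cat \<Rightarrow> 'o \<Rightarrow> 'a" where
  "from_initial C d = (THE f. f \<in> hom C (initial_ob C) d)"


section \<open>Finite sequences and multitensors\<close>

text \<open>The category \<open>MV\<close>, functorial in \<open>V\<close>, with the unit and multiplication of the monad \<open>M\<close>.\<close>

definition seq_cat :: "('o, 'a) cat \<Rightarrow> ('o list, 'a list) cat" where
  "seq_cat V = \<lparr>Obj = lists (Obj V), Arr = lists (Arr V), Dom = map (Dom V), Cod = map (Cod V),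
     Idt = map (Idt V), Cmp = map2 (Cmp V)\<rparr>"

definition seq_fun :: "('o1, 'a1) cat \<Rightarrow> ('o1, 'a1, 'o2, 'a2) ftor
    \<Rightarrow> ('o1 list, 'a1 list, 'o2 list, 'a2 list) ftor" where
  "seq_fun V H = Ftor (\<lambda>Z\<in>lists (Obj V). map (fob H) Z) (\<lambda>f\<in>lists (Arr V). map (far H) f)"

definition singleton_fun :: "('o, 'a) cat \<Rightarrow> ('o, 'a, 'o list, 'a list) ftor" where
  "singleton_fun V = Ftor (\<lambda>Z\<in>Obj V. [Z]) (\<lambda>f\<in>Arr V. [f])"

definition concat_fun :: "('o, 'a) cat \<Rightarrow> ('o list list, 'a list list, 'o list, 'a list) ftor" where
  "concat_fun V =
     Ftor (\<lambda>Z\<in>lists (lists (Obj V)). concat Z) (\<lambda>f\<in>lists (lists (Arr V)). concat f)"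

datatype ('o, 'a) multitensor =
  Multitensor (mt_fun: "('o list, 'a list, 'o, 'a) ftor") (mt_unit: "'o \<Rightarrow> 'a")
    (mt_sub: "'o list list \<Rightarrow> 'a")

abbreviation mt_ob :: "('o, 'a) multitensor \<Rightarrow> 'o list \<Rightarrow> 'o" where
  "mt_ob E \<equiv> fob (mt_fun E)"

abbreviation mt_ar :: "('o, 'a) multitensor \<Rightarrow> 'a list \<Rightarrow> 'a" where
  "mt_ar E \<equiv> far (mt_fun E)"

locale is_multitensor =
  fixes V :: "('o, 'a) cat" and E :: "('o, 'a) multitensor"
  assumes unit_natural:
      "nat_trans V V (fid V) (fcomp V (mt_fun E) (singleton_fun V)) (mt_unit E)"
    and sub_natural:
      "nat_trans (seq_cat (seq_cat V)) V
         (fcomp (seq_cat (seq_cat V)) (mt_fun E) (seq_fun (seq_cat V) (mt_fun E)))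
         (fcomp (seq_cat (seq_cat V)) (mt_fun E) (concat_fun V)) (mt_sub E)"
    and unit_outer: "Z \<in> lists (Obj V) \<Longrightarrow>
        mt_sub E [Z] \<cdot>\<^bsub>V\<^esub> mt_unit E (mt_ob E Z) = Idt V (mt_ob E Z)"
    and unit_inner: "Z \<in> lists (Obj V) \<Longrightarrow>
        mt_sub E (map (\<lambda>z. [z]) Z) \<cdot>\<^bsub>V\<^esub> mt_ar E (map (mt_unit E) Z) = Idt V (mt_ob E Z)"
    and sub_assoc: "Zsss \<in> lists (lists (lists (Obj V))) \<Longrightarrow>
        mt_sub E (map concat Zsss) \<cdot>\<^bsub>V\<^esub> mt_ar E (map (mt_sub E) Zsss)
          = mt_sub E (concat Zsss) \<cdot>\<^bsub>V\<^esub> mt_sub E (map (map (mt_ob E)) Zsss)"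

definition preserves_coproducts_in_each_variable ::
    "('u set \<Rightarrow> bool) \<Rightarrow> ('o1, 'a1) cat \<Rightarrow> ('o2, 'a2) cat \<Rightarrow> ('o1 list, 'a1 list, 'o2, 'a2) ftor
      \<Rightarrow> bool" where
  "preserves_coproducts_in_each_variable small V W E \<longleftrightarrow>
     (\<forall>xs\<in>lists (Obj V). \<forall>ys\<in>lists (Obj V). \<forall>(I :: 'u set) A c \<iota>.
        small I \<and> is_coproduct V I A c \<iota> \<longrightarrow>
        is_coproduct W I (\<lambda>i. fob E (xs @ A i # ys)) (fob E (xs @ c # ys))
          (\<lambda>i. far E (map (Idt V) xs @ \<iota> i # map (Idt V) ys)))"

locale is_lax_monoidal =
  fixes V :: "('o1, 'a1) cat" and E :: "('o1, 'a1) multitensor"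
    and W :: "('o2, 'a2) cat" and F :: "('o2, 'a2) multitensor"
    and H :: "('o1, 'a1, 'o2, 'a2) ftor" and \<psi> :: "'o1 list \<Rightarrow> 'a2"
  assumes underlying_functor: "is_functor V W H"
    and coherence_natural:
      "nat_trans (seq_cat V) W
         (fcomp (seq_cat V) (mt_fun F) (seq_fun V H)) (fcomp (seq_cat V) H (mt_fun E)) \<psi>"
    and coherence_unit: "Z \<in> Obj V \<Longrightarrow>
        \<psi> [Z] \<cdot>\<^bsub>W\<^esub> mt_unit F (fob H Z) = far H (mt_unit E Z)"
    and coherence_sub: "Zss \<in> lists (lists (Obj V)) \<Longrightarrow>
        \<psi> (concat Zss) \<cdot>\<^bsub>W\<^esub> mt_sub F (map (map (fob H)) Zss)
          = far H (mt_sub E Zss) \<cdot>\<^bsub>W\<^esub> (\<psi> (map (mt_ob E) Zss) \<cdot>\<^bsub>W\<^esub> mt_ar F (map \<psi> Zss))"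

locale is_monoidal_trans =
  fixes V :: "('o1, 'a1) cat" and E :: "('o1, 'a1) multitensor"
    and W :: "('o2, 'a2) cat" and F :: "('o2, 'a2) multitensor"
    and H :: "('o1, 'a1, 'o2, 'a2) ftor" and \<psi> :: "'o1 list \<Rightarrow> 'a2"
    and K :: "('o1, 'a1, 'o2, 'a2) ftor" and \<kappa> :: "'o1 list \<Rightarrow> 'a2"
    and \<phi> :: "'o1 \<Rightarrow> 'a2"
  assumes underlying_trans: "nat_trans V W H K \<phi>"
    and trans_coherence: "X \<in> lists (Obj V) \<Longrightarrow>
        \<phi> (mt_ob E X) \<cdot>\<^bsub>W\<^esub> \<psi> X = \<kappa> X \<cdot>\<^bsub>W\<^esub> mt_ar F (map \<phi> X)"


section \<open>Enriched graphs\<close>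

datatype ('u, 'o) graph = Graph (gobj: "'u set") (ghom: "'u \<Rightarrow> 'u \<Rightarrow> 'o")

datatype ('u, 'o, 'a) gmor =
  Gmor (gdom: "('u, 'o) graph") (gcod: "('u, 'o) graph") (gfun: "'u \<Rightarrow> 'u")
    (gmap: "'u \<Rightarrow> 'u \<Rightarrow> 'a")

definition restrict2 :: "'u set \<Rightarrow> ('u \<Rightarrow> 'u \<Rightarrow> 'b) \<Rightarrow> 'u \<Rightarrow> 'u \<Rightarrow> 'b" where
  "restrict2 A h = (\<lambda>a b. if a \<in> A \<and> b \<in> A then h a b else undefined)"

definition mk_graph :: "'u set \<Rightarrow> ('u \<Rightarrow> 'u \<Rightarrow> 'o) \<Rightarrow> ('u, 'o) graph" where
  "mk_graph A h = Graph A (restrict2 A h)"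

definition mk_gmor :: "('u, 'o) graph \<Rightarrow> ('u, 'o) graph \<Rightarrow> ('u \<Rightarrow> 'u) \<Rightarrow> ('u \<Rightarrow> 'u \<Rightarrow> 'a)
    \<Rightarrow> ('u, 'o, 'a) gmor" where
  "mk_gmor X Y f h = Gmor X Y (restrict f (gobj X)) (restrict2 (gobj X) h)"

definition is_graph :: "('u set \<Rightarrow> bool) \<Rightarrow> ('o, 'a) cat \<Rightarrow> ('u, 'o) graph \<Rightarrow> bool" where
  "is_graph small V X \<longleftrightarrow>
     small (gobj X) \<and> (\<forall>a\<in>gobj X. \<forall>b\<in>gobj X. ghom X a b \<in> Obj V) \<and>
     ghom X = restrict2 (gobj X) (ghom X)"

definition is_gmor :: "('u set \<Rightarrow> bool) \<Rightarrow> ('o, 'a) cat \<Rightarrow> ('u, 'o, 'a) gmor \<Rightarrow> bool" where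
  "is_gmor small V f \<longleftrightarrow>
     is_graph small V (gdom f) \<and> is_graph small V (gcod f) \<and>
     gfun f \<in> gobj (gdom f) \<rightarrow>\<^sub>E gobj (gcod f) \<and>
     (\<forall>a\<in>gobj (gdom f). \<forall>b\<in>gobj (gdom f).
        gmap f a b \<in> hom V (ghom (gdom f) a b) (ghom (gcod f) (gfun f a) (gfun f b))) \<and>
     gmap f = restrict2 (gobj (gdom f)) (gmap f)"

definition graph_cat :: "('u set \<Rightarrow> bool) \<Rightarrow> ('o, 'a) cat \<Rightarrow> (('u, 'o) graph, ('u, 'o, 'a) gmor) cat"
  where
  "graph_cat small V =
     \<lparr>Obj = {X. is_graph small V X}, Arr = {f. is_gmor small V f}, Dom = gdom, Cod = gcod,
      Idt = (\<lambda>X. mk_gmor X X (\<lambda>a. a) (\<lambda>a b. Idt V (ghom X a b))),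
      Cmp = (\<lambda>g f. mk_gmor (gdom f) (gcod g) (\<lambda>a. gfun g (gfun f a))
               (\<lambda>a b. gmap g (gfun f a) (gfun f b) \<cdot>\<^bsub>V\<^esub> gmap f a b))\<rparr>"

definition graph_push :: "('o1, 'a1, 'o2, 'a2) ftor \<Rightarrow> ('u, 'o1) graph \<Rightarrow> ('u, 'o2) graph" where
  "graph_push H X = mk_graph (gobj X) (\<lambda>a b. fob H (ghom X a b))"

definition graph_fun :: "('u set \<Rightarrow> bool) \<Rightarrow> ('o1, 'a1) cat \<Rightarrow> ('o1, 'a1, 'o2, 'a2) ftor
    \<Rightarrow> (('u, 'o1) graph, ('u, 'o1, 'a1) gmor, ('u, 'o2) graph, ('u, 'o2, 'a2) gmor) ftor" where
  "graph_fun small V H =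
     Ftor (\<lambda>X\<in>Obj (graph_cat small V). graph_push H X)
          (\<lambda>f\<in>Arr (graph_cat small V).
             mk_gmor (graph_push H (gdom f)) (graph_push H (gcod f)) (gfun f)
               (\<lambda>a b. far H (gmap f a b)))"

definition graph_nat :: "('u set \<Rightarrow> bool) \<Rightarrow> ('o1, 'a1) cat \<Rightarrow> ('o1, 'a1, 'o2, 'a2) ftor
    \<Rightarrow> ('o1, 'a1, 'o2, 'a2) ftor \<Rightarrow> ('o1 \<Rightarrow> 'a2) \<Rightarrow> ('u, 'o1) graph \<Rightarrow> ('u, 'o2, 'a2) gmor" where
  "graph_nat small V H K \<phi> =
     (\<lambda>X\<in>Obj (graph_cat small V).
        mk_gmor (graph_push H X) (graph_push K X) (\<lambda>a. a) (\<lambda>a b. \<phi> (ghom X a b)))"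

definition functor_over_Set :: "('u set \<Rightarrow> bool) \<Rightarrow> ('o1, 'a1) cat
    \<Rightarrow> (('u, 'o1) graph, ('u, 'o1, 'a1) gmor, ('u, 'o2) graph, ('u, 'o2, 'a2) gmor) ftor
    \<Rightarrow> bool" where
  "functor_over_Set small V T \<longleftrightarrow>
     (\<forall>X\<in>Obj (graph_cat small V). gobj (fob T X) = gobj X) \<and>
     (\<forall>f\<in>Arr (graph_cat small V). gfun (far T f) = gfun f)"

definition nat_over_Set :: "('u set \<Rightarrow> bool) \<Rightarrow> ('o1, 'a1) cat
    \<Rightarrow> (('u, 'o1) graph \<Rightarrow> ('u, 'o2, 'a2) gmor) \<Rightarrow> bool" where
  "nat_over_Set small V \<tau> \<longleftrightarrow>
     (\<forall>X\<in>Obj (graph_cat small V). gfun (\<tau> X) = (\<lambda>a\<in>gobj X. a))"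


section \<open>Sequences as graphs\<close>

text \<open>
  An injection \<open>\<nu> :: nat \<Rightarrow> 'u\<close> realises the objects \<open>0, \<dots>, n\<close> of a sequence as elements of
  \<open>'u\<close>.
\<close>

definition seq_graph :: "(nat \<Rightarrow> 'u) \<Rightarrow> ('o, 'a) cat \<Rightarrow> 'o list \<Rightarrow> ('u, 'o) graph" where
  "seq_graph \<nu> V Z =
     mk_graph (\<nu> ` {..length Z})
       (\<lambda>a b. if inv \<nu> b = Suc (inv \<nu> a) then Z ! inv \<nu> a else initial_ob V)"

text \<open>
  The morphism from the graph of \<open>Z\<close> to \<open>X\<close> given by \<open>i \<mapsto> f i\<close> on objects and by \<open>hs ! i\<close> on
  the hom from \<open>i\<close> to \<open>i + 1\<close>; the other homs of the source are initial.
\<close>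

definition seq_mor :: "(nat \<Rightarrow> 'u) \<Rightarrow> ('o, 'a) cat \<Rightarrow> 'o list \<Rightarrow> ('u, 'o) graph \<Rightarrow> (nat \<Rightarrow> 'u)
    \<Rightarrow> 'a list \<Rightarrow> ('u, 'o, 'a) gmor" where
  "seq_mor \<nu> V Z X f hs =
     mk_gmor (seq_graph \<nu> V Z) X (\<lambda>a. f (inv \<nu> a))
       (\<lambda>a b. if inv \<nu> b = Suc (inv \<nu> a) then hs ! inv \<nu> a
              else from_initial V (ghom X (f (inv \<nu> a)) (f (inv \<nu> b))))"

definition steps :: "'u list \<Rightarrow> ('u \<times> 'u) list" where
  "steps x = zip x (tl x)"

definition paths :: "'u set \<Rightarrow> 'u \<Rightarrow> 'u \<Rightarrow> 'u list set" where
  "paths A a b = {x. x \<noteq> [] \<and> set x \<subseteq> A \<and> hd x = a \<and> last x = b}"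

text \<open>The sequence \<open>x\<^sup>*X\<close> and the morphism from it to \<open>X\<close>.\<close>

definition path_seq :: "('u, 'o) graph \<Rightarrow> 'u list \<Rightarrow> 'o list" where
  "path_seq X x = map (\<lambda>(a, b). ghom X a b) (steps x)"

definition path_mor :: "(nat \<Rightarrow> 'u) \<Rightarrow> ('o, 'a) cat \<Rightarrow> ('u, 'o) graph \<Rightarrow> 'u list
    \<Rightarrow> ('u, 'o, 'a) gmor" where
  "path_mor \<nu> V X x =
     seq_mor \<nu> V (path_seq X x) X (\<lambda>i. x ! i) (map (Idt V) (path_seq X x))"

text \<open>The inclusion of the sequence \<open>ys\<close> into \<open>xs @ ys @ zs\<close>.\<close>

definition subseq_mor :: "(nat \<Rightarrow> 'u) \<Rightarrow> ('o, 'a) cat \<Rightarrow> 'o list \<Rightarrow> 'o list \<Rightarrow> 'o list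
    \<Rightarrow> ('u, 'o, 'a) gmor" where
  "subseq_mor \<nu> V xs ys zs =
     seq_mor \<nu> V ys (seq_graph \<nu> V (xs @ ys @ zs)) (\<lambda>i. \<nu> (length xs + i)) (map (Idt V) ys)"

text \<open>The functor \<open>MV \<rightarrow> W\<close> obtained from a functor \<open>T\<close> from \<open>V\<close>-graphs to \<open>W\<close>-graphs over sets.\<close>

definition bar_fun :: "(nat \<Rightarrow> 'u) \<Rightarrow> ('o1, 'a1) cat
    \<Rightarrow> (('u, 'o1) graph, ('u, 'o1, 'a1) gmor, ('u, 'o2) graph, ('u, 'o2, 'a2) gmor) ftor
    \<Rightarrow> ('o1 list, 'a1 list, 'o2, 'a2) ftor" where
  "bar_fun \<nu> V T =
     Ftor (\<lambda>Z\<in>lists (Obj V). ghom (fob T (seq_graph \<nu> V Z)) (\<nu> 0) (\<nu> (length Z)))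
          (\<lambda>f\<in>lists (Arr V).
             gmap (far T (seq_mor \<nu> V (map (Dom V) f) (seq_graph \<nu> V (map (Cod V) f)) \<nu> f))
               (\<nu> 0) (\<nu> (length f)))"

definition path_like :: "('u set \<Rightarrow> bool) \<Rightarrow> (nat \<Rightarrow> 'u) \<Rightarrow> ('o1, 'a1) cat \<Rightarrow> ('o2, 'a2) cat
    \<Rightarrow> (('u, 'o1) graph, ('u, 'o1, 'a1) gmor, ('u, 'o2) graph, ('u, 'o2, 'a2) gmor) ftor
    \<Rightarrow> bool" where
  "path_like small \<nu> V W T \<longleftrightarrow>
     (\<forall>X\<in>Obj (graph_cat small V). \<forall>a\<in>gobj X. \<forall>b\<in>gobj X.
        is_coproduct W (paths (gobj X) a b)
          (\<lambda>x. ghom (fob T (seq_graph \<nu> V (path_seq X x))) (\<nu> 0) (\<nu> (length x - 1)))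
          (ghom (fob T X) a b)
          (\<lambda>x. gmap (far T (path_mor \<nu> V X x)) (\<nu> 0) (\<nu> (length x - 1))))"


section \<open>2-categories and 2-equivalences\<close>

text \<open>
  A strict 2-category is given by its underlying category of 0-cells and 1-cells, the category of
  1-cells and 2-cells under vertical composition, and horizontal composition of 2-cells.
\<close>

record ('x, 'f, 't) two_cat =
  under :: "('x, 'f) cat"
  vert :: "('f, 't) cat"
  hcmp :: "'t \<Rightarrow> 't \<Rightarrow> 't"

definition horiz :: "('x, 'f, 't) two_cat \<Rightarrow> ('x, 't) cat" where
  "horiz C =
     \<lparr>Obj = Obj (under C), Arr = Arr (vert C),
      Dom = (\<lambda>\<alpha>. Dom (under C) (Dom (vert C) \<alpha>)), Cod = (\<lambda>\<alpha>. Cod (under C) (Cod (vert C) \<alpha>)),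
      Idt = (\<lambda>A. Idt (vert C) (Idt (under C) A)), Cmp = hcmp C\<rparr>"

locale two_category =
  fixes C :: "('x, 'f, 't) two_cat"
  assumes under_category: "category (under C)"
    and vert_category: "category (vert C)"
    and horiz_category: "category (horiz C)"
    and one_cells: "Obj (vert C) = Arr (under C)"
    and parallel: "\<alpha> \<in> hom (vert C) f g \<Longrightarrow>
        Dom (under C) f = Dom (under C) g \<and> Cod (under C) f = Cod (under C) g"
    and hcmp_hom: "\<lbrakk>\<alpha> \<in> hom (vert C) f g; \<beta> \<in> hom (vert C) f' g';
          Cod (under C) f = Dom (under C) f'\<rbrakk>
        \<Longrightarrow> hcmp C \<beta> \<alpha> \<in> hom (vert C) (f' \<cdot>\<^bsub>under C\<^esub> f) (g' \<cdot>\<^bsub>under C\<^esub> g)"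
    and hcmp_Idt: "\<lbrakk>f \<in> hom (under C) A B; f' \<in> hom (under C) B D\<rbrakk>
        \<Longrightarrow> hcmp C (Idt (vert C) f') (Idt (vert C) f) = Idt (vert C) (f' \<cdot>\<^bsub>under C\<^esub> f)"
    and interchange: "\<lbrakk>\<alpha> \<in> hom (vert C) f g; \<beta> \<in> hom (vert C) g h;
          \<alpha>' \<in> hom (vert C) f' g'; \<beta>' \<in> hom (vert C) g' h';
          Cod (under C) f = Dom (under C) f'\<rbrakk>
        \<Longrightarrow> hcmp C (\<beta>' \<cdot>\<^bsub>vert C\<^esub> \<alpha>') (\<beta> \<cdot>\<^bsub>vert C\<^esub> \<alpha>)
          = hcmp C \<beta>' \<beta> \<cdot>\<^bsub>vert C\<^esub> hcmp C \<alpha>' \<alpha>"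

datatype ('x1, 'f1, 't1, 'x2, 'f2, 't2) two_ftor =
  Two_Ftor (on0: "'x1 \<Rightarrow> 'x2") (on1: "'f1 \<Rightarrow> 'f2") (on2: "'t1 \<Rightarrow> 't2")

locale two_functor =
  fixes C :: "('x1, 'f1, 't1) two_cat" and D :: "('x2, 'f2, 't2) two_cat"
    and F :: "('x1, 'f1, 't1, 'x2, 'f2, 't2) two_ftor"
  assumes source_two_category: "two_category C"
    and target_two_category: "two_category D"
    and under_functor: "is_functor (under C) (under D) (Ftor (on0 F) (on1 F))"
    and vert_functor: "is_functor (vert C) (vert D) (Ftor (on1 F) (on2 F))"
    and horiz_functor: "is_functor (horiz C) (horiz D) (Ftor (on0 F) (on2 F))"

definition mk_two_ftor :: "('x1, 'f1, 't1) two_cat \<Rightarrow> ('x1 \<Rightarrow> 'x2) \<Rightarrow> ('f1 \<Rightarrow> 'f2) \<Rightarrow> ('t1 \<Rightarrow> 't2)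
    \<Rightarrow> ('x1, 'f1, 't1, 'x2, 'f2, 't2) two_ftor" where
  "mk_two_ftor C F0 F1 F2 =
     Two_Ftor (restrict F0 (Obj (under C))) (restrict F1 (Arr (under C)))
       (restrict F2 (Arr (vert C)))"

definition two_fid :: "('x, 'f, 't) two_cat \<Rightarrow> ('x, 'f, 't, 'x, 'f, 't) two_ftor" where
  "two_fid C = mk_two_ftor C (\<lambda>A. A) (\<lambda>f. f) (\<lambda>\<alpha>. \<alpha>)"

definition two_fcomp :: "('x1, 'f1, 't1) two_cat \<Rightarrow> ('x2, 'f2, 't2, 'x3, 'f3, 't3) two_ftor
    \<Rightarrow> ('x1, 'f1, 't1, 'x2, 'f2, 't2) two_ftor \<Rightarrow> ('x1, 'f1, 't1, 'x3, 'f3, 't3) two_ftor" where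
  "two_fcomp C G F =
     mk_two_ftor C (\<lambda>A. on0 G (on0 F A)) (\<lambda>f. on1 G (on1 F f)) (\<lambda>\<alpha>. on2 G (on2 F \<alpha>))"

definition is_iso :: "('o, 'a) cat \<Rightarrow> 'o \<Rightarrow> 'o \<Rightarrow> 'a \<Rightarrow> bool" where
  "is_iso C a b f \<longleftrightarrow> f \<in> hom C a b \<and>
     (\<exists>g\<in>hom C b a. g \<cdot>\<^bsub>C\<^esub> f = Idt C a \<and> f \<cdot>\<^bsub>C\<^esub> g = Idt C b)"

locale two_natural_iso =
  fixes C :: "('x1, 'f1, 't1) two_cat" and D :: "('x2, 'f2, 't2) two_cat"
    and F G :: "('x1, 'f1, 't1, 'x2, 'f2, 't2) two_ftor" and \<theta> :: "'x1 \<Rightarrow> 'f2"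
  assumes source_two_functor: "two_functor C D F"
    and target_two_functor: "two_functor C D G"
    and component_iso: "A \<in> Obj (under C) \<Longrightarrow> is_iso (under D) (on0 F A) (on0 G A) (\<theta> A)"
    and one_naturality: "f \<in> hom (under C) A B \<Longrightarrow>
        \<theta> B \<cdot>\<^bsub>under D\<^esub> on1 F f = on1 G f \<cdot>\<^bsub>under D\<^esub> \<theta> A"
    and two_naturality: "\<alpha> \<in> hom (horiz C) A B \<Longrightarrow>
        hcmp D (Idt (vert D) (\<theta> B)) (on2 F \<alpha>) = hcmp D (on2 G \<alpha>) (Idt (vert D) (\<theta> A))"

definition two_equivalence :: "('x1, 'f1, 't1) two_cat \<Rightarrow> ('x2, 'f2, 't2) two_cat
    \<Rightarrow> ('x1, 'f1, 't1, 'x2, 'f2, 't2) two_ftor \<Rightarrow> ('x2, 'f2, 't2, 'x1, 'f1, 't1) two_ftor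
    \<Rightarrow> bool" where
  "two_equivalence C D F G \<longleftrightarrow>
     two_category C \<and> two_category D \<and> two_functor C D F \<and> two_functor D C G \<and>
     (\<exists>\<theta>. two_natural_iso C C (two_fid C) (two_fcomp C G F) \<theta>) \<and>
     (\<exists>\<theta>. two_natural_iso D D (two_fcomp D F G) (two_fid D) \<theta>)"


section \<open>The 2-categories DISTMULT and PLMND\<close>

text \<open>
  In both 2-categories the 0-cells are pairs \<open>(V, E)\<close> of a category and further structure, the
  1-cells from \<open>(V, E)\<close> to \<open>(W, F)\<close> carry pairs \<open>(H, \<psi>)\<close> of a functor \<open>H : V \<rightarrow> W\<close> and
  coherence data, and the 2-cells from \<open>(H, \<psi>)\<close> to \<open>(K, \<kappa>)\<close> carry a natural transformation
  \<open>\<phi> : H \<rightarrow> K\<close>. For PLMND this means that the monad \<open>(\<G>V, T)\<close>, the monad functor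
  \<open>(\<G>H, \<psi>)\<close> and the monad transformation \<open>\<G>\<phi>\<close> are recorded as \<open>(V, T)\<close>, \<open>(H, \<psi>)\<close> and \<open>\<phi>\<close>;
  no information is lost or gained, as \<open>\<G>\<close> is injective on functors and transformations.
\<close>

datatype ('x, 'd) cell = Cell (src: 'x) (tgt: 'x) (dat: 'd)

type_synonym ('o, 'a, 'e, 'p) one_cell =
  "(('o, 'a) cat \<times> 'e, ('o, 'a, 'o, 'a) ftor \<times> 'p) cell"

type_synonym ('o, 'a, 'e, 'p) two_cell = "(('o, 'a, 'e, 'p) one_cell, 'o \<Rightarrow> 'a) cell"

abbreviation cell_ftor :: "('o, 'a, 'e, 'p) one_cell \<Rightarrow> ('o, 'a, 'o, 'a) ftor" where
  "cell_ftor f \<equiv> fst (dat f)"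

definition cell_two_cat ::
    "(('o, 'a) cat \<times> 'e) set \<Rightarrow> ('o, 'a, 'e, 'p) one_cell set \<Rightarrow> ('o, 'a, 'e, 'p) two_cell set
     \<Rightarrow> (('o, 'a) cat \<times> 'e \<Rightarrow> ('o, 'a, 'e, 'p) one_cell)
     \<Rightarrow> (('o, 'a, 'e, 'p) one_cell \<Rightarrow> ('o, 'a, 'e, 'p) one_cell \<Rightarrow> ('o, 'a, 'e, 'p) one_cell)
     \<Rightarrow> (('o, 'a) cat \<times> 'e, ('o, 'a, 'e, 'p) one_cell, ('o, 'a, 'e, 'p) two_cell) two_cat" where
  "cell_two_cat X0 X1 X2 id1 comp1 =
     \<lparr>under = \<lparr>Obj = X0, Arr = X1, Dom = src, Cod = tgt, Idt = id1, Cmp = comp1\<rparr>,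
      vert = \<lparr>Obj = X1, Arr = X2, Dom = src, Cod = tgt,
        Idt = (\<lambda>f. Cell f f
          (\<lambda>Z\<in>Obj (fst (src f)). Idt (fst (tgt f)) (fob (cell_ftor f) Z))),
        Cmp = (\<lambda>\<beta> \<alpha>. Cell (src \<alpha>) (tgt \<beta>)
          (\<lambda>Z\<in>Obj (fst (src (src \<alpha>))). dat \<beta> Z \<cdot>\<^bsub>fst (tgt (src \<alpha>))\<^esub> dat \<alpha> Z))\<rparr>,
      hcmp = (\<lambda>\<beta> \<alpha>. Cell (comp1 (src \<beta>) (src \<alpha>)) (comp1 (tgt \<beta>) (tgt \<alpha>))
        (\<lambda>Z\<in>Obj (fst (src (src \<alpha>))).
           far (cell_ftor (tgt \<beta>)) (dat \<alpha> Z) \<cdot>\<^bsub>fst (tgt (src \<beta>))\<^esub>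
             dat \<beta> (fob (cell_ftor (src \<alpha>)) Z)))\<rparr>"

type_synonym ('o, 'a) dm_0 = "('o, 'a) cat \<times> ('o, 'a) multitensor"
type_synonym ('o, 'a) dm_1 = "('o, 'a, ('o, 'a) multitensor, 'o list \<Rightarrow> 'a) one_cell"
type_synonym ('o, 'a) dm_2 = "('o, 'a, ('o, 'a) multitensor, 'o list \<Rightarrow> 'a) two_cell"

definition dm_objects :: "('u set \<Rightarrow> bool) \<Rightarrow> ('o, 'a) dm_0 set" where
  "dm_objects small =
     {(V, E). category V \<and> has_coproducts small V \<and> is_multitensor V E \<and>
        preserves_coproducts_in_each_variable small V V (mt_fun E)}"

definition dm_arrows :: "('u set \<Rightarrow> bool) \<Rightarrow> ('o, 'a) dm_1 set" where
  "dm_arrows small =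
     {Cell (V, E) (W, F) (H, \<psi>) | V E W F H \<psi>.
        (V, E) \<in> dm_objects small \<and> (W, F) \<in> dm_objects small \<and> is_lax_monoidal V E W F H \<psi>}"

definition dm_two_cells :: "('u set \<Rightarrow> bool) \<Rightarrow> ('o, 'a) dm_2 set" where
  "dm_two_cells small =
     {Cell (Cell (V, E) (W, F) (H, \<psi>)) (Cell (V, E) (W, F) (K, \<kappa>)) \<phi> | V E W F H \<psi> K \<kappa> \<phi>.
        Cell (V, E) (W, F) (H, \<psi>) \<in> dm_arrows small \<and>
        Cell (V, E) (W, F) (K, \<kappa>) \<in> dm_arrows small \<and>
        is_monoidal_trans V E W F H \<psi> K \<kappa> \<phi>}"

fun dm_id :: "('o, 'a) dm_0 \<Rightarrow> ('o, 'a) dm_1" where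
  "dm_id (V, E) = Cell (V, E) (V, E) (fid V, \<lambda>Z\<in>lists (Obj V). Idt V (mt_ob E Z))"

fun dm_comp :: "('o, 'a) dm_1 \<Rightarrow> ('o, 'a) dm_1 \<Rightarrow> ('o, 'a) dm_1" where
  "dm_comp (Cell _ (W, F) (K, \<kappa>)) (Cell (V, E) _ (H, \<psi>)) =
     Cell (V, E) (W, F)
       (fcomp V K H, \<lambda>Z\<in>lists (Obj V). far K (\<psi> Z) \<cdot>\<^bsub>W\<^esub> \<kappa> (map (fob H) Z))"

definition DISTMULT :: "('u set \<Rightarrow> bool) \<Rightarrow> (('o, 'a) dm_0, ('o, 'a) dm_1, ('o, 'a) dm_2) two_cat"
  where
  "DISTMULT small =
     cell_two_cat (dm_objects small) (dm_arrows small) (dm_two_cells small) dm_id dm_comp"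

type_synonym ('u, 'o, 'a) gmonad = "(('u, 'o) graph, ('u, 'o, 'a) gmor) monad"
type_synonym ('u, 'o, 'a) pl_0 = "('o, 'a) cat \<times> ('u, 'o, 'a) gmonad"
type_synonym ('u, 'o, 'a) pl_1 =
  "('o, 'a, ('u, 'o, 'a) gmonad, ('u, 'o) graph \<Rightarrow> ('u, 'o, 'a) gmor) one_cell"
type_synonym ('u, 'o, 'a) pl_2 =
  "('o, 'a, ('u, 'o, 'a) gmonad, ('u, 'o) graph \<Rightarrow> ('u, 'o, 'a) gmor) two_cell"

definition monad_over_Set ::
    "('u set \<Rightarrow> bool) \<Rightarrow> ('o, 'a) cat \<Rightarrow> ('u, 'o, 'a) gmonad \<Rightarrow> bool" where
  "monad_over_Set small V T \<longleftrightarrow>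
     is_monad (graph_cat small V) T \<and> functor_over_Set small V (mnd_fun T) \<and>
     nat_over_Set small V (mnd_unit T) \<and> nat_over_Set small V (mnd_mult T)"

locale is_graph_monad_functor =
  fixes small :: "'u set \<Rightarrow> bool"
    and V :: "('o, 'a) cat" and T :: "('u, 'o, 'a) gmonad"
    and W :: "('o, 'a) cat" and S :: "('u, 'o, 'a) gmonad"
    and H :: "('o, 'a, 'o, 'a) ftor" and \<psi> :: "('u, 'o) graph \<Rightarrow> ('u, 'o, 'a) gmor"
  assumes underlying_functor: "is_functor V W H"
    and coherence_natural:
      "nat_trans (graph_cat small V) (graph_cat small W)
         (fcomp (graph_cat small V) (mnd_fun S) (graph_fun small V H))
         (fcomp (graph_cat small V) (graph_fun small V H) (mnd_fun T)) \<psi>"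
    and coherence_over_Set: "nat_over_Set small V \<psi>"
    and coherence_unit: "X \<in> Obj (graph_cat small V) \<Longrightarrow>
        \<psi> X \<cdot>\<^bsub>graph_cat small W\<^esub> mnd_unit S (fob (graph_fun small V H) X)
          = far (graph_fun small V H) (mnd_unit T X)"
    and coherence_mult: "X \<in> Obj (graph_cat small V) \<Longrightarrow>
        \<psi> X \<cdot>\<^bsub>graph_cat small W\<^esub> mnd_mult S (fob (graph_fun small V H) X)
          = far (graph_fun small V H) (mnd_mult T X) \<cdot>\<^bsub>graph_cat small W\<^esub>
              (\<psi> (fob (mnd_fun T) X) \<cdot>\<^bsub>graph_cat small W\<^esub> far (mnd_fun S) (\<psi> X))"

locale is_graph_monad_trans =
  fixes small :: "'u set \<Rightarrow> bool"
    and V :: "('o, 'a) cat" and T :: "('u, 'o, 'a) gmonad"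
    and W :: "('o, 'a) cat" and S :: "('u, 'o, 'a) gmonad"
    and H :: "('o, 'a, 'o, 'a) ftor" and \<psi> :: "('u, 'o) graph \<Rightarrow> ('u, 'o, 'a) gmor"
    and K :: "('o, 'a, 'o, 'a) ftor" and \<kappa> :: "('u, 'o) graph \<Rightarrow> ('u, 'o, 'a) gmor"
    and \<phi> :: "'o \<Rightarrow> 'a"
  assumes underlying_trans: "nat_trans V W H K \<phi>"
    and trans_coherence: "X \<in> Obj (graph_cat small V) \<Longrightarrow>
        graph_nat small V H K \<phi> (fob (mnd_fun T) X) \<cdot>\<^bsub>graph_cat small W\<^esub> \<psi> X
          = \<kappa> X \<cdot>\<^bsub>graph_cat small W\<^esub> far (mnd_fun S) (graph_nat small V H K \<phi> X)"

definition pl_objects :: "('u set \<Rightarrow> bool) \<Rightarrow> (nat \<Rightarrow> 'u) \<Rightarrow> ('u, 'o, 'a) pl_0 set" where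
  "pl_objects small \<nu> =
     {(V, T). category V \<and> has_coproducts small V \<and> monad_over_Set small V T \<and>
        preserves_coproducts_in_each_variable small V V (bar_fun \<nu> V (mnd_fun T)) \<and>
        path_like small \<nu> V V (mnd_fun T)}"

definition pl_arrows :: "('u set \<Rightarrow> bool) \<Rightarrow> (nat \<Rightarrow> 'u) \<Rightarrow> ('u, 'o, 'a) pl_1 set" where
  "pl_arrows small \<nu> =
     {Cell (V, T) (W, S) (H, \<psi>) | V T W S H \<psi>.
        (V, T) \<in> pl_objects small \<nu> \<and> (W, S) \<in> pl_objects small \<nu> \<and>
        is_graph_monad_functor small V T W S H \<psi>}"

definition pl_two_cells :: "('u set \<Rightarrow> bool) \<Rightarrow> (nat \<Rightarrow> 'u) \<Rightarrow> ('u, 'o, 'a) pl_2 set" where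
  "pl_two_cells small \<nu> =
     {Cell (Cell (V, T) (W, S) (H, \<psi>)) (Cell (V, T) (W, S) (K, \<kappa>)) \<phi> | V T W S H \<psi> K \<kappa> \<phi>.
        Cell (V, T) (W, S) (H, \<psi>) \<in> pl_arrows small \<nu> \<and>
        Cell (V, T) (W, S) (K, \<kappa>) \<in> pl_arrows small \<nu> \<and>
        is_graph_monad_trans small V T W S H \<psi> K \<kappa> \<phi>}"

fun pl_id :: "('u set \<Rightarrow> bool) \<Rightarrow> ('u, 'o, 'a) pl_0 \<Rightarrow> ('u, 'o, 'a) pl_1" where
  "pl_id small (V, T) =
     Cell (V, T) (V, T)
       (fid V, \<lambda>X\<in>Obj (graph_cat small V). Idt (graph_cat small V) (fob (mnd_fun T) X))"

fun pl_comp :: "('u set \<Rightarrow> bool) \<Rightarrow> ('u, 'o, 'a) pl_1 \<Rightarrow> ('u, 'o, 'a) pl_1 \<Rightarrow> ('u, 'o, 'a) pl_1"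
  where
  "pl_comp small (Cell (U, R) (W, S) (K, \<kappa>)) (Cell (V, T) _ (H, \<psi>)) =
     Cell (V, T) (W, S)
       (fcomp V K H,
        \<lambda>X\<in>Obj (graph_cat small V).
          far (graph_fun small U K) (\<psi> X) \<cdot>\<^bsub>graph_cat small W\<^esub>
            \<kappa> (fob (graph_fun small V H) X))"

definition PLMND :: "('u set \<Rightarrow> bool) \<Rightarrow> (nat \<Rightarrow> 'u)
    \<Rightarrow> (('u, 'o, 'a) pl_0, ('u, 'o, 'a) pl_1, ('u, 'o, 'a) pl_2) two_cat" where
  "PLMND small \<nu> =
     cell_two_cat (pl_objects small \<nu>) (pl_arrows small \<nu>) (pl_two_cells small \<nu>)
       (pl_id small) (pl_comp small)"


section \<open>The 2-functor \<open>\<Gamma>\<close>\<close>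

definition Gam_hom :: "('o, 'a) cat \<Rightarrow> ('o, 'a) multitensor \<Rightarrow> ('u, 'o) graph \<Rightarrow> 'u \<Rightarrow> 'u \<Rightarrow> 'o"
  where
  "Gam_hom V E X a b = coprod V (paths (gobj X) a b) (\<lambda>x. mt_ob E (path_seq X x))"

definition Gam_in :: "('o, 'a) cat \<Rightarrow> ('o, 'a) multitensor \<Rightarrow> ('u, 'o) graph \<Rightarrow> 'u list \<Rightarrow> 'a" where
  "Gam_in V E X x =
     coprod_in V (paths (gobj X) (hd x) (last x)) (\<lambda>x. mt_ob E (path_seq X x)) x"

definition Gam_graph :: "('o, 'a) cat \<Rightarrow> ('o, 'a) multitensor \<Rightarrow> ('u, 'o) graph \<Rightarrow> ('u, 'o) graph"
  where
  "Gam_graph V E X = mk_graph (gobj X) (Gam_hom V E X)"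

definition Gam_gmor :: "('o, 'a) cat \<Rightarrow> ('o, 'a) multitensor \<Rightarrow> ('u, 'o, 'a) gmor
    \<Rightarrow> ('u, 'o, 'a) gmor" where
  "Gam_gmor V E f =
     mk_gmor (Gam_graph V E (gdom f)) (Gam_graph V E (gcod f)) (gfun f)
       (\<lambda>a b. copair V (paths (gobj (gdom f)) a b) (\<lambda>x. mt_ob E (path_seq (gdom f) x))
                (Gam_hom V E (gcod f) (gfun f a) (gfun f b))
                (\<lambda>x. Gam_in V E (gcod f) (map (gfun f) x) \<cdot>\<^bsub>V\<^esub>
                       mt_ar E (map (\<lambda>(c, d). gmap f c d) (steps x))))"

definition Gam_unit :: "('o, 'a) cat \<Rightarrow> ('o, 'a) multitensor \<Rightarrow> ('u, 'o) graph \<Rightarrow> ('u, 'o, 'a) gmor"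
  where
  "Gam_unit V E X =
     mk_gmor X (Gam_graph V E X) (\<lambda>a. a)
       (\<lambda>a b. Gam_in V E X [a, b] \<cdot>\<^bsub>V\<^esub> mt_unit E (ghom X a b))"

text \<open>
  A refinement of a path \<open>y = [y\<^sub>0, \<dots>, y\<^sub>k]\<close> is a list of \<open>k\<close> paths, the \<open>i\<close>-th one from
  \<open>y\<^sub>i\<^sub>-\<^sub>1\<close> to \<open>y\<^sub>i\<close>; these index the summands in the decomposition by distributivity of the
  \<open>y\<close>-th summand of the twofold application of \<open>\<Gamma>E\<close>.
\<close>

definition refinements :: "'u set \<Rightarrow> 'u list \<Rightarrow> 'u list list set" where
  "refinements A y = listset (map (\<lambda>(c, d). paths A c d) (steps y))"

definition path_concat :: "'u \<Rightarrow> 'u list list \<Rightarrow> 'u list" where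
  "path_concat a xs = a # concat (map tl xs)"

definition Gam_mult :: "('o, 'a) cat \<Rightarrow> ('o, 'a) multitensor \<Rightarrow> ('u, 'o) graph \<Rightarrow> ('u, 'o, 'a) gmor"
  where
  "Gam_mult V E X =
     mk_gmor (Gam_graph V E (Gam_graph V E X)) (Gam_graph V E X) (\<lambda>a. a)
       (\<lambda>a b. THE h. h \<in> hom V (Gam_hom V E (Gam_graph V E X) a b) (Gam_hom V E X a b) \<and>
          (\<forall>y\<in>paths (gobj X) a b. \<forall>xs\<in>refinements (gobj X) y.
             h \<cdot>\<^bsub>V\<^esub> (Gam_in V E (Gam_graph V E X) y \<cdot>\<^bsub>V\<^esub> mt_ar E (map (Gam_in V E X) xs))
               = Gam_in V E X (path_concat a xs) \<cdot>\<^bsub>V\<^esub> mt_sub E (map (path_seq X) xs)))"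

definition Gam_monad :: "('u set \<Rightarrow> bool) \<Rightarrow> ('o, 'a) cat \<Rightarrow> ('o, 'a) multitensor
    \<Rightarrow> ('u, 'o, 'a) gmonad" where
  "Gam_monad small V E =
     Monad (Ftor (restrict (Gam_graph V E) (Obj (graph_cat small V)))
             (restrict (Gam_gmor V E) (Arr (graph_cat small V))))
       (restrict (Gam_unit V E) (Obj (graph_cat small V)))
       (restrict (Gam_mult V E) (Obj (graph_cat small V)))"

definition Gam_coherence :: "('u set \<Rightarrow> bool) \<Rightarrow> ('o, 'a) cat \<Rightarrow> ('o, 'a) multitensor
    \<Rightarrow> ('o, 'a) cat \<Rightarrow> ('o, 'a) multitensor \<Rightarrow> ('o, 'a, 'o, 'a) ftor \<Rightarrow> ('o list \<Rightarrow> 'a)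
    \<Rightarrow> ('u, 'o) graph \<Rightarrow> ('u, 'o, 'a) gmor" where
  "Gam_coherence small V E W F H \<psi> =
     (\<lambda>X\<in>Obj (graph_cat small V).
        mk_gmor (Gam_graph W F (graph_push H X)) (graph_push H (Gam_graph V E X)) (\<lambda>a. a)
          (\<lambda>a b. copair W (paths (gobj X) a b) (\<lambda>x. fob H (mt_ob E (path_seq X x)))
                   (fob H (Gam_hom V E X a b)) (\<lambda>x. far H (Gam_in V E X x)) \<cdot>\<^bsub>W\<^esub>
                 coprod_map W (paths (gobj X) a b)
                   (\<lambda>x. mt_ob F (path_seq (graph_push H X) x))
                   (\<lambda>x. fob H (mt_ob E (path_seq X x)))
                   (\<lambda>x. \<psi> (path_seq X x))))"

fun Gam_0 :: "('u set \<Rightarrow> bool) \<Rightarrow> ('o, 'a) dm_0 \<Rightarrow> ('u, 'o, 'a) pl_0" where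
  "Gam_0 small (V, E) = (V, Gam_monad small V E)"

fun Gam_1 :: "('u set \<Rightarrow> bool) \<Rightarrow> ('o, 'a) dm_1 \<Rightarrow> ('u, 'o, 'a) pl_1" where
  "Gam_1 small (Cell (V, E) (W, F) (H, \<psi>)) =
     Cell (Gam_0 small (V, E)) (Gam_0 small (W, F)) (H, Gam_coherence small V E W F H \<psi>)"

fun Gam_2 :: "('u set \<Rightarrow> bool) \<Rightarrow> ('o, 'a) dm_2 \<Rightarrow> ('u, 'o, 'a) pl_2" where
  "Gam_2 small (Cell f g \<phi>) = Cell (Gam_1 small f) (Gam_1 small g) \<phi>"

definition Gamma :: "('u set \<Rightarrow> bool) \<Rightarrow>
    (('o, 'a) dm_0, ('o, 'a) dm_1, ('o, 'a) dm_2,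
     ('u, 'o, 'a) pl_0, ('u, 'o, 'a) pl_1, ('u, 'o, 'a) pl_2) two_ftor" where
  "Gamma small = mk_two_ftor (DISTMULT small) (Gam_0 small) (Gam_1 small) (Gam_2 small)"


section \<open>The 2-functor from PLMND to DISTMULT\<close>

definition bar_unit :: "(nat \<Rightarrow> 'u) \<Rightarrow> ('o, 'a) cat \<Rightarrow> ('u, 'o, 'a) gmonad \<Rightarrow> 'o \<Rightarrow> 'a" where
  "bar_unit \<nu> V T = (\<lambda>Z\<in>Obj V. gmap (mnd_unit T (seq_graph \<nu> V [Z])) (\<nu> 0) (\<nu> 1))"

text \<open>
  The morphism from the graph of the sequence of all \<open>T(Z\<^sub>i)(0, n\<^sub>i)\<close> to \<open>T\<close> of the concatenated
  sequence, which sends \<open>i\<close> to the partial sum \<open>n\<^sub>1 + \<dots> + n\<^sub>i\<close>.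
\<close>

definition bar_tau :: "(nat \<Rightarrow> 'u) \<Rightarrow> ('o, 'a) cat \<Rightarrow> ('u, 'o, 'a) gmonad \<Rightarrow> 'o list list
    \<Rightarrow> ('u, 'o, 'a) gmor" where
  "bar_tau \<nu> V T Z =
     (let offset = (\<lambda>i. length (concat (take i Z))) in
      seq_mor \<nu> V (map (fob (bar_fun \<nu> V (mnd_fun T))) Z)
        (fob (mnd_fun T) (seq_graph \<nu> V (concat Z)))
        (\<lambda>i. \<nu> (offset i))
        (map (\<lambda>i. gmap (far (mnd_fun T)
                     (subseq_mor \<nu> V (concat (take i Z)) (Z ! i) (concat (drop (Suc i) Z))))
                   (\<nu> 0) (\<nu> (length (Z ! i))))
           [0..<length Z]))"

definition bar_sub :: "(nat \<Rightarrow> 'u) \<Rightarrow> ('o, 'a) cat \<Rightarrow> ('u, 'o, 'a) gmonad \<Rightarrow> 'o list list \<Rightarrow> 'a"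
  where
  "bar_sub \<nu> V T =
     (\<lambda>Z\<in>lists (lists (Obj V)).
        gmap (mnd_mult T (seq_graph \<nu> V (concat Z))) (\<nu> 0) (\<nu> (length (concat Z))) \<cdot>\<^bsub>V\<^esub>
        gmap (far (mnd_fun T) (bar_tau \<nu> V T Z)) (\<nu> 0) (\<nu> (length Z)))"

definition bar_multitensor :: "(nat \<Rightarrow> 'u) \<Rightarrow> ('o, 'a) cat \<Rightarrow> ('u, 'o, 'a) gmonad
    \<Rightarrow> ('o, 'a) multitensor" where
  "bar_multitensor \<nu> V T =
     Multitensor (bar_fun \<nu> V (mnd_fun T)) (bar_unit \<nu> V T) (bar_sub \<nu> V T)"

text \<open>The canonical morphism from the graph of \<open>(HX\<^sub>1, \<dots>, HX\<^sub>n)\<close> to the image under \<open>H\<close> of that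
  of \<open>(X\<^sub>1, \<dots>, X\<^sub>n)\<close>.\<close>

definition seq_push_mor :: "(nat \<Rightarrow> 'u) \<Rightarrow> ('o, 'a) cat \<Rightarrow> ('o, 'a) cat \<Rightarrow> ('o, 'a, 'o, 'a) ftor
    \<Rightarrow> 'o list \<Rightarrow> ('u, 'o, 'a) gmor" where
  "seq_push_mor \<nu> V W H X =
     seq_mor \<nu> W (map (fob H) X) (graph_push H (seq_graph \<nu> V X)) \<nu>
       (map (\<lambda>Z. Idt W (fob H Z)) X)"

definition bar_coherence :: "(nat \<Rightarrow> 'u) \<Rightarrow> ('o, 'a) cat \<Rightarrow> ('o, 'a) cat \<Rightarrow> ('u, 'o, 'a) gmonad
    \<Rightarrow> ('o, 'a, 'o, 'a) ftor \<Rightarrow> (('u, 'o) graph \<Rightarrow> ('u, 'o, 'a) gmor) \<Rightarrow> 'o list \<Rightarrow> 'a" where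
  "bar_coherence \<nu> V W S H \<psi> =
     (\<lambda>X\<in>lists (Obj V).
        gmap (\<psi> (seq_graph \<nu> V X)) (\<nu> 0) (\<nu> (length X)) \<cdot>\<^bsub>W\<^esub>
        gmap (far (mnd_fun S) (seq_push_mor \<nu> V W H X)) (\<nu> 0) (\<nu> (length X)))"

fun bar_0 :: "(nat \<Rightarrow> 'u) \<Rightarrow> ('u, 'o, 'a) pl_0 \<Rightarrow> ('o, 'a) dm_0" where
  "bar_0 \<nu> (V, T) = (V, bar_multitensor \<nu> V T)"

fun bar_1 :: "(nat \<Rightarrow> 'u) \<Rightarrow> ('u, 'o, 'a) pl_1 \<Rightarrow> ('o, 'a) dm_1" where
  "bar_1 \<nu> (Cell (V, T) (W, S) (H, \<psi>)) =
     Cell (bar_0 \<nu> (V, T)) (bar_0 \<nu> (W, S)) (H, bar_coherence \<nu> V W S H \<psi>)"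

fun bar_2 :: "(nat \<Rightarrow> 'u) \<Rightarrow> ('u, 'o, 'a) pl_2 \<Rightarrow> ('o, 'a) dm_2" where
  "bar_2 \<nu> (Cell f g \<phi>) = Cell (bar_1 \<nu> f) (bar_1 \<nu> g) \<phi>"

definition Bar :: "('u set \<Rightarrow> bool) \<Rightarrow> (nat \<Rightarrow> 'u) \<Rightarrow>
    (('u, 'o, 'a) pl_0, ('u, 'o, 'a) pl_1, ('u, 'o, 'a) pl_2,
     ('o, 'a) dm_0, ('o, 'a) dm_1, ('o, 'a) dm_2) two_ftor" where
  "Bar small \<nu> = mk_two_ftor (PLMND small \<nu>) (bar_0 \<nu>) (bar_1 \<nu>) (bar_2 \<nu>)"

end

(*
  For a distributive multitensor E and a path-like monad T on V-graphs, consider comparison maps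
  t_X(x) : E(x^*X) -> TX(a,b), natural in X, which exhibit TX(a,b) as the coproduct over all paths
  x from a to b, and which intertwine the units and the multiplications. Distributivity makes the
  induced cocones over refinements of paths into TTX(a,b) and TTTX(a,b) coproducts too. Hence the
  monad laws for T can be tested on these cocones, where they become the multitensor laws for E
  postcomposed with t; and the latter determine the multitensor laws, as t is invertible on the
  canonical path of the graph of a sequence. Such data relate E both to Gamma E (with the coproduct
  inclusions) and to any T with bar T = E (by path-likeness).

  The same two tests show that the equation Psi_X . s_HX(x) = H(t_X(x)) . psi_(x^*X) is a bijection
  between lax monoidal structures psi and monad functor structures Psi on a functor H, compatible
  with composition and with 2-cells. So all 2-categorical laws for PLMND follow from those for
  DISTMULT, and the unit and counit of the equivalence are the cells which correspond to the
  identity of the monad and of the multitensor, for the two comparisons which share it.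
*)
theory Submission
  imports Defs
begin

section \<open>Categories and coproducts\<close>

text \<open>That t is invertible on the canonical path rests on distributivity over the empty
  coproduct: every other path in the graph of a sequence crosses an initial hom, and E sends a
  sequence with an initial entry to an initial object. This is what leads back from graphs to
  sequences, and it survives every functor H, since functors preserve split monomorphisms even when
  they preserve no coproducts. Two obstacles shape the rest. Paths and refinements are lists, while
  coproducts are provided only over small subsets of \<open>'u\<close>; hence lists over a small set
  have to be coded inside an infinite small set. And E determines a compared T only up to
  isomorphism, as T does E; so the correspondence of 1-cells is kept as a relation, unique on each
  side once the other side and the boundary are fixed. An equation between 1-cells is then proved by
  matching both of its sides with one partner. On 2-cells the data are the same natural
  transformation on both sides, so that only two predicates have to be compared.\<close>

abbreviation cmp_at :: "'a \<Rightarrow> ('o, 'a) cat \<Rightarrow> 'a \<Rightarrow> 'a" ("(_/ o[_]/ _)" [56, 0, 55] 55)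
  where "g o[C] f \<equiv> Cmp C g f"

abbreviation seqs :: "('o, 'a) cat \<Rightarrow> 'o list set" where "seqs C \<equiv> lists (Obj C)"

text \<open>The entrywise premise of \<open>E_cmp\<close>, with the arguments outer map, inner map,
  result.\<close>

abbreviation composite :: "('o, 'a) cat \<Rightarrow> 'a \<Rightarrow> 'a \<Rightarrow> 'a \<Rightarrow> bool" where
  "composite C g f h \<equiv> f \<in> Arr C \<and> g \<in> Arr C \<and> Cod C f = Dom C g \<and> h = g o[C] f"

abbreviation walks :: "('u, 'o) graph \<Rightarrow> 'u \<Rightarrow> 'u \<Rightarrow> 'u list set" where "walks X a b \<equiv> paths (gobj X) a b"

abbreviation refined :: "('u, 'o) graph \<Rightarrow> 'u list \<Rightarrow> 'u list list set" where "refined X \<equiv> refinements (gobj X)"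

lemma hom_iff: "f \<in> hom C a b \<longleftrightarrow> f \<in> Arr C \<and> Dom C f = a \<and> Cod C f = b"
  by (auto simp: hom_def)

context category
begin

lemma cmp_hom [simp]:
  assumes "f \<in> Arr C" "g \<in> Arr C" "Cod C f = Dom C g"
  shows "g o[C] f \<in> Arr C" "Dom C (g o[C] f) = Dom C f" "Cod C (g o[C] f) = Cod C g"
  using Cmp_hom[of f "Dom C f" "Cod C f" g "Cod C g"] assms by (auto simp: hom_def)

lemma assoc:
  assumes "f \<in> Arr C" "g \<in> Arr C" "h \<in> Arr C" "Cod C f = Dom C g" "Cod C g = Dom C h"
  shows "(h o[C] g) o[C] f = h o[C] (g o[C] f)"
  using assms by (intro Cmp_assoc) (auto simp: hom_def)

text \<open>Once composites are bracketed to the right by \<open>assoc\<close>, a known equation for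
  g after f no longer occurs literally in front of a further factor; in this form the simplifier can
  still use it there.\<close>

lemma cmp_reduce:
  assumes "g o[C] f = k" "f \<in> Arr C" "g \<in> Arr C" "r \<in> Arr C" "Cod C f = Dom C g" "Cod C r = Dom C f"
  shows "g o[C] (f o[C] r) = k o[C] r"
  using assms assoc by metis

lemma Idt_simps [simp]:
  assumes "a \<in> Obj C"
  shows "Idt C a \<in> Arr C" "Dom C (Idt C a) = a" "Cod C (Idt C a) = a"
  using Idt_hom[OF assms] by (auto simp: hom_def)

lemma Idt_cmp [simp]:
  "\<lbrakk>f \<in> Arr C; Cod C f = b\<rbrakk> \<Longrightarrow> Idt C b o[C] f = f"
  "\<lbrakk>f \<in> Arr C; Dom C f = a\<rbrakk> \<Longrightarrow> f o[C] Idt C a = f"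
  by (auto intro!: Idt_left Idt_right simp: hom_def)

lemma hom_Obj: "f \<in> hom C a b \<Longrightarrow> a \<in> Obj C \<and> b \<in> Obj C"
  using Dom_closed Cod_closed by (auto simp: hom_def)

section \<open>Coproduct cocones and the construction of new ones from old\<close>

lemma coproduct_hom: "\<lbrakk>is_coproduct C I A c \<iota>; i \<in> I\<rbrakk> \<Longrightarrow> \<iota> i \<in> hom C (A i) c"
  by (simp add: is_coproduct_def)

lemma coproduct_Obj: "is_coproduct C I A c \<iota> \<Longrightarrow> c \<in> Obj C"
  by (simp add: is_coproduct_def)

lemma coproduct_ex1:
  assumes "is_coproduct C I A c \<iota>" "d \<in> Obj C" "\<And>i. i \<in> I \<Longrightarrow> f i \<in> hom C (A i) d"
  shows "\<exists>!h. h \<in> hom C c d \<and> (\<forall>i\<in>I. h o[C] \<iota> i = f i)"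
  using assms by (simp add: is_coproduct_def)

lemma coproduct_copair:
  assumes "is_coproduct C I A c \<iota>" "d \<in> Obj C" "\<And>i. i \<in> I \<Longrightarrow> f i \<in> hom C (A i) d"
  shows "\<exists>h \<in> hom C c d. \<forall>i\<in>I. h o[C] \<iota> i = f i"
  using coproduct_ex1[of I A c \<iota> d f, OF assms] by blast

lemma coproduct_eqI:
  assumes cp: "is_coproduct C I A c \<iota>" and h: "h \<in> hom C c d" and k: "k \<in> hom C c d"
    and "\<And>i. i \<in> I \<Longrightarrow> h o[C] \<iota> i = k o[C] \<iota> i"
  shows "h = k"
proof -
  have "d \<in> Obj C" using h hom_Obj by blast
  moreover have "k o[C] \<iota> i \<in> hom C (A i) d" if "i \<in> I" for i
    using Cmp_hom[OF coproduct_hom[OF cp that] k] .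
  ultimately have "\<exists>!h. h \<in> hom C c d \<and> (\<forall>i\<in>I. h o[C] \<iota> i = k o[C] \<iota> i)"
    by (rule coproduct_ex1[OF cp])
  then show ?thesis using assms by blast
qed

lemma coproductI:
  assumes "c \<in> Obj C" "\<And>i. i \<in> I \<Longrightarrow> \<iota> i \<in> hom C (A i) c"
    and ex: "\<And>d f. \<lbrakk>d \<in> Obj C; \<And>i. i \<in> I \<Longrightarrow> f i \<in> hom C (A i) d\<rbrakk>
  \<Longrightarrow> \<exists>h \<in> hom C c d. \<forall>i\<in>I. h o[C] \<iota> i = f i"
    and eq: "\<And>d h k. \<lbrakk>h \<in> hom C c d; k \<in> hom C c d; \<And>i. i \<in> I \<Longrightarrow> h o[C] \<iota> i = k o[C] \<iota> i\<rbrakk> \<Longrightarrow> h = k"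
  shows "is_coproduct C I A c \<iota>"
  unfolding is_coproduct_def
proof (intro conjI ballI allI impI)
  fix d f assume d: "d \<in> Obj C" and "\<forall>i\<in>I. f i \<in> hom C (A i) d"
  then have "\<And>i. i \<in> I \<Longrightarrow> f i \<in> hom C (A i) d" by blast
  from ex[OF d this] obtain h where h: "h \<in> hom C c d" "\<forall>i\<in>I. h o[C] \<iota> i = f i" by blast
  show "\<exists>!h. h \<in> hom C c d \<and> (\<forall>i\<in>I. h o[C] \<iota> i = f i)"
  proof (rule ex1I[of _ h])
    show "h \<in> hom C c d \<and> (\<forall>i\<in>I. h o[C] \<iota> i = f i)" using h by simp
    fix k assume "k \<in> hom C c d \<and> (\<forall>i\<in>I. k o[C] \<iota> i = f i)"
    then show "k = h" using h by (intro eq[of k d h]) simp_all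
  qed
qed (use assms in auto)

text \<open>The index type may change here. The hypotheses speak of index sets in \<open>'u\<close>,
  the applications of sets of paths, of lists of paths and of pairs, and this lemma mediates between
  them.\<close>

lemma coproduct_reindex:
  assumes cp: "is_coproduct C I A c \<iota>" and g: "bij_betw g J I"
    and e: "\<And>j. j \<in> J \<Longrightarrow> A' j = A (g j)" "\<And>j. j \<in> J \<Longrightarrow> \<iota>' j = \<iota> (g j)"
  shows "is_coproduct C J A' c \<iota>'"
proof (rule coproductI)
  show "c \<in> Obj C" using cp by (auto simp: is_coproduct_def)
  show "\<iota>' j \<in> hom C (A' j) c" if "j \<in> J" for j
    using that e coproduct_hom[OF cp] bij_betwE[OF g] by auto
  show "\<exists>h \<in> hom C c d. \<forall>j\<in>J. h o[C] \<iota>' j = f j"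
    if d: "d \<in> Obj C" and f: "\<And>j. j \<in> J \<Longrightarrow> f j \<in> hom C (A' j) d" for d f
  proof -
    let ?g = "inv_into J g"
    have "f (?g i) \<in> hom C (A i) d" if "i \<in> I" for i
      using f[of "?g i"] e(1)[of "?g i"] that g
      by (metis bij_betw_def bij_betw_inv_into_right inv_into_into)
    from coproduct_copair[OF cp d, of "\<lambda>i. f (?g i)", OF this]
    obtain h where h: "h \<in> hom C c d" "\<And>i. i \<in> I \<Longrightarrow> h o[C] \<iota> i = f (?g i)" by blast
    then have "\<forall>j\<in>J. h o[C] \<iota>' j = f j"
      using e(2) g by (metis bij_betwE bij_betw_inv_into_left)
    then show ?thesis using h by blast
  qed
  show "h = k" if h: "h \<in> hom C c d" and k: "k \<in> hom C c d"
    and hk: "\<And>j. j \<in> J \<Longrightarrow> h o[C] \<iota>' j = k o[C] \<iota>' j" for d h k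
  proof (rule coproduct_eqI[OF cp h k])
    fix i assume "i \<in> I"
    then obtain j where "j \<in> J" "i = g j" using g by (metis bij_betw_def imageE)
    then show "h o[C] \<iota> i = k o[C] \<iota> i" using hk e by metis
  qed
qed

text \<open>Iterated coproducts, with pairs as indices. For a path and a refinement of it this gives
  the universal property behind the definite description in \<open>Gam_mult\<close>.\<close>

lemma coproduct_Sigma:
  assumes cp: "is_coproduct C I A c \<iota>"
    and cp': "\<And>i. i \<in> I \<Longrightarrow> is_coproduct C (J i) (B i) (A i) (\<kappa> i)"
  shows "is_coproduct C (Sigma I J) (\<lambda>p. B (fst p) (snd p)) c (\<lambda>p. \<iota> (fst p) o[C] \<kappa> (fst p) (snd p))"
proof (rule coproductI)
  have a: "h o[C] (\<iota> i o[C] \<kappa> i j) = (h o[C] \<iota> i) o[C] \<kappa> i j"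
    if "h \<in> hom C c d" "i \<in> I" "j \<in> J i" for h d i j
    using Cmp_assoc[OF coproduct_hom[OF cp'[OF that(2)] that(3)] coproduct_hom[OF cp that(2)] that(1)] by simp
  show "c \<in> Obj C" using cp by (auto simp: is_coproduct_def)
  show "\<iota> (fst p) o[C] \<kappa> (fst p) (snd p) \<in> hom C (B (fst p) (snd p)) c" if "p \<in> Sigma I J" for p
    using that by (intro Cmp_hom[OF coproduct_hom[OF cp'] coproduct_hom[OF cp]]) auto
  show "\<exists>h \<in> hom C c d. \<forall>p\<in>Sigma I J. h o[C] (\<iota> (fst p) o[C] \<kappa> (fst p) (snd p)) = f p"
    if d: "d \<in> Obj C" and f: "\<And>p. p \<in> Sigma I J \<Longrightarrow> f p \<in> hom C (B (fst p) (snd p)) d" for d f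
  proof -
    have "\<exists>h \<in> hom C (A i) d. \<forall>j\<in>J i. h o[C] \<kappa> i j = f (i, j)" if "i \<in> I" for i
    proof -
      have "f (i, j) \<in> hom C (B i j) d" if "j \<in> J i" for j
        using f[of "(i, j)"] that \<open>i \<in> I\<close> by simp
      then have "\<exists>h \<in> hom C (A i) d. \<forall>j\<in>J i. h o[C] \<kappa> i j = f (i, j)"
        by (rule coproduct_copair[OF cp'[OF \<open>i \<in> I\<close>] d])
      then show ?thesis .
    qed
    then have "\<forall>i\<in>I. \<exists>h. h \<in> hom C (A i) d \<and> (\<forall>j\<in>J i. h o[C] \<kappa> i j = f (i, j))" by blast
    from bchoice[OF this] obtain k where k: "\<And>i. i \<in> I \<Longrightarrow> k i \<in> hom C (A i) d"
      "\<And>i j. i \<in> I \<Longrightarrow> j \<in> J i \<Longrightarrow> k i o[C] \<kappa> i j = f (i, j)" by blast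
    from coproduct_copair[OF cp d, of k, OF k(1)]
    obtain h where h: "h \<in> hom C c d" "\<And>i. i \<in> I \<Longrightarrow> h o[C] \<iota> i = k i" by blast
    then have "h o[C] (\<iota> i o[C] \<kappa> i j) = f (i, j)" if "i \<in> I" "j \<in> J i" for i j
      using k(2) a[OF h(1) that] that by simp
    then show ?thesis using h(1) by (intro bexI[of _ h]) auto
  qed
  show "h = k" if h: "h \<in> hom C c d" and k: "k \<in> hom C c d"
    and hk: "\<And>p. p \<in> Sigma I J \<Longrightarrow>
    h o[C] (\<iota> (fst p) o[C] \<kappa> (fst p) (snd p)) = k o[C] (\<iota> (fst p) o[C] \<kappa> (fst p) (snd p))"
    for d h k
  proof (rule coproduct_eqI[OF cp h k])
    fix i assume i: "i \<in> I"
    show "h o[C] \<iota> i = k o[C] \<iota> i"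
    proof (rule coproduct_eqI[OF cp'[OF i]])
      show "h o[C] \<iota> i \<in> hom C (A i) d" "k o[C] \<iota> i \<in> hom C (A i) d"
        using Cmp_hom[OF coproduct_hom[OF cp i]] h k by auto
      show "(h o[C] \<iota> i) o[C] \<kappa> i j = (k o[C] \<iota> i) o[C] \<kappa> i j" if "j \<in> J i" for j
        using a[OF h i that] a[OF k i that] hk[of "(i, j)"] i that by auto
    qed
  qed
qed

text \<open>Transport of a universal property along an isomorphism of cocones. It carries the
  cocones formed with E over to those formed with \<open>bar_fun\<close>, in terms of which
  distributivity and path-likeness of a monad are defined.\<close>

lemma coproduct_iso:
  assumes cp: "is_coproduct C I A c \<iota>"
    and e: "is_iso C c c' e" and e': "\<And>i. i \<in> I \<Longrightarrow> is_iso C (A i) (A' i) (e' i)"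
    and \<iota>': "\<And>i. i \<in> I \<Longrightarrow> \<iota>' i \<in> hom C (A' i) c'"
    and eq: "\<And>i. i \<in> I \<Longrightarrow> \<iota>' i o[C] e' i = e o[C] \<iota> i"
  shows "is_coproduct C I A' c' \<iota>'"
proof (rule coproductI)
  from e obtain r where r: "r \<in> hom C c' c" "r o[C] e = Idt C c" "e o[C] r = Idt C c'"
    and eh: "e \<in> hom C c c'" by (auto simp: is_iso_def)
  show c': "c' \<in> Obj C" using eh hom_Obj by blast
  show "\<iota>' i \<in> hom C (A' i) c'" if "i \<in> I" for i using \<iota>' that .
  \<comment> \<open>Each \<open>e' i\<close> is invertible, hence epic, so maps out of
    \<open>A' i\<close> may be compared after it.\<close>
  have cancel: "f = g" if "i \<in> I" "f \<in> hom C (A' i) d" "g \<in> hom C (A' i) d"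
    "f o[C] e' i = g o[C] e' i" for f g i d
  proof -
    from e'[OF that(1)] obtain s where s: "s \<in> hom C (A' i) (A i)" "e' i o[C] s = Idt C (A' i)"
      "e' i \<in> hom C (A i) (A' i)" by (auto simp: is_iso_def)
    then have "f = (f o[C] e' i) o[C] s" "g = (g o[C] e' i) o[C] s"
      using that(2,3) by (simp_all add: hom_iff assoc)
    then show ?thesis using that(4) by metis
  qed
  show "\<exists>h \<in> hom C c' d. \<forall>i\<in>I. h o[C] \<iota>' i = f i"
    if d: "d \<in> Obj C" and f: "\<And>i. i \<in> I \<Longrightarrow> f i \<in> hom C (A' i) d" for d f
  proof -
    have "f i o[C] e' i \<in> hom C (A i) d" if "i \<in> I" for i
      using f[OF that] e'[OF that] Cmp_hom by (auto simp: is_iso_def)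
    from coproduct_copair[OF cp d, of "\<lambda>i. f i o[C] e' i", OF this]
    obtain h where h: "h \<in> hom C c d" "\<And>i. i \<in> I \<Longrightarrow> h o[C] \<iota> i = f i o[C] e' i" by blast
    have "(h o[C] r) o[C] \<iota>' i = f i" if i: "i \<in> I" for i
    proof (rule cancel[OF i _ f[OF i]])
      show "(h o[C] r) o[C] \<iota>' i \<in> hom C (A' i) d"
        using h(1) r(1) \<iota>'[OF i] by (simp add: hom_iff)
      have "e' i \<in> hom C (A i) (A' i)" using e'[OF i] by (simp add: is_iso_def)
      then show "((h o[C] r) o[C] \<iota>' i) o[C] e' i = f i o[C] e' i"
        using h(1) r(1) \<iota>'[OF i] eh coproduct_hom[OF cp i] h(2)[OF i]
        by (simp add: hom_iff assoc eq[OF i] cmp_reduce[OF r(2)])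
    qed
    moreover have "h o[C] r \<in> hom C c' d" using h r Cmp_hom by blast
    ultimately show ?thesis by blast
  qed
  show "h = k" if h: "h \<in> hom C c' d" and k: "k \<in> hom C c' d"
    and hk: "\<And>i. i \<in> I \<Longrightarrow> h o[C] \<iota>' i = k o[C] \<iota>' i" for d h k
  proof -
    have "h o[C] e = k o[C] e"
    proof (rule coproduct_eqI[OF cp])
      show "h o[C] e \<in> hom C c d" "k o[C] e \<in> hom C c d" using h k eh Cmp_hom by blast+
      fix i assume i: "i \<in> I"
      have "e' i \<in> hom C (A i) (A' i)" using e'[OF i] by (simp add: is_iso_def)
      then have "f o[C] (e o[C] \<iota> i) = (f o[C] \<iota>' i) o[C] e' i" if "f \<in> hom C c' d" for f
        using that \<iota>'[OF i] eh coproduct_hom[OF cp i] eq[OF i] by (simp add: hom_iff assoc)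
      then show "(h o[C] e) o[C] \<iota> i = (k o[C] e) o[C] \<iota> i"
        using h k eh coproduct_hom[OF cp i] hk[OF i] by (simp add: hom_iff assoc)
    qed
    moreover have "f = (f o[C] e) o[C] r" if "f \<in> hom C c' d" for f
      using that eh r by (simp add: hom_iff assoc)
    ultimately show ?thesis using h k by metis
  qed
qed

lemma coproduct_cong:
  assumes "is_coproduct C I A c \<iota>" "\<And>i. i \<in> I \<Longrightarrow> A i = A' i" "\<And>i. i \<in> I \<Longrightarrow> \<iota> i = \<iota>' i"
  shows "is_coproduct C I A' c \<iota>'"
  by (rule coproduct_reindex[OF assms(1), of id]) (use assms in \<open>auto simp: bij_betw_def\<close>)

text \<open>Base case for products of index sets: an empty list of factors leaves exactly one index,
  the empty list.\<close>

lemma coproduct_singleton: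
  assumes "a \<in> Obj C" shows "is_coproduct C {i} (\<lambda>_. a) a (\<lambda>_. Idt C a)"
  by (rule coproductI) (use assms Idt_hom in \<open>auto simp: hom_iff\<close>)

lemma copair:
  assumes "is_coproduct C I A (coprod C I A) (coprod_in C I A)" "d \<in> Obj C"
    and "\<And>i. i \<in> I \<Longrightarrow> f i \<in> hom C (A i) d"
  shows "copair C I A d f \<in> hom C (coprod C I A) d"
    and "i \<in> I \<Longrightarrow> copair C I A d f o[C] coprod_in C I A i = f i"
proof -
  have "\<exists>!h. h \<in> hom C (coprod C I A) d \<and> (\<forall>i\<in>I. h o[C] coprod_in C I A i = f i)"
    by (rule coproduct_ex1[OF assms])
  from theI'[OF this]
  have *: "copair C I A d f \<in> hom C (coprod C I A) d \<and>
    (\<forall>i\<in>I. copair C I A d f o[C] coprod_in C I A i = f i)" unfolding copair_def .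
  show "copair C I A d f \<in> hom C (coprod C I A) d" using * by blast
  show "i \<in> I \<Longrightarrow> copair C I A d f o[C] coprod_in C I A i = f i" using * by blast
qed

end


section \<open>Smallness\<close>

lemma infinite_Times_lepoll: "infinite B \<Longrightarrow> B \<times> B \<lesssim> B"
  using card_of_Times_same_infinite[of B] eqpoll_iff_card_of_ordIso[of "B \<times> B" B]
  by (auto intro: eqpoll_imp_lepoll)

text \<open>A list is coded by its length together with a nested pairing of its entries. The nested
  pairing alone separates only lists of equal length, because the arbitrary end marker
  \<open>e 0\<close> may also be the code of a longer list.\<close>

lemma infinite_lists_lepoll:
  assumes "infinite B" shows "lists B \<lesssim> B"
proof -
  obtain g where g: "inj_on g (B \<times> B)" "g ` (B \<times> B) \<subseteq> B"
    using infinite_Times_lepoll[OF assms] by (auto simp: lepoll_def)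
  obtain e :: "nat \<Rightarrow> 'a" where e: "inj e" "range e \<subseteq> B"
    using assms unfolding infinite_le_lepoll lepoll_def by auto
  define code where "code xs = foldr (\<lambda>x r. g (x, r)) xs (e 0)" for xs
  have code_B: "code xs \<in> B" if "xs \<in> lists B" for xs
    using that by (induction xs) (use e g in \<open>auto simp: code_def\<close>)
  have code_inj: "xs = ys"
    if "xs \<in> lists B" "ys \<in> lists B" "length xs = length ys" "code xs = code ys" for xs ys
    using that(3,1,2,4)
  proof (induction xs ys rule: list_induct2)
    case (Cons x xs y ys)
    then have "g (x, code xs) = g (y, code ys)" by (simp add: code_def)
    then have "x = y \<and> code xs = code ys"
      using inj_onD[OF g(1), of "(x, code xs)" "(y, code ys)"] code_B[of xs] code_B[of ys] Cons.prems
      by simp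
    then show ?case using Cons by auto
  qed simp
  define h where "h xs = g (e (length xs), code xs)" for xs
  have "h xs \<in> B" if "xs \<in> lists B" for xs
  proof -
    have "(e (length xs), code xs) \<in> B \<times> B" using code_B[OF that] e by auto
    then show ?thesis using g(2) unfolding h_def by blast
  qed
  then have "h ` lists B \<subseteq> B" by blast
  moreover have "inj_on h (lists B)"
  proof (rule inj_onI)
    fix xs ys assume *: "xs \<in> lists B" "ys \<in> lists B" "h xs = h ys"
    then have "e (length xs) = e (length ys) \<and> code xs = code ys"
      using inj_onD[OF g(1), of "(e (length xs), code xs)" "(e (length ys), code ys)"] e
        code_B[of xs] code_B[of ys] by (auto simp: h_def)
    then show "xs = ys" using * code_inj e by (metis injD)
  qed
  ultimately show ?thesis unfolding lepoll_def by blast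
qed

context smallness
begin

lemma small_finite: "finite A \<Longrightarrow> small A"
  using small_infinite small_lepoll finite_lepoll_infinite by metis

lemma small_Un: "\<lbrakk>small A; small B\<rbrakk> \<Longrightarrow> small (A \<union> B)"
proof -
  assume A: "small A" and B: "small B"
  \<comment> \<open>\<open>small_UN\<close> takes its index set inside \<open>'u\<close>, so two
    distinct elements have to be found there to index A and B.\<close>
  obtain C :: "'u set" where "infinite C" using small_infinite by blast
  obtain p where "p \<in> C" using \<open>infinite C\<close> infinite_imp_nonempty by blast
  moreover from \<open>infinite C\<close> obtain q where "q \<in> C - {p}"
    using infinite_imp_nonempty[of "C - {p}"] by auto
  ultimately have "p \<noteq> q" by auto
  moreover have "(\<Union>i\<in>{p, q}. if i = p then A else B) = A \<union> B" using \<open>p \<noteq> q\<close> by auto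
  moreover have "small (\<Union>i\<in>{p, q}. if i = p then A else B)"
    using A B by (intro small_UN) (simp_all add: small_finite)
  ultimately show ?thesis by simp
qed

text \<open>If A is finite, lists over A need not embed in A; adding an infinite small set repairs
  this.\<close>

lemma small_lists: "small A \<Longrightarrow> \<exists>B :: 'u set. small B \<and> lists A \<lesssim> B"
proof -
  assume A: "small A"
  obtain C :: "'u set" where C: "small C" "infinite C" using small_infinite by blast
  have "lists A \<lesssim> lists (A \<union> C)" by (intro subset_imp_lepoll lists_mono) auto
  also have "\<dots> \<lesssim> A \<union> C" using C by (intro infinite_lists_lepoll) auto
  finally show ?thesis using A C small_Un by blast
qed

end

text \<open>Sets of paths and of refinements are not subsets of \<open>'u\<close>; smallness is
  extended to arbitrary types by way of an injection into a small set.\<close>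

definition small_index :: "('u set \<Rightarrow> bool) \<Rightarrow> 'i set \<Rightarrow> bool" where
  "small_index small I \<longleftrightarrow> (\<exists>J. small J \<and> I \<lesssim> J)"

context category
begin

text \<open>The hypothesis quantifies over index sets in \<open>'u\<close>. The family is moved
  along an injection to its image, and the cocone found there is moved back;
  \<open>preserves_coproduct\<close> makes the same detour.\<close>

lemma coproduct_exists:
  assumes "smallness small" "has_coproducts small C" "small_index small I" "\<And>i. i \<in> I \<Longrightarrow> A i \<in> Obj C"
  shows "is_coproduct C I A (coprod C I A) (coprod_in C I A)"
proof -
  interpret smallness small by fact
  obtain J f where J: "small J" "inj_on f I" "f ` I \<subseteq> J"
    using assms(3) by (auto simp: small_index_def lepoll_def)
  then have "small (f ` I)" using small_lepoll subset_imp_lepoll by blast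
  moreover have "\<forall>j\<in>f ` I. A (inv_into I f j) \<in> Obj C"
    using assms(4) by (auto simp: inv_into_into)
  ultimately obtain c \<iota> where cp: "is_coproduct C (f ` I) (\<lambda>j. A (inv_into I f j)) c \<iota>"
    using assms(2)[unfolded has_coproducts_def, rule_format, of "f ` I" "\<lambda>j. A (inv_into I f j)"]
    by blast
  have "is_coproduct C I A c (\<lambda>i. \<iota> (f i))"
    by (rule coproduct_reindex[OF cp, of f]) (use J in \<open>auto simp: bij_betw_def\<close>)
  then have "\<exists>p. is_coproduct C I A (fst p) (snd p)" by auto
  from someI_ex[OF this] show ?thesis
    by (simp add: coprod_def coprod_in_def chosen_coproduct_def)
qed

lemma preserves_coproduct:
  assumes "smallness small" "preserves_coproducts_in_each_variable small C D E" "category D"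
    and "small_index small I" "is_coproduct C I A c \<iota>"
    and "xs \<in> seqs C" "ys \<in> seqs C"
  shows "is_coproduct D I (\<lambda>i. fob E (xs @ A i # ys)) (fob E (xs @ c # ys))
  (\<lambda>i. far E (map (Idt C) xs @ \<iota> i # map (Idt C) ys))"
proof -
  interpret smallness small by fact
  interpret D: category D by fact
  obtain J f where J: "small J" "inj_on f I" "f ` I \<subseteq> J"
    using assms(4) by (auto simp: small_index_def lepoll_def)
  let ?g = "inv_into I f"
  have s: "small (f ` I)" using J small_lepoll subset_imp_lepoll by blast
  have "is_coproduct C (f ` I) (\<lambda>j. A (?g j)) c (\<lambda>j. \<iota> (?g j))"
    by (rule coproduct_reindex[OF assms(5), of ?g]) (use J in \<open>auto simp: bij_betw_inv_into inj_on_imp_bij_betw\<close>)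
  then have "is_coproduct D (f ` I) (\<lambda>j. fob E (xs @ A (?g j) # ys)) (fob E (xs @ c # ys))
    (\<lambda>j. far E (map (Idt C) xs @ \<iota> (?g j) # map (Idt C) ys))"
    using assms(2)[unfolded preserves_coproducts_in_each_variable_def, rule_format, OF assms(6,7)] s
    by blast
  then show ?thesis
    by (rule D.coproduct_reindex[where g = f]) (use J in \<open>auto simp: bij_betw_def\<close>)
qed

end


section \<open>Functors on finite sequences\<close>

lemma seq_cat_simps [simp]:
  "Obj (seq_cat V) = seqs V" "Arr (seq_cat V) = lists (Arr V)"
  "Dom (seq_cat V) = map (Dom V)" "Cod (seq_cat V) = map (Cod V)"
  "Idt (seq_cat V) = map (Idt V)" "Cmp (seq_cat V) = map2 (Cmp V)"
  by (simp_all add: seq_cat_def)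

lemma hom_seq_cat:
  "f \<in> hom (seq_cat V) As Bs \<longleftrightarrow> length f = length As \<and> length f = length Bs \<and>
     (\<forall>i<length f. f ! i \<in> hom V (As ! i) (Bs ! i))"
  by (auto simp: hom_iff list_eq_iff_nth_eq in_lists_conv_set set_conv_nth)

lemma in_lists_nth: "xs \<in> lists A \<longleftrightarrow> (\<forall>i<length xs. xs ! i \<in> A)"
  by (auto simp: in_lists_conv_set set_conv_nth)

lemma category_seq_cat:
  assumes "category V" shows "category (seq_cat V)"
proof -
  interpret category V by fact
  show ?thesis
  proof
    show "h \<in> hom (seq_cat V) a b \<Longrightarrow> k \<in> hom (seq_cat V) b c \<Longrightarrow> k o[seq_cat V] h \<in> hom (seq_cat V) a c"
      for h k a b c by (auto simp: hom_seq_cat intro!: Cmp_hom)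
    show "f \<in> hom (seq_cat V) a b \<Longrightarrow> Idt (seq_cat V) b o[seq_cat V] f = f" for f a b
      by (auto simp: hom_seq_cat list_eq_iff_nth_eq intro!: Idt_left)
    show "f \<in> hom (seq_cat V) a b \<Longrightarrow> f o[seq_cat V] Idt (seq_cat V) a = f" for f a b
      by (auto simp: hom_seq_cat list_eq_iff_nth_eq intro!: Idt_right)
    show "\<lbrakk>f \<in> hom (seq_cat V) a b; g \<in> hom (seq_cat V) b c; h \<in> hom (seq_cat V) c d\<rbrakk>
      \<Longrightarrow> (h o[seq_cat V] g) o[seq_cat V] f = h o[seq_cat V] (g o[seq_cat V] f)" for f g h a b c d
      by (auto simp: hom_seq_cat list_eq_iff_nth_eq intro!: Cmp_assoc)
    show "a \<in> Obj (seq_cat V) \<Longrightarrow> Idt (seq_cat V) a \<in> hom (seq_cat V) a a" for a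
      by (auto simp: hom_seq_cat in_lists_nth intro!: Idt_hom)
  qed (auto simp: in_lists_nth intro: Dom_closed Cod_closed)
qed

text \<open>A functor out of the category of sequences, without the extensionality requirement of
  \<^locale>\<open>is_functor\<close>, which \<^locale>\<open>is_multitensor\<close> does not impose on its functor part.\<close>

locale list_functor = category V for V :: "('o, 'a) cat" +
  fixes E :: "('o list, 'a list, 'o, 'a) ftor"
  assumes E_ob: "Z \<in> seqs V \<Longrightarrow> fob E Z \<in> Obj V"
    and E_hom': "f \<in> hom (seq_cat V) A B \<Longrightarrow> far E f \<in> hom V (fob E A) (fob E B)"
    and E_Idt: "Z \<in> seqs V \<Longrightarrow> far E (map (Idt V) Z) = Idt V (fob E Z)"
    and E_cmp': "\<lbrakk>f \<in> hom (seq_cat V) A B; g \<in> hom (seq_cat V) B D\<rbrakk>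
  \<Longrightarrow> far E (map2 (Cmp V) g f) = far E g o[V] far E f"
begin

lemma E_hom:
  assumes "length f = length A" "length f = length B" "\<And>i. i < length f \<Longrightarrow> f ! i \<in> hom V (A ! i) (B ! i)"
  shows "far E f \<in> hom V (fob E A) (fob E B)"
  using assms by (intro E_hom') (auto simp: hom_seq_cat)

text \<open>The composite is a given list h instead of a term with \<open>map2\<close>, so that it
  can be named in whatever form the context needs and checked entry by entry.\<close>

lemma E_cmp:
  assumes "length f = length h" "length g = length h"
    and "\<And>i. i < length h \<Longrightarrow> f ! i \<in> Arr V \<and> g ! i \<in> Arr V \<and> Cod V (f ! i) = Dom V (g ! i) \<and> h ! i = g ! i o[V] f ! i"
  shows "far E g o[V] far E f = far E h"
proof -
  have "h = map2 (Cmp V) g f" using assms by (auto simp: list_eq_iff_nth_eq)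
  moreover have "f \<in> hom (seq_cat V) (map (Dom V) f) (map (Cod V) f)"
    "g \<in> hom (seq_cat V) (map (Cod V) f) (map (Cod V) g)"
    unfolding hom_seq_cat using assms by (auto simp: hom_iff)
  ultimately show ?thesis using E_cmp' by metis
qed

text \<open>Preservation in each variable yields preservation in all variables at once, the index
  set being the product \<open>listset Js\<close>. One A and one \<iota> serve all positions because
  in the applications the summand that belongs to a path depends on the path alone.\<close>

lemma coproduct_multi:
  assumes "smallness small" and pres: "preserves_coproducts_in_each_variable small V V E"
    and "length cs = length Js"
    and "\<And>i. i < length Js \<Longrightarrow> small_index small (Js ! i)"
    and "\<And>i. i < length Js \<Longrightarrow> is_coproduct V (Js ! i) A (cs ! i) \<iota>"
  shows "is_coproduct V (listset Js) (\<lambda>xs. fob E (map A xs)) (fob E cs) (\<lambda>xs. far E (map \<iota> xs))"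
proof -
  \<comment> \<open>The induction treats the variables from left to right; zs holds the entries for
    which a summand has already been selected, and they stay fixed.\<close>
  have "is_coproduct V (listset Js) (\<lambda>xs. fob E (zs @ map A xs)) (fob E (zs @ cs))
    (\<lambda>xs. far E (map (Idt V) zs @ map \<iota> xs))" if "zs \<in> seqs V" for zs
    using assms(3,4,5) that
  proof (induction Js arbitrary: cs zs)
    case Nil
    then show ?case
      using coproduct_singleton[OF E_ob[OF Nil(4)], of "[]"] E_Idt[OF Nil(4)]
      by (auto elim!: coproduct_cong)
  next
    case (Cons J Js c' zs)
    then obtain c cs where c': "c' = c # cs" and len: "length cs = length Js" by (cases c') auto
    have cpc: "is_coproduct V J A c \<iota>" using Cons.prems(3)[of 0] c' by simp
    have cpi: "is_coproduct V (Js ! i) A (cs ! i) \<iota>" if "i < length Js" for i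
      using Cons.prems(3)[of "Suc i"] c' that by simp
    have cs: "cs \<in> seqs V"
      using cpi len by (auto simp: in_lists_nth is_coproduct_def)
    have A: "A j \<in> Obj V" if "j \<in> J" for j using coproduct_hom[OF cpc that] hom_Obj by blast
    \<comment> \<open>Distributivity in the variable c, with the entries on both sides of it
      fixed.\<close>
    have 1: "is_coproduct V J (\<lambda>j. fob E (zs @ A j # cs)) (fob E (zs @ c # cs))
      (\<lambda>j. far E (map (Idt V) zs @ \<iota> j # map (Idt V) cs))"
      using preserves_coproduct[OF assms(1) pres category_axioms _ cpc Cons.prems(4) cs]
        Cons.prems(2)[of 0] by simp
    have 2: "is_coproduct V (listset Js) (\<lambda>xs. fob E ((zs @ [A j]) @ map A xs)) (fob E (zs @ A j # cs))
      (\<lambda>xs. far E (map (Idt V) (zs @ [A j]) @ map \<iota> xs))" if "j \<in> J" for j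
      using Cons.IH[OF len, of "zs @ [A j]"] Cons.prems(2)[of "Suc _"] cpi Cons.prems(4) A[OF that] by force
    have 3: "is_coproduct V (J \<times> listset Js) (\<lambda>p. fob E ((zs @ [A (fst p)]) @ map A (snd p))) (fob E (zs @ c # cs))
      (\<lambda>p. far E (map (Idt V) zs @ \<iota> (fst p) # map (Idt V) cs) o[V]
      far E (map (Idt V) (zs @ [A (fst p)]) @ map \<iota> (snd p)))"
      using coproduct_Sigma[OF 1 2] by simp
    show ?case unfolding c'
    proof (rule coproduct_reindex[OF 3, of "\<lambda>xs. (hd xs, tl xs)"])
      show "bij_betw (\<lambda>xs. (hd xs, tl xs)) (listset (J # Js)) (J \<times> listset Js)"
        by (rule bij_betw_byWitness[where f' = "\<lambda>p. fst p # snd p"]) (auto simp: set_Cons_def)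
      fix xs assume "xs \<in> listset (J # Js)"
      then obtain x ys where xs: "xs = x # ys" and x: "x \<in> J" and ys: "ys \<in> listset Js"
        by (auto simp: set_Cons_def)
      show "fob E (zs @ map A xs) = fob E ((zs @ [A (fst (hd xs, tl xs))]) @ map A (snd (hd xs, tl xs)))"
        by (simp add: xs)
      have lys: "length ys = length cs \<and> (\<forall>i<length ys. \<iota> (ys ! i) \<in> hom V (A (ys ! i)) (cs ! i))"
        using ys cpi len
      proof (induction Js arbitrary: ys cs)
        case (Cons J Js)
        then obtain y ys' d ds where "ys = y # ys'" "cs = d # ds" "y \<in> J" "ys' \<in> listset Js"
          by (cases cs) (auto simp: set_Cons_def)
        then show ?case using Cons.IH[of ys' ds] Cons.prems(2)[of "Suc _"] Cons.prems(2)[of 0] Cons.prems(3)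
          by (auto simp: nth_Cons coproduct_hom split: nat.split)
      qed auto
      \<comment> \<open>Injecting the later entries first and the head entry afterwards is the same
        as injecting all of them together: at each entry at least one of the two factors is an
        identity.\<close>
      have "far E (map (Idt V) zs @ \<iota> x # map (Idt V) cs) o[V]
        far E (map (Idt V) (zs @ [A x]) @ map \<iota> ys) = far E (map (Idt V) zs @ map \<iota> xs)"
      proof (rule E_cmp)
        fix i assume i: "i < length (map (Idt V) zs @ map \<iota> xs)"
        consider "i < length zs" | "i = length zs" | k where "i = Suc (length zs + k)" "k < length ys"
        proof (cases "i < length zs")
          case False
          then obtain k where k: "i = length zs + k" by (metis le_Suc_ex not_less)
          then show ?thesis using i xs that(2) that(3)[of "k - 1"] by (cases k) auto
        qed (rule that(1))
        then show "(map (Idt V) (zs @ [A x]) @ map \<iota> ys) ! i \<in> Arr V \<and>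
          (map (Idt V) zs @ \<iota> x # map (Idt V) cs) ! i \<in> Arr V \<and>
          Cod V ((map (Idt V) (zs @ [A x]) @ map \<iota> ys) ! i) =
          Dom V ((map (Idt V) zs @ \<iota> x # map (Idt V) cs) ! i) \<and>
          (map (Idt V) zs @ map \<iota> xs) ! i =
          (map (Idt V) zs @ \<iota> x # map (Idt V) cs) ! i o[V] (map (Idt V) (zs @ [A x]) @ map \<iota> ys) ! i"
        proof cases
          case 1
          then show ?thesis using Cons.prems(4) by (auto simp: nth_append in_lists_nth)
        next
          case 2
          then show ?thesis using A[OF x] coproduct_hom[OF cpc x] xs by (auto simp: nth_append hom_iff)
        next
          case 3
          then show ?thesis using lys cs xs by (auto simp: nth_append hom_iff in_lists_nth)
        qed
      qed (use lys xs in auto)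
      then show "far E (map (Idt V) zs @ map \<iota> xs) =
        far E (map (Idt V) zs @ \<iota> (fst (hd xs, tl xs)) # map (Idt V) cs) o[V]
        far E (map (Idt V) (zs @ [A (fst (hd xs, tl xs))]) @ map \<iota> (snd (hd xs, tl xs)))"
        by (simp add: xs)
    qed
  qed
  from this[of "[]"] show ?thesis by simp
qed

end

section \<open>Paths and their refinements\<close>

lemma listset_nth:
  "xs \<in> listset As \<longleftrightarrow> length xs = length As \<and> (\<forall>i<length As. xs ! i \<in> As ! i)"
proof (induction As arbitrary: xs)
  case (Cons A As)
  show ?case
    by (cases xs) (auto simp: set_Cons_def Cons nth_Cons all_conj_distrib less_Suc_eq_0_disj split: nat.splits)
qed simp

lemma listset_append: "\<lbrakk>xs \<in> listset As; ys \<in> listset Bs\<rbrakk> \<Longrightarrow> xs @ ys \<in> listset (As @ Bs)"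
  by (auto simp: listset_nth nth_append)

lemma listset_concat:
  "list_all2 (\<lambda>xs As. xs \<in> listset As) xss Ass \<Longrightarrow> concat xss \<in> listset (concat Ass)"
  by (induction rule: list_all2_induct) (auto intro: listset_append)

lemma steps_simps [simp]: "steps [] = []" "steps [a] = []" "steps (a # b # x) = (a, b) # steps (b # x)"
  by (simp_all add: steps_def)

lemma length_steps [simp]: "length (steps x) = length x - 1"
  by (simp add: steps_def)

lemma nth_steps: "i < length x - 1 \<Longrightarrow> steps x ! i = (x ! i, x ! Suc i)"
  by (simp add: steps_def nth_tl)

lemma steps_append: "x \<noteq> [] \<Longrightarrow> steps (x @ r) = steps x @ steps (last x # r)"
proof (induction x)
  case (Cons a x)
  then show ?case by (cases x) auto
qed simp

lemma length_path_seq [simp]: "length (path_seq X x) = length x - 1"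
  by (simp add: path_seq_def)

lemma nth_path_seq: "i < length x - 1 \<Longrightarrow> path_seq X x ! i = ghom X (x ! i) (x ! Suc i)"
  by (simp add: path_seq_def nth_steps)

text \<open>The action of \<open>path_seq\<close> on morphisms: by \<open>path_map_hom\<close> this
  is a morphism of sequences from \<open>path_seq X x\<close> to
  \<open>path_seq Y (map (gfun f) x)\<close>.\<close>

definition path_map :: "('u, 'o, 'a) gmor \<Rightarrow> 'u list \<Rightarrow> 'a list" where
  "path_map f x = map (\<lambda>(c, d). gmap f c d) (steps x)"

lemma length_path_map [simp]: "length (path_map f x) = length x - 1"
  by (simp add: path_map_def)

lemma nth_path_map: "i < length x - 1 \<Longrightarrow> path_map f x ! i = gmap f (x ! i) (x ! Suc i)"
  by (simp add: path_map_def nth_steps)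

lemma paths_iff:
  "x \<in> paths A a b \<longleftrightarrow> x \<noteq> [] \<and> (\<forall>i<length x. x ! i \<in> A) \<and> x ! 0 = a \<and> x ! (length x - 1) = b"
  by (auto simp: paths_def set_conv_nth hd_conv_nth last_conv_nth)

lemma paths_nth: "\<lbrakk>x \<in> paths A a b; i < length x\<rbrakk> \<Longrightarrow> x ! i \<in> A"
  by (simp add: paths_iff)

lemma paths_ends: "x \<in> paths A a b \<Longrightarrow> a \<in> A \<and> b \<in> A \<and> x \<noteq> [] \<and> hd x = a \<and> last x = b"
  by (auto simp: paths_def)

lemma paths_single: "a \<in> A \<Longrightarrow> [a] \<in> paths A a a" and paths_pair: "\<lbrakk>a \<in> A; b \<in> A\<rbrakk> \<Longrightarrow> [a, b] \<in> paths A a b"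
  by (auto simp: paths_def)

lemma paths_map: "\<lbrakk>x \<in> paths A a b; f ` A \<subseteq> B\<rbrakk> \<Longrightarrow> map f x \<in> paths B (f a) (f b)"
  by (auto simp: paths_def hd_map last_map)

section \<open>Refinements of paths and their concatenation\<close>

lemma refinements_nth:
  "xs \<in> refinements A y \<longleftrightarrow> length xs = length y - 1 \<and>
     (\<forall>i<length xs. xs ! i \<in> paths A (y ! i) (y ! Suc i))"
  by (auto simp: refinements_def listset_nth nth_steps)

lemma refinements_simps [simp]: "refinements A [a] = {[]}"
  "refinements A (a # b # y) = {x # xs | x xs. x \<in> paths A a b \<and> xs \<in> refinements A (b # y)}"
  by (auto simp: refinements_def set_Cons_def)

lemma tl_path_concat [simp]: "tl (path_concat a xs) = concat (map tl xs)"
  and hd_path_concat [simp]: "hd (path_concat a xs) = a"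
  and path_concat_Nil [simp]: "path_concat a [] = [a]"
  by (simp_all add: path_concat_def)

text \<open>The vertex b ends x and starts the rest; x keeps it and \<open>tl\<close> removes it
  from the rest.\<close>

lemma path_concat_Cons:
  assumes "x \<in> paths A a b" shows "path_concat a (x # xs) = x @ tl (path_concat b xs)"
  using assms by (cases x) (auto simp: path_concat_def paths_def)

text \<open>Gluing removes one copy of each shared vertex and loses no edge. Everything built from
  edges, such as \<open>path_seq\<close> and \<open>path_map\<close>, therefore turns gluing into
  \<open>concat\<close>.\<close>

lemma path_concat_props:
  assumes "y \<in> paths A a b" "xs \<in> refinements A y"
  shows "path_concat a xs \<in> paths A a b \<and> steps (path_concat a xs) = concat (map steps xs)"
  using assms
proof (induction y arbitrary: a xs)
  case (Cons a' y)
  then have a': "a' = a" by (simp add: paths_def)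
  show ?case
  proof (cases y)
    case Nil
    then show ?thesis using Cons.prems a' by (auto simp: paths_def)
  next
    case y: (Cons c r)
    then obtain x xs' where xs: "xs = x # xs'" "x \<in> paths A a c" "xs' \<in> refinements A y"
      using Cons.prems a' by auto
    have "y \<in> paths A c b" using Cons.prems(1) y by (auto simp: paths_def)
    note IH = Cons.IH[OF this xs(3)]
    then obtain r' where r': "path_concat c xs' = c # r'" by (simp add: path_concat_def)
    have "x @ r' \<in> paths A a b"
      using IH xs(2) r' by (auto simp: paths_def split: if_splits)
    then show ?thesis
      using IH xs r' path_concat_Cons[OF xs(2), of xs'] steps_append[of x r']
      by (auto simp: paths_def)
  qed
qed (simp add: paths_def)

lemma path_seq_concat:
  "\<lbrakk>y \<in> paths A a b; xs \<in> refinements A y\<rbrakk>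
    \<Longrightarrow> path_seq X (path_concat a xs) = concat (map (path_seq X) xs)"
  by (simp add: path_seq_def[abs_def] path_concat_props map_concat comp_def)

lemma path_map_concat:
  "\<lbrakk>y \<in> paths A a b; xs \<in> refinements A y\<rbrakk>
    \<Longrightarrow> path_map f (path_concat a xs) = concat (map (path_map f) xs)"
  by (simp add: path_map_def[abs_def] path_concat_props map_concat comp_def)

lemma map_path_concat: "map f (path_concat a xs) = path_concat (f a) (map (map f) xs)"
  by (simp add: path_concat_def map_concat map_tl comp_def)

lemma refinements_map:
  "\<lbrakk>xs \<in> refinements A y; f ` A \<subseteq> B\<rbrakk> \<Longrightarrow> map (map f) xs \<in> refinements B (map f y)"
  by (auto simp: refinements_nth intro: paths_map)

text \<open>The edges of the glued path are the edges of its pieces in order, so refinements of the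
  pieces combine to one of the whole.\<close>

lemma refinements_concat:
  assumes "y \<in> paths A a b" "xs \<in> refinements A y"
    and "length xss = length xs" "\<And>i. i < length xs \<Longrightarrow> xss ! i \<in> refinements A (xs ! i)"
  shows "concat xss \<in> refinements A (path_concat a xs)"
proof -
  have "map (\<lambda>(c, d). paths A c d) (steps (path_concat a xs)) =
    concat (map (\<lambda>x. map (\<lambda>(c, d). paths A c d) (steps x)) xs)"
    using path_concat_props[OF assms(1,2)] by (simp add: map_concat comp_def)
  moreover have "list_all2 (\<lambda>xs As. xs \<in> listset As) xss
    (map (\<lambda>x. map (\<lambda>(c, d). paths A c d) (steps x)) xs)"
    using assms(3,4) by (auto simp: list_all2_conv_all_nth refinements_def)
  ultimately show ?thesis using listset_concat by (simp add: refinements_def)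
qed

text \<open>Gluing in two stages and gluing all pieces at once give the same path. Together with
  \<open>refinements_concat\<close> this is the combinatorial content of associativity. The start of
  each inner path is recovered as a \<open>hd\<close>, since the mapped function does not see
  y.\<close>

lemma refinements_map2_concat:
  assumes "xs \<in> refinements A y" "length xss = length xs"
    and "\<And>i. i < length xs \<Longrightarrow> xss ! i \<in> refinements A (xs ! i)"
  shows "map2 (\<lambda>x. path_concat (hd x)) xs xss \<in> refinements A y"
    and "path_concat a (map2 (\<lambda>x. path_concat (hd x)) xs xss) = path_concat a (concat xss)"
proof -
  have "path_concat (hd (xs ! i)) (xss ! i) \<in> paths A (y ! i) (y ! Suc i)" if "i < length xs" for i
    using path_concat_props[OF _ assms(3)[OF that]] assms(1) that paths_ends
    by (metis refinements_nth)
  then show "map2 (\<lambda>x. path_concat (hd x)) xs xss \<in> refinements A y"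
    using assms(1,2) by (auto simp: refinements_nth)
  have "map tl (map2 (\<lambda>x. path_concat (hd x)) xs xss) = map (\<lambda>xs. concat (map tl xs)) xss"
    using assms(2) by (auto simp: list_eq_iff_nth_eq)
  moreover have "concat (map (\<lambda>xs. concat (map tl xs)) xss) = concat (map tl (concat xss))"
    by (induction xss) auto
  ultimately show "path_concat a (map2 (\<lambda>x. path_concat (hd x)) xs xss) = path_concat a (concat xss)"
    unfolding path_concat_def by (simp only:)
qed

text \<open>The offset counts the edges of the earlier pieces and not their vertices, since
  consecutive pieces share a vertex. The offsets in \<open>bar_tau\<close> are the same numbers,
  computed from lengths of sequences.\<close>

lemma path_concat_nth:
  assumes "y \<in> paths A a b" "xs \<in> refinements A y" "i < length xs" "j < length (xs ! i)"
  shows "length (concat (map tl (take i xs))) + j < length (path_concat a xs)"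
    and "path_concat a xs ! (length (concat (map tl (take i xs))) + j) = xs ! i ! j"
proof -
  have "length (concat (map tl (take i xs))) + j < length (path_concat a xs) \<and>
    path_concat a xs ! (length (concat (map tl (take i xs))) + j) = xs ! i ! j"
    using assms
  proof (induction y arbitrary: a xs i)
    case (Cons a' y)
    then have a': "a' = a" by (simp add: paths_def)
    with Cons.prems obtain c r where y: "y = c # r" by (cases y) auto
    then obtain x xs' where xs: "xs = x # xs'" "x \<in> paths A a c" "xs' \<in> refinements A y"
      using Cons.prems a' by auto
    have y': "y \<in> paths A c b" using Cons.prems(1) y by (auto simp: paths_def)
    note pc = path_concat_Cons[OF xs(2), of xs']
    show ?case
    proof (cases i)
      case 0
      then show ?thesis using xs(1) pc Cons.prems(4) by (simp add: nth_append)
    next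
      case (Suc k)
      let ?m = "length (concat (map tl (take k xs'))) + j"
      have IH: "?m < length (path_concat c xs')" "path_concat c xs' ! ?m = xs' ! k ! j"
        using Cons.IH[OF y' xs(3), of k] Cons.prems(3,4) Suc xs(1) by auto
      have x: "x \<noteq> []" "last x = c" using xs(2) by (auto simp: paths_def)
      have m: "length (concat (map tl (take i xs))) + j = length x - 1 + ?m" using Suc xs(1) by simp
      obtain r' where r': "path_concat c xs' = c # r'" by (simp add: path_concat_def)
      have "(x @ r') ! (length x - 1 + ?m) = (c # r') ! ?m"
      \<comment> \<open>For \<open>?m = 0\<close> the vertex is the shared one: the index still
        points into x, at its last vertex, which is also the first vertex of the rest.\<close>
      proof (cases "?m = 0")
        case True
        then show ?thesis unfolding True using x by (simp add: nth_append last_conv_nth)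
      next
        case False
        then obtain m' where m': "?m = Suc m'" by (metis not0_implies_Suc)
        have "length x - 1 + Suc m' = length x + m'" using x by (cases x) auto
        then show ?thesis unfolding m' by (simp only: nth_append_length_plus nth_Cons_Suc)
      qed
      moreover have "length x - 1 + ?m < length (x @ r')"
        using IH(1) x unfolding r' by (cases x) auto
      ultimately show ?thesis unfolding xs(1) pc m[unfolded xs(1)] using IH(2) unfolding r' Suc by simp
    qed
  qed (simp add: paths_def)
  then show "length (concat (map tl (take i xs))) + j < length (path_concat a xs)"
    and "path_concat a xs ! (length (concat (map tl (take i xs))) + j) = xs ! i ! j" by auto
qed

text \<open>Converse of \<open>path_seq_concat\<close>: every bracketing of the sequence along x
  comes from a refinement, an empty block giving a path with one vertex. This is how laws about
  arbitrary nested sequences are reached from graphs.\<close>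

lemma path_split:
  assumes "x \<in> paths A a b" "path_seq X x = concat Zss"
  shows "\<exists>y xs. y \<in> paths A a b \<and> xs \<in> refinements A y \<and> path_concat a xs = x \<and> map (path_seq X) xs = Zss"
  using assms
proof (induction Zss arbitrary: a x)
  case Nil
  then have "x = [a]" by (cases x; cases "tl x") (auto simp: path_seq_def paths_def)
  then show ?case using Nil by (intro exI[of _ "[a]"] exI[of _ "[]"]) auto
next
  case (Cons Z Zss)
  let ?n = "length Z"
  \<comment> \<open>A block of n entries spans n + 1 vertices; the two parts overlap in the vertex
    \<open>?c\<close> where they meet.\<close>
  let ?x1 = "take (Suc ?n) x" and ?x2 = "drop ?n x" and ?c = "x ! length Z"
  have "length x - 1 = ?n + length (concat Zss)" using arg_cong[OF Cons.prems(2), of length] by simp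
  moreover have "x \<noteq> []" using Cons.prems(1) by (simp add: paths_def)
  ultimately have len: "?n < length x" by (cases x) auto
  have last: "last ?x1 = ?c" using len by (simp add: take_Suc_conv_app_nth)
  then have x1: "?x1 \<in> paths A a ?c"
    using Cons.prems(1) len by (auto simp: paths_def dest: in_set_takeD)
  have x2: "?x2 \<in> paths A ?c b" using Cons.prems(1) len by (auto simp: paths_def hd_drop_conv_nth dest: in_set_dropD)
  have s: "steps x = steps ?x1 @ steps ?x2"
  proof -
    have "x = ?x1 @ drop (Suc ?n) x" by simp
    then have "steps x = steps ?x1 @ steps (last ?x1 # drop (Suc ?n) x)"
      using steps_append[of ?x1 "drop (Suc ?n) x"] len by (metis \<open>x \<noteq> []\<close> nat.distinct(1) take_eq_Nil)
    moreover have "last ?x1 # drop (Suc ?n) x = ?x2"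
      using len last by (simp add: Cons_nth_drop_Suc)
    ultimately show ?thesis by simp
  qed
  have "path_seq X ?x1 @ path_seq X ?x2 = Z @ concat Zss"
    using Cons.prems(2) s by (simp add: path_seq_def)
  moreover have "length (path_seq X ?x1) = ?n" using len by simp
  ultimately have ps: "path_seq X ?x1 = Z" "path_seq X ?x2 = concat Zss" by auto
  obtain y xs where IH: "y \<in> paths A ?c b" "xs \<in> refinements A y" "path_concat ?c xs = ?x2"
    "map (path_seq X) xs = Zss" using Cons.IH[OF x2 ps(2)] by blast
  obtain r where y: "y = ?c # r" using IH(1) by (cases y) (auto simp: paths_def)
  have "tl ?x2 = drop (Suc ?n) x" by (simp add: drop_Suc tl_drop)
  then have "path_concat a (?x1 # xs) = x"
    using path_concat_Cons[OF x1, of xs] IH(3) by (metis append_take_drop_id)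
  moreover have "a # y \<in> paths A a b" using IH(1) Cons.prems(1) y by (auto simp: paths_def)
  moreover have "?x1 # xs \<in> refinements A (a # y)" using x1 IH(2) y by simp
  ultimately show ?case using ps(1) IH(4) by (intro exI[of _ "a # y"] exI[of _ "?x1 # xs"]) simp
qed

text \<open>\<open>path_split\<close> is used for the outer blocks and again inside each of the
  resulting paths; \<open>refinements_map2_concat\<close> identifies the two ways of gluing.\<close>

lemma path_split2:
  assumes "x \<in> paths A a b" "path_seq X x = concat (concat Zsss)"
  shows "\<exists>z ys xss. z \<in> paths A a b \<and> ys \<in> refinements A z \<and> length xss = length ys \<and>
    (\<forall>i<length ys. xss ! i \<in> refinements A (ys ! i)) \<and> map (map (path_seq X)) xss = Zsss \<and>
    path_concat a (concat xss) = x"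
proof -
  have "concat (concat Zsss) = concat (map concat Zsss)" by (induction Zsss) auto
  then have "path_seq X x = concat (map concat Zsss)" using assms(2) by simp
  then obtain z xs where z: "z \<in> paths A a b" "xs \<in> refinements A z" "path_concat a xs = x"
    "map (path_seq X) xs = map concat Zsss" using path_split[OF assms(1)] by blast
  have len: "length Zsss = length xs" using z(4) map_eq_imp_length_eq by metis
  let ?P = "\<lambda>i y ws. y \<in> paths A (z ! i) (z ! Suc i) \<and> ws \<in> refinements A y \<and>
    path_concat (z ! i) ws = xs ! i \<and> map (path_seq X) ws = Zsss ! i"
  have "\<exists>y ws. ?P i y ws" if "i < length xs" for i
  proof (rule path_split)
    show "xs ! i \<in> paths A (z ! i) (z ! Suc i)" using z(2) that by (simp add: refinements_nth)
    show "path_seq X (xs ! i) = concat (Zsss ! i)"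
      using arg_cong[OF z(4), of "\<lambda>l. l ! i"] that len by simp
  qed
  then have "\<forall>i\<in>{..<length xs}. \<exists>p. ?P i (fst p) (snd p)" unfolding split_paired_Ex fst_conv snd_conv by blast
  from bchoice[OF this] obtain p where p: "\<And>i. i < length xs \<Longrightarrow> ?P i (fst (p i)) (snd (p i))" by auto
  define Y WS where "Y i = fst (p i)" and "WS i = snd (p i)" for i
  have YW: "?P i (Y i) (WS i)" if "i < length xs" for i using p[OF that] unfolding Y_def WS_def .
  define ys xss where "ys = map Y [0..<length xs]" and "xss = map WS [0..<length xs]"
  have ys: "ys \<in> refinements A z" using YW z(2) by (simp add: refinements_nth ys_def)
  have xss: "xss ! i \<in> refinements A (ys ! i)" if "i < length ys" for i
    using YW that by (simp add: ys_def xss_def)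
  have len_xss: "length xss = length ys" by (simp add: ys_def xss_def)
  have "path_concat (hd (Y i)) (WS i) = xs ! i" if "i < length xs" for i
    using YW[OF that] paths_ends[of "Y i"] by auto
  then have "map2 (\<lambda>x. path_concat (hd x)) ys xss = xs"
    by (intro nth_equalityI) (simp_all add: ys_def xss_def)
  then have "path_concat a (concat xss) = x"
    using refinements_map2_concat(2)[OF ys len_xss xss, of a] z(3) by simp
  moreover have "map (map (path_seq X)) xss = Zsss"
  proof (rule nth_equalityI)
    show "map (map (path_seq X)) xss ! i = Zsss ! i" if "i < length (map (map (path_seq X)) xss)" for i
      using YW[of i] that by (simp add: xss_def)
  qed (simp add: len xss_def)
  ultimately show ?thesis using z(1) ys xss len_xss by blast
qed


section \<open>The category of enriched graphs\<close>

lemma gcat_simps: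
  "X \<in> Obj (graph_cat small V) \<longleftrightarrow> is_graph small V X" "f \<in> Arr (graph_cat small V) \<longleftrightarrow> is_gmor small V f"
  "Dom (graph_cat small V) = gdom" "Cod (graph_cat small V) = gcod"
  by (simp_all add: graph_cat_def)

lemma gobj_mk_graph [simp]: "gobj (mk_graph A h) = A"
  by (simp add: mk_graph_def)

lemma ghom_mk_graph [simp]: "\<lbrakk>a \<in> A; b \<in> A\<rbrakk> \<Longrightarrow> ghom (mk_graph A h) a b = h a b"
  by (simp add: mk_graph_def restrict2_def)

lemma is_graph_mk_graph:
  "\<lbrakk>small A; \<And>a b. \<lbrakk>a \<in> A; b \<in> A\<rbrakk> \<Longrightarrow> h a b \<in> Obj V\<rbrakk> \<Longrightarrow> is_graph small V (mk_graph A h)"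
  unfolding is_graph_def by (simp add: mk_graph_def restrict2_def fun_eq_iff)

text \<open>The extensionality equation is turned around: read from left to right as in the
  definition, it would reproduce its own left-hand side when used for rewriting.\<close>

lemma is_graph_iff:
  "is_graph small V X \<longleftrightarrow> small (gobj X) \<and> (\<forall>a\<in>gobj X. \<forall>b\<in>gobj X. ghom X a b \<in> Obj V) \<and>
     restrict2 (gobj X) (ghom X) = ghom X"
  unfolding is_graph_def by (intro conj_cong refl) (rule eq_commute)

lemma is_gmor_iff:
  "is_gmor small V f \<longleftrightarrow>
     is_graph small V (gdom f) \<and> is_graph small V (gcod f) \<and>
     gfun f \<in> gobj (gdom f) \<rightarrow>\<^sub>E gobj (gcod f) \<and>
     (\<forall>a\<in>gobj (gdom f). \<forall>b\<in>gobj (gdom f).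
  gmap f a b \<in> hom V (ghom (gdom f) a b) (ghom (gcod f) (gfun f a) (gfun f b))) \<and>
     restrict2 (gobj (gdom f)) (gmap f) = gmap f"
  unfolding is_gmor_def by (intro conj_cong refl) (rule eq_commute)

lemma restrict2_eqI:
  assumes "restrict2 A h = h" "restrict2 A k = k" "\<And>a b. \<lbrakk>a \<in> A; b \<in> A\<rbrakk> \<Longrightarrow> h a b = k a b"
  shows "h = k"
proof -
  have "restrict2 A h = restrict2 A k" using assms(3) by (auto simp: restrict2_def fun_eq_iff)
  then show ?thesis unfolding assms(1,2) .
qed

lemma graph_eqI:
  assumes "is_graph small V X" "is_graph small W Y" "gobj X = gobj Y"
    and "\<And>a b. \<lbrakk>a \<in> gobj X; b \<in> gobj X\<rbrakk> \<Longrightarrow> ghom X a b = ghom Y a b"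
  shows "X = Y"
proof -
  have "ghom X = ghom Y"
    by (rule restrict2_eqI[of "gobj X"]) (use assms in \<open>auto simp: is_graph_iff\<close>)
  then show ?thesis using assms(3) by (cases X; cases Y) simp
qed

lemma is_graph_hom: "\<lbrakk>is_graph small V X; a \<in> gobj X; b \<in> gobj X\<rbrakk> \<Longrightarrow> ghom X a b \<in> Obj V"
  by (simp add: is_graph_iff)

lemma is_graph_small: "is_graph small V X \<Longrightarrow> small (gobj X)"
  by (simp add: is_graph_iff)

lemma gmor_selectors [simp]:
  "gdom (mk_gmor X Y f h) = X" "gcod (mk_gmor X Y f h) = Y"
  "a \<in> gobj X \<Longrightarrow> gfun (mk_gmor X Y f h) a = f a"
  "\<lbrakk>a \<in> gobj X; b \<in> gobj X\<rbrakk> \<Longrightarrow> gmap (mk_gmor X Y f h) a b = h a b"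
  by (simp_all add: mk_gmor_def restrict2_def)

lemma graph_hom_iff:
  "f \<in> hom (graph_cat small V) X Y \<longleftrightarrow> is_graph small V X \<and> is_graph small V Y \<and>
     gdom f = X \<and> gcod f = Y \<and> gfun f \<in> gobj X \<rightarrow>\<^sub>E gobj Y \<and>
     (\<forall>a\<in>gobj X. \<forall>b\<in>gobj X. gmap f a b \<in> hom V (ghom X a b) (ghom Y (gfun f a) (gfun f b))) \<and>
     restrict2 (gobj X) (gmap f) = gmap f"
  by (auto simp: hom_iff gcat_simps is_gmor_iff)

lemma mk_gmor_hom:
  assumes "is_graph small V X" "is_graph small V Y" "\<And>a. a \<in> gobj X \<Longrightarrow> f a \<in> gobj Y"
    and "\<And>a b. \<lbrakk>a \<in> gobj X; b \<in> gobj X\<rbrakk> \<Longrightarrow> h a b \<in> hom V (ghom X a b) (ghom Y (f a) (f b))"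
  shows "mk_gmor X Y f h \<in> hom (graph_cat small V) X Y"
  using assms by (auto simp: graph_hom_iff mk_gmor_def restrict2_def fun_eq_iff)

lemma gmor_eqI:
  assumes "f \<in> hom (graph_cat small V) X Y" "g \<in> hom (graph_cat small V) X Y"
    and "\<And>a. a \<in> gobj X \<Longrightarrow> gfun f a = gfun g a"
    and "\<And>a b. \<lbrakk>a \<in> gobj X; b \<in> gobj X\<rbrakk> \<Longrightarrow> gmap f a b = gmap g a b"
  shows "f = g"
proof -
  have "restrict2 (gobj X) (gmap f) = gmap f" "restrict2 (gobj X) (gmap g) = gmap g"
    and ext: "gfun f \<in> extensional (gobj X)" "gfun g \<in> extensional (gobj X)"
    using assms(1,2) by (auto simp: graph_hom_iff PiE_def)
  then have "gmap f = gmap g" using assms(4) by (auto intro: restrict2_eqI[of "gobj X"])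
  moreover have "gfun f = gfun g" by (rule extensionalityI[OF ext assms(3)])
  moreover note assms(1,2)
  ultimately show ?thesis by (cases f; cases g) (auto simp: graph_hom_iff)
qed

lemma gmor_hom:
  assumes "f \<in> hom (graph_cat small V) X Y"
  shows "is_graph small V X" "is_graph small V Y" "gdom f = X" "gcod f = Y" "gfun f ` gobj X \<subseteq> gobj Y"
    "a \<in> gobj X \<Longrightarrow> gfun f a \<in> gobj Y"
    "\<lbrakk>a \<in> gobj X; b \<in> gobj X\<rbrakk> \<Longrightarrow> gmap f a b \<in> hom V (ghom X a b) (ghom Y (gfun f a) (gfun f b))"
  using assms by (auto simp: graph_hom_iff)

lemma graph_cmp:
  assumes "f \<in> hom (graph_cat small V) X Y"
  shows "a \<in> gobj X \<Longrightarrow> gfun (g o[graph_cat small V] f) a = gfun g (gfun f a)"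
    "\<lbrakk>a \<in> gobj X; b \<in> gobj X\<rbrakk> \<Longrightarrow>
  gmap (g o[graph_cat small V] f) a b = gmap g (gfun f a) (gfun f b) o[V] gmap f a b"
  using assms by (auto simp: graph_cat_def hom_iff)

lemma graph_Idt:
  "a \<in> gobj X \<Longrightarrow> gfun (Idt (graph_cat small V) X) a = a"
  "\<lbrakk>a \<in> gobj X; b \<in> gobj X\<rbrakk> \<Longrightarrow> gmap (Idt (graph_cat small V) X) a b = Idt V (ghom X a b)"
  by (auto simp: graph_cat_def)

lemma category_graph_cat:
  assumes "category V" shows "category (graph_cat small V)"
proof -
  interpret category V by fact
  let ?G = "graph_cat small V"
  have cmp: "g o[?G] f \<in> hom ?G X Z" if "f \<in> hom ?G X Y" "g \<in> hom ?G Y Z" for f g X Y Z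
  proof -
    have "g o[?G] f = mk_gmor X Z (\<lambda>a. gfun g (gfun f a))
      (\<lambda>a b. gmap g (gfun f a) (gfun f b) o[V] gmap f a b)"
      using that by (simp add: graph_cat_def hom_iff)
    also have "\<dots> \<in> hom ?G X Z"
      by (intro mk_gmor_hom Cmp_hom[OF gmor_hom(7)[OF that(1)] gmor_hom(7)[OF that(2)]]
        gmor_hom[OF that(1)] gmor_hom[OF that(2)])
    finally show ?thesis .
  qed
  have idt: "Idt ?G X \<in> hom ?G X X" if "is_graph small V X" for X
    using that mk_gmor_hom[of small V X X "\<lambda>a. a" "\<lambda>a b. Idt V (ghom X a b)"]
    by (auto simp: graph_cat_def is_graph_hom Idt_hom)
  show ?thesis
  proof
    show "Idt ?G Y o[?G] f = f" if "f \<in> hom ?G X Y" for f X Y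
    proof (rule gmor_eqI[OF cmp[OF that idt[OF gmor_hom(2)[OF that]]] that])
      show "gmap (Idt ?G Y o[?G] f) a b = gmap f a b" if "a \<in> gobj X" "b \<in> gobj X" for a b
        using that Idt_left[OF gmor_hom(7)[OF \<open>f \<in> hom ?G X Y\<close> that]]
        by (simp add: graph_cmp[OF \<open>f \<in> hom ?G X Y\<close>] graph_Idt gmor_hom(6)[OF \<open>f \<in> hom ?G X Y\<close>])
    qed (simp add: graph_cmp[OF that] graph_Idt gmor_hom(6)[OF that])
    show "f o[?G] Idt ?G X = f" if "f \<in> hom ?G X Y" for f X Y
    proof (rule gmor_eqI[OF cmp[OF idt[OF gmor_hom(1)[OF that]] that] that])
      note i = idt[OF gmor_hom(1)[OF that]]
      show "gmap (f o[?G] Idt ?G X) a b = gmap f a b" if "a \<in> gobj X" "b \<in> gobj X" for a b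
        using that Idt_right[OF gmor_hom(7)[OF \<open>f \<in> hom ?G X Y\<close> that]]
        by (simp add: graph_cmp[OF i] graph_Idt)
    qed (simp add: graph_cmp[OF idt[OF gmor_hom(1)[OF that]]] graph_Idt)
    show "(h o[?G] g) o[?G] f = h o[?G] (g o[?G] f)"
      if f: "f \<in> hom ?G X Y" and g: "g \<in> hom ?G Y Z" and h: "h \<in> hom ?G Z W" for f g h X Y Z W
    proof (rule gmor_eqI[OF cmp[OF f cmp[OF g h]] cmp[OF cmp[OF f g] h]])
      show "gmap ((h o[?G] g) o[?G] f) a b = gmap (h o[?G] (g o[?G] f)) a b" if "a \<in> gobj X" "b \<in> gobj X" for a b
        using that Cmp_assoc[OF gmor_hom(7)[OF f that] gmor_hom(7)[OF g] gmor_hom(7)[OF h]] gmor_hom(6)[OF f] gmor_hom(6)[OF g]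
        by (simp add: graph_cmp[OF f] graph_cmp[OF g] graph_cmp[OF cmp[OF f g]])
    qed (use gmor_hom(6)[OF f] in \<open>simp add: graph_cmp[OF f] graph_cmp[OF g] graph_cmp[OF cmp[OF f g]]\<close>)
  qed (use cmp idt in \<open>auto simp: gcat_simps is_gmor_iff\<close>)
qed

lemma path_seq_Obj:
  assumes "is_graph small V X" "x \<in> walks X a b"
  shows "path_seq X x \<in> seqs V"
  using assms paths_nth[OF assms(2)] unfolding in_lists_nth by (auto simp: nth_path_seq is_graph_hom)

lemma path_seq_Obj_refinement:
  assumes "is_graph small V X" "xs \<in> refined X y"
  shows "map (path_seq X) xs \<in> lists (seqs V)"
proof -
  have "xs ! i \<in> walks X (y ! i) (y ! Suc i)" if "i < length xs" for i
    using assms(2) that by (simp add: refinements_nth)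
  from path_seq_Obj[OF assms(1) this] have "path_seq X (xs ! i) \<in> seqs V" if "i < length xs" for i
    using that .
  then show ?thesis by (subst in_lists_nth) simp
qed

lemma path_map_hom:
  assumes f: "f \<in> hom (graph_cat small V) X Y" and x: "x \<in> walks X a b"
  shows "map (gfun f) x \<in> walks Y (gfun f a) (gfun f b)"
    and "path_map f x \<in> hom (seq_cat V) (path_seq X x) (path_seq Y (map (gfun f) x))"
proof -
  show "map (gfun f) x \<in> walks Y (gfun f a) (gfun f b)"
    using paths_map[OF x] gmor_hom(5)[OF f] .
  show "path_map f x \<in> hom (seq_cat V) (path_seq X x) (path_seq Y (map (gfun f) x))"
    unfolding hom_seq_cat using paths_nth[OF x] gmor_hom(7)[OF f]
    by (auto simp: nth_path_map nth_path_seq)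
qed


section \<open>Sequences as graphs\<close>

locale gcat = category V + smallness small
  for small :: "'u set \<Rightarrow> bool" and \<nu> :: "nat \<Rightarrow> 'u" and V :: "('o, 'a) cat" +
  assumes inj_\<nu>: "inj \<nu>" and coproducts: "has_coproducts small V"
begin

abbreviation graph :: "('u, 'o) graph \<Rightarrow> bool" where "graph \<equiv> is_graph small V"

abbreviation GV :: "(('u, 'o) graph, ('u, 'o, 'a) gmor) cat" where "GV \<equiv> graph_cat small V"

lemma \<nu>_eq [simp]: "\<nu> i = \<nu> j \<longleftrightarrow> i = j" using inj_\<nu> by (auto dest: injD)

lemma inv_\<nu> [simp]: "inv \<nu> (\<nu> i) = i" using inj_\<nu> by simp

text \<open>A coproduct over the empty set, which is small, is an initial object; hence the choice
  in \<open>initial_ob\<close> has a witness.\<close>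

lemma initial: "initial_ob V \<in> Obj V \<and> (\<forall>d\<in>Obj V. \<exists>!f. f \<in> hom V (initial_ob V) d)"
proof -
  have "small {}" by (simp add: small_finite)
  then obtain c and \<iota> :: "'u \<Rightarrow> 'a" where "is_coproduct V {} (\<lambda>_. undefined) c \<iota>"
    using coproducts unfolding has_coproducts_def by blast
  then have "c \<in> Obj V \<and> (\<forall>d\<in>Obj V. \<exists>!f. f \<in> hom V c d)" by (simp add: is_coproduct_def)
  then show ?thesis unfolding initial_ob_def by (rule someI)
qed

lemma initial_Obj: "initial_ob V \<in> Obj V"
  using initial by blast

lemma initial_unique: "\<lbrakk>f \<in> hom V (initial_ob V) d; g \<in> hom V (initial_ob V) d\<rbrakk> \<Longrightarrow> f = g"
  using initial hom_Obj by blast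

lemma from_initial: "d \<in> Obj V \<Longrightarrow> from_initial V d \<in> hom V (initial_ob V) d"
  using initial theI'[of "\<lambda>f. f \<in> hom V (initial_ob V) d"] unfolding from_initial_def by blast

lemma initial_coproduct: "is_coproduct V {} A (initial_ob V) \<iota>"
  using initial by (auto simp: is_coproduct_def)

lemma coproduct_empty_initial:
  assumes "is_coproduct V {} A c \<iota>" "f \<in> hom V c d" "g \<in> hom V c d" shows "f = g"
  using coproduct_eqI[OF assms] by simp

abbreviation seq :: "'o list \<Rightarrow> ('u, 'o) graph" where "seq \<equiv> seq_graph \<nu> V"

lemma gobj_seq [simp]: "gobj (seq Z) = \<nu> ` {..length Z}"
  by (simp add: seq_graph_def)

lemma ghom_seq:
  "i < length Z \<Longrightarrow> ghom (seq Z) (\<nu> i) (\<nu> (Suc i)) = Z ! i"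
  "\<lbrakk>i \<le> length Z; j \<le> length Z; j \<noteq> Suc i\<rbrakk> \<Longrightarrow> ghom (seq Z) (\<nu> i) (\<nu> j) = initial_ob V"
  by (simp_all add: seq_graph_def)

lemma seq_graph: "Z \<in> seqs V \<Longrightarrow> graph (seq Z)"
  unfolding seq_graph_def
  by (intro is_graph_mk_graph small_finite) (auto simp: initial_Obj in_lists_nth)

lemma seq_mor_hom:
  assumes Z: "Z \<in> seqs V" and X: "graph X"
    and f: "\<And>i. i \<le> length Z \<Longrightarrow> f i \<in> gobj X"
    and h: "\<And>i. i < length Z \<Longrightarrow> h ! i \<in> hom V (Z ! i) (ghom X (f i) (f (Suc i)))"
  shows "seq_mor \<nu> V Z X f h \<in> hom GV (seq Z) X"
  unfolding seq_mor_def
proof (rule mk_gmor_hom[OF seq_graph[OF Z] X])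
  fix a b assume "a \<in> gobj (seq Z)" "b \<in> gobj (seq Z)"
  then obtain i j where "a = \<nu> i" "b = \<nu> j" "i \<le> length Z" "j \<le> length Z" by auto
  then show "(if inv \<nu> b = Suc (inv \<nu> a) then h ! inv \<nu> a
    else from_initial V (ghom X (f (inv \<nu> a)) (f (inv \<nu> b))))
    \<in> hom V (ghom (seq Z) a b) (ghom X (f (inv \<nu> a)) (f (inv \<nu> b)))"
    using f h by (auto simp: ghom_seq intro!: from_initial is_graph_hom[OF X])
qed (use f in auto)

lemma seq_mor_simps [simp]:
  "i \<le> length Z \<Longrightarrow> gfun (seq_mor \<nu> V Z X f h) (\<nu> i) = f i"
  "i < length Z \<Longrightarrow> gmap (seq_mor \<nu> V Z X f h) (\<nu> i) (\<nu> (Suc i)) = h ! i"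
  by (simp_all add: seq_mor_def)

text \<open>All other homs of the graph of a sequence are initial, so two morphisms that agree on
  objects agree there automatically.\<close>

lemma seq_hom_eqI:
  assumes f: "f \<in> hom GV (seq Z) X" and g: "g \<in> hom GV (seq Z) X"
    and 0: "\<And>i. i \<le> length Z \<Longrightarrow> gfun f (\<nu> i) = gfun g (\<nu> i)"
    and 1: "\<And>i. i < length Z \<Longrightarrow> gmap f (\<nu> i) (\<nu> (Suc i)) = gmap g (\<nu> i) (\<nu> (Suc i))"
  shows "f = g"
proof (rule gmor_eqI[OF f g])
  show "gfun f a = gfun g a" if "a \<in> gobj (seq Z)" for a using 0 that by auto
  fix a b assume ab: "a \<in> gobj (seq Z)" "b \<in> gobj (seq Z)"
  then obtain i j where ij: "a = \<nu> i" "b = \<nu> j" "i \<le> length Z" "j \<le> length Z" by auto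
  show "gmap f a b = gmap g a b"
  proof (cases "j = Suc i")
    case True
    then show ?thesis using 1 ij by simp
  next
    case False
    then have "ghom (seq Z) a b = initial_ob V" using ij ghom_seq by simp
    then show ?thesis
      using gmor_hom(7)[OF f ab] gmor_hom(7)[OF g ab] 0 ij initial_unique by metis
  qed
qed

text \<open>The path along which the graph of a sequence Z of length n returns Z itself, see
  \<open>path_seq_canon\<close>.\<close>

definition canon :: "nat \<Rightarrow> 'u list" where "canon n = map \<nu> [0..<Suc n]"

lemma length_canon [simp]: "length (canon n) = Suc n"
  and nth_canon: "i \<le> n \<Longrightarrow> canon n ! i = \<nu> i"
  by (simp_all add: canon_def del: upt_Suc)

lemma canon_paths: "canon n \<in> paths (\<nu> ` {..n}) (\<nu> 0) (\<nu> n)"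
  by (auto simp: paths_iff nth_canon simp flip: length_greater_0_conv)

lemma path_seq_canon [simp]: "path_seq (seq Z) (canon (length Z)) = Z"
  by (auto simp: list_eq_iff_nth_eq nth_path_seq nth_canon ghom_seq)

lemma path_mor_hom:
  assumes X: "graph X" and x: "x \<in> walks X a b"
  shows "path_mor \<nu> V X x \<in> hom GV (seq (path_seq X x)) X"
  unfolding path_mor_def
proof (rule seq_mor_hom[OF path_seq_Obj[OF X x] X])
  show "x ! i \<in> gobj X" if "i \<le> length (path_seq X x)" for i
    using paths_nth[OF x, of i] that paths_ends[OF x] by (cases x) auto
  show "map (Idt V) (path_seq X x) ! i \<in> hom V (path_seq X x ! i) (ghom X (x ! i) (x ! Suc i))"
    if "i < length (path_seq X x)" for i
    using path_seq_Obj[OF X x] that unfolding in_lists_nth by (auto simp: nth_path_seq intro!: Idt_hom)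
qed

text \<open>By the last two equations the path morphism sends the canonical path to x and consists
  of identities along it. With naturality of t they reduce questions about t at x to questions at a
  canonical path.\<close>

lemma path_mor_simps:
  assumes "x \<in> walks X a b"
  shows "i < length x \<Longrightarrow> gfun (path_mor \<nu> V X x) (\<nu> i) = x ! i"
    "Suc i < length x \<Longrightarrow> gmap (path_mor \<nu> V X x) (\<nu> i) (\<nu> (Suc i)) = Idt V (ghom X (x ! i) (x ! Suc i))"
    "map (gfun (path_mor \<nu> V X x)) (canon (length x - 1)) = x"
    "path_map (path_mor \<nu> V X x) (canon (length x - 1)) = map (Idt V) (path_seq X x)"
proof -
  have x: "x \<noteq> []" using assms by (simp add: paths_def)
  show 1: "i < length x \<Longrightarrow> gfun (path_mor \<nu> V X x) (\<nu> i) = x ! i" for i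
    by (simp add: path_mor_def)
  show 2: "Suc i < length x \<Longrightarrow> gmap (path_mor \<nu> V X x) (\<nu> i) (\<nu> (Suc i)) = Idt V (ghom X (x ! i) (x ! Suc i))" for i
    by (simp add: path_mor_def nth_path_seq)
  show "map (gfun (path_mor \<nu> V X x)) (canon (length x - 1)) = x"
    by (rule nth_equalityI) (use x in \<open>simp_all add: 1 nth_canon\<close>)
  show "path_map (path_mor \<nu> V X x) (canon (length x - 1)) = map (Idt V) (path_seq X x)"
    by (rule nth_equalityI) (simp_all add: 2 nth_path_map nth_canon nth_path_seq)
qed

lemma small_paths: "small A \<Longrightarrow> small_index small (paths A a b)"
proof -
  assume "small A"
  then obtain B :: "'u set" where "small B" "lists A \<lesssim> B" using small_lists by blast
  moreover have "paths A a b \<lesssim> lists A" by (intro subset_imp_lepoll) (auto simp: paths_def)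
  ultimately show ?thesis unfolding small_index_def using lepoll_trans by blast
qed

end

text \<open>The refinement of a path by its own edges. It belongs to the inner unit law of a
  multitensor, in which every entry becomes a sequence of length one.\<close>

lemma steps_refinement:
  assumes "x \<in> paths A a b"
  shows "map (\<lambda>(c, d). [c, d]) (steps x) \<in> refinements A x"
    and "path_concat a (map (\<lambda>(c, d). [c, d]) (steps x)) = x"
    and "map (path_seq X) (map (\<lambda>(c, d). [c, d]) (steps x)) = map (\<lambda>z. [z]) (path_seq X x)"
proof -
  show "map (\<lambda>(c, d). [c, d]) (steps x) \<in> refinements A x"
    by (auto simp: refinements_nth nth_steps intro!: paths_pair paths_nth[OF assms])
  have "concat (map tl (map (\<lambda>(c, d). [c, d]) (steps x))) = map snd (steps x)"
    by (induction "steps x" arbitrary: x) (auto simp: case_prod_unfold comp_def concat_map_singleton)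
  moreover have "map snd (steps x) = tl x" unfolding steps_def by (rule map_snd_zip_take[THEN trans]) simp
  ultimately show "path_concat a (map (\<lambda>(c, d). [c, d]) (steps x)) = x"
    using assms by (cases x) (simp_all add: path_concat_def paths_def)
  show "map (path_seq X) (map (\<lambda>(c, d). [c, d]) (steps x)) = map (\<lambda>z. [z]) (path_seq X x)"
    by (simp add: path_seq_def case_prod_unfold)
qed

section \<open>Functors and natural transformations\<close>

lemma is_functorI:
  assumes "category C" "category D" "fob F \<in> extensional (Obj C)" "far F \<in> extensional (Arr C)"
    and "\<And>a. a \<in> Obj C \<Longrightarrow> fob F a \<in> Obj D"
    and "\<And>f a b. f \<in> hom C a b \<Longrightarrow> far F f \<in> hom D (fob F a) (fob F b)"
    and "\<And>a. a \<in> Obj C \<Longrightarrow> far F (Idt C a) = Idt D (fob F a)"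
    and "\<And>f g a b c. \<lbrakk>f \<in> hom C a b; g \<in> hom C b c\<rbrakk> \<Longrightarrow> far F (g o[C] f) = far F g o[D] far F f"
  shows "is_functor C D F"
  using assms by (intro is_functor.intro) (auto simp: PiE_def)

lemma functor_eqI:
  assumes "is_functor C D F" "is_functor C D G"
    and "\<And>a. a \<in> Obj C \<Longrightarrow> fob F a = fob G a" "\<And>f. f \<in> Arr C \<Longrightarrow> far F f = far G f"
  shows "F = G"
proof -
  have "fob F = fob G"
    using extensionalityI[of "fob F" "Obj C" "fob G"] is_functor.fob_closed assms by (auto simp: PiE_def)
  moreover have "far F = far G"
    using extensionalityI[of "far F" "Arr C" "far G"] is_functor.far_extensional assms by auto
  ultimately show ?thesis by (cases F; cases G) simp
qed

context is_functor
begin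

lemma fob_Obj: "a \<in> Obj C \<Longrightarrow> fob F a \<in> Obj D"
  using fob_closed by auto

lemma far_simps [simp]:
  assumes "f \<in> Arr C"
  shows "far F f \<in> Arr D" "Dom D (far F f) = fob F (Dom C f)" "Cod D (far F f) = fob F (Cod C f)"
  using far_hom[of f "Dom C f" "Cod C f"] assms by (auto simp: hom_iff)

lemma far_Cmp':
  "\<lbrakk>f \<in> Arr C; g \<in> Arr C; Cod C f = Dom C g\<rbrakk> \<Longrightarrow> far F (g o[C] f) = far F g o[D] far F f"
  by (rule far_Cmp[of f "Dom C f" "Cod C f" g "Cod C g"]) (auto simp: hom_iff)

end

lemma fid_functor:
  assumes "category C" shows "is_functor C C (fid C)"
proof -
  interpret category C by fact
  show ?thesis by (rule is_functorI) (auto simp: fid_def hom_iff assms Dom_closed Cod_closed)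
qed

lemma fid_simps [simp]: "a \<in> Obj C \<Longrightarrow> fob (fid C) a = a" "f \<in> Arr C \<Longrightarrow> far (fid C) f = f"
  by (simp_all add: fid_def)

lemma fcomp_simps [simp]:
  "a \<in> Obj C \<Longrightarrow> fob (fcomp C G F) a = fob G (fob F a)"
  "f \<in> Arr C \<Longrightarrow> far (fcomp C G F) f = far G (far F f)"
  by (simp_all add: fcomp_def)

lemma fcomp_functor:
  assumes "is_functor C D F" "is_functor D E G" shows "is_functor C E (fcomp C G F)"
proof -
  interpret F: is_functor C D F by fact
  interpret G: is_functor D E G by fact
  interpret C: category C by (rule F.source_category)
  show ?thesis
    by (rule is_functorI)
      (auto simp: fcomp_def hom_iff F.source_category G.target_category F.fob_Obj G.fob_Obj
      F.far_Idt G.far_Idt F.far_Cmp' G.far_Cmp' C.Dom_closed C.Cod_closed)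
qed

lemma fcomp_assoc:
  assumes "is_functor C D F" shows "fcomp C (fcomp D H G) F = fcomp C H (fcomp C G F)"
proof -
  interpret is_functor C D F by fact
  show ?thesis by (auto simp: fcomp_def fob_Obj fun_eq_iff)
qed

lemma fcomp_fid:
  assumes "is_functor C D F" shows "fcomp C F (fid C) = F" "fcomp C (fid D) F = F"
proof -
  interpret F: is_functor C D F by fact
  note f = F.fob_Obj F.far_simps
  show "fcomp C F (fid C) = F" "fcomp C (fid D) F = F"
    by (rule functor_eqI[OF fcomp_functor[OF fid_functor[OF F.source_category] assms] assms]; simp)
      (rule functor_eqI[OF fcomp_functor[OF assms fid_functor[OF F.target_category]] assms]; simp add: f)
qed

lemma nat_transI:
  assumes "is_functor C D F" "is_functor C D G" "\<tau> \<in> extensional (Obj C)"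
    and "\<And>a. a \<in> Obj C \<Longrightarrow> \<tau> a \<in> hom D (fob F a) (fob G a)"
    and "\<And>f a b. f \<in> hom C a b \<Longrightarrow> \<tau> b o[D] far F f = far G f o[D] \<tau> a"
  shows "nat_trans C D F G \<tau>"
  using assms by (intro nat_trans.intro) auto

lemma concat_lists: "Z \<in> lists (lists A) \<Longrightarrow> concat Z \<in> lists A"
  by (induction Z) auto

lemma concat_hom:
  assumes "f \<in> hom (seq_cat (seq_cat V)) A B"
  shows "concat f \<in> hom (seq_cat V) (concat A) (concat B)"
  using assms concat_lists[of f "Arr V"] by (auto simp: hom_iff map_concat)

lemma map2_concat:
  assumes "length f = length g" "\<And>i. i < length f \<Longrightarrow> length (f ! i) = length (g ! i)"
  shows "concat (map2 (map2 h) f g) = map2 h (concat f) (concat g)"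
proof -
  have "list_all2 (\<lambda>a b. length a = length b) f g" using assms by (simp add: list_all2_conv_all_nth)
  then show ?thesis by (induction rule: list_all2_induct) auto
qed

context list_functor
begin

lemma E_map_hom:
  "f \<in> hom (seq_cat (seq_cat V)) A B \<Longrightarrow> map (far E) f \<in> hom (seq_cat V) (map (fob E) A) (map (fob E) B)"
  unfolding hom_seq_cat by (auto intro!: E_hom simp: hom_seq_cat)

text \<open>\<open>nat_trans\<close> demands that its source and target satisfy
  \<open>is_functor\<close>. This functor and the next two are the ones in the naturality of unit
  and substitution; \<open>fcomp\<close> restricts them, which makes them extensional even where E
  is not.\<close>

lemma singleton_functor: "is_functor V V (fcomp V E (singleton_fun V))"
proof (rule is_functorI)
  show "far (fcomp V E (singleton_fun V)) f \<in> hom V (fob (fcomp V E (singleton_fun V)) a) (fob (fcomp V E (singleton_fun V)) b)"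
    if f: "f \<in> hom V a b" for f a b
  proof -
    have "far E [f] \<in> hom V (fob E [a]) (fob E [b])" by (rule E_hom) (use f in auto)
    then show ?thesis using f hom_Obj[OF f] by (simp add: singleton_fun_def hom_iff)
  qed
  show "far (fcomp V E (singleton_fun V)) (g o[V] f) = far (fcomp V E (singleton_fun V)) g o[V] far (fcomp V E (singleton_fun V)) f"
    if f: "f \<in> hom V a b" and g: "g \<in> hom V b c" for f g a b c
  proof -
    have "far E [g] o[V] far E [f] = far E [g o[V] f]" by (rule E_cmp) (use f g in \<open>auto simp: hom_iff\<close>)
    then show ?thesis using f g by (simp add: singleton_fun_def hom_iff)
  qed
qed (auto simp: fcomp_def singleton_fun_def category_axioms E_ob E_Idt[of "[_]", simplified])

lemma inner_functor:
  "is_functor (seq_cat (seq_cat V)) V (fcomp (seq_cat (seq_cat V)) E (seq_fun (seq_cat V) E))" (is "is_functor ?C V ?F")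
proof (rule is_functorI)
  have ob: "fob ?F A = fob E (map (fob E) A)" if "A \<in> Obj ?C" for A
    using that by (simp add: seq_fun_def)
  have ar: "far ?F f = far E (map (far E) f)" if "f \<in> Arr ?C" for f
    using that by (simp add: seq_fun_def)
  show "category ?C" by (intro category_seq_cat category_axioms)
  then interpret C: category ?C .
  have map_ob: "map (fob E) A \<in> seqs V" if "A \<in> Obj ?C" for A
    using that E_ob by (induction A) auto
  show "fob ?F A \<in> Obj V" if "A \<in> Obj ?C" for A
    unfolding ob[OF that] by (rule E_ob[OF map_ob[OF that]])
  show "far ?F f \<in> hom V (fob ?F A) (fob ?F B)" if f: "f \<in> hom ?C A B" for f A B
    using E_hom'[OF E_map_hom[OF f]] C.hom_Obj[OF f] f ob ar unfolding hom_iff[of f] by metis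
  show "far ?F (Idt ?C A) = Idt V (fob ?F A)" if A: "A \<in> Obj ?C" for A
  proof -
    have "map (far E) (Idt ?C A) = map (Idt V) (map (fob E) A)" using A E_Idt by auto
    then show ?thesis using E_Idt[OF map_ob[OF A]] ar[OF C.Idt_simps(1)[OF A]] ob[OF A] by metis
  qed
  show "far ?F (g o[?C] f) = far ?F g o[V] far ?F f" if f: "f \<in> hom ?C A B" and g: "g \<in> hom ?C B D" for f g A B D
  proof -
    have "map (far E) (g o[?C] f) = map2 (Cmp V) (map (far E) g) (map (far E) f)"
    proof (rule nth_equalityI)
      fix i assume i: "i < length (map (far E) (g o[?C] f))"
      then have "f ! i \<in> hom (seq_cat V) (A ! i) (B ! i)" "g ! i \<in> hom (seq_cat V) (B ! i) (D ! i)"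
        using f g unfolding hom_seq_cat[of _ "seq_cat V"] by auto
      from E_cmp'[OF this] show "map (far E) (g o[?C] f) ! i = map2 (Cmp V) (map (far E) g) (map (far E) f) ! i"
        using i by simp
    qed simp
    then show ?thesis
      using E_cmp'[OF E_map_hom[OF f] E_map_hom[OF g]] C.Cmp_hom[OF f g] f g ar unfolding hom_iff by metis
  qed
qed (auto simp: fcomp_def category_axioms)

lemma concat_functor:
  "is_functor (seq_cat (seq_cat V)) V (fcomp (seq_cat (seq_cat V)) E (concat_fun V))" (is "is_functor ?C V ?F")
proof (rule is_functorI)
  have ob: "fob ?F A = fob E (concat A)" if "A \<in> Obj ?C" for A
    using that by (simp add: concat_fun_def)
  have ar: "far ?F f = far E (concat f)" if "f \<in> Arr ?C" for f
    using that by (simp add: concat_fun_def)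
  show "category ?C" by (intro category_seq_cat category_axioms)
  then interpret C: category ?C .
  have conc_ob: "concat A \<in> seqs V" if "A \<in> Obj ?C" for A
    using concat_lists that by simp
  show "fob ?F A \<in> Obj V" if "A \<in> Obj ?C" for A
    unfolding ob[OF that] by (rule E_ob[OF conc_ob[OF that]])
  show "far ?F f \<in> hom V (fob ?F A) (fob ?F B)" if f: "f \<in> hom ?C A B" for f A B
    using E_hom'[OF concat_hom[OF f]] C.hom_Obj[OF f] f ob ar unfolding hom_iff[of f] by metis
  show "far ?F (Idt ?C A) = Idt V (fob ?F A)" if A: "A \<in> Obj ?C" for A
    using E_Idt[OF conc_ob[OF A]] ar[OF C.Idt_simps(1)[OF A]] ob[OF A] by (simp add: map_concat)
  show "far ?F (g o[?C] f) = far ?F g o[V] far ?F f" if f: "f \<in> hom ?C A B" and g: "g \<in> hom ?C B D" for f g A B D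
  proof -
    have "concat (g o[?C] f) = map2 (Cmp V) (concat g) (concat f)"
      using f g unfolding seq_cat_simps(6) by (intro map2_concat) (auto simp: hom_seq_cat)
    then show ?thesis
      using E_cmp'[OF concat_hom[OF f] concat_hom[OF g]] C.Cmp_hom[OF f g] f g ar unfolding hom_iff by metis
  qed
qed (auto simp: fcomp_def category_axioms)

end

text \<open>A sequence Z is embedded as \<open>[Z]\<close>, and \<open>concat [Z]\<close> is Z
  again. So functoriality of E is read off from that of E after concatenation, which is the target
  of the substitution.\<close>

lemma multitensor_list_functor:
  assumes "category V" "is_multitensor V E" shows "list_functor V (mt_fun E)"
proof -
  interpret category V by fact
  interpret E: is_multitensor V E by fact
  interpret S: nat_trans "seq_cat (seq_cat V)" V
    "fcomp (seq_cat (seq_cat V)) (mt_fun E) (seq_fun (seq_cat V) (mt_fun E))"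
    "fcomp (seq_cat (seq_cat V)) (mt_fun E) (concat_fun V)" "mt_sub E" by (rule E.sub_natural)
  interpret C: is_functor "seq_cat (seq_cat V)" V "fcomp (seq_cat (seq_cat V)) (mt_fun E) (concat_fun V)"
    by (rule S.target_functor)
  have hom: "[f] \<in> hom (seq_cat (seq_cat V)) [A] [B]" if "f \<in> hom (seq_cat V) A B" for f A B
    using that by (auto simp: hom_seq_cat)
  show ?thesis
  proof
    show "mt_ob E Z \<in> Obj V" if "Z \<in> seqs V" for Z
      using C.fob_Obj[of "[Z]"] that by (simp add: concat_fun_def)
    show "mt_ar E f \<in> hom V (mt_ob E A) (mt_ob E B)" if f: "f \<in> hom (seq_cat V) A B" for f A B
    proof -
      interpret S: category "seq_cat V" by (rule category_seq_cat) fact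
      show ?thesis using C.far_hom[OF hom[OF f]] f S.hom_Obj[OF f] by (simp add: concat_fun_def hom_iff)
    qed
    show "mt_ar E (map (Idt V) Z) = Idt V (mt_ob E Z)" if "Z \<in> seqs V" for Z
    proof -
      have "map (Idt V) Z \<in> lists (Arr V)" using that by auto
      then show ?thesis using C.far_Idt[of "[Z]"] that by (simp add: concat_fun_def)
    qed
    show "mt_ar E (map2 (Cmp V) g f) = mt_ar E g o[V] mt_ar E f"
      if f: "f \<in> hom (seq_cat V) A B" and g: "g \<in> hom (seq_cat V) B D" for f g A B D
    proof -
      interpret S: category "seq_cat V" by (rule category_seq_cat) fact
      have "map2 (Cmp V) g f \<in> lists (Arr V)" using S.Cmp_hom[OF f g] by (simp add: hom_iff)
      then show ?thesis using C.far_Cmp[OF hom[OF f] hom[OF g]] f g by (simp add: concat_fun_def hom_iff)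
    qed
  qed
qed


context gcat
begin

text \<open>Along the canonical path the graph morphism made from f gives f back; naturality of t at
  it thus becomes naturality in sequences.\<close>

lemma seq_mor_canon:
  assumes "f \<in> hom (seq_cat V) Z Z'"
  shows "seq_mor \<nu> V Z (seq Z') \<nu> f \<in> hom GV (seq Z) (seq Z')"
    and "map (gfun (seq_mor \<nu> V Z (seq Z') \<nu> f)) (canon (length Z)) = canon (length Z')"
    and "path_map (seq_mor \<nu> V Z (seq Z') \<nu> f) (canon (length Z)) = f"
proof -
  interpret S: category "seq_cat V" by (rule category_seq_cat) (rule category_axioms)
  note l = assms[unfolded hom_seq_cat]
  show "seq_mor \<nu> V Z (seq Z') \<nu> f \<in> hom GV (seq Z) (seq Z')"
    by (rule seq_mor_hom[OF _ seq_graph]) (use S.hom_Obj[OF assms] l in \<open>auto simp: ghom_seq\<close>)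
  show "map (gfun (seq_mor \<nu> V Z (seq Z') \<nu> f)) (canon (length Z)) = canon (length Z')"
    by (rule nth_equalityI) (use l in \<open>simp_all add: nth_canon\<close>)
  show "path_map (seq_mor \<nu> V Z (seq Z') \<nu> f) (canon (length Z)) = f"
    by (rule nth_equalityI) (use l in \<open>simp_all add: nth_canon nth_path_map\<close>)
qed

end

section \<open>Comparing a multitensor with a monad on graphs\<close>

text \<open>The maps \<open>t X x : E(x\<^sup>*X) \<rightarrow> TX(a, b)\<close> identify \<open>TX(a, b)\<close> with the coproduct of the
  \<open>E(x\<^sup>*X)\<close>. For \<open>\<Gamma>E\<close> they are the coproduct inclusions, and for the multitensor of a path-like
  monad \<open>T\<close> they are the maps exhibiting \<open>T\<close> as path-like.\<close>

locale functor_comparison = gcat small \<nu> V + list_functor V "mt_fun E"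
  for small :: "'u set \<Rightarrow> bool" and \<nu> :: "nat \<Rightarrow> 'u" and V :: "('o, 'a) cat" and E :: "('o, 'a) multitensor" +
  fixes T :: "('u, 'o, 'a) gmonad" and t :: "('u, 'o) graph \<Rightarrow> 'u list \<Rightarrow> 'a"
  assumes E_pres: "preserves_coproducts_in_each_variable small V V (mt_fun E)"
    and T_functor: "is_functor (graph_cat small V) (graph_cat small V) (mnd_fun T)"
    and T_over: "functor_over_Set small V (mnd_fun T)"
    and t_coproduct: "\<lbrakk>is_graph small V X; a \<in> gobj X; b \<in> gobj X\<rbrakk> \<Longrightarrow>
  is_coproduct V (walks X a b) (\<lambda>x. mt_ob E (path_seq X x)) (ghom (fob (mnd_fun T) X) a b) (t X)"
    and t_nat: "\<lbrakk>f \<in> hom (graph_cat small V) X Y; x \<in> walks X a b\<rbrakk> \<Longrightarrow>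
  gmap (far (mnd_fun T) f) a b o[V] t X x = t Y (map (gfun f) x) o[V] mt_ar E (path_map f x)"
begin

sublocale GV: category GV by (rule category_graph_cat) (rule category_axioms)
sublocale TF: is_functor GV GV "mnd_fun T" by (rule T_functor)

abbreviation TO :: "('u, 'o) graph \<Rightarrow> ('u, 'o) graph" where "TO \<equiv> fob (mnd_fun T)"
abbreviation TA :: "('u, 'o, 'a) gmor \<Rightarrow> ('u, 'o, 'a) gmor" where "TA \<equiv> far (mnd_fun T)"

lemma T_graph [simp]: "graph X \<Longrightarrow> graph (TO X)"
  and gobj_T [simp]: "graph X \<Longrightarrow> gobj (TO X) = gobj X"
  using TF.fob_Obj[of X] T_over by (auto simp: gcat_simps functor_over_Set_def)

lemma T_mor: "f \<in> hom GV X Y \<Longrightarrow> TA f \<in> hom GV (TO X) (TO Y)"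
  and gfun_T: "f \<in> hom GV X Y \<Longrightarrow> gfun (TA f) = gfun f"
  using TF.far_hom[of f X Y] T_over by (auto simp: functor_over_Set_def hom_iff)

lemma t_hom:
  assumes "graph X" "x \<in> walks X a b"
  shows "t X x \<in> hom V (mt_ob E (path_seq X x)) (ghom (TO X) a b)"
  using coproduct_hom[OF t_coproduct[OF assms(1)] assms(2)] paths_ends[OF assms(2)] by simp

section \<open>Coproduct decompositions of the iterates of T\<close>

lemma small_refinements: "small A \<Longrightarrow> small_index small (refinements A y)"
proof -
  assume "small A"
  then obtain B :: "'u set" where B: "small B" "lists A \<lesssim> B" using small_lists by blast
  obtain D :: "'u set" where D: "small D" "lists B \<lesssim> D" using small_lists[OF B(1)] by blast
  have "refinements A y \<subseteq> lists (lists A)"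
    by (auto simp: refinements_nth set_conv_nth paths_iff)
  then have "refinements A y \<lesssim> lists (lists A)" by (rule subset_imp_lepoll)
  also have "\<dots> \<lesssim> lists B" using B(2) by (rule lists_lepoll_mono)
  also have "\<dots> \<lesssim> D" by (rule D(2))
  finally show ?thesis using D(1) by (auto simp: small_index_def)
qed

text \<open>Each factor TX(c, d) of the sequence along y is a coproduct over paths from c to d, and
  a choice of one such path for every edge of y is precisely a refinement of y.\<close>

lemma tt_coproduct:
  assumes X: "graph X" and y: "y \<in> walks X a b"
  shows "is_coproduct V (refinements (gobj X) y) (\<lambda>xs. mt_ob E (map (\<lambda>x. mt_ob E (path_seq X x)) xs))
    (mt_ob E (path_seq (TO X) y)) (\<lambda>xs. mt_ar E (map (t X) xs))"
  unfolding refinements_def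
proof (rule coproduct_multi[OF smallness_axioms E_pres])
  fix i assume i: "i < length (map (\<lambda>(c, d). walks X c d) (steps y))"
  then show "small_index small (map (\<lambda>(c, d). walks X c d) (steps y) ! i)"
    using small_paths[OF is_graph_small[OF X]] by (simp add: nth_steps)
  show "is_coproduct V (map (\<lambda>(c, d). walks X c d) (steps y) ! i) (\<lambda>x. mt_ob E (path_seq X x))
    (path_seq (TO X) y ! i) (t X)"
    using i t_coproduct[OF X, of "y ! i" "y ! Suc i"] paths_nth[OF y]
    by (simp add: nth_steps nth_path_seq)
qed simp

lemma tt_hom: "\<lbrakk>graph X; y \<in> walks X a b; xs \<in> refined X y\<rbrakk> \<Longrightarrow>
    mt_ar E (map (t X) xs) \<in> hom V (mt_ob E (map (\<lambda>x. mt_ob E (path_seq X x)) xs)) (mt_ob E (path_seq (TO X) y))"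
  by (rule coproduct_hom[OF tt_coproduct])

text \<open>Here the factors are coproducts over refinements, by \<open>tt_coproduct\<close>; an
  index is one refinement for each member of ys.\<close>

lemma ttt_coproduct:
  assumes X: "graph X" and z: "z \<in> walks X a b" and ys: "ys \<in> refined X z"
  shows "is_coproduct V (listset (map (refined X) ys))
    (\<lambda>xss. mt_ob E (map (\<lambda>xs. mt_ob E (map (\<lambda>x. mt_ob E (path_seq X x)) xs)) xss))
    (mt_ob E (map (\<lambda>y. mt_ob E (path_seq (TO X) y)) ys)) (\<lambda>xss. mt_ar E (map (\<lambda>xs. mt_ar E (map (t X) xs)) xss))"
proof (rule coproduct_multi[OF smallness_axioms E_pres])
  fix i assume i: "i < length (map (refined X) ys)"
  then show "small_index small (map (refined X) ys ! i)"
    using small_refinements[OF is_graph_small[OF X]] by simp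
  have "ys ! i \<in> walks X (z ! i) (z ! Suc i)" using i ys by (simp add: refinements_nth)
  from tt_coproduct[OF X this] show "is_coproduct V (map (refined X) ys ! i)
    (\<lambda>xs. mt_ob E (map (\<lambda>x. mt_ob E (path_seq X x)) xs))
    (map (\<lambda>y. mt_ob E (path_seq (TO X) y)) ys ! i) (\<lambda>xs. mt_ar E (map (t X) xs))"
    using i by simp
qed simp

lemma T_eqI:
  assumes "graph X" "a \<in> gobj X" "b \<in> gobj X"
    "h \<in> hom V (ghom (TO X) a b) d" "k \<in> hom V (ghom (TO X) a b) d"
    "\<And>x. x \<in> walks X a b \<Longrightarrow> h o[V] t X x = k o[V] t X x"
  shows "h = k"
  by (rule coproduct_eqI[OF t_coproduct[OF assms(1-3)] assms(4-6)])

lemma TT_eqI: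
  assumes X: "graph X" "a \<in> gobj X" "b \<in> gobj X"
    and h: "h \<in> hom V (ghom (TO (TO X)) a b) d" and k: "k \<in> hom V (ghom (TO (TO X)) a b) d"
    and hk: "\<And>y xs. \<lbrakk>y \<in> walks X a b; xs \<in> refined X y\<rbrakk> \<Longrightarrow>
  h o[V] (t (TO X) y o[V] mt_ar E (map (t X) xs)) = k o[V] (t (TO X) y o[V] mt_ar E (map (t X) xs))"
  shows "h = k"
proof (rule T_eqI[of "TO X" a b])
  fix y assume "y \<in> walks (TO X) a b"
  then have y: "y \<in> walks X a b" using X by simp
  have ty: "t (TO X) y \<in> hom V (mt_ob E (path_seq (TO X) y)) (ghom (TO (TO X)) a b)"
    using t_hom[of "TO X"] X y by simp
  show "h o[V] t (TO X) y = k o[V] t (TO X) y"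
  proof (rule coproduct_eqI[OF tt_coproduct[OF X(1) y] Cmp_hom[OF ty h] Cmp_hom[OF ty k]])
    fix xs assume xs: "xs \<in> refined X y"
    show "(h o[V] t (TO X) y) o[V] mt_ar E (map (t X) xs) = (k o[V] t (TO X) y) o[V] mt_ar E (map (t X) xs)"
      using hk[OF y xs] Cmp_assoc[OF tt_hom[OF X(1) y xs] ty h] Cmp_assoc[OF tt_hom[OF X(1) y xs] ty k] by simp
  qed
qed (use X h k in simp_all)

lemma TTT_eqI:
  assumes X: "graph X" "a \<in> gobj X" "b \<in> gobj X"
    and h: "h \<in> hom V (ghom (TO (TO (TO X))) a b) d" and k: "k \<in> hom V (ghom (TO (TO (TO X))) a b) d"
    and hk: "\<And>z ys xss. \<lbrakk>z \<in> walks X a b; ys \<in> refined X z; length xss = length ys;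
  \<And>i. i < length ys \<Longrightarrow> xss ! i \<in> refined X (ys ! i)\<rbrakk> \<Longrightarrow>
  h o[V] ((t (TO (TO X)) z o[V] mt_ar E (map (t (TO X)) ys)) o[V] mt_ar E (map (\<lambda>xs. mt_ar E (map (t X) xs)) xss))
  = k o[V] ((t (TO (TO X)) z o[V] mt_ar E (map (t (TO X)) ys)) o[V] mt_ar E (map (\<lambda>xs. mt_ar E (map (t X) xs)) xss))"
  shows "h = k"
\<comment> \<open>The test at TX disposes of the path z and its refinement ys; only the innermost
  coproduct remains for \<open>ttt_coproduct\<close>.\<close>
proof (rule TT_eqI[of "TO X" a b])
  fix z ys assume "z \<in> walks (TO X) a b" "ys \<in> refined (TO X) z"
  then have z: "z \<in> walks X a b" and ys: "ys \<in> refined X z" using X by simp_all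
  let ?c = "t (TO (TO X)) z o[V] mt_ar E (map (t (TO X)) ys)"
  have c: "?c \<in> hom V (mt_ob E (map (\<lambda>y. mt_ob E (path_seq (TO X) y)) ys)) (ghom (TO (TO (TO X))) a b)"
    using t_hom[of "TO (TO X)"] tt_hom[of "TO X"] X z ys by (intro Cmp_hom) auto
  show "h o[V] ?c = k o[V] ?c"
  proof (rule coproduct_eqI[OF ttt_coproduct[OF X(1) z ys] Cmp_hom[OF c h] Cmp_hom[OF c k]])
    fix xss assume xss: "xss \<in> listset (map (refined X) ys)"
    note e = coproduct_hom[OF ttt_coproduct[OF X(1) z ys] xss]
    show "(h o[V] ?c) o[V] mt_ar E (map (\<lambda>xs. mt_ar E (map (t X) xs)) xss)
      = (k o[V] ?c) o[V] mt_ar E (map (\<lambda>xs. mt_ar E (map (t X) xs)) xss)"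
      using hk[OF z ys, of xss] xss Cmp_assoc[OF e c h] Cmp_assoc[OF e c k] by (simp add: listset_nth)
  qed
qed (use X h k in simp_all)

section \<open>Invertibility of the comparison at the canonical path of a sequence\<close>

lemma E_initial:
  assumes "Z \<in> seqs V" "initial_ob V \<in> set Z"
  shows "is_coproduct V ({} :: 'u set) A (mt_ob E Z) \<iota>"
proof -
  obtain xs ys where Z: "Z = xs @ initial_ob V # ys" using assms(2) by (meson split_list)
  have "small_index small ({} :: 'u set)" using small_finite by (auto simp: small_index_def)
  from preserves_coproduct[OF smallness_axioms E_pres category_axioms this
    initial_coproduct[of _ "\<lambda>_. undefined"], of xs ys]
  show ?thesis using Z assms(1) by (simp add: is_coproduct_def)
qed

text \<open>A path that avoids initial homs can only step from i to i + 1. By induction its i-th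
  vertex is then \<nu> i, and its endpoint fixes its length.\<close>

lemma noncanonical_path:
  assumes "x \<in> paths (\<nu> ` {..length Z}) (\<nu> 0) (\<nu> (length Z))" "x \<noteq> canon (length Z)"
  shows "initial_ob V \<in> set (path_seq (seq Z) x)"
proof (rule ccontr)
  assume *: "initial_ob V \<notin> set (path_seq (seq Z) x)"
  have xi: "i < length x \<Longrightarrow> x ! i = \<nu> i" for i
  proof (induction i)
    case 0
    then show ?case using assms(1) by (simp add: paths_iff)
  next
    case (Suc i)
    obtain j where j: "x ! Suc i = \<nu> j" "j \<le> length Z" using paths_nth[OF assms(1) Suc.prems] by auto
    obtain k where k: "x ! i = \<nu> k" "k \<le> length Z" using paths_nth[OF assms(1), of i] Suc.prems by auto
    then have "k = i" using Suc by simp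
    have "path_seq (seq Z) x ! i \<in> set (path_seq (seq Z) x)" using Suc.prems by (intro nth_mem) simp
    then have "path_seq (seq Z) x ! i \<noteq> initial_ob V" using * by metis
    then have "ghom (seq Z) (\<nu> i) (\<nu> j) \<noteq> initial_ob V"
      using Suc by (simp add: nth_path_seq j(1))
    then show ?case using ghom_seq(2)[of i Z j] j k \<open>k = i\<close> by fastforce
  qed
  have ne: "x \<noteq> []" using assms(1) by (simp add: paths_def)
  then have "\<nu> (length x - 1) = \<nu> (length Z)" using xi[of "length x - 1"] assms(1) by (simp add: paths_iff)
  then have len: "length x = Suc (length Z)" using ne by (cases x) simp_all
  have "x = canon (length Z)" by (rule nth_equalityI) (simp_all add: len xi nth_canon)
  then show False using assms(2) by simp
qed

abbreviation tc :: "'o list \<Rightarrow> 'a" where "tc Z \<equiv> t (seq Z) (canon (length Z))"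
abbreviation Tbar :: "'o list \<Rightarrow> 'o" where "Tbar Z \<equiv> ghom (TO (seq Z)) (\<nu> 0) (\<nu> (length Z))"

lemma tc_hom: "Z \<in> seqs V \<Longrightarrow> tc Z \<in> hom V (mt_ob E Z) (Tbar Z)"
  using t_hom[OF seq_graph, of Z "canon (length Z)"] canon_paths by simp

text \<open>All summands other than the canonical one are initial, so they contribute nothing to the
  coproduct.\<close>

lemma tc_iso:
  assumes Z: "Z \<in> seqs V" shows "is_iso V (mt_ob E Z) (Tbar Z) (tc Z)"
proof -
  let ?P = "walks (seq Z) (\<nu> 0) (\<nu> (length Z))" and ?c = "canon (length Z)"
  have cp: "is_coproduct V ?P (\<lambda>x. mt_ob E (path_seq (seq Z) x)) (Tbar Z) (t (seq Z))"
    by (rule t_coproduct[OF seq_graph[OF Z]]) auto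
  have ini: "is_coproduct V ({} :: 'u set) (\<lambda>_. undefined) (mt_ob E (path_seq (seq Z) x)) (\<lambda>_. undefined)"
    if "x \<in> ?P" "x \<noteq> ?c" for x
    using that by (intro E_initial path_seq_Obj[OF seq_graph[OF Z]] noncanonical_path) auto
  have EZ: "mt_ob E Z \<in> Obj V" by (rule E_ob[OF Z])
  \<comment> \<open>The cocone for the inverse: the identity on the canonical summand, and on each
    other summand some map, of which there is exactly one because the summand is initial.\<close>
  define f where "f x = (if x = ?c then Idt V (mt_ob E Z)
    else SOME g. g \<in> hom V (mt_ob E (path_seq (seq Z) x)) (mt_ob E Z))" for x
  have f: "f x \<in> hom V (mt_ob E (path_seq (seq Z) x)) (mt_ob E Z)" if "x \<in> ?P" for x
  proof (cases "x = ?c")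
    case True
    then show ?thesis using Idt_hom[OF EZ] by (simp add: f_def)
  next
    case False
    have "\<exists>g \<in> hom V (mt_ob E (path_seq (seq Z) x)) (mt_ob E Z). \<forall>i\<in>{} :: 'u set. g o[V] undefined = undefined"
      using coproduct_copair[OF ini[OF that False] EZ] by simp
    then show ?thesis using False someI_ex[of "\<lambda>g. g \<in> hom V (mt_ob E (path_seq (seq Z) x)) (mt_ob E Z)"]
      by (auto simp: f_def)
  qed
  from coproduct_copair[OF cp EZ, of f, OF f]
  obtain r where r: "r \<in> hom V (Tbar Z) (mt_ob E Z)" "\<And>x. x \<in> ?P \<Longrightarrow> r o[V] t (seq Z) x = f x" by blast
  have c: "?c \<in> ?P" using canon_paths by simp
  have rt: "r o[V] tc Z = Idt V (mt_ob E Z)" using r(2)[OF c] by (simp add: f_def)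
  have TZ: "Tbar Z \<in> Obj V" using coproduct_Obj[OF cp] .
  have "tc Z o[V] r = Idt V (Tbar Z)"
  proof (rule coproduct_eqI[OF cp Cmp_hom[OF r(1) tc_hom[OF Z]] Idt_hom[OF TZ]])
    fix x assume x: "x \<in> ?P"
    note tx = coproduct_hom[OF cp x]
    show "(tc Z o[V] r) o[V] t (seq Z) x = Idt V (Tbar Z) o[V] t (seq Z) x"
    proof (cases "x = ?c")
      case True
      then show ?thesis using rt r(1) tc_hom[OF Z] EZ TZ by (simp add: hom_iff assoc)
    next
      case False
      show ?thesis
        by (rule coproduct_empty_initial[OF ini[OF x False]])
          (rule Cmp_hom[OF tx Cmp_hom[OF r(1) tc_hom[OF Z]]] Cmp_hom[OF tx Idt_hom[OF TZ]])+
    qed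
  qed
  then show ?thesis using r(1) rt tc_hom[OF Z] by (auto simp: is_iso_def)
qed

text \<open>\<open>tc\<close> has a left inverse, hence is monic. This turns equations observed in T
  back into equations for E.\<close>

lemma tc_cancel:
  assumes "Z \<in> seqs V" "h \<in> hom V d (mt_ob E Z)" "k \<in> hom V d (mt_ob E Z)"
    "tc Z o[V] h = tc Z o[V] k"
  shows "h = k"
proof -
  from tc_iso[OF assms(1)] obtain r where r: "r \<in> hom V (Tbar Z) (mt_ob E Z)"
    "r o[V] tc Z = Idt V (mt_ob E Z)" by (auto simp: is_iso_def)
  have "l = r o[V] (tc Z o[V] l)" if "l \<in> hom V d (mt_ob E Z)" for l
    using that tc_hom[OF assms(1)] r by (simp add: hom_iff flip: assoc)
  then show ?thesis using assms(2-4) by metis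
qed

text \<open>Naturality of t at the path morphism, where E is applied to identities only. So t is
  determined by T and by its values at canonical paths.\<close>

lemma t_path_mor:
  assumes X: "graph X" and x: "x \<in> walks X a b"
  shows "gmap (TA (path_mor \<nu> V X x)) (\<nu> 0) (\<nu> (length x - 1)) o[V] tc (path_seq X x) = t X x"
proof -
  have "canon (length x - 1) \<in> paths (gobj (seq (path_seq X x))) (\<nu> 0) (\<nu> (length x - 1))"
    using canon_paths by simp
  from t_nat[OF path_mor_hom[OF X x] this]
  show ?thesis
    using t_hom[OF X x] path_seq_Obj[OF X x]
    by (simp add: path_mor_simps(3,4)[OF x, simplified] E_Idt hom_iff E_ob)
qed

lemma tc_nat:
  assumes "f \<in> hom (seq_cat V) Z Z'"
  shows "gmap (TA (seq_mor \<nu> V Z (seq Z') \<nu> f)) (\<nu> 0) (\<nu> (length Z)) o[V] tc Z = tc Z' o[V] mt_ar E f"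
  using t_nat[OF seq_mor_canon(1)[OF assms], of "canon (length Z)" "\<nu> 0" "\<nu> (length Z)"] canon_paths
  by (simp add: seq_mor_canon[OF assms])

end

text \<open>The units, the substitution and the multiplication are merely typed and tied together by
  \<open>\<eta>_t\<close> and \<open>\<mu>_t\<close>; neither their naturality nor any law is
  assumed. That leaves both implications open: monad laws from multitensor laws, and the
  converse.\<close>

locale comparison = functor_comparison small \<nu> V E T t
  for small :: "'u set \<Rightarrow> bool" and \<nu> :: "nat \<Rightarrow> 'u" and V :: "('o, 'a) cat" and E :: "('o, 'a) multitensor"
    and T :: "('u, 'o, 'a) gmonad" and t :: "('u, 'o) graph \<Rightarrow> 'u list \<Rightarrow> 'a" +
  assumes u_ext: "mt_unit E \<in> extensional (Obj V)"
    and u_hom: "Z \<in> Obj V \<Longrightarrow> mt_unit E Z \<in> hom V Z (mt_ob E [Z])"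
    and \<sigma>_ext: "mt_sub E \<in> extensional (lists (seqs V))"
    and \<sigma>_hom: "Zss \<in> lists (seqs V) \<Longrightarrow>
  mt_sub E Zss \<in> hom V (mt_ob E (map (mt_ob E) Zss)) (mt_ob E (concat Zss))"
    and \<eta>_ext: "mnd_unit T \<in> extensional (Obj (graph_cat small V))"
    and \<eta>_hom: "is_graph small V X \<Longrightarrow> mnd_unit T X \<in> hom (graph_cat small V) X (fob (mnd_fun T) X)"
    and \<eta>_fun: "is_graph small V X \<Longrightarrow> gfun (mnd_unit T X) = (\<lambda>a\<in>gobj X. a)"
    and \<mu>_ext: "mnd_mult T \<in> extensional (Obj (graph_cat small V))"
    and \<mu>_hom: "is_graph small V X \<Longrightarrow>
  mnd_mult T X \<in> hom (graph_cat small V) (fob (mnd_fun T) (fob (mnd_fun T) X)) (fob (mnd_fun T) X)"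
    and \<mu>_fun: "is_graph small V X \<Longrightarrow> gfun (mnd_mult T X) = (\<lambda>a\<in>gobj X. a)"
    and \<eta>_t: "\<lbrakk>is_graph small V X; a \<in> gobj X; b \<in> gobj X\<rbrakk> \<Longrightarrow>
  gmap (mnd_unit T X) a b = t X [a, b] o[V] mt_unit E (ghom X a b)"
    and \<mu>_t: "\<lbrakk>is_graph small V X; y \<in> walks X a b; xs \<in> refined X y\<rbrakk> \<Longrightarrow>
  gmap (mnd_mult T X) a b o[V] (t (fob (mnd_fun T) X) y o[V] mt_ar E (map (t X) xs))
  = t X (path_concat a xs) o[V] mt_sub E (map (path_seq X) xs)"
begin

abbreviation \<eta> :: "('u, 'o) graph \<Rightarrow> ('u, 'o, 'a) gmor" where "\<eta> \<equiv> mnd_unit T"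
abbreviation \<mu> :: "('u, 'o) graph \<Rightarrow> ('u, 'o, 'a) gmor" where "\<mu> \<equiv> mnd_mult T"

end

lemma concat_inj:
  assumes "concat xs = concat ys" "length xs = length ys" "\<And>i. i < length xs \<Longrightarrow> length (xs ! i) = length (ys ! i)"
  shows "xs = ys"
  using assms concat_eq_concat_iff[of xs ys] by (auto simp: set_zip)

lemma map_gfun_id: "\<lbrakk>gfun f = (\<lambda>a\<in>A. a); x \<in> paths A a b\<rbrakk> \<Longrightarrow> map (gfun f) x = x"
  by (auto simp: paths_def intro!: map_idI)

lemma path_concat_single: "x \<in> paths A a b \<Longrightarrow> path_concat a [x] = x"
  by (cases x) (auto simp: paths_def path_concat_def)

context list_functor
begin

lemma E_map_cmp:
  assumes "\<And>x. x \<in> set xs \<Longrightarrow> f x \<in> Arr V \<and> g x \<in> Arr V \<and> Cod V (f x) = Dom V (g x)"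
  shows "far E (map g xs) o[V] far E (map f xs) = far E (map (\<lambda>x. g x o[V] f x) xs)"
  by (rule E_cmp) (use assms in auto)

lemma E_map_hom_set:
  assumes "\<And>x. x \<in> set xs \<Longrightarrow> f x \<in> hom V (A x) (B x)"
  shows "far E (map f xs) \<in> hom V (fob E (map A xs)) (fob E (map B xs))"
  by (rule E_hom) (use assms in auto)

end

section \<open>The two sides of each naturality and monad law, evaluated on the cocones of t\<close>

context comparison
begin

lemma \<eta>_map: "\<lbrakk>graph X; a \<in> gobj X; b \<in> gobj X\<rbrakk> \<Longrightarrow> gmap (\<eta> X) a b \<in> hom V (ghom X a b) (ghom (TO X) a b)"
  using gmor_hom(7)[OF \<eta>_hom] by (simp add: \<eta>_fun)

lemma \<mu>_map: "\<lbrakk>graph X; a \<in> gobj X; b \<in> gobj X\<rbrakk> \<Longrightarrow> gmap (\<mu> X) a b \<in> hom V (ghom (TO (TO X)) a b) (ghom (TO X) a b)"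
  using gmor_hom(7)[OF \<mu>_hom] by (simp add: \<mu>_fun)

lemma T_map: "\<lbrakk>f \<in> hom GV X Y; a \<in> gobj X; b \<in> gobj X\<rbrakk> \<Longrightarrow>
    gmap (TA f) a b \<in> hom V (ghom (TO X) a b) (ghom (TO Y) (gfun f a) (gfun f b))"
  using gmor_hom(7)[OF T_mor] gmor_hom(1) gfun_T by fastforce

lemma T\<eta>_map: "\<lbrakk>graph X; a \<in> gobj X; b \<in> gobj X\<rbrakk> \<Longrightarrow> gmap (TA (\<eta> X)) a b \<in> hom V (ghom (TO X) a b) (ghom (TO (TO X)) a b)"
  using T_map[OF \<eta>_hom] by (simp add: \<eta>_fun)

lemma T\<mu>_map: "\<lbrakk>graph X; a \<in> gobj X; b \<in> gobj X\<rbrakk> \<Longrightarrow>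
    gmap (TA (\<mu> X)) a b \<in> hom V (ghom (TO (TO (TO X))) a b) (ghom (TO (TO X)) a b)"
  using T_map[OF \<mu>_hom] by (simp add: \<mu>_fun)

lemma \<sigma>_path_hom:
  assumes X: "graph X" and y: "y \<in> walks X a b" and xs: "xs \<in> refined X y"
  shows "mt_sub E (map (path_seq X) xs) \<in>
    hom V (mt_ob E (map (\<lambda>x. mt_ob E (path_seq X x)) xs)) (mt_ob E (path_seq X (path_concat a xs)))"
  using \<sigma>_hom[OF path_seq_Obj_refinement[OF X xs]] by (simp add: path_seq_concat[OF y xs] comp_def)

text \<open>Both expressions end in the same comparison map, and the maps in front of it are the two
  sides of naturality of u. They can be read in either direction: from u to \<eta> because equal
  maps stay equal after t, and from \<eta> to u where t can be cancelled. The following lemmas have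
  the same design.\<close>

lemma unit_naturality:
  assumes f: "f \<in> hom GV X Y" and a: "a \<in> gobj X" and b: "b \<in> gobj X"
  shows "gmap (\<eta> Y o[GV] f) a b =
  t Y [gfun f a, gfun f b] o[V] (mt_unit E (ghom Y (gfun f a) (gfun f b)) o[V] gmap f a b)"
    and "gmap (TA f o[GV] \<eta> X) a b =
  t Y [gfun f a, gfun f b] o[V] (mt_ar E [gmap f a b] o[V] mt_unit E (ghom X a b))"
proof -
  note X = gmor_hom(1)[OF f] and Y = gmor_hom(2)[OF f]
  have fa: "gfun f a \<in> gobj Y" and fb: "gfun f b \<in> gobj Y" using gmor_hom(6)[OF f] a b by auto
  have fab: "gmap f a b \<in> hom V (ghom X a b) (ghom Y (gfun f a) (gfun f b))" by (rule gmor_hom(7)[OF f a b])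
  have tY: "t Y [gfun f a, gfun f b] \<in> hom V (mt_ob E [ghom Y (gfun f a) (gfun f b)]) (ghom (TO Y) (gfun f a) (gfun f b))"
    using t_hom[OF Y paths_pair[OF fa fb]] by (simp add: path_seq_def)
  have tX: "t X [a, b] \<in> hom V (mt_ob E [ghom X a b]) (ghom (TO X) a b)"
    using t_hom[OF X paths_pair[OF a b]] by (simp add: path_seq_def)
  note uY = u_hom[OF is_graph_hom[OF Y fa fb]] and uX = u_hom[OF is_graph_hom[OF X a b]]
  have Ef: "mt_ar E [gmap f a b] \<in> hom V (mt_ob E [ghom X a b]) (mt_ob E [ghom Y (gfun f a) (gfun f b)])"
    by (rule E_hom) (use fab in auto)
  show "gmap (\<eta> Y o[GV] f) a b =
    t Y [gfun f a, gfun f b] o[V] (mt_unit E (ghom Y (gfun f a) (gfun f b)) o[V] gmap f a b)"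
    using Cmp_assoc[OF fab uY tY] by (simp add: graph_cmp[OF f] a b \<eta>_t[OF Y fa fb])
  have "gmap (TA f) a b o[V] t X [a, b] = t Y [gfun f a, gfun f b] o[V] mt_ar E [gmap f a b]"
    using t_nat[OF f paths_pair[OF a b]] by (simp add: path_map_def)
  then show "gmap (TA f o[GV] \<eta> X) a b =
    t Y [gfun f a, gfun f b] o[V] (mt_ar E [gmap f a b] o[V] mt_unit E (ghom X a b))"
    using Cmp_assoc[OF uX tX T_map[OF f a b]] Cmp_assoc[OF uX Ef tY]
    by (simp add: graph_cmp[OF \<eta>_hom[OF X]] a b \<eta>_fun[OF X] \<eta>_t[OF X a b])
qed

text \<open>The same on the cocone of the second iterate, with the two sides of naturality of
  \<sigma>.\<close>

lemma mult_naturality: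
  assumes f: "f \<in> hom GV X Y" and y: "y \<in> walks X a b" and xs: "xs \<in> refined X y"
  shows "gmap (\<mu> Y o[GV] TA (TA f)) a b o[V] (t (TO X) y o[V] mt_ar E (map (t X) xs)) =
  t Y (map (gfun f) (path_concat a xs)) o[V]
  (mt_sub E (map (path_seq Y) (map (map (gfun f)) xs)) o[V] mt_ar E (map (\<lambda>x. mt_ar E (path_map f x)) xs))"
    (is "?L1 = ?R1")
    and "gmap (TA f o[GV] \<mu> X) a b o[V] (t (TO X) y o[V] mt_ar E (map (t X) xs)) =
  t Y (map (gfun f) (path_concat a xs)) o[V]
  (mt_ar E (path_map f (path_concat a xs)) o[V] mt_sub E (map (path_seq X) xs))"
    (is "?L2 = ?R2")
proof -
  let ?tt = "t (TO X) y o[V] mt_ar E (map (t X) xs)" and ?e = "\<lambda>x. mt_ob E (path_seq Y (map (gfun f) x))" and ?tf = "\<lambda>x. t Y (map (gfun f) x) o[V] mt_ar E (path_map f x)"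
  note X = gmor_hom(1)[OF f] and Y = gmor_hom(2)[OF f] and Tf = T_mor[OF f]
  have a: "a \<in> gobj X" and b: "b \<in> gobj X" using paths_ends[OF y] by auto
  have fa: "gfun f a \<in> gobj Y" and fb: "gfun f b \<in> gobj Y" using gmor_hom(6)[OF f] a b by auto
  let ?fy = "map (gfun f) y" and ?fxs = "map (map (gfun f)) xs" and ?x = "path_concat a xs"
  have x: "?x \<in> walks X a b" using path_concat_props[OF y xs] by simp
  have fy: "?fy \<in> walks Y (gfun f a) (gfun f b)" by (rule path_map_hom(1)[OF f y])
  have fxs: "?fxs \<in> refined Y ?fy" by (rule refinements_map[OF xs gmor_hom(5)[OF f]])
  have xi: "xs ! i \<in> walks X (y ! i) (y ! Suc i)" if "i < length xs" for i
    using xs that by (simp add: refinements_nth)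
  have xin: "\<exists>c d. z \<in> walks X c d" if "z \<in> set xs" for z using that xi by (auto simp: in_set_conv_nth)
  have tf: "t Y (map (gfun f) z) \<in> hom V (mt_ob E (path_seq Y (map (gfun f) z))) (ghom (TO Y) (gfun f (hd z)) (gfun f (last z)))"
    if "z \<in> set xs" for z
    using xin[OF that] t_hom[OF Y path_map_hom(1)[OF f]] paths_ends by metis
  have Ef: "mt_ar E (path_map f z) \<in> hom V (mt_ob E (path_seq X z)) (mt_ob E (path_seq Y (map (gfun f) z)))"
    if "z \<in> set xs" for z
    using xin[OF that] E_hom'[OF path_map_hom(2)[OF f]] by blast
  let ?F = "mt_ar E (map (\<lambda>x. mt_ar E (path_map f x)) xs)"
  have F: "?F \<in> hom V (mt_ob E (map (\<lambda>x. mt_ob E (path_seq X x)) xs)) (mt_ob E (map ?e xs))"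
    by (rule E_map_hom_set) (rule Ef)
  note tt = tt_hom[OF X y xs]
  have ty: "t (TO X) y \<in> hom V (mt_ob E (path_seq (TO X) y)) (ghom (TO (TO X)) a b)"
    using t_hom[of "TO X"] X y by simp
  have tfy: "t (TO Y) ?fy \<in> hom V (mt_ob E (path_seq (TO Y) ?fy)) (ghom (TO (TO Y)) (gfun f a) (gfun f b))"
    using t_hom[of "TO Y"] Y fy by simp
  have tfxs: "mt_ar E (map (t Y) ?fxs) \<in> hom V (mt_ob E (map ?e xs)) (mt_ob E (path_seq (TO Y) ?fy))"
    using tt_hom[OF Y fy fxs] by (simp add: comp_def)
  have Tfy: "path_map (TA f) y \<in> hom (seq_cat V) (path_seq (TO X) y) (path_seq (TO Y) ?fy)"
    using path_map_hom(2)[OF Tf, of y a b] y X by (simp add: gfun_T[OF f])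
  note ETfy = E_hom'[OF Tfy]
  have TTf: "gmap (TA (TA f)) a b \<in> hom V (ghom (TO (TO X)) a b) (ghom (TO (TO Y)) (gfun f a) (gfun f b))"
    using T_map[OF Tf, of a b] a b X by (simp add: gfun_T[OF f])
  note mY = \<mu>_map[OF Y fa fb]
  have sY: "mt_sub E (map (path_seq Y) ?fxs) \<in> hom V (mt_ob E (map ?e xs))
    (mt_ob E (path_seq Y (map (gfun f) ?x)))"
    using \<sigma>_path_hom[OF Y fy fxs] by (simp add: map_path_concat comp_def)
  have tfx: "t Y (map (gfun f) ?x) \<in> hom V (mt_ob E (path_seq Y (map (gfun f) ?x))) (ghom (TO Y) (gfun f a) (gfun f b))"
    by (rule t_hom[OF Y path_map_hom(1)[OF f x]])
  \<comment> \<open>Three squares are pasted: t at T f, then t at f entry by entry under E, then the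
    formula for \<mu> at the image of the refinement.\<close>
  have 1: "gmap (TA (TA f)) a b o[V] t (TO X) y = t (TO Y) ?fy o[V] mt_ar E (path_map (TA f) y)"
    using t_nat[OF Tf, of y a b] y X by (simp add: gfun_T[OF f])
  have 2: "mt_ar E (path_map (TA f) y) o[V] mt_ar E (map (t X) xs) = mt_ar E (map (t Y) ?fxs) o[V] ?F"
  proof -
    have len: "length xs = length y - 1" using xs by (simp add: refinements_nth)
    have "mt_ar E (path_map (TA f) y) o[V] mt_ar E (map (t X) xs) =
      mt_ar E (map ?tf xs)"
    proof (rule E_cmp)
      fix i assume "i < length (map ?tf xs)"
      then have i: "i < length xs" by simp
      have yi: "y ! i \<in> gobj X" "y ! Suc i \<in> gobj X" using paths_nth[OF y] i len by auto
      note h = t_hom[OF X xi[OF i]] T_map[OF f yi] t_nat[OF f xi[OF i]]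
      then show "composite V (path_map (TA f) y ! i) (map (t X) xs ! i) (map ?tf xs ! i)"
        using i len by (simp add: nth_path_map hom_iff)
    qed (simp_all add: len)
    also have "\<dots> = mt_ar E (map (\<lambda>x. t Y (map (gfun f) x)) xs) o[V] ?F"
      using tf Ef by (subst E_map_cmp) (auto simp: hom_iff)
    finally show ?thesis by (simp add: comp_def)
  qed
  have 3: "gmap (\<mu> Y) (gfun f a) (gfun f b) o[V] (t (TO Y) ?fy o[V] mt_ar E (map (t Y) ?fxs)) =
    t Y (map (gfun f) ?x) o[V] mt_sub E (map (path_seq Y) ?fxs)"
    using \<mu>_t[OF Y fy fxs] by (simp add: map_path_concat)
  have "?L1 = (gmap (\<mu> Y) (gfun f a) (gfun f b) o[V] gmap (TA (TA f)) a b) o[V] ?tt"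
    using graph_cmp(2)[OF T_mor[OF Tf], of a b] a b X by (simp add: gfun_T[OF f] gfun_T[OF Tf])
  also have "\<dots> = gmap (\<mu> Y) (gfun f a) (gfun f b) o[V] ((gmap (TA (TA f)) a b o[V] t (TO X) y) o[V] mt_ar E (map (t X) xs))"
    using mY TTf ty tt by (simp add: hom_iff assoc)
  also have "\<dots> = gmap (\<mu> Y) (gfun f a) (gfun f b) o[V] (t (TO Y) ?fy o[V] (mt_ar E (path_map (TA f) y) o[V] mt_ar E (map (t X) xs)))"
    unfolding 1 using tfy ETfy tt by (simp add: hom_iff assoc)
  also have "\<dots> = (gmap (\<mu> Y) (gfun f a) (gfun f b) o[V] (t (TO Y) ?fy o[V] mt_ar E (map (t Y) ?fxs))) o[V] ?F"
    unfolding 2 using mY tfy tfxs F by (simp add: hom_iff assoc)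
  also have "\<dots> = ?R1"
    unfolding 3 using tfx sY F by (simp add: hom_iff assoc)
  finally show "?L1 = ?R1" .
  have Tfab: "gmap (TA f) a b \<in> hom V (ghom (TO X) a b) (ghom (TO Y) (gfun f a) (gfun f b))" by (rule T_map[OF f a b])
  note mX = \<mu>_map[OF X a b] and sX = \<sigma>_path_hom[OF X y xs] and tX = t_hom[OF X x]
    and Efx = E_hom'[OF path_map_hom(2)[OF f x]]
  have "?L2 = (gmap (TA f) a b o[V] gmap (\<mu> X) a b) o[V] ?tt"
    using graph_cmp(2)[OF \<mu>_hom[OF X], of a b "TA f"] a b X by (simp add: \<mu>_fun[OF X])
  also have "\<dots> = gmap (TA f) a b o[V] (gmap (\<mu> X) a b o[V] ?tt)"
    using Tfab mX ty tt by (simp add: hom_iff assoc)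
  also have "\<dots> = (gmap (TA f) a b o[V] t X ?x) o[V] mt_sub E (map (path_seq X) xs)"
    unfolding \<mu>_t[OF X y xs] using Tfab tX sX by (simp add: hom_iff assoc)
  also have "\<dots> = ?R2"
    unfolding t_nat[OF f x] using tfx Efx sX by (simp add: hom_iff assoc)
  finally show "?L2 = ?R2" .
qed

text \<open>The unit at TX inserts the path with the single edge from a to b, and \<open>[x]\<close>
  is a refinement of that path. Naturality of u moves \<open>t X x\<close> past u, after which the
  formula for \<mu> applies to this refinement.\<close>

lemma unit_outer_t:
  assumes u_nat: "\<And>f A B. f \<in> hom V A B \<Longrightarrow> mt_unit E B o[V] f = mt_ar E [f] o[V] mt_unit E A"
    and X: "graph X" and x: "x \<in> walks X a b"
  shows "gmap (\<mu> X o[GV] \<eta> (TO X)) a b o[V] t X x =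
    t X x o[V] (mt_sub E [path_seq X x] o[V] mt_unit E (mt_ob E (path_seq X x)))"
proof -
  have a: "a \<in> gobj X" and b: "b \<in> gobj X" using paths_ends[OF x] by auto
  let ?EZ = "mt_ob E (path_seq X x)"
  note X' = T_graph[OF X]
  have y: "[a, b] \<in> walks X a b" by (rule paths_pair[OF a b])
  have xs: "[x] \<in> refined X [a, b]" using x by simp
  have tp: "t (TO X) [a, b] \<in> hom V (mt_ob E [ghom (TO X) a b]) (ghom (TO (TO X)) a b)"
    using t_hom[OF X', of "[a, b]" a b] y X by (simp add: path_seq_def)
  have ab: "ghom (TO X) a b \<in> Obj V" using is_graph_hom[OF X'] a b X by simp
  have EZ: "?EZ \<in> Obj V" by (rule E_ob[OF path_seq_Obj[OF X x]])
  note tx = t_hom[OF X x]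
  have Et: "mt_ar E [t X x] \<in> hom V (mt_ob E [?EZ]) (mt_ob E [ghom (TO X) a b])"
    by (rule E_hom) (use tx in auto)
  note u1 = u_hom[OF ab] and u2 = u_hom[OF EZ] and m = \<mu>_map[OF X a b]
  have s: "mt_sub E [path_seq X x] \<in> hom V (mt_ob E [?EZ]) ?EZ"
    using \<sigma>_path_hom[OF X y xs] by (simp add: path_concat_single[OF x])
  have e: "gmap (\<eta> (TO X)) a b \<in> hom V (ghom (TO X) a b) (ghom (TO (TO X)) a b)"
    using \<eta>_map[OF X'] a b X by simp
  have "gmap (\<mu> X o[GV] \<eta> (TO X)) a b o[V] t X x = gmap (\<mu> X) a b o[V] (gmap (\<eta> (TO X)) a b o[V] t X x)"
    using graph_cmp(2)[OF \<eta>_hom[OF X'], of a b] a b X e m tx by (simp add: \<eta>_fun[OF X'] hom_iff assoc)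
  also have "gmap (\<eta> (TO X)) a b = t (TO X) [a, b] o[V] mt_unit E (ghom (TO X) a b)"
    using \<eta>_t[OF X'] a b X by simp
  also have "gmap (\<mu> X) a b o[V] (\<dots> o[V] t X x) =
    gmap (\<mu> X) a b o[V] (t (TO X) [a, b] o[V] (mt_unit E (ghom (TO X) a b) o[V] t X x))"
    using tp u1 tx by (simp add: hom_iff assoc)
  also have "\<dots> = (gmap (\<mu> X) a b o[V] (t (TO X) [a, b] o[V] mt_ar E (map (t X) [x]))) o[V] mt_unit E ?EZ"
    unfolding u_nat[OF tx] using m tp Et u2 by (simp add: hom_iff assoc)
  also have "\<dots> = t X x o[V] (mt_sub E [path_seq X x] o[V] mt_unit E ?EZ)"
    unfolding \<mu>_t[OF X y xs] using tx s u2 by (simp add: hom_iff assoc path_concat_single[OF x])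
  finally show ?thesis .
qed

text \<open>T of the unit inserts a one-edge path at every edge of x; these form the refinement of x
  in \<open>steps_refinement\<close>, whose gluing is x.\<close>

lemma unit_inner_t:
  assumes X: "graph X" and x: "x \<in> walks X a b"
  shows "gmap (\<mu> X o[GV] TA (\<eta> X)) a b o[V] t X x =
    t X x o[V] (mt_sub E (map (\<lambda>z. [z]) (path_seq X x)) o[V] mt_ar E (map (mt_unit E) (path_seq X x)))"
proof -
  have a: "a \<in> gobj X" and b: "b \<in> gobj X" using paths_ends[OF x] by auto
  let ?Z = "path_seq X x" and ?xs = "map (\<lambda>(c, d). [c, d]) (steps x)"
  note X' = T_graph[OF X]
  note xs = steps_refinement(1)[OF x] and pc = steps_refinement(2)[OF x] and ps = steps_refinement(3)[OF x]
  note tx = t_hom[OF X x] and m = \<mu>_map[OF X a b] and Te = T\<eta>_map[OF X a b]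
  have tTx: "t (TO X) x \<in> hom V (mt_ob E (path_seq (TO X) x)) (ghom (TO (TO X)) a b)"
    using t_hom[OF X', of x a b] x X by simp
  note tt = tt_hom[OF X x xs]
  have s: "mt_sub E (map (\<lambda>z. [z]) ?Z) \<in> hom V (mt_ob E (map (\<lambda>z. mt_ob E [z]) ?Z)) (mt_ob E ?Z)"
    using \<sigma>_path_hom[OF X x xs] unfolding pc ps by (simp add: path_seq_def case_prod_unfold comp_def)
  have Z: "?Z \<in> seqs V" by (rule path_seq_Obj[OF X x])
  have Eu: "mt_ar E (map (mt_unit E) ?Z) \<in> hom V (mt_ob E ?Z) (mt_ob E (map (\<lambda>z. mt_ob E [z]) ?Z))"
    using E_map_hom_set[of ?Z "mt_unit E" "\<lambda>z. z" "\<lambda>z. mt_ob E [z]"] u_hom Z by auto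
  have tt': "mt_ar E (map (t X) ?xs) \<in> hom V (mt_ob E (map (\<lambda>z. mt_ob E [z]) ?Z)) (mt_ob E (path_seq (TO X) x))"
    using tt by (simp add: path_seq_def case_prod_unfold comp_def)
  have 1: "gmap (TA (\<eta> X)) a b o[V] t X x = t (TO X) x o[V] mt_ar E (path_map (\<eta> X) x)"
    using t_nat[OF \<eta>_hom[OF X] x] by (simp add: map_gfun_id[OF \<eta>_fun[OF X] x])
  \<comment> \<open>Each entry is the formula for \<eta> at one edge, so E of the list splits into E
    of the comparison maps after E of the units.\<close>
  have 2: "mt_ar E (path_map (\<eta> X) x) = mt_ar E (map (t X) ?xs) o[V] mt_ar E (map (mt_unit E) ?Z)"
  proof (rule E_cmp[symmetric])
    fix i assume "i < length (path_map (\<eta> X) x)"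
    then have i: "i < length x - 1" by simp
    then have xi: "x ! i \<in> gobj X" "x ! Suc i \<in> gobj X" using paths_nth[OF x] by auto
    show "composite V (map (t X) ?xs ! i) (map (mt_unit E) ?Z ! i) (path_map (\<eta> X) x ! i)"
      using i u_hom[OF is_graph_hom[OF X xi]] t_hom[OF X paths_pair[OF xi]] \<eta>_t[OF X xi]
      by (simp add: nth_path_map nth_path_seq nth_steps hom_iff path_seq_def[of X "[_, _]"])
  qed simp_all
  have "gmap (\<mu> X o[GV] TA (\<eta> X)) a b o[V] t X x = gmap (\<mu> X) a b o[V] (gmap (TA (\<eta> X)) a b o[V] t X x)"
    using graph_cmp(2)[OF T_mor[OF \<eta>_hom[OF X]], of a b] a b X m Te tx
    by (simp add: \<eta>_fun[OF X] gfun_T[OF \<eta>_hom[OF X]] hom_iff assoc)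
  also have "\<dots> = (gmap (\<mu> X) a b o[V] (t (TO X) x o[V] mt_ar E (map (t X) ?xs))) o[V] mt_ar E (map (mt_unit E) ?Z)"
    unfolding 1 2 using m tTx tt' Eu by (simp add: hom_iff assoc)
  also have "\<dots> = t X x o[V] (mt_sub E (map (\<lambda>z. [z]) ?Z) o[V] mt_ar E (map (mt_unit E) ?Z))"
    unfolding \<mu>_t[OF X x xs] pc ps using tx s Eu by (simp add: hom_iff assoc)
  finally show ?thesis .
qed

text \<open>With the inner multiplication first, the pieces in each \<open>xss ! i\<close> are glued
  and then the results; with the outer one first, ys is glued and \<open>concat xss\<close> refines
  the result. Both lead to x. On the second side \<sigma> at homs of TX has to be moved past the
  maps t, which is where its naturality is used.\<close>

lemma assoc_t:
  assumes X: "graph X" and z: "z \<in> walks X a b" and ys: "ys \<in> refined X z"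
    and len: "length xss = length ys" and xss: "\<And>i. i < length ys \<Longrightarrow> xss ! i \<in> refined X (ys ! i)"
  defines "ttt \<equiv> (t (TO (TO X)) z o[V] mt_ar E (map (t (TO X)) ys)) o[V] mt_ar E (map (\<lambda>xs. mt_ar E (map (t X) xs)) xss)"
    and "x \<equiv> path_concat a (concat xss)" and "Zsss \<equiv> map (map (path_seq X)) xss"
  shows "gmap (\<mu> X o[GV] TA (\<mu> X)) a b o[V] ttt =
  t X x o[V] (mt_sub E (map concat Zsss) o[V] mt_ar E (map (mt_sub E) Zsss))"
    and "(\<And>f A B. f \<in> hom (seq_cat (seq_cat V)) A B \<Longrightarrow>
  mt_sub E B o[V] mt_ar E (map (mt_ar E) f) = mt_ar E (concat f) o[V] mt_sub E A) \<Longrightarrow>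
  gmap (\<mu> X o[GV] \<mu> (TO X)) a b o[V] ttt =
  t X x o[V] (mt_sub E (concat Zsss) o[V] mt_sub E (map (map (mt_ob E)) Zsss))"
proof -
  let ?e = "\<lambda>x. mt_ob E (path_seq X x)"
  let ?EZ = "map (map (mt_ob E)) Zsss"
  let ?sZ = "map (mt_sub E) Zsss"
  let ?pT = "map (path_seq (TO X)) ys"
  let ?c = "mt_sub E (map concat Zsss) o[V] mt_ar E ?sZ"
  let ?d = "mt_sub E (concat Zsss) o[V] mt_sub E ?EZ"
  have a: "a \<in> gobj X" and b: "b \<in> gobj X" using paths_ends[OF z] by auto
  note X' = T_graph[OF X] and X'' = T_graph[OF T_graph[OF X]]
  let ?tz = "t (TO (TO X)) z" and ?ty = "mt_ar E (map (t (TO X)) ys)"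
    and ?tx = "mt_ar E (map (\<lambda>xs. mt_ar E (map (t X) xs)) xss)"
  have yi: "ys ! i \<in> walks X (z ! i) (z ! Suc i)" if "i < length ys" for i
    using ys that by (simp add: refinements_nth)
  have zi: "z ! i \<in> gobj X" "z ! Suc i \<in> gobj X" if "i < length ys" for i
    using ys that paths_nth[OF z] by (auto simp: refinements_nth)
  have lz: "length ys = length z - 1" using ys by (simp add: refinements_nth)
  note m = \<mu>_map[OF X a b] and Tm = T\<mu>_map[OF X a b]
  have mT: "gmap (\<mu> (TO X)) a b \<in> hom V (ghom (TO (TO (TO X))) a b) (ghom (TO (TO X)) a b)"
    using \<mu>_map[OF X'] a b X by simp
  have tz: "?tz \<in> hom V (mt_ob E (path_seq (TO (TO X)) z)) (ghom (TO (TO (TO X))) a b)"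
    using t_hom[OF X''] z X X' by simp
  have tz': "t (TO X) z \<in> hom V (mt_ob E (path_seq (TO X) z)) (ghom (TO (TO X)) a b)"
    using t_hom[OF X'] z X by simp
  have ty: "?ty \<in> hom V (mt_ob E (map (\<lambda>y. mt_ob E (path_seq (TO X) y)) ys)) (mt_ob E (path_seq (TO (TO X)) z))"
    using tt_hom[OF X'] z ys X by simp
  have "xss \<in> listset (map (refined X) ys)" using len xss by (simp add: listset_nth)
  note tx = coproduct_hom[OF ttt_coproduct[OF X z ys] this]
  \<comment> \<open>The paths glued from each \<open>xss ! i\<close>. They refine z because gluing a
    refinement of \<open>ys ! i\<close> keeps its endpoints.\<close>
  let ?ws = "map2 (\<lambda>x. path_concat (hd x)) ys xss"
  let ?ts = "\<lambda>i. t X (?ws ! i) o[V] mt_sub E (map (path_seq X) (xss ! i))"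
  have ws: "?ws \<in> refined X z" and xws: "path_concat a ?ws = path_concat a (concat xss)"
    using refinements_map2_concat(1)[OF ys len] refinements_map2_concat(2)[OF ys len, of a] xss by blast+
  have wi: "?ws ! i = path_concat (z ! i) (xss ! i)" if "i < length ys" for i
    using that len paths_ends[OF yi[OF that]] by simp
  have psws: "map (path_seq X) ?ws = map concat Zsss"
    by (rule nth_equalityI) (use len path_seq_concat[OF yi xss] wi in \<open>simp_all add: Zsss_def comp_def\<close>)
  have x: "x \<in> walks X a b"
    using path_concat_props[OF z ws] xws by (simp add: x_def)
  note hx = t_hom[OF X x] and tws = tt_hom[OF X z ws]
  have sws: "mt_sub E (map concat Zsss) \<in> hom V (mt_ob E (map ?e ?ws)) (mt_ob E (path_seq X x))"
    using \<sigma>_path_hom[OF X z ws] unfolding psws xws x_def .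
  have si: "mt_sub E (map (path_seq X) (xss ! i)) \<in> hom V (mt_ob E (map ?e (xss ! i)))
    (mt_ob E (path_seq X (?ws ! i)))" if "i < length ys" for i
    using \<sigma>_path_hom[OF X yi xss] that wi by simp
  have Es: "mt_ar E ?sZ \<in> hom V (mt_ob E (map (\<lambda>xs. mt_ob E (map ?e xs)) xss))
    (mt_ob E (map ?e ?ws))"
    by (rule E_hom) (use si len in \<open>simp_all add: Zsss_def\<close>)
  have pm: "path_map (\<mu> X) z \<in> hom (seq_cat V) (path_seq (TO (TO X)) z) (path_seq (TO X) z)"
    using path_map_hom(2)[OF \<mu>_hom[OF X], of z a b] z X X' by (simp add: map_gfun_id[OF \<mu>_fun[OF X] z])
  note Epm = E_hom'[OF pm]
  have P1: "gmap (TA (\<mu> X)) a b o[V] ?tz = t (TO X) z o[V] mt_ar E (path_map (\<mu> X) z)"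
    using t_nat[OF \<mu>_hom[OF X], of z a b] z X X' by (simp add: map_gfun_id[OF \<mu>_fun[OF X] z])
  \<comment> \<open>Entry by entry under E this is the formula for \<mu> at \<open>ys ! i\<close>
    and its refinement \<open>xss ! i\<close>; \<open>E_cmp\<close> first merges the factors and
    then splits the result.\<close>
  have P2: "mt_ar E (path_map (\<mu> X) z) o[V] (?ty o[V] ?tx) = mt_ar E (map (t X) ?ws) o[V] mt_ar E ?sZ"
  proof -
    let ?tyx = "map (\<lambda>i. t (TO X) (ys ! i) o[V] mt_ar E (map (t X) (xss ! i))) [0..<length ys]"
    have tyi: "t (TO X) (ys ! i) \<in> hom V (mt_ob E (path_seq (TO X) (ys ! i))) (ghom (TO (TO X)) (z ! i) (z ! Suc i))"
      if "i < length ys" for i using t_hom[OF X'] yi[OF that] X by simp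
    note txi = tt_hom[OF X yi xss]
    have "?ty o[V] ?tx = mt_ar E ?tyx"
      by (rule E_cmp) (use len tyi txi in \<open>simp_all add: hom_iff\<close>)
    then have "mt_ar E (path_map (\<mu> X) z) o[V] (?ty o[V] ?tx) = mt_ar E (path_map (\<mu> X) z) o[V] mt_ar E ?tyx" by simp
    also have "\<dots> = mt_ar E (map ?ts [0..<length ys])"
    proof (rule E_cmp)
      fix i assume "i < length (map ?ts [0..<length ys])"
      then have i: "i < length ys" by simp
      show "composite V (path_map (\<mu> X) z ! i) (?tyx ! i) (map ?ts [0..<length ys] ! i)"
        using i lz tyi[OF i] txi[OF i i] \<mu>_map[OF X zi[OF i]] \<mu>_t[OF X yi[OF i] xss[OF i]] wi[OF i] len
        by (simp add: nth_path_map hom_iff)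
    qed (simp_all add: lz)
    also have "\<dots> = mt_ar E (map (t X) ?ws) o[V] mt_ar E ?sZ"
    proof (rule E_cmp[symmetric])
      fix i assume "i < length (map ?ts [0..<length ys])"
      then have i: "i < length ys" by simp
      have "?ws ! i \<in> walks X (z ! i) (z ! Suc i)" using ws i len by (simp add: refinements_nth)
      note t_hom[OF X this]
      then show "map (mt_sub E) Zsss ! i \<in> Arr V \<and> map (t X) ?ws ! i \<in> Arr V \<and>
        Cod V (map (mt_sub E) Zsss ! i) = Dom V (map (t X) ?ws ! i) \<and>
        map ?ts [0..<length ys] ! i =
        map (t X) ?ws ! i o[V] map (mt_sub E) Zsss ! i"
        using si[OF i] i len by (simp add: Zsss_def hom_iff del: nth_zip)
    qed (simp_all add: len Zsss_def)
    finally show ?thesis .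
  qed
  have "gmap (\<mu> X o[GV] TA (\<mu> X)) a b o[V] ttt = gmap (\<mu> X) a b o[V] ((gmap (TA (\<mu> X)) a b o[V] ?tz) o[V] (?ty o[V] ?tx))"
    unfolding ttt_def using graph_cmp(2)[OF T_mor[OF \<mu>_hom[OF X]], of a b "\<mu> X"] a b X X' m Tm tz ty tx
    by (simp add: \<mu>_fun[OF X] gfun_T[OF \<mu>_hom[OF X]] hom_iff assoc)
  also have "\<dots> = gmap (\<mu> X) a b o[V] (t (TO X) z o[V] (mt_ar E (path_map (\<mu> X) z) o[V] (?ty o[V] ?tx)))"
    unfolding P1 using tz' Epm ty tx by (simp add: hom_iff assoc)
  also have "\<dots> = (gmap (\<mu> X) a b o[V] (t (TO X) z o[V] mt_ar E (map (t X) ?ws))) o[V] mt_ar E ?sZ"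
    unfolding P2 using m tz' tws Es by (simp add: hom_iff assoc)
  also have "\<dots> = t X x o[V] ?c"
    unfolding \<mu>_t[OF X z ws] psws xws x_def[symmetric] using hx sws Es by (simp add: hom_iff assoc)
  finally show "gmap (\<mu> X o[GV] TA (\<mu> X)) a b o[V] ttt =
    t X x o[V] ?c" .
  assume \<sigma>_nat: "\<And>f A B. f \<in> hom (seq_cat (seq_cat V)) A B \<Longrightarrow>
    mt_sub E B o[V] mt_ar E (map (mt_ar E) f) = mt_ar E (concat f) o[V] mt_sub E A"
  \<comment> \<open>The other side: ys is glued to one path, and all pieces together refine
    it.\<close>
  let ?y = "path_concat a ys" and ?xs = "concat xss"
  have y: "?y \<in> walks X a b" using path_concat_props[OF z ys] by simp
  have xs: "?xs \<in> refined X ?y" by (rule refinements_concat[OF z ys len xss])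
  have t2: "t (TO X) ?y \<in> hom V (mt_ob E (path_seq (TO X) ?y)) (ghom (TO (TO X)) a b)"
    using t_hom[OF X'] y X by simp
  note ttxs = tt_hom[OF X y xs]
  have sT: "mt_sub E ?pT \<in> hom V (mt_ob E (map (\<lambda>y. mt_ob E (path_seq (TO X) y)) ys)) (mt_ob E (path_seq (TO X) ?y))"
    using \<sigma>_path_hom[OF X'] z ys X by simp
  have f: "map (map (t X)) xss \<in> hom (seq_cat (seq_cat V)) ?EZ ?pT"
  proof -
    have xij: "xss ! i ! j \<in> walks X (ys ! i ! j) (ys ! i ! Suc j) \<and> length (xss ! i) = length (ys ! i) - 1"
      if "i < length ys" "j < length (xss ! i)" for i j using xss[OF that(1)] that(2) by (simp add: refinements_nth)
    have li: "length (xss ! i) = length (ys ! i) - 1" if "i < length ys" for i using xss[OF that] by (simp add: refinements_nth)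
    show ?thesis unfolding hom_seq_cat[of _ "seq_cat V"] hom_seq_cat[of _ V]
      using len li xij t_hom[OF X xij[THEN conjunct1]] by (simp add: Zsss_def nth_path_seq)
  qed
  have "mt_sub E ?EZ \<in> hom V (mt_ob E (map (mt_ob E) ?EZ)) (mt_ob E (concat ?EZ))"
  proof (rule \<sigma>_hom)
    interpret S: category "seq_cat (seq_cat V)" by (intro category_seq_cat category_axioms)
    show "map (map (mt_ob E)) Zsss \<in> lists (seqs V)" using S.hom_Obj[OF f] by simp
  qed
  then have sE: "mt_sub E ?EZ \<in> hom V
    (mt_ob E (map (\<lambda>xs. mt_ob E (map ?e xs)) xss)) (mt_ob E (map ?e ?xs))"
    by (simp add: Zsss_def comp_def map_concat)
  have sx: "mt_sub E (concat Zsss) \<in> hom V (mt_ob E (map ?e ?xs)) (mt_ob E (path_seq X x))"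
    using \<sigma>_path_hom[OF X y xs] unfolding x_def
    using refinements_map2_concat path_concat_def by (simp add: Zsss_def map_concat path_concat_def)
  have pcx: "path_concat a ?xs = x" by (simp add: x_def)
  have Q1: "mt_sub E ?pT o[V] ?tx = mt_ar E (map (t X) ?xs) o[V] mt_sub E ?EZ"
    using \<sigma>_nat[OF f] by (simp add: comp_def map_concat)
  have Q2: "gmap (\<mu> (TO X)) a b o[V] (?tz o[V] ?ty) = t (TO X) ?y o[V] mt_sub E ?pT"
    using \<mu>_t[OF X', of z a b ys] z ys X by simp
  have Q3: "gmap (\<mu> X) a b o[V] (t (TO X) ?y o[V] mt_ar E (map (t X) ?xs)) = t X x o[V] mt_sub E (concat Zsss)"
    using \<mu>_t[OF X y xs] by (simp add: pcx Zsss_def map_concat)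
  have "gmap (\<mu> X o[GV] \<mu> (TO X)) a b o[V] ttt = gmap (\<mu> X) a b o[V] ((gmap (\<mu> (TO X)) a b o[V] (?tz o[V] ?ty)) o[V] ?tx)"
    unfolding ttt_def using graph_cmp(2)[OF \<mu>_hom[OF X'], of a b "\<mu> X"] a b X X' X'' m mT tz ty tx
    by (simp add: \<mu>_fun[OF X'] hom_iff assoc)
  also have "\<dots> = gmap (\<mu> X) a b o[V] (t (TO X) ?y o[V] (mt_sub E ?pT o[V] ?tx))"
    unfolding Q2 using t2 sT tx by (simp add: hom_iff assoc)
  also have "\<dots> = (gmap (\<mu> X) a b o[V] (t (TO X) ?y o[V] mt_ar E (map (t X) ?xs))) o[V] mt_sub E ?EZ"
    unfolding Q1 using m t2 ttxs sE by (simp add: hom_iff assoc)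
  also have "\<dots> = t X x o[V] ?d"
    unfolding Q3 using hx sx sE by (simp add: hom_iff assoc)
  finally show "gmap (\<mu> X o[GV] \<mu> (TO X)) a b o[V] ttt =
    t X x o[V] ?d" .
qed

end

lemma concat_map_concat: "concat (map concat Zsss) = concat (concat Zsss)"
  by (induction Zsss) auto

lemma map_lists: "\<lbrakk>xs \<in> lists A; \<And>x. x \<in> A \<Longrightarrow> f x \<in> B\<rbrakk> \<Longrightarrow> map f xs \<in> lists B"
  by (induction xs) auto

lemma multitensor_naturality:
  assumes "category V" "is_multitensor V E"
  shows "f \<in> hom V A B \<Longrightarrow> mt_unit E B o[V] f = mt_ar E [f] o[V] mt_unit E A"
    and "g \<in> hom (seq_cat (seq_cat V)) Zss Zss' \<Longrightarrow>
  mt_sub E Zss' o[V] mt_ar E (map (mt_ar E) g) = mt_ar E (concat g) o[V] mt_sub E Zss"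
proof -
  interpret category V by fact
  interpret E: is_multitensor V E by fact
  interpret U: nat_trans V V "fid V" "fcomp V (mt_fun E) (singleton_fun V)" "mt_unit E" by (rule E.unit_natural)
  interpret S: nat_trans "seq_cat (seq_cat V)" V
    "fcomp (seq_cat (seq_cat V)) (mt_fun E) (seq_fun (seq_cat V) (mt_fun E))"
    "fcomp (seq_cat (seq_cat V)) (mt_fun E) (concat_fun V)" "mt_sub E" by (rule E.sub_natural)
  show "mt_unit E B o[V] f = mt_ar E [f] o[V] mt_unit E A" if "f \<in> hom V A B"
    using U.naturality[OF that] that by (simp add: hom_iff singleton_fun_def)
  show "mt_sub E Zss' o[V] mt_ar E (map (mt_ar E) g) = mt_ar E (concat g) o[V] mt_sub E Zss"
    if "g \<in> hom (seq_cat (seq_cat V)) Zss Zss'"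
    using S.naturality[OF that] that by (simp add: hom_iff seq_fun_def concat_fun_def)
qed

section \<open>Monad laws for T and multitensor laws for E\<close>

context comparison
begin

lemma over_Set_simps [simp]:
  "\<lbrakk>graph X; a \<in> gobj X\<rbrakk> \<Longrightarrow> gfun (\<eta> X) a = a" "\<lbrakk>graph X; a \<in> gobj X\<rbrakk> \<Longrightarrow> gfun (\<mu> X) a = a"
  by (simp_all add: \<eta>_fun \<mu>_fun)

lemma monad_of_multitensor:
  assumes M: "is_multitensor V E" shows "monad_over_Set small V T"
proof -
  interpret M: is_multitensor V E by (rule M)
  note u_nat = multitensor_naturality(1)[OF category_axioms M]
    and \<sigma>_nat = multitensor_naturality(2)[OF category_axioms M]
  have TT: "is_functor GV GV (fcomp GV (mnd_fun T) (mnd_fun T))" by (rule fcomp_functor[OF T_functor T_functor])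
  have "is_monad GV T"
  proof (rule is_monad.intro)
    show "nat_trans GV GV (fid GV) (mnd_fun T) \<eta>"
    proof (rule nat_transI[OF fid_functor[OF GV.category_axioms] T_functor \<eta>_ext])
      show "\<eta> X \<in> hom GV (fob (fid GV) X) (TO X)" if "X \<in> Obj GV" for X
        using that \<eta>_hom by (simp add: gcat_simps)
      fix f X Y assume f: "f \<in> hom GV X Y"
      note X = gmor_hom(1)[OF f] and Y = gmor_hom(2)[OF f]
      have "\<eta> Y o[GV] f = TA f o[GV] \<eta> X"
      proof (rule gmor_eqI[OF GV.Cmp_hom[OF f \<eta>_hom[OF Y]] GV.Cmp_hom[OF \<eta>_hom[OF X] T_mor[OF f]]])
        fix a assume a: "a \<in> gobj X"
        then show "gfun (\<eta> Y o[GV] f) a = gfun (TA f o[GV] \<eta> X) a"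
          by (simp add: graph_cmp(1)[OF f] graph_cmp(1)[OF \<eta>_hom[OF X]] X Y gmor_hom(6)[OF f] gfun_T[OF f])
        fix b assume b: "b \<in> gobj X"
        show "gmap (\<eta> Y o[GV] f) a b = gmap (TA f o[GV] \<eta> X) a b"
          unfolding unit_naturality[OF f a b] u_nat[OF gmor_hom(7)[OF f a b]] ..
      qed
      then show "\<eta> Y o[GV] far (fid GV) f = TA f o[GV] \<eta> X" using f by (simp add: hom_iff)
    qed
    show "nat_trans GV GV (fcomp GV (mnd_fun T) (mnd_fun T)) (mnd_fun T) \<mu>"
    proof (rule nat_transI[OF TT T_functor \<mu>_ext])
      show "\<mu> X \<in> hom GV (fob (fcomp GV (mnd_fun T) (mnd_fun T)) X) (TO X)" if "X \<in> Obj GV" for X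
        using that \<mu>_hom by (simp add: gcat_simps)
      fix f X Y assume f: "f \<in> hom GV X Y"
      note X = gmor_hom(1)[OF f] and Y = gmor_hom(2)[OF f]
      note Tf = T_mor[OF f] and TTf = T_mor[OF T_mor[OF f]]
      note l = GV.Cmp_hom[OF TTf \<mu>_hom[OF Y]] and r = GV.Cmp_hom[OF \<mu>_hom[OF X] Tf]
      have obj: "gfun (\<mu> Y o[GV] TA (TA f)) a = gfun (TA f o[GV] \<mu> X) a" if "a \<in> gobj X" for a
        using that by (simp add: graph_cmp(1)[OF TTf] graph_cmp(1)[OF \<mu>_hom[OF X]] X Y gmor_hom(6)[OF f] gfun_T[OF f] gfun_T[OF Tf])
      have "\<mu> Y o[GV] TA (TA f) = TA f o[GV] \<mu> X"
      proof (rule gmor_eqI[OF l r])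
        show "gfun (\<mu> Y o[GV] TA (TA f)) a = gfun (TA f o[GV] \<mu> X) a" if "a \<in> gobj (TO (TO X))" for a
          using obj that X by simp
        fix a b assume "a \<in> gobj (TO (TO X))" "b \<in> gobj (TO (TO X))"
        then have a: "a \<in> gobj X" and b: "b \<in> gobj X" using X by simp_all
        show "gmap (\<mu> Y o[GV] TA (TA f)) a b = gmap (TA f o[GV] \<mu> X) a b"
        proof (rule TT_eqI[OF X a b])
          show "gmap (\<mu> Y o[GV] TA (TA f)) a b \<in> hom V (ghom (TO (TO X)) a b)
            (ghom (TO Y) (gfun (TA f o[GV] \<mu> X) a) (gfun (TA f o[GV] \<mu> X) b))"
            using gmor_hom(7)[OF l, of a b] a b X by (simp add: obj)
          show "gmap (TA f o[GV] \<mu> X) a b \<in> hom V (ghom (TO (TO X)) a b)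
            (ghom (TO Y) (gfun (TA f o[GV] \<mu> X) a) (gfun (TA f o[GV] \<mu> X) b))"
            using gmor_hom(7)[OF r, of a b] a b X by simp
          fix y xs assume y: "y \<in> walks X a b" and xs: "xs \<in> refined X y"
          have "map (path_map f) xs \<in> hom (seq_cat (seq_cat V)) (map (path_seq X) xs) (map (path_seq Y) (map (map (gfun f)) xs))"
            unfolding hom_seq_cat[of _ "seq_cat V"] using path_map_hom(2)[OF f] xs by (auto simp: refinements_nth)
          from \<sigma>_nat[OF this]
          have "mt_sub E (map (path_seq Y) (map (map (gfun f)) xs)) o[V] mt_ar E (map (\<lambda>x. mt_ar E (path_map f x)) xs) =
            mt_ar E (path_map f (path_concat a xs)) o[V] mt_sub E (map (path_seq X) xs)"
            by (simp add: path_map_concat[OF y xs] comp_def)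
          then show "gmap (\<mu> Y o[GV] TA (TA f)) a b o[V] (t (TO X) y o[V] mt_ar E (map (t X) xs)) =
            gmap (TA f o[GV] \<mu> X) a b o[V] (t (TO X) y o[V] mt_ar E (map (t X) xs))"
            unfolding mult_naturality[OF f y xs] by simp
        qed
      qed
      then show "\<mu> Y o[GV] far (fcomp GV (mnd_fun T) (mnd_fun T)) f = TA f o[GV] \<mu> X" using f by (simp add: hom_iff)
    qed
  next
    fix X assume "X \<in> Obj GV"
    then have X: "graph X" by (simp add: gcat_simps)
    note X' = T_graph[OF X]
    have i: "Idt GV (TO X) \<in> hom GV (TO X) (TO X)" using X' GV.Idt_hom by (simp add: gcat_simps)
    \<comment> \<open>An endomorphism of TX which fixes objects and is absorbed by all comparison
      maps is the identity. The explicit identity of E on the right is the form in which the unit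
      laws of E arrive.\<close>
    have key: "f = Idt GV (TO X)" if f: "f \<in> hom GV (TO X) (TO X)" and f0: "\<And>a. a \<in> gobj X \<Longrightarrow> gfun f a = a"
      and f1: "\<And>a b x. x \<in> walks X a b \<Longrightarrow> gmap f a b o[V] t X x = t X x o[V] Idt V (mt_ob E (path_seq X x))" for f
    proof (rule gmor_eqI[OF f i])
      show "gfun f a = gfun (Idt GV (TO X)) a" if "a \<in> gobj (TO X)" for a
        using that f0 X by (simp add: graph_Idt)
      fix a b assume ab: "a \<in> gobj (TO X)" "b \<in> gobj (TO X)"
      then have a: "a \<in> gobj X" and b: "b \<in> gobj X" using X by simp_all
      note g = is_graph_hom[OF X' ab]
      have "gmap f a b = Idt V (ghom (TO X) a b)"
      proof (rule T_eqI[OF X a b])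
        show "gmap f a b \<in> hom V (ghom (TO X) a b) (ghom (TO X) a b)"
          using gmor_hom(7)[OF f ab] f0 a b by simp
        show "Idt V (ghom (TO X) a b) \<in> hom V (ghom (TO X) a b) (ghom (TO X) a b)" by (rule Idt_hom[OF g])
        show "gmap f a b o[V] t X x = Idt V (ghom (TO X) a b) o[V] t X x" if "x \<in> walks X a b" for x
          using f1[OF that] t_hom[OF X that] by (simp add: hom_iff)
      qed
      then show "gmap f a b = gmap (Idt GV (TO X)) a b" using ab by (simp add: graph_Idt)
    qed
    have \<eta>X': "\<eta> (TO X) \<in> hom GV (TO X) (TO (TO X))" by (rule \<eta>_hom[OF X'])
    note T\<eta>X = T_mor[OF \<eta>_hom[OF X]]
    show "\<mu> X o[GV] \<eta> (TO X) = Idt GV (TO X)"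
    proof (rule key[OF GV.Cmp_hom[OF \<eta>X' \<mu>_hom[OF X]]])
      show "gfun (\<mu> X o[GV] \<eta> (TO X)) a = a" if "a \<in> gobj X" for a
        using that X X' by (simp add: graph_cmp(1)[OF \<eta>X'])
      show "gmap (\<mu> X o[GV] \<eta> (TO X)) a b o[V] t X x = t X x o[V] Idt V (mt_ob E (path_seq X x))"
        if x: "x \<in> walks X a b" for a b x
        using unit_outer_t[OF u_nat X x] M.unit_outer[OF path_seq_Obj[OF X x]] by simp
    qed
    show "\<mu> X o[GV] TA (\<eta> X) = Idt GV (TO X)"
    proof (rule key[OF GV.Cmp_hom[OF T\<eta>X \<mu>_hom[OF X]]])
      show "gfun (\<mu> X o[GV] TA (\<eta> X)) a = a" if "a \<in> gobj X" for a
        using that X X' by (simp add: graph_cmp(1)[OF T\<eta>X] gfun_T[OF \<eta>_hom[OF X]])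
      show "gmap (\<mu> X o[GV] TA (\<eta> X)) a b o[V] t X x = t X x o[V] Idt V (mt_ob E (path_seq X x))"
        if x: "x \<in> walks X a b" for a b x
        using unit_inner_t[OF X x] M.unit_inner[OF path_seq_Obj[OF X x]] by simp
    qed
    note \<mu>X' = \<mu>_hom[OF X'] and T\<mu>X = T_mor[OF \<mu>_hom[OF X]]
    note l = GV.Cmp_hom[OF T\<mu>X \<mu>_hom[OF X]] and r = GV.Cmp_hom[OF \<mu>X' \<mu>_hom[OF X]]
    have l0: "gfun (\<mu> X o[GV] TA (\<mu> X)) a = a" and r0: "gfun (\<mu> X o[GV] \<mu> (TO X)) a = a" if "a \<in> gobj X" for a
      using that X X' T_graph[OF X'] by (simp_all add: graph_cmp(1)[OF T\<mu>X] graph_cmp(1)[OF \<mu>X'] gfun_T[OF \<mu>_hom[OF X]])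
    show "\<mu> X o[GV] TA (\<mu> X) = \<mu> X o[GV] \<mu> (TO X)"
    proof (rule gmor_eqI[OF l r])
      show "gfun (\<mu> X o[GV] TA (\<mu> X)) a = gfun (\<mu> X o[GV] \<mu> (TO X)) a" if "a \<in> gobj (TO (TO (TO X)))" for a
        using that X X' by (simp add: l0 r0)
      fix a b assume ab: "a \<in> gobj (TO (TO (TO X)))" "b \<in> gobj (TO (TO (TO X)))"
      then have a: "a \<in> gobj X" and b: "b \<in> gobj X" using X by simp_all
      show "gmap (\<mu> X o[GV] TA (\<mu> X)) a b = gmap (\<mu> X o[GV] \<mu> (TO X)) a b"
      proof (rule TTT_eqI[OF X a b])
        show "gmap (\<mu> X o[GV] TA (\<mu> X)) a b \<in> hom V (ghom (TO (TO (TO X))) a b) (ghom (TO X) a b)"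
          using gmor_hom(7)[OF l ab] by (simp add: l0 a b)
        show "gmap (\<mu> X o[GV] \<mu> (TO X)) a b \<in> hom V (ghom (TO (TO (TO X))) a b) (ghom (TO X) a b)"
          using gmor_hom(7)[OF r ab] by (simp add: r0 a b)
        fix z ys xss
        assume z: "z \<in> walks X a b" and ys: "ys \<in> refined X z" and len: "length xss = length ys"
          and xss: "\<And>i. i < length ys \<Longrightarrow> xss ! i \<in> refined X (ys ! i)"
        have "map (map (path_seq X)) xss \<in> lists (lists (seqs V))"
        proof -
          have "path_seq X (xss ! i ! j) \<in> seqs V" if "i < length xss" "j < length (xss ! i)" for i j
          proof -
            have "xss ! i ! j \<in> walks X (ys ! i ! j) (ys ! i ! Suc j)"
              using xss[of i] that len by (simp add: refinements_nth)
            then show ?thesis by (rule path_seq_Obj[OF X])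
          qed
          then show ?thesis unfolding in_lists_nth[of _ "lists (seqs V)"] in_lists_nth[of _ "seqs V"]
            by simp
        qed
        note A = M.sub_assoc[OF this]
        show "gmap (\<mu> X o[GV] TA (\<mu> X)) a b o[V] ((t (TO (TO X)) z o[V] mt_ar E (map (t (TO X)) ys)) o[V] mt_ar E (map (\<lambda>xs. mt_ar E (map (t X) xs)) xss)) =
          gmap (\<mu> X o[GV] \<mu> (TO X)) a b o[V] ((t (TO (TO X)) z o[V] mt_ar E (map (t (TO X)) ys)) o[V] mt_ar E (map (\<lambda>xs. mt_ar E (map (t X) xs)) xss))"
          using assoc_t(1)[OF X z ys len xss] assoc_t(2)[OF X z ys len xss \<sigma>_nat] A by simp
      qed
    qed
  qed
  then show ?thesis
    unfolding monad_over_Set_def nat_over_Set_def using T_over \<eta>_fun \<mu>_fun by (auto simp: gcat_simps)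
qed

text \<open>A law for a nested sequence is read in the graph of its concatenation, at the canonical
  path. \<open>path_split\<close> and \<open>path_split2\<close> supply the refinements that
  reproduce the given bracketing, and \<open>tc_cancel\<close> finally removes the comparison
  map.\<close>

lemma multitensor_of_monad:
  assumes M: "is_monad GV T" shows "is_multitensor V E"
proof -
  let ?SS = "seq_cat (seq_cat V)"
  interpret M: is_monad GV T by (rule M)
  interpret N: nat_trans GV GV "fid GV" "mnd_fun T" \<eta> by (rule M.unit_natural)
  interpret N': nat_trans GV GV "fcomp GV (mnd_fun T) (mnd_fun T)" "mnd_fun T" \<mu> by (rule M.mult_natural)
  have \<eta>_nat: "\<eta> Y o[GV] f = TA f o[GV] \<eta> X" and \<mu>_nat: "\<mu> Y o[GV] TA (TA f) = TA f o[GV] \<mu> X"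
    if "f \<in> hom GV X Y" for f X Y
    using N.naturality[OF that] N'.naturality[OF that] that by (simp_all add: hom_iff)
  have canon: "canon (length Z) \<in> walks (seq Z) (\<nu> 0) (\<nu> (length Z))" for Z using canon_paths by simp
  have u_nat: "mt_unit E B o[V] f = mt_ar E [f] o[V] mt_unit E A" if f: "f \<in> hom V A B" for f A B
  proof -
    have A: "[A] \<in> seqs V" and B: "[B] \<in> seqs V" using hom_Obj[OF f] by auto
    have f': "[f] \<in> hom (seq_cat V) [A] [B]" using f by (simp add: hom_seq_cat)
    let ?m = "seq_mor \<nu> V [A] (seq [B]) \<nu> [f]"
    note m = seq_mor_canon(1)[OF f']
    have c: "canon (length [B]) = [\<nu> 0, \<nu> 1]" by (simp add: canon_def)
    have m1: "gmap ?m (\<nu> 0) (\<nu> 1) = f" "gfun ?m (\<nu> 0) = \<nu> 0" "gfun ?m (\<nu> 1) = \<nu> 1" by simp_all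
    have g1: "ghom (seq [A]) (\<nu> 0) (\<nu> 1) = A" "ghom (seq [B]) (\<nu> 0) (\<nu> 1) = B"
      using ghom_seq(1)[of 0 "[A]"] ghom_seq(1)[of 0 "[B]"] by simp_all
    have \<nu>1: "\<nu> 0 \<in> gobj (seq [A])" "\<nu> 1 \<in> gobj (seq [A])" by auto
    have eq: "tc [B] o[V] (mt_unit E B o[V] f) = tc [B] o[V] (mt_ar E [f] o[V] mt_unit E A)"
      using unit_naturality[OF m \<nu>1] \<eta>_nat[OF m] unfolding m1 g1 c by simp
    show ?thesis
    proof (rule tc_cancel[OF B _ _ eq])
      show "mt_unit E B o[V] f \<in> hom V A (mt_ob E [B])" using Cmp_hom[OF f u_hom] B by auto
      have "mt_ar E [f] \<in> hom V (mt_ob E [A]) (mt_ob E [B])" by (rule E_hom'[OF f'])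
      then show "mt_ar E [f] o[V] mt_unit E A \<in> hom V A (mt_ob E [B])" using Cmp_hom[OF u_hom] A by auto
    qed
  qed
  have concat_Obj: "concat Z \<in> seqs V" if "Z \<in> lists (seqs V)" for Z using concat_lists[OF that] .
  have \<sigma>_nat: "mt_sub E B o[V] mt_ar E (map (mt_ar E) f) = mt_ar E (concat f) o[V] mt_sub E A"
    if f: "f \<in> hom ?SS A B" for f A B
  proof -
    interpret SS: category "?SS" by (intro category_seq_cat category_axioms)
    have A: "A \<in> lists (seqs V)" and B: "B \<in> lists (seqs V)" using SS.hom_Obj[OF f] by simp_all
    note f' = concat_hom[OF f]
    let ?X = "seq (concat A)" and ?Y = "seq (concat B)" and ?m = "seq_mor \<nu> V (concat A) (seq (concat B)) \<nu> (concat f)"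
    note m = seq_mor_canon[OF f']
    have "path_seq ?X (canon (length (concat A))) = concat A" by simp
    from path_split[OF canon this] obtain y xs where y: "y \<in> paths (gobj ?X) (\<nu> 0) (\<nu> (length (concat A)))"
      and xs: "xs \<in> refinements (gobj ?X) y" and pc: "path_concat (\<nu> 0) xs = canon (length (concat A))"
      and ps: "map (path_seq ?X) xs = A" by blast
    have lA: "length A = length xs" using arg_cong[OF ps, of length] by simp
    have lAi: "length (A ! i) = length (xs ! i) - 1" if "i < length xs" for i
      using arg_cong[OF ps, of "\<lambda>Z. length (Z ! i)"] that by simp
    have lf: "length f = length xs" "length B = length xs" using f lA by (auto simp: hom_seq_cat)
    have lfi: "length (f ! i) = length (xs ! i) - 1" "length (B ! i) = length (xs ! i) - 1" if "i < length xs" for i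
    proof -
      have "f ! i \<in> hom (seq_cat V) (A ! i) (B ! i)" using f that lf unfolding hom_seq_cat[of f] by simp
      then show "length (f ! i) = length (xs ! i) - 1" "length (B ! i) = length (xs ! i) - 1"
        using lAi[OF that] by (simp_all add: hom_seq_cat)
    qed
    \<comment> \<open>The blocks of f are recovered from their concatenation, since their lengths
      are those prescribed by the refinement; the same reasoning then recovers B.\<close>
    have pm: "map (path_map ?m) xs = f"
    proof (rule concat_inj)
      show "concat (map (path_map ?m) xs) = concat f" using m(3) path_map_concat[OF y xs, of ?m] pc by simp
    qed (simp_all add: lf lfi)
    have psY: "map (path_seq ?Y) (map (map (gfun ?m)) xs) = B"
    proof (rule concat_inj)
      have "map (map (gfun ?m)) xs \<in> refinements (gobj ?Y) (map (gfun ?m) y)"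
        by (rule refinements_map[OF xs gmor_hom(5)[OF m(1)]])
      from path_seq_concat[OF path_map_hom(1)[OF m(1) y] this, of ?Y]
      have "path_seq ?Y (path_concat (gfun ?m (\<nu> 0)) (map (map (gfun ?m)) xs)) =
        concat (map (path_seq ?Y) (map (map (gfun ?m)) xs))" .
      moreover have "path_concat (gfun ?m (\<nu> 0)) (map (map (gfun ?m)) xs) = canon (length (concat B))"
        using m(2) pc map_path_concat[of "gfun ?m" "\<nu> 0" xs] by simp
      ultimately show "concat (map (path_seq ?Y) (map (map (gfun ?m)) xs)) = concat B" by simp
    qed (simp_all add: lf lfi)
    have eq: "tc (concat B) o[V] (mt_sub E B o[V] mt_ar E (map (mt_ar E) f)) = tc (concat B) o[V] (mt_ar E (concat f) o[V] mt_sub E A)"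
    proof -
      have "map (\<lambda>x. mt_ar E (path_map ?m x)) xs = map (mt_ar E) (map (path_map ?m) xs)" by simp
      then have "map (\<lambda>x. mt_ar E (path_map ?m x)) xs = map (mt_ar E) f" unfolding pm .
      then show ?thesis
        using mult_naturality[OF m(1) y xs] \<mu>_nat[OF m(1)] unfolding pc m(2,3) ps psY by simp
    qed
    have EEf: "mt_ar E (map (mt_ar E) f) \<in> hom V (mt_ob E (map (mt_ob E) A)) (mt_ob E (map (mt_ob E) B))"
      by (rule E_hom'[OF E_map_hom[OF f]])
    show ?thesis
      by (rule tc_cancel[OF concat_Obj[OF B] Cmp_hom[OF EEf \<sigma>_hom[OF B]] Cmp_hom[OF \<sigma>_hom[OF A] E_hom'[OF f']] eq])
  qed
  show ?thesis
  proof (rule is_multitensor.intro)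
    show "nat_trans V V (fid V) (fcomp V (mt_fun E) (singleton_fun V)) (mt_unit E)"
      by (rule nat_transI[OF fid_functor[OF category_axioms] singleton_functor u_ext])
        (use u_hom u_nat in \<open>auto simp: singleton_fun_def hom_iff\<close>)
    show "nat_trans ?SS V (fcomp ?SS (mt_fun E) (seq_fun (seq_cat V) (mt_fun E)))
      (fcomp ?SS (mt_fun E) (concat_fun V)) (mt_sub E)"
    proof (rule nat_transI[OF inner_functor concat_functor])
      show "mt_sub E \<in> extensional (Obj ?SS)" using \<sigma>_ext by simp
      show "mt_sub E A \<in> hom V (fob (fcomp ?SS (mt_fun E) (seq_fun (seq_cat V) (mt_fun E))) A)
        (fob (fcomp ?SS (mt_fun E) (concat_fun V)) A)" if "A \<in> Obj ?SS" for A
        using that \<sigma>_hom by (simp add: seq_fun_def concat_fun_def)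
      show "mt_sub E B o[V] far (fcomp ?SS (mt_fun E) (seq_fun (seq_cat V) (mt_fun E))) f =
        far (fcomp ?SS (mt_fun E) (concat_fun V)) f o[V] mt_sub E A"
        if f: "f \<in> hom ?SS A B" for f A B
        using \<sigma>_nat[OF f] f by (simp add: seq_fun_def concat_fun_def hom_iff)
    qed
  next
    fix Z assume Z: "Z \<in> seqs V"
    note X = seq_graph[OF Z] and c = canon[of Z]
    note TX = T_graph[OF X] and tc = tc_hom[OF Z] and EZ = E_ob[OF Z]
    have X': "seq Z \<in> Obj GV" using X by (simp add: gcat_simps)
    have \<nu>Z: "\<nu> 0 \<in> gobj (TO (seq Z))" "\<nu> (length Z) \<in> gobj (TO (seq Z))" using X by auto
    have idt: "gmap (Idt GV (TO (seq Z))) (\<nu> 0) (\<nu> (length Z)) o[V] tc Z = tc Z o[V] Idt V (mt_ob E Z)"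
      using tc by (simp add: graph_Idt(2)[OF \<nu>Z] hom_iff)
    have ZZ: "[Z] \<in> lists (seqs V)" "map (\<lambda>z. [z]) Z \<in> lists (seqs V)" using Z by auto
    have u': "mt_unit E (mt_ob E Z) \<in> hom V (mt_ob E Z) (mt_ob E [mt_ob E Z])" by (rule u_hom[OF EZ])
    show "mt_sub E [Z] o[V] mt_unit E (mt_ob E Z) = Idt V (mt_ob E Z)"
    proof (rule tc_cancel[OF Z _ Idt_hom[OF EZ]])
      show "mt_sub E [Z] o[V] mt_unit E (mt_ob E Z) \<in> hom V (mt_ob E Z) (mt_ob E Z)"
        using Cmp_hom[OF u'] \<sigma>_hom[OF ZZ(1)] by simp
      show "tc Z o[V] (mt_sub E [Z] o[V] mt_unit E (mt_ob E Z)) = tc Z o[V] Idt V (mt_ob E Z)"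
        using unit_outer_t[OF u_nat X c] M.unit_left[OF X'] idt by simp
    qed
    have Eu: "mt_ar E (map (mt_unit E) Z) \<in> hom V (mt_ob E Z) (mt_ob E (map (\<lambda>z. mt_ob E [z]) Z))"
      using E_map_hom_set[of Z "mt_unit E" "\<lambda>z. z" "\<lambda>z. mt_ob E [z]"] u_hom Z by auto
    show "mt_sub E (map (\<lambda>z. [z]) Z) o[V] mt_ar E (map (mt_unit E) Z) = Idt V (mt_ob E Z)"
    proof (rule tc_cancel[OF Z _ Idt_hom[OF EZ]])
      show "mt_sub E (map (\<lambda>z. [z]) Z) o[V] mt_ar E (map (mt_unit E) Z) \<in> hom V (mt_ob E Z) (mt_ob E Z)"
        using Cmp_hom[OF Eu] \<sigma>_hom[OF ZZ(2)] by (simp add: comp_def)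
      show "tc Z o[V] (mt_sub E (map (\<lambda>z. [z]) Z) o[V] mt_ar E (map (mt_unit E) Z)) = tc Z o[V] Idt V (mt_ob E Z)"
        using unit_inner_t[OF X c] M.unit_right[OF X'] idt by simp
    qed
  next
    fix Zsss assume Zsss: "Zsss \<in> lists (lists (seqs V))"
    let ?Z = "concat (concat Zsss)"
    have cZ: "concat Zsss \<in> lists (seqs V)" by (rule concat_lists[OF Zsss])
    have Z: "?Z \<in> seqs V" by (rule concat_lists[OF cZ])
    note X = seq_graph[OF Z]
    have X': "seq ?Z \<in> Obj GV" using X by (simp add: gcat_simps)
    have "path_seq (seq ?Z) (canon (length ?Z)) = ?Z" by simp
    from path_split2[OF canon this] obtain z ys xss where z: "z \<in> walks (seq ?Z) (\<nu> 0) (\<nu> (length ?Z))"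
      and ys: "ys \<in> refined (seq ?Z) z" and len: "length xss = length ys"
      and xss: "\<forall>i<length ys. xss ! i \<in> refined (seq ?Z) (ys ! i)"
      and ps: "map (map (path_seq (seq ?Z))) xss = Zsss"
      and pc: "path_concat (\<nu> 0) (concat xss) = canon (length ?Z)" by blast
    have xss': "xss ! i \<in> refined (seq ?Z) (ys ! i)" if "i < length ys" for i using xss that by blast
    have EZ: "map (map (mt_ob E)) Zsss \<in> lists (seqs V)"
      by (rule map_lists[OF Zsss]) (erule map_lists, rule E_ob)
    have mcZ: "map concat Zsss \<in> lists (seqs V)" by (rule map_lists[OF Zsss concat_lists])
    have Esub: "mt_ar E (map (mt_sub E) Zsss) \<in> hom V (mt_ob E (map (\<lambda>Zss. mt_ob E (map (mt_ob E) Zss)) Zsss)) (mt_ob E (map (\<lambda>Zss. mt_ob E (concat Zss)) Zsss))"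
      by (rule E_map_hom_set) (use \<sigma>_hom Zsss in auto)
    have 1: "mt_sub E (map concat Zsss) o[V] mt_ar E (map (mt_sub E) Zsss) \<in> hom V (mt_ob E (map (\<lambda>Zss. mt_ob E (map (mt_ob E) Zss)) Zsss)) (mt_ob E ?Z)"
      using Cmp_hom[OF Esub] \<sigma>_hom[OF mcZ] concat_map_concat[of Zsss] by (simp add: comp_def)
    have 2: "mt_sub E (concat Zsss) o[V] mt_sub E (map (map (mt_ob E)) Zsss) \<in> hom V (mt_ob E (map (\<lambda>Zss. mt_ob E (map (mt_ob E) Zss)) Zsss)) (mt_ob E ?Z)"
      using Cmp_hom \<sigma>_hom[OF EZ] \<sigma>_hom[OF cZ] by (simp add: comp_def map_concat)
    show "mt_sub E (map concat Zsss) o[V] mt_ar E (map (mt_sub E) Zsss) = mt_sub E (concat Zsss) o[V] mt_sub E (map (map (mt_ob E)) Zsss)"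
      by (rule tc_cancel[OF Z 1 2])
        (use assoc_t(1)[OF X z ys len xss'] assoc_t(2)[OF X z ys len xss' \<sigma>_nat] M.mult_assoc[OF X'] in \<open>simp add: ps pc\<close>)
  qed
qed

text \<open>By \<open>tc_iso\<close> and \<open>tc_nat\<close> the maps \<open>tc\<close> form a
  natural isomorphism from E to the functor that T induces on sequences, and preservation of
  coproducts is invariant under it.\<close>

lemma bar_distributive: "preserves_coproducts_in_each_variable small V V (bar_fun \<nu> V (mnd_fun T))"
  unfolding preserves_coproducts_in_each_variable_def
proof (intro ballI allI impI)
  let ?B = "bar_fun \<nu> V (mnd_fun T)"
  fix xs ys and I :: "'u set" and A c \<iota>
  assume xs: "xs \<in> seqs V" and ys: "ys \<in> seqs V" and cp: "small I \<and> is_coproduct V I A c \<iota>"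
  then have cp': "is_coproduct V I (\<lambda>i. mt_ob E (xs @ A i # ys)) (mt_ob E (xs @ c # ys))
    (\<lambda>i. mt_ar E (map (Idt V) xs @ \<iota> i # map (Idt V) ys))"
    using E_pres unfolding preserves_coproducts_in_each_variable_def by blast
  note \<iota> = coproduct_hom[OF conjunct2[OF cp]]
  have bar_ob: "fob ?B Z = Tbar Z" if "Z \<in> seqs V" for Z
    using that by (simp add: bar_fun_def)
  have bar_ar: "far ?B f = gmap (TA (seq_mor \<nu> V Z (seq Z') \<nu> f)) (\<nu> 0) (\<nu> (length Z))"
    if "f \<in> hom (seq_cat V) Z Z'" for f Z Z'
    using that by (auto simp: bar_fun_def hom_iff)
  have c: "xs @ c # ys \<in> seqs V" using xs ys coproduct_Obj conjunct2[OF cp] by auto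
  have Ai: "xs @ A i # ys \<in> seqs V" if "i \<in> I" for i using xs ys hom_Obj[OF \<iota>[OF that]] by simp
  have f: "map (Idt V) xs @ \<iota> i # map (Idt V) ys \<in> hom (seq_cat V) (xs @ A i # ys) (xs @ c # ys)" if "i \<in> I" for i
    using \<iota>[OF that] xs ys by (auto simp: hom_iff intro!: map_idI)
  show "is_coproduct V I (\<lambda>i. fob ?B (xs @ A i # ys)) (fob ?B (xs @ c # ys))
    (\<lambda>i. far ?B (map (Idt V) xs @ \<iota> i # map (Idt V) ys))"
  proof (rule coproduct_iso[OF cp'])
    show "is_iso V (mt_ob E (xs @ c # ys)) (fob ?B (xs @ c # ys)) (tc (xs @ c # ys))"
      unfolding bar_ob[OF c] by (rule tc_iso[OF c])
    fix i assume i: "i \<in> I"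
    show "is_iso V (mt_ob E (xs @ A i # ys)) (fob ?B (xs @ A i # ys)) (tc (xs @ A i # ys))"
      unfolding bar_ob[OF Ai[OF i]] by (rule tc_iso[OF Ai[OF i]])
    note fi = f[OF i]
    show "far ?B (map (Idt V) xs @ \<iota> i # map (Idt V) ys) \<in> hom V
      (fob ?B (xs @ A i # ys)) (fob ?B (xs @ c # ys))"
      unfolding bar_ob[OF c] bar_ob[OF Ai[OF i]] bar_ar[OF fi]
      using T_map[OF seq_mor_canon(1)[OF fi], of "\<nu> 0" "\<nu> (length (xs @ A i # ys))"] by simp
    show "far ?B (map (Idt V) xs @ \<iota> i # map (Idt V) ys) o[V] tc (xs @ A i # ys) =
      tc (xs @ c # ys) o[V] mt_ar E (map (Idt V) xs @ \<iota> i # map (Idt V) ys)"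
      unfolding bar_ar[OF fi] by (rule tc_nat[OF fi])
  qed
qed

text \<open>By \<open>t_path_mor\<close> the cocone in the definition of path-likeness differs from
  the cocone of t only by the isomorphisms \<open>tc\<close> on the summands.\<close>

lemma T_path_like: "path_like small \<nu> V V (mnd_fun T)"
  unfolding path_like_def
proof (intro ballI)
  fix X a b assume "X \<in> Obj GV" and a: "a \<in> gobj X" and b: "b \<in> gobj X"
  then have X: "graph X" by (simp add: gcat_simps)
  show "is_coproduct V (walks X a b)
     (\<lambda>x. ghom (TO (seq (path_seq X x))) (\<nu> 0) (\<nu> (length x - 1))) (ghom (TO X) a b)
     (\<lambda>x. gmap (TA (path_mor \<nu> V X x)) (\<nu> 0) (\<nu> (length x - 1)))"
  proof (rule coproduct_iso[OF t_coproduct[OF X a b]])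
    have "ghom (TO X) a b \<in> Obj V" using is_graph_hom[OF T_graph[OF X]] a b X by simp
    then show "is_iso V (ghom (TO X) a b) (ghom (TO X) a b) (Idt V (ghom (TO X) a b))"
      unfolding is_iso_def using Idt_hom by (auto intro!: bexI[of _ "Idt V (ghom (TO X) a b)"])
    fix x assume x: "x \<in> walks X a b"
    show "is_iso V (mt_ob E (path_seq X x)) (ghom (TO (seq (path_seq X x))) (\<nu> 0) (\<nu> (length x - 1))) (tc (path_seq X x))"
      using tc_iso[OF path_seq_Obj[OF X x]] by simp
    show "gmap (TA (path_mor \<nu> V X x)) (\<nu> 0) (\<nu> (length x - 1)) \<in> hom V (ghom (TO (seq (path_seq X x))) (\<nu> 0) (\<nu> (length x - 1))) (ghom (TO X) a b)"
    proof -
      have "x \<noteq> []" using x by (simp add: paths_def)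
      then have "gfun (path_mor \<nu> V X x) (\<nu> 0) = a" "gfun (path_mor \<nu> V X x) (\<nu> (length x - 1)) = b"
        using path_mor_simps(1)[OF x] x by (auto simp: paths_iff)
      then show ?thesis using T_map[OF path_mor_hom[OF X x], of "\<nu> 0" "\<nu> (length x - 1)"] by simp
    qed
    show "gmap (TA (path_mor \<nu> V X x)) (\<nu> 0) (\<nu> (length x - 1)) o[V] tc (path_seq X x) = Idt V (ghom (TO X) a b) o[V] t X x"
      using t_path_mor[OF X x] t_hom[OF X x] by (simp add: hom_iff)
  qed
qed

end

section \<open>The monad of a distributive multitensor\<close>

locale distributive_multitensor = gcat small \<nu> V + is_multitensor V E
  for small :: "'u set \<Rightarrow> bool" and \<nu> :: "nat \<Rightarrow> 'u" and V :: "('o, 'a) cat" and E :: "('o, 'a) multitensor" +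
  assumes distributive: "preserves_coproducts_in_each_variable small V V (mt_fun E)"
begin

sublocale list_functor V "mt_fun E"
  by (rule multitensor_list_functor) (unfold_locales)

sublocale GV: category GV by (rule category_graph_cat) (rule category_axioms)

abbreviation G :: "('u, 'o) graph \<Rightarrow> ('u, 'o) graph" where "G \<equiv> Gam_graph V E"
abbreviation GA :: "('u, 'o, 'a) gmor \<Rightarrow> ('u, 'o, 'a) gmor" where "GA \<equiv> Gam_gmor V E"
abbreviation inc :: "('u, 'o) graph \<Rightarrow> 'u list \<Rightarrow> 'a" where "inc \<equiv> Gam_in V E"

text \<open>\<open>Gam_in\<close> reads the endpoints off the path and agrees with the chosen
  injection on paths from a to b. The first form is needed to unfold \<open>copair\<close>, the
  second is uniform in a and b and serves as t.\<close>

lemma Gam_coproduct: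
  assumes X: "graph X"
  shows "is_coproduct V (walks X a b) (\<lambda>x. mt_ob E (path_seq X x)) (Gam_hom V E X a b)
  (coprod_in V (walks X a b) (\<lambda>x. mt_ob E (path_seq X x)))"
    and "is_coproduct V (walks X a b) (\<lambda>x. mt_ob E (path_seq X x)) (Gam_hom V E X a b) (inc X)"
proof -
  show 1: "is_coproduct V (walks X a b) (\<lambda>x. mt_ob E (path_seq X x)) (Gam_hom V E X a b)
    (coprod_in V (walks X a b) (\<lambda>x. mt_ob E (path_seq X x)))"
    unfolding Gam_hom_def
    by (rule coproduct_exists[OF smallness_axioms coproducts small_paths[OF is_graph_small[OF X]]])
      (rule E_ob[OF path_seq_Obj[OF X]])
  show "is_coproduct V (walks X a b) (\<lambda>x. mt_ob E (path_seq X x)) (Gam_hom V E X a b) (inc X)"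
    by (rule coproduct_cong[OF 1]) (auto simp: Gam_in_def paths_def)
qed

lemma gobj_Gam [simp]: "gobj (G X) = gobj X"
  and ghom_Gam: "\<lbrakk>a \<in> gobj X; b \<in> gobj X\<rbrakk> \<Longrightarrow> ghom (G X) a b = Gam_hom V E X a b"
  by (simp_all add: Gam_graph_def)

lemma Gam_is_graph: "graph X \<Longrightarrow> graph (G X)"
  unfolding Gam_graph_def
  by (rule is_graph_mk_graph) (auto intro: is_graph_small coproduct_Obj[OF Gam_coproduct(2)])

lemma inc_hom: "\<lbrakk>graph X; x \<in> walks X a b\<rbrakk>
    \<Longrightarrow> inc X x \<in> hom V (mt_ob E (path_seq X x)) (Gam_hom V E X a b)"
  by (rule coproduct_hom[OF Gam_coproduct(2)])

lemma Gam_map: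
  assumes f: "f \<in> hom GV X Y" and a: "a \<in> gobj X" and b: "b \<in> gobj X"
  shows "gmap (GA f) a b \<in> hom V (Gam_hom V E X a b) (Gam_hom V E Y (gfun f a) (gfun f b))"
    and "x \<in> walks X a b \<Longrightarrow>
  gmap (GA f) a b o[V] inc X x = inc Y (map (gfun f) x) o[V] mt_ar E (path_map f x)"
proof -
  note X = gmor_hom(1)[OF f] and Y = gmor_hom(2)[OF f]
  let ?k = "\<lambda>x. inc Y (map (gfun f) x) o[V] mt_ar E (path_map f x)"
  have cp: "is_coproduct V (walks X a b) (\<lambda>x. mt_ob E (path_seq X x))
    (coprod V (walks X a b) (\<lambda>x. mt_ob E (path_seq X x)))
    (coprod_in V (walks X a b) (\<lambda>x. mt_ob E (path_seq X x)))"
    using Gam_coproduct(1)[OF X] by (simp add: Gam_hom_def)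
  have k: "?k x \<in> hom V (mt_ob E (path_seq X x)) (Gam_hom V E Y (gfun f a) (gfun f b))"
    if "x \<in> walks X a b" for x
    by (rule Cmp_hom[OF E_hom'[OF path_map_hom(2)[OF f that]] inc_hom[OF Y path_map_hom(1)[OF f that]]])
  have e: "gmap (GA f) a b = copair V (walks X a b) (\<lambda>x. mt_ob E (path_seq X x))
    (Gam_hom V E Y (gfun f a) (gfun f b)) ?k"
    using a b gmor_hom(3,4)[OF f] by (simp add: Gam_gmor_def path_map_def)
  note c = copair[OF cp coproduct_Obj[OF Gam_coproduct(2)[OF Y]], of ?k "gfun f a" "gfun f b", OF k]
  show "gmap (GA f) a b \<in> hom V (Gam_hom V E X a b) (Gam_hom V E Y (gfun f a) (gfun f b))"
    using c(1) unfolding e by (simp add: Gam_hom_def)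
  show "gmap (GA f) a b o[V] inc X x = ?k x" if "x \<in> walks X a b"
    using c(2)[of x] that unfolding e by (simp add: Gam_in_def paths_ends[OF that])
qed

lemma Gam_gmor_hom:
  assumes f: "f \<in> hom GV X Y" shows "GA f \<in> hom GV (G X) (G Y)" and "gfun (GA f) = gfun f"
proof -
  note X = gmor_hom(1)[OF f] and Y = gmor_hom(2)[OF f]
  have fe: "gfun f \<in> extensional (gobj X)" using f by (simp add: graph_hom_iff PiE_def)
  then show f0: "gfun (GA f) = gfun f"
    using gmor_hom(3)[OF f] by (simp add: Gam_gmor_def mk_gmor_def extensional_restrict)
  have "GA f = mk_gmor (G X) (G Y) (gfun f) (gmap (GA f))"
    using gmor_hom(3,4)[OF f] fe unfolding Gam_gmor_def mk_gmor_def
    by (simp add: restrict2_def fun_eq_iff)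
  also have "\<dots> \<in> hom GV (G X) (G Y)"
    by (rule mk_gmor_hom)
      (use X Y Gam_is_graph gmor_hom(6)[OF f] Gam_map(1)[OF f] in \<open>simp_all add: ghom_Gam\<close>)
  finally show "GA f \<in> hom GV (G X) (G Y)" .
qed

lemma path_map_Idt:
  assumes X: "graph X" and x: "x \<in> walks X a b"
  shows "path_map (Idt GV X) x = map (Idt V) (path_seq X x)" and "map (gfun (Idt GV X)) x = x"
proof -
  show "path_map (Idt GV X) x = map (Idt V) (path_seq X x)"
    by (rule nth_equalityI) (simp_all add: nth_path_map nth_path_seq graph_Idt paths_nth[OF x])
  show "map (gfun (Idt GV X)) x = x"
    by (rule nth_equalityI) (simp_all add: graph_Idt paths_nth[OF x])
qed

lemma path_map_cmp:
  assumes f: "f \<in> hom GV X Y" and g: "g \<in> hom GV Y Z" and x: "x \<in> walks X a b"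
  shows "mt_ar E (path_map (g o[GV] f) x) = mt_ar E (path_map g (map (gfun f) x)) o[V] mt_ar E (path_map f x)"
    and "map (gfun (g o[GV] f)) x = map (gfun g) (map (gfun f) x)"
proof -
  have "path_map (g o[GV] f) x = map2 (Cmp V) (path_map g (map (gfun f) x)) (path_map f x)"
    by (rule nth_equalityI) (simp_all add: nth_path_map graph_cmp(2)[OF f] paths_nth[OF x])
  then show "mt_ar E (path_map (g o[GV] f) x) = mt_ar E (path_map g (map (gfun f) x)) o[V] mt_ar E (path_map f x)"
    using E_cmp'[OF path_map_hom(2)[OF f x] path_map_hom(2)[OF g path_map_hom(1)[OF f x]]] by simp
  show "map (gfun (g o[GV] f)) x = map (gfun g) (map (gfun f) x)"
    by (rule nth_equalityI) (simp_all add: graph_cmp(1)[OF f] paths_nth[OF x])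
qed

text \<open>The tests in \<open>functor_comparison\<close> presuppose a functor; this one is
  available earlier and proves functoriality.\<close>

lemma Gam_eqI:
  assumes X: "graph X" and f: "f \<in> hom GV (G X) Y" and g: "g \<in> hom GV (G X) Y"
    and 0: "\<And>a. a \<in> gobj X \<Longrightarrow> gfun f a = gfun g a"
    and 1: "\<And>a b x. x \<in> walks X a b \<Longrightarrow> gmap f a b o[V] inc X x = gmap g a b o[V] inc X x"
  shows "f = g"
proof (rule gmor_eqI[OF f g])
  show "gfun f a = gfun g a" if "a \<in> gobj (G X)" for a using 0 that by simp
  fix a b assume ab: "a \<in> gobj (G X)" "b \<in> gobj (G X)"
  show "gmap f a b = gmap g a b"
    by (rule coproduct_eqI[OF Gam_coproduct(2)[OF X] _ _ 1])
      (use gmor_hom(7)[OF f ab] gmor_hom(7)[OF g ab] 0 ab in \<open>simp_all add: ghom_Gam\<close>)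
qed

abbreviation GT :: "('u, 'o, 'a) gmonad" where "GT \<equiv> Gam_monad small V E"

lemma Gam_monad_simps [simp]:
  "graph X \<Longrightarrow> fob (mnd_fun GT) X = G X" "f \<in> hom GV X Y \<Longrightarrow> far (mnd_fun GT) f = GA f"
  "graph X \<Longrightarrow> mnd_unit GT X = Gam_unit V E X" "graph X \<Longrightarrow> mnd_mult GT X = Gam_mult V E X"
  by (simp_all add: Gam_monad_def gcat_simps hom_iff)

lemma Gam_functor: "is_functor GV GV (mnd_fun GT)"
proof (rule is_functorI[OF GV.category_axioms GV.category_axioms])
  show "fob (mnd_fun GT) \<in> extensional (Obj GV)" "far (mnd_fun GT) \<in> extensional (Arr GV)"
    by (simp_all add: Gam_monad_def)
  show "fob (mnd_fun GT) X \<in> Obj GV" if "X \<in> Obj GV" for X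
    using that Gam_is_graph by (simp add: gcat_simps)
  show "far (mnd_fun GT) f \<in> hom GV (fob (mnd_fun GT) X) (fob (mnd_fun GT) Y)" if f: "f \<in> hom GV X Y" for f X Y
    using Gam_gmor_hom(1)[OF f] gmor_hom(1,2)[OF f] f by simp
  show "far (mnd_fun GT) (Idt GV X) = Idt GV (fob (mnd_fun GT) X)" if "X \<in> Obj GV" for X
  proof -
    have X: "graph X" using that by (simp add: gcat_simps)
    note i = GV.Idt_hom[OF that]
    have GX: "G X \<in> Obj GV" using Gam_is_graph[OF X] by (simp add: gcat_simps)
    have "GA (Idt GV X) = Idt GV (G X)"
    proof (rule Gam_eqI[OF X Gam_gmor_hom(1)[OF i] GV.Idt_hom[OF GX]])
      show "gfun (GA (Idt GV X)) a = gfun (Idt GV (G X)) a" if "a \<in> gobj X" for a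
        using that by (simp add: Gam_gmor_hom(2)[OF i] graph_Idt)
      fix a b x assume x: "x \<in> walks X a b"
      then have ab: "a \<in> gobj X" "b \<in> gobj X" using paths_ends[of x] by simp_all
      have "gmap (GA (Idt GV X)) a b o[V] inc X x = inc X x"
        using Gam_map(2)[OF i ab x] inc_hom[OF X x] E_ob[OF path_seq_Obj[OF X x]]
        by (simp add: path_map_Idt[OF X x] E_Idt[OF path_seq_Obj[OF X x]] hom_iff)
      also have "\<dots> = gmap (Idt GV (G X)) a b o[V] inc X x"
        using inc_hom[OF X x] ab by (simp add: graph_Idt ghom_Gam hom_iff)
      finally show "gmap (GA (Idt GV X)) a b o[V] inc X x = gmap (Idt GV (G X)) a b o[V] inc X x" .
    qed
    then show ?thesis using X i by simp
  qed
  show "far (mnd_fun GT) (g o[GV] f) = far (mnd_fun GT) g o[GV] far (mnd_fun GT) f"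
    if f: "f \<in> hom GV X Y" and g: "g \<in> hom GV Y Z" for f g X Y Z
  proof -
    note gf = GV.Cmp_hom[OF f g] and X = gmor_hom(1)[OF f] and Y = gmor_hom(2)[OF f] and Z = gmor_hom(2)[OF g]
    note Gf = Gam_gmor_hom[OF f] and Gg = Gam_gmor_hom[OF g] and Ggf = Gam_gmor_hom[OF gf]
    have "GA (g o[GV] f) = GA g o[GV] GA f"
    proof (rule Gam_eqI[OF X Ggf(1) GV.Cmp_hom[OF Gf(1) Gg(1)]])
      show "gfun (GA (g o[GV] f)) a = gfun (GA g o[GV] GA f) a" if "a \<in> gobj X" for a
        using that by (simp add: Ggf(2) graph_cmp(1)[OF Gf(1)] graph_cmp(1)[OF f] Gf(2) Gg(2))
      fix a b x assume x: "x \<in> walks X a b"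
      then have ab: "a \<in> gobj X" "b \<in> gobj X" using paths_ends[of x] by simp_all
      have fab: "gfun f a \<in> gobj Y" "gfun f b \<in> gobj Y" using gmor_hom(6)[OF f] ab by auto
      note fx = path_map_hom[OF f x]
      note gfx = path_map_hom[OF g fx(1)]
      note h = Gam_map(1)[OF f ab] Gam_map(1)[OF g fab] inc_hom[OF X x] inc_hom[OF Y fx(1)] inc_hom[OF Z gfx(1)]
        E_hom'[OF fx(2)] E_hom'[OF gfx(2)]
      have "gmap (GA g o[GV] GA f) a b o[V] inc X x = gmap (GA g) (gfun f a) (gfun f b) o[V] (gmap (GA f) a b o[V] inc X x)"
        using h ab by (simp add: graph_cmp(2)[OF Gf(1)] Gf(2) hom_iff assoc)
      also have "\<dots> = (gmap (GA g) (gfun f a) (gfun f b) o[V] inc Y (map (gfun f) x)) o[V] mt_ar E (path_map f x)"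
        unfolding Gam_map(2)[OF f ab x] using h by (simp add: hom_iff assoc)
      also have "\<dots> = inc Z (map (gfun g) (map (gfun f) x)) o[V] (mt_ar E (path_map g (map (gfun f) x)) o[V] mt_ar E (path_map f x))"
        unfolding Gam_map(2)[OF g fab fx(1)] using h by (simp add: hom_iff assoc)
      finally show "gmap (GA (g o[GV] f)) a b o[V] inc X x = gmap (GA g o[GV] GA f) a b o[V] inc X x"
        unfolding Gam_map(2)[OF gf ab x] path_map_cmp[OF f g x] by simp
    qed
    then show ?thesis using f g gf by simp
  qed
qed

lemma Gam_functor_comparison: "functor_comparison small \<nu> V E GT inc"
proof (rule functor_comparison.intro[OF gcat_axioms list_functor_axioms], rule functor_comparison_axioms.intro)
  show "functor_over_Set small V (mnd_fun GT)"
    unfolding functor_over_Set_def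
  proof (intro conjI ballI)
    show "gobj (fob (mnd_fun GT) X) = gobj X" if "X \<in> Obj GV" for X using that by (simp add: gcat_simps)
    fix f assume "f \<in> Arr GV"
    then have "f \<in> hom GV (gdom f) (gcod f)" by (simp add: hom_iff gcat_simps)
    then show "gfun (far (mnd_fun GT) f) = gfun f" using Gam_gmor_hom(2) by simp
  qed
  show "is_coproduct V (walks X a b) (\<lambda>x. mt_ob E (path_seq X x)) (ghom (fob (mnd_fun GT) X) a b) (inc X)"
    if "graph X" "a \<in> gobj X" "b \<in> gobj X" for X a b
    using that Gam_coproduct(2) by (simp add: ghom_Gam)
  show "gmap (far (mnd_fun GT) f) a b o[V] inc X x = inc Y (map (gfun f) x) o[V] mt_ar E (path_map f x)"
    if "f \<in> hom GV X Y" "x \<in> walks X a b" for f X Y x a b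
    using that Gam_map(2) paths_ends[OF that(2)] by simp
qed (fact distributive Gam_functor)+

sublocale F: functor_comparison small \<nu> V E GT inc by (rule Gam_functor_comparison)

text \<open>The definite description in \<open>Gam_mult\<close> denotes: pairs of a path and a
  refinement of it index a coproduct cocone on the hom of the second iterate, by distributivity and
  \<open>coproduct_Sigma\<close>.\<close>

lemma Gam_mult_map:
  assumes X: "graph X" and a: "a \<in> gobj X" and b: "b \<in> gobj X"
  shows "gmap (Gam_mult V E X) a b \<in> hom V (Gam_hom V E (G X) a b) (Gam_hom V E X a b)"
    and "\<lbrakk>y \<in> walks X a b; xs \<in> refined X y\<rbrakk> \<Longrightarrow>
  gmap (Gam_mult V E X) a b o[V] (inc (G X) y o[V] mt_ar E (map (inc X) xs)) =
  inc X (path_concat a xs) o[V] mt_sub E (map (path_seq X) xs)"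
proof -
  note GX = Gam_is_graph[OF X]
  let ?S = "Sigma (walks X a b) (refined X)"
  let ?k = "\<lambda>p. inc X (path_concat a (snd p)) o[V] mt_sub E (map (path_seq X) (snd p))"
  have s: "mt_sub E Zss \<in> hom V (mt_ob E (map (mt_ob E) Zss)) (mt_ob E (concat Zss))"
    if "Zss \<in> lists (seqs V)" for Zss
    using nat_trans.component_hom[OF sub_natural, of Zss] that by (simp add: seq_fun_def concat_fun_def)
  have k: "?k p \<in> hom V (mt_ob E (map (\<lambda>x. mt_ob E (path_seq X x)) (snd p))) (Gam_hom V E X a b)"
    if "p \<in> ?S" for p
  proof -
    obtain y xs where p1: "p = (y, xs)" by (cases p)
    with that have p: "p = (y, xs)" "y \<in> walks X a b" "xs \<in> refined X y" by simp_all
    from s[OF path_seq_Obj_refinement[OF X p(3)]] show ?thesis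
      using Cmp_hom[OF _ inc_hom[OF X]] path_concat_props[OF p(2,3)] path_seq_concat[OF p(2,3), of X] p(1)
      by (simp add: comp_def)
  qed
  have "is_coproduct V (walks X a b) (\<lambda>y. mt_ob E (path_seq (G X) y)) (Gam_hom V E (G X) a b) (inc (G X))"
    using Gam_coproduct(2)[OF GX] by simp
  moreover have "is_coproduct V (refinements (gobj X) y) (\<lambda>xs. mt_ob E (map (\<lambda>x. mt_ob E (path_seq X x)) xs))
    (mt_ob E (path_seq (G X) y)) (\<lambda>xs. mt_ar E (map (inc X) xs))" if "y \<in> walks X a b" for y
    using F.tt_coproduct[OF X that] X by simp
  ultimately have cp: "is_coproduct V ?S (\<lambda>p. mt_ob E (map (\<lambda>x. mt_ob E (path_seq X x)) (snd p)))
    (Gam_hom V E (G X) a b) (\<lambda>p. inc (G X) (fst p) o[V] mt_ar E (map (inc X) (snd p)))"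
    by (rule coproduct_Sigma)
  from coproduct_ex1[OF cp coproduct_Obj[OF Gam_coproduct(2)[OF X]], of ?k, OF k]
  have "\<exists>!h. h \<in> hom V (Gam_hom V E (G X) a b) (Gam_hom V E X a b) \<and>
    (\<forall>y\<in>walks X a b. \<forall>xs\<in>refined X y.
    h o[V] (inc (G X) y o[V] mt_ar E (map (inc X) xs))
    = inc X (path_concat a xs) o[V] mt_sub E (map (path_seq X) xs))"
    by (simp add: split_paired_Ball_Sigma)
  from theI'[OF this]
  have "gmap (Gam_mult V E X) a b \<in> hom V (Gam_hom V E (G X) a b) (Gam_hom V E X a b) \<and>
    (\<forall>y\<in>walks X a b. \<forall>xs\<in>refined X y.
    gmap (Gam_mult V E X) a b o[V] (inc (G X) y o[V] mt_ar E (map (inc X) xs))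
    = inc X (path_concat a xs) o[V] mt_sub E (map (path_seq X) xs))"
    using a b by (simp add: Gam_mult_def)
  then show "gmap (Gam_mult V E X) a b \<in> hom V (Gam_hom V E (G X) a b) (Gam_hom V E X a b)"
    and "\<lbrakk>y \<in> walks X a b; xs \<in> refined X y\<rbrakk> \<Longrightarrow>
    gmap (Gam_mult V E X) a b o[V] (inc (G X) y o[V] mt_ar E (map (inc X) xs)) =
    inc X (path_concat a xs) o[V] mt_sub E (map (path_seq X) xs)" by blast+
qed

lemma Gam_comparison: "comparison small \<nu> V E GT inc"
proof (rule comparison.intro[OF Gam_functor_comparison], rule comparison_axioms.intro)
  interpret U: nat_trans V V "fid V" "fcomp V (mt_fun E) (singleton_fun V)" "mt_unit E" by (rule unit_natural)
  interpret S: nat_trans "seq_cat (seq_cat V)" V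
    "fcomp (seq_cat (seq_cat V)) (mt_fun E) (seq_fun (seq_cat V) (mt_fun E))"
    "fcomp (seq_cat (seq_cat V)) (mt_fun E) (concat_fun V)" "mt_sub E" by (rule sub_natural)
  show "mt_unit E \<in> extensional (Obj V)" by (rule U.components_extensional)
  show u: "mt_unit E Z \<in> hom V Z (mt_ob E [Z])" if "Z \<in> Obj V" for Z
    using U.component_hom[OF that] that by (simp add: singleton_fun_def)
  show "mt_sub E \<in> extensional (lists (seqs V))" using S.components_extensional by simp
  show "mt_sub E Zss \<in> hom V (mt_ob E (map (mt_ob E) Zss)) (mt_ob E (concat Zss))"
    if "Zss \<in> lists (seqs V)" for Zss
    using S.component_hom[of Zss] that by (simp add: seq_fun_def concat_fun_def)
  show "mnd_unit GT \<in> extensional (Obj GV)" "mnd_mult GT \<in> extensional (Obj GV)" by (simp_all add: Gam_monad_def)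
  fix X assume X: "graph X"
  note GX = Gam_is_graph[OF X]
  have u': "inc X [a, b] o[V] mt_unit E (ghom X a b) \<in> hom V (ghom X a b) (Gam_hom V E X a b)"
    if "a \<in> gobj X" "b \<in> gobj X" for a b
    using Cmp_hom[OF u[OF is_graph_hom[OF X that]]] inc_hom[OF X paths_pair[OF that]] by (simp add: path_seq_def)
  show "mnd_unit GT X \<in> hom GV X (fob (mnd_fun GT) X)"
    using X GX unfolding Gam_monad_simps(1,3)[OF X] Gam_unit_def
    by (intro mk_gmor_hom) (simp_all add: ghom_Gam u')
  show "gfun (mnd_unit GT X) = (\<lambda>a\<in>gobj X. a)" "gfun (mnd_mult GT X) = (\<lambda>a\<in>gobj X. a)"
    using X by (simp_all add: Gam_unit_def Gam_mult_def mk_gmor_def)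
  show "gmap (mnd_unit GT X) a b = inc X [a, b] o[V] mt_unit E (ghom X a b)"
    if "a \<in> gobj X" "b \<in> gobj X" for a b
    using X that by (simp add: Gam_unit_def)
  have "Gam_mult V E X = mk_gmor (G (G X)) (G X) (\<lambda>a. a) (gmap (Gam_mult V E X))"
    by (simp add: Gam_mult_def mk_gmor_def restrict2_def fun_eq_iff)
  also have "\<dots> \<in> hom GV (G (G X)) (G X)"
    using X GX Gam_is_graph[OF GX] Gam_mult_map(1)[OF X] by (intro mk_gmor_hom) (simp_all add: ghom_Gam)
  finally show "mnd_mult GT X \<in> hom GV (fob (mnd_fun GT) (fob (mnd_fun GT) X)) (fob (mnd_fun GT) X)"
    using X GX by simp
  show "gmap (mnd_mult GT X) a b o[V] (inc (fob (mnd_fun GT) X) y o[V] mt_ar E (map (inc X) xs))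
    = inc X (path_concat a xs) o[V] mt_sub E (map (path_seq X) xs)"
    if "y \<in> walks X a b" "xs \<in> refined X y" for y a b xs
    using Gam_mult_map(2)[OF X] paths_ends[OF that(1)] that X by simp
qed

end

lemma dm_object_comparison:
  assumes "smallness small" "inj \<nu>" "(V, E) \<in> dm_objects small"
  shows "comparison small \<nu> V E (Gam_monad small V E) (Gam_in V E)"
proof -
  interpret distributive_multitensor small \<nu> V E
    using assms by (intro distributive_multitensor.intro gcat.intro gcat_axioms.intro
      distributive_multitensor_axioms.intro) (simp_all add: dm_objects_def)
  show ?thesis by (rule Gam_comparison)
qed

section \<open>The multitensor of a path-like monad\<close>

context gcat
begin

text \<open>With \<open>seq_mor_cmp\<close> this makes the graph of a sequence functorial in the
  sequence, from which functoriality of \<open>bar_fun\<close> follows by applying T.\<close>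

lemma seq_mor_Idt:
  assumes Z: "Z \<in> seqs V"
  shows "seq_mor \<nu> V Z (seq Z) \<nu> (map (Idt V) Z) = Idt GV (seq Z)"
proof -
  interpret GV: category GV by (rule category_graph_cat) (rule category_axioms)
  interpret S: category "seq_cat V" by (rule category_seq_cat) (rule category_axioms)
  have "map (Idt V) Z \<in> hom (seq_cat V) Z Z" using S.Idt_hom[of Z] Z by simp
  note m = seq_mor_canon(1)[OF this]
  have "seq Z \<in> Obj GV" using seq_graph[OF Z] by (simp add: gcat_simps)
  then show ?thesis
    by (intro seq_hom_eqI[OF m GV.Idt_hom]) (simp_all add: graph_Idt ghom_seq)
qed

lemma seq_mor_cmp:
  assumes f: "f \<in> hom (seq_cat V) A B" and g: "g \<in> hom (seq_cat V) B D"
  shows "seq_mor \<nu> V A (seq D) \<nu> (map2 (Cmp V) g f) =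
    seq_mor \<nu> V B (seq D) \<nu> g o[GV] seq_mor \<nu> V A (seq B) \<nu> f"
proof -
  interpret GV: category GV by (rule category_graph_cat) (rule category_axioms)
  interpret S: category "seq_cat V" by (rule category_seq_cat) (rule category_axioms)
  have gf: "map2 (Cmp V) g f \<in> hom (seq_cat V) A D" using S.Cmp_hom[OF f g] by simp
  have l: "length A = length f" "length B = length f" "length g = length f" "length D = length f"
    using f g by (auto simp: hom_seq_cat)
  note m = seq_mor_canon(1)
  show ?thesis
    by (rule seq_hom_eqI[OF m[OF gf] GV.Cmp_hom[OF m[OF f] m[OF g]]]) (simp_all add: graph_cmp[OF m[OF f]] l)
qed

text \<open>Both sides are morphisms out of the graph of a sequence, so \<open>seq_hom_eqI\<close>
  only asks about vertices and consecutive homs. Applying T to this equation gives naturality of the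
  path-like cocone.\<close>

lemma path_mor_naturality:
  assumes f: "f \<in> hom GV X Y" and x: "x \<in> walks X a b"
  shows "f o[GV] path_mor \<nu> V X x =
    path_mor \<nu> V Y (map (gfun f) x) o[GV]
  seq_mor \<nu> V (path_seq X x) (seq (path_seq Y (map (gfun f) x))) \<nu> (path_map f x)"
proof -
  interpret GV: category GV by (rule category_graph_cat) (rule category_axioms)
  note pX = path_mor_hom[OF gmor_hom(1)[OF f] x] and fx = path_map_hom[OF f x]
  note pY = path_mor_hom[OF gmor_hom(2)[OF f] fx(1)] and m = seq_mor_canon(1)[OF fx(2)]
  have ne: "x \<noteq> []" using x by (simp add: paths_def)
  have lt: "i < length x" if "i \<le> length x - 1" for i using that ne by (cases x) auto
  show ?thesis
  proof (rule seq_hom_eqI[OF GV.Cmp_hom[OF pX f] GV.Cmp_hom[OF m pY]])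
    show "gfun (f o[GV] path_mor \<nu> V X x) (\<nu> i) = gfun (path_mor \<nu> V Y (map (gfun f) x) o[GV]
      seq_mor \<nu> V (path_seq X x) (seq (path_seq Y (map (gfun f) x))) \<nu> (path_map f x)) (\<nu> i)"
      if "i \<le> length (path_seq X x)" for i
      using that lt[of i] path_mor_simps(1)[OF x, of i] path_mor_simps(1)[OF fx(1), of i]
      by (simp add: graph_cmp(1)[OF pX] graph_cmp(1)[OF m])
    fix i assume "i < length (path_seq X x)"
    then have i: "Suc i < length x" by simp
    have xi: "x ! i \<in> gobj X" "x ! Suc i \<in> gobj X" using paths_nth[OF x] i by auto
    note fi = gmor_hom(7)[OF f xi]
    show "gmap (f o[GV] path_mor \<nu> V X x) (\<nu> i) (\<nu> (Suc i)) = gmap (path_mor \<nu> V Y (map (gfun f) x) o[GV]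
      seq_mor \<nu> V (path_seq X x) (seq (path_seq Y (map (gfun f) x))) \<nu> (path_map f x)) (\<nu> i) (\<nu> (Suc i))"
      using i path_mor_simps(1)[OF x] path_mor_simps(2)[OF x i] path_mor_simps(2)[OF fx(1), of i] fi
      by (simp add: graph_cmp(2)[OF pX] graph_cmp(2)[OF m] nth_path_map hom_iff)
  qed
qed

end

locale path_like_monad = gcat small \<nu> V
  for small :: "'u set \<Rightarrow> bool" and \<nu> :: "nat \<Rightarrow> 'u" and V :: "('o, 'a) cat" +
  fixes T :: "('u, 'o, 'a) gmonad"
  assumes monad: "monad_over_Set small V T"
    and distributive: "preserves_coproducts_in_each_variable small V V (bar_fun \<nu> V (mnd_fun T))"
    and path_like: "path_like small \<nu> V V (mnd_fun T)"
begin

sublocale is_monad GV T using monad by (simp add: monad_over_Set_def)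
sublocale N: nat_trans GV GV "fid GV" "mnd_fun T" "mnd_unit T" by (rule unit_natural)
sublocale N': nat_trans GV GV "fcomp GV (mnd_fun T) (mnd_fun T)" "mnd_fun T" "mnd_mult T" by (rule mult_natural)
sublocale TF: is_functor GV GV "mnd_fun T" by (rule N.target_functor)
sublocale GV: category GV by (rule TF.source_category)

abbreviation TO :: "('u, 'o) graph \<Rightarrow> ('u, 'o) graph" where "TO \<equiv> fob (mnd_fun T)"
abbreviation TA :: "('u, 'o, 'a) gmor \<Rightarrow> ('u, 'o, 'a) gmor" where "TA \<equiv> far (mnd_fun T)"

text \<open>The maps which path-likeness requires to form a coproduct cocone; they become the
  comparison t for T and its own multitensor.\<close>

definition inc :: "('u, 'o) graph \<Rightarrow> 'u list \<Rightarrow> 'a" where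
  "inc X x = gmap (TA (path_mor \<nu> V X x)) (\<nu> 0) (\<nu> (length x - 1))"

lemma T_graph [simp]: "graph X \<Longrightarrow> graph (TO X)"
  and gobj_T [simp]: "graph X \<Longrightarrow> gobj (TO X) = gobj X"
  using TF.fob_Obj[of X] monad by (auto simp: gcat_simps monad_over_Set_def functor_over_Set_def)

lemma T_mor: "f \<in> hom GV X Y \<Longrightarrow> TA f \<in> hom GV (TO X) (TO Y)"
  and gfun_T: "f \<in> hom GV X Y \<Longrightarrow> gfun (TA f) = gfun f"
  using TF.far_hom[of f X Y] monad by (auto simp: monad_over_Set_def functor_over_Set_def hom_iff)

lemma T_map: "\<lbrakk>f \<in> hom GV X Y; a \<in> gobj X; b \<in> gobj X\<rbrakk> \<Longrightarrow>
    gmap (TA f) a b \<in> hom V (ghom (TO X) a b) (ghom (TO Y) (gfun f a) (gfun f b))"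
  using gmor_hom(7)[OF T_mor] gmor_hom(1) gfun_T by fastforce

lemma T_cmp:
  assumes f: "f \<in> hom GV X Y" and g: "g \<in> hom GV Y Z" and a: "a \<in> gobj X" "b \<in> gobj X"
  shows "gmap (TA (g o[GV] f)) a b = gmap (TA g) (gfun f a) (gfun f b) o[V] gmap (TA f) a b"
  using graph_cmp(2)[OF T_mor[OF f], of a b "TA g"] a gmor_hom(1)[OF f]
  by (simp add: TF.far_Cmp[OF f g] gfun_T[OF f])

lemma bar_ob: "Z \<in> seqs V \<Longrightarrow> fob (bar_fun \<nu> V (mnd_fun T)) Z = ghom (TO (seq Z)) (\<nu> 0) (\<nu> (length Z))"
  by (simp add: bar_fun_def)

lemma bar_ar: "f \<in> hom (seq_cat V) Z Z' \<Longrightarrow>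
    far (bar_fun \<nu> V (mnd_fun T)) f = gmap (TA (seq_mor \<nu> V Z (seq Z') \<nu> f)) (\<nu> 0) (\<nu> (length Z))"
  by (auto simp: bar_fun_def hom_iff)

lemma bar_list_functor: "list_functor V (bar_fun \<nu> V (mnd_fun T))"
proof
  interpret S: category "seq_cat V" by (rule category_seq_cat) (rule category_axioms)
  let ?B = "bar_fun \<nu> V (mnd_fun T)"
  have ends: "\<nu> 0 \<in> gobj (seq Z)" "\<nu> (length Z) \<in> gobj (seq Z)" for Z by auto
  show "fob ?B Z \<in> Obj V" if Z: "Z \<in> seqs V" for Z
    using is_graph_hom[OF T_graph[OF seq_graph[OF Z]]] seq_graph[OF Z] by (simp add: bar_ob[OF Z])
  show "far ?B f \<in> hom V (fob ?B A) (fob ?B B)" if f: "f \<in> hom (seq_cat V) A B" for f A B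
  proof -
    have "A \<in> seqs V" "B \<in> seqs V" using S.hom_Obj[OF f] by simp_all
    moreover have "length A = length B" using f by (simp add: hom_seq_cat)
    ultimately show ?thesis using T_map[OF seq_mor_canon(1)[OF f] ends] by (simp add: bar_ar[OF f] bar_ob)
  qed
  show "far ?B (map (Idt V) Z) = Idt V (fob ?B Z)" if Z: "Z \<in> seqs V" for Z
  proof -
    have i: "map (Idt V) Z \<in> hom (seq_cat V) Z Z" using S.Idt_hom[of Z] Z by simp
    have X: "seq Z \<in> Obj GV" "graph (seq Z)" using seq_graph[OF Z] by (simp_all add: gcat_simps)
    show ?thesis
      unfolding bar_ar[OF i] seq_mor_Idt[OF Z] TF.far_Idt[OF X(1)] bar_ob[OF Z]
      using X(2) by (intro graph_Idt(2)) auto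
  qed
  show "far ?B (map2 (Cmp V) g f) = far ?B g o[V] far ?B f"
    if f: "f \<in> hom (seq_cat V) A B" and g: "g \<in> hom (seq_cat V) B D" for f g A B D
  proof -
    have gf: "map2 (Cmp V) g f \<in> hom (seq_cat V) A D" using S.Cmp_hom[OF f g] by simp
    have "length A = length B" using f by (simp add: hom_seq_cat)
    then show ?thesis
      unfolding bar_ar[OF gf] bar_ar[OF f] bar_ar[OF g] seq_mor_cmp[OF f g]
        T_cmp[OF seq_mor_canon(1)[OF f] seq_mor_canon(1)[OF g] ends] by simp
  qed
qed

abbreviation B :: "('o, 'a) multitensor" where "B \<equiv> bar_multitensor \<nu> V T"

lemma B_simps [simp]: "mt_fun B = bar_fun \<nu> V (mnd_fun T)" "mt_unit B = bar_unit \<nu> V T" "mt_sub B = bar_sub \<nu> V T"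
  by (simp_all add: bar_multitensor_def)

sublocale list_functor V "mt_fun B" using bar_list_functor by simp

lemma B_path_seq: "\<lbrakk>graph X; x \<in> walks X a b\<rbrakk> \<Longrightarrow>
    mt_ob B (path_seq X x) = ghom (TO (seq (path_seq X x))) (\<nu> 0) (\<nu> (length x - 1))"
  using path_seq_Obj[of small V X x a b] by (simp add: bar_ob)

lemma inc_coproduct: "\<lbrakk>graph X; a \<in> gobj X; b \<in> gobj X\<rbrakk> \<Longrightarrow>
    is_coproduct V (walks X a b) (\<lambda>x. mt_ob B (path_seq X x)) (ghom (TO X) a b) (inc X)"
  using path_like[unfolded path_like_def, rule_format, of X a b]
  by (rule coproduct_cong) (simp_all add: gcat_simps B_path_seq inc_def del: B_simps)

lemma path_mor_ends:
  assumes "x \<in> walks X a b"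
  shows "gfun (path_mor \<nu> V X x) (\<nu> 0) = a" "gfun (path_mor \<nu> V X x) (\<nu> (length x - 1)) = b"
proof -
  have "x \<noteq> []" using assms by (simp add: paths_def)
  then show "gfun (path_mor \<nu> V X x) (\<nu> 0) = a" "gfun (path_mor \<nu> V X x) (\<nu> (length x - 1)) = b"
    using path_mor_simps(1)[OF assms] assms by (auto simp: paths_iff)
qed

lemma inc_naturality:
  assumes f: "f \<in> hom GV X Y" and x: "x \<in> walks X a b"
  shows "gmap (TA f) a b o[V] inc X x = inc Y (map (gfun f) x) o[V] mt_ar B (path_map f x)"
proof -
  note pX = path_mor_hom[OF gmor_hom(1)[OF f] x] and fx = path_map_hom[OF f x]
  note pY = path_mor_hom[OF gmor_hom(2)[OF f] fx(1)] and m = seq_mor_canon(1)[OF fx(2)]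
  have ends: "\<nu> 0 \<in> gobj (seq (path_seq X x))" "\<nu> (length x - 1) \<in> gobj (seq (path_seq X x))" by auto
  have "gmap (TA f) a b o[V] inc X x = gmap (TA (f o[GV] path_mor \<nu> V X x)) (\<nu> 0) (\<nu> (length x - 1))"
    unfolding T_cmp[OF pX f ends] path_mor_ends[OF x] inc_def ..
  also have "\<dots> = inc Y (map (gfun f) x) o[V] mt_ar B (path_map f x)"
    unfolding path_mor_naturality[OF f x] T_cmp[OF m pY ends] by (simp add: inc_def bar_ar[OF fx(2)])
  finally show ?thesis .
qed

lemma bar_functor_comparison: "functor_comparison small \<nu> V B T inc"
proof (rule functor_comparison.intro[OF gcat_axioms list_functor_axioms], rule functor_comparison_axioms.intro)
  show "functor_over_Set small V (mnd_fun T)" using monad by (simp add: monad_over_Set_def)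
  show "preserves_coproducts_in_each_variable small V V (mt_fun B)" using distributive by simp
qed (fact TF.is_functor_axioms inc_coproduct inc_naturality)+

sublocale C: functor_comparison small \<nu> V B T inc by (rule bar_functor_comparison)

lemma \<eta>_hom: "graph X \<Longrightarrow> mnd_unit T X \<in> hom GV X (TO X)"
  and \<eta>_nat: "f \<in> hom GV X Y \<Longrightarrow> mnd_unit T Y o[GV] f = TA f o[GV] mnd_unit T X"
  and \<eta>_fun: "graph X \<Longrightarrow> gfun (mnd_unit T X) = (\<lambda>a\<in>gobj X. a)"
  using N.component_hom[of X] N.naturality[of f X Y] monad
  by (simp_all add: gcat_simps hom_iff monad_over_Set_def nat_over_Set_def)

lemma \<mu>_hom: "graph X \<Longrightarrow> mnd_mult T X \<in> hom GV (TO (TO X)) (TO X)"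
  and \<mu>_nat: "f \<in> hom GV X Y \<Longrightarrow> mnd_mult T Y o[GV] TA (TA f) = TA f o[GV] mnd_mult T X"
  and \<mu>_fun: "graph X \<Longrightarrow> gfun (mnd_mult T X) = (\<lambda>a\<in>gobj X. a)"
  using N'.component_hom[of X] N'.naturality[of f X Y] monad
  by (simp_all add: gcat_simps hom_iff monad_over_Set_def nat_over_Set_def)

lemma bar_unit_hom:
  assumes "Z \<in> Obj V" shows "bar_unit \<nu> V T Z \<in> hom V Z (mt_ob B [Z])"
proof -
  have Z: "[Z] \<in> seqs V" using assms by simp
  have "gmap (mnd_unit T (seq [Z])) (\<nu> 0) (\<nu> 1) \<in> hom V (ghom (seq [Z]) (\<nu> 0) (\<nu> 1)) (ghom (TO (seq [Z])) (\<nu> 0) (\<nu> 1))"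
    using gmor_hom(7)[OF \<eta>_hom[OF seq_graph[OF Z]], of "\<nu> 0" "\<nu> 1"] by (simp add: \<eta>_fun[OF seq_graph[OF Z]])
  moreover have "ghom (seq [Z]) (\<nu> 0) (\<nu> 1) = Z" using ghom_seq(1)[of 0 "[Z]"] by simp
  ultimately show ?thesis using assms Z by (simp add: bar_unit_def bar_ob)
qed

text \<open>The edge from a to b is itself a morphism from the graph of a sequence of length one to
  X, and the claim is naturality of \<eta> at this morphism.\<close>

lemma \<eta>_inc:
  assumes X: "graph X" and a: "a \<in> gobj X" and b: "b \<in> gobj X"
  shows "gmap (mnd_unit T X) a b = inc X [a, b] o[V] bar_unit \<nu> V T (ghom X a b)"
proof -
  have x: "[a, b] \<in> walks X a b" by (rule paths_pair[OF a b])
  note p = path_mor_hom[OF X x]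
  have ps: "path_seq X [a, b] = [ghom X a b]" by (simp add: path_seq_def)
  note Z = is_graph_hom[OF X a b]
  have S: "graph (seq [ghom X a b])" using Z by (intro seq_graph) simp
  have \<nu>: "\<nu> 0 \<in> gobj (seq [ghom X a b])" "\<nu> 1 \<in> gobj (seq [ghom X a b])" by auto
  have pm: "gfun (path_mor \<nu> V X [a, b]) (\<nu> 0) = a" "gfun (path_mor \<nu> V X [a, b]) (\<nu> 1) = b"
    "gmap (path_mor \<nu> V X [a, b]) (\<nu> 0) (\<nu> 1) = Idt V (ghom X a b)"
    using path_mor_ends[OF x] path_mor_simps(2)[OF x, of 0] by simp_all
  have e: "gmap (mnd_unit T X) a b \<in> hom V (ghom X a b) (ghom (TO X) a b)"
    using gmor_hom(7)[OF \<eta>_hom[OF X] a b] a b by (simp add: \<eta>_fun[OF X])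
  have "gmap (mnd_unit T X) a b = gmap (mnd_unit T X o[GV] path_mor \<nu> V X [a, b]) (\<nu> 0) (\<nu> 1)"
    using graph_cmp(2)[OF p[unfolded ps] \<nu>, of "mnd_unit T X"] e by (simp add: pm pm[simplified] hom_iff)
  also have "\<dots> = gmap (TA (path_mor \<nu> V X [a, b])) (\<nu> 0) (\<nu> 1) o[V] gmap (mnd_unit T (seq [ghom X a b])) (\<nu> 0) (\<nu> 1)"
    unfolding \<eta>_nat[OF p] ps using graph_cmp(2)[OF \<eta>_hom[OF S] \<nu>] \<nu> by (simp add: \<eta>_fun[OF S])
  also have "\<dots> = inc X [a, b] o[V] bar_unit \<nu> V T (ghom X a b)"
    using Z by (simp add: inc_def bar_unit_def)
  finally show ?thesis .
qed

section \<open>The substitution induced by a monad on graphs, compared with its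
  multiplication\<close>

lemma subseq_mor_hom:
  assumes "xs @ ys @ zs \<in> seqs V"
  shows "subseq_mor \<nu> V xs ys zs \<in> hom GV (seq ys) (seq (xs @ ys @ zs))"
  unfolding subseq_mor_def
proof (rule seq_mor_hom[OF _ seq_graph[OF assms]])
  show "map (Idt V) ys ! i \<in> hom V (ys ! i) (ghom (seq (xs @ ys @ zs)) (\<nu> (length xs + i)) (\<nu> (length xs + Suc i)))"
    if "i < length ys" for i
  proof -
    have "ys ! i \<in> Obj V" using assms that by (auto simp: in_lists_conv_set)
    then show ?thesis
      using that ghom_seq(1)[of "length xs + i" "xs @ ys @ zs"] by (auto simp: nth_append intro: Idt_hom)
  qed
qed (use assms in auto)

lemma concat_take_drop:
  assumes "i < length Zss"
  shows "concat (take i Zss) @ Zss ! i @ concat (drop (Suc i) Zss) = concat Zss"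
    and "length (concat (take (Suc i) Zss)) = length (concat (take i Zss)) + length (Zss ! i)"
proof -
  show "concat (take i Zss) @ Zss ! i @ concat (drop (Suc i) Zss) = concat Zss"
    using arg_cong[OF id_take_nth_drop[OF assms], of concat] by simp
  show "length (concat (take (Suc i) Zss)) = length (concat (take i Zss)) + length (Zss ! i)"
    using assms by (simp add: take_Suc_conv_app_nth)
qed

text \<open>The hom maps fit together because the inclusion of the i-th block starts at the i-th
  offset and ends at the next one.\<close>

lemma bar_tau:
  assumes Zss: "Zss \<in> lists (seqs V)"
  defines "off \<equiv> \<lambda>i. length (concat (take i Zss))"
    and "sub \<equiv> \<lambda>i. subseq_mor \<nu> V (concat (take i Zss)) (Zss ! i) (concat (drop (Suc i) Zss))"
  shows "bar_tau \<nu> V T Zss \<in> hom GV (seq (map (mt_ob B) Zss)) (TO (seq (concat Zss)))"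
    and "i \<le> length Zss \<Longrightarrow> gfun (bar_tau \<nu> V T Zss) (\<nu> i) = \<nu> (off i)"
    and "i < length Zss \<Longrightarrow> gmap (bar_tau \<nu> V T Zss) (\<nu> i) (\<nu> (Suc i)) = gmap (TA (sub i)) (\<nu> 0) (\<nu> (length (Zss ! i)))"
    and "i < length Zss \<Longrightarrow> sub i \<in> hom GV (seq (Zss ! i)) (seq (concat Zss))"
proof -
  let ?h = "map (\<lambda>i. gmap (TA (sub i)) (\<nu> 0) (\<nu> (length (Zss ! i)))) [0..<length Zss]"
  have tau: "bar_tau \<nu> V T Zss = seq_mor \<nu> V (map (mt_ob B) Zss) (TO (seq (concat Zss))) (\<lambda>i. \<nu> (off i)) ?h"
    by (simp add: bar_tau_def Let_def off_def sub_def)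
  have cZ: "concat Zss \<in> seqs V" by (rule concat_lists[OF Zss])
  note X = seq_graph[OF cZ]
  have Zi: "Zss ! i \<in> seqs V" if "i < length Zss" for i using Zss that unfolding in_lists_nth[of Zss] by blast
  show sub: "sub i \<in> hom GV (seq (Zss ! i)) (seq (concat Zss))" if "i < length Zss" for i
    unfolding sub_def using subseq_mor_hom[of "concat (take i Zss)" "Zss ! i" "concat (drop (Suc i) Zss)"] cZ
    by (simp only: concat_take_drop(1)[OF that])
  have off: "off i \<le> length (concat Zss)" for i
  proof -
    have "length (concat Zss) = length (concat (take i Zss @ drop i Zss))" by simp
    then show ?thesis unfolding off_def concat_append by simp
  qed
  show "bar_tau \<nu> V T Zss \<in> hom GV (seq (map (mt_ob B) Zss)) (TO (seq (concat Zss)))"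
    unfolding tau
  proof (rule seq_mor_hom[OF map_lists[OF Zss E_ob] T_graph[OF X]])
    show "\<nu> (off i) \<in> gobj (TO (seq (concat Zss)))" for i using X off by simp
    fix i assume "i < length (map (mt_ob B) Zss)"
    then have i: "i < length Zss" by simp
    have "gfun (sub i) (\<nu> 0) = \<nu> (off i)" "gfun (sub i) (\<nu> (length (Zss ! i))) = \<nu> (off (Suc i))"
      by (simp_all add: sub_def subseq_mor_def off_def concat_take_drop(2)[OF i])
    then show "?h ! i \<in> hom V (map (mt_ob B) Zss ! i) (ghom (TO (seq (concat Zss))) (\<nu> (off i)) (\<nu> (off (Suc i))))"
      using T_map[OF sub[OF i], of "\<nu> 0" "\<nu> (length (Zss ! i))"] i Zi[OF i] by (simp add: bar_ob)
  qed
  show "i \<le> length Zss \<Longrightarrow> gfun (bar_tau \<nu> V T Zss) (\<nu> i) = \<nu> (off i)"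
    unfolding tau by simp
  show "i < length Zss \<Longrightarrow> gmap (bar_tau \<nu> V T Zss) (\<nu> i) (\<nu> (Suc i)) = gmap (TA (sub i)) (\<nu> 0) (\<nu> (length (Zss ! i)))"
    unfolding tau by simp
qed

lemma bar_sub_hom:
  assumes Zss: "Zss \<in> lists (seqs V)"
  shows "bar_sub \<nu> V T Zss \<in> hom V (mt_ob B (map (mt_ob B) Zss)) (mt_ob B (concat Zss))"
proof -
  note tau = bar_tau[OF Zss]
  have cZ: "concat Zss \<in> seqs V" by (rule concat_lists[OF Zss])
  note X = seq_graph[OF cZ]
  have mZ: "map (mt_ob B) Zss \<in> seqs V" by (rule map_lists[OF Zss E_ob])
  let ?n = "length (concat Zss)"
  have "gmap (TA (bar_tau \<nu> V T Zss)) (\<nu> 0) (\<nu> (length Zss)) \<in>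
    hom V (ghom (TO (seq (map (mt_ob B) Zss))) (\<nu> 0) (\<nu> (length Zss))) (ghom (TO (TO (seq (concat Zss)))) (\<nu> 0) (\<nu> ?n))"
    using T_map[OF tau(1), of "\<nu> 0" "\<nu> (length Zss)"] tau(2)[of 0] tau(2)[of "length Zss"] by simp
  moreover have "gmap (mnd_mult T (seq (concat Zss))) (\<nu> 0) (\<nu> ?n) \<in> hom V (ghom (TO (TO (seq (concat Zss)))) (\<nu> 0) (\<nu> ?n)) (ghom (TO (seq (concat Zss))) (\<nu> 0) (\<nu> ?n))"
    using gmor_hom(7)[OF \<mu>_hom[OF X], of "\<nu> 0" "\<nu> ?n"] X by (simp add: \<mu>_fun[OF X])
  ultimately have "bar_sub \<nu> V T Zss \<in> hom V (ghom (TO (seq (map (mt_ob B) Zss))) (\<nu> 0) (\<nu> (length Zss))) (ghom (TO (seq (concat Zss))) (\<nu> 0) (\<nu> ?n))"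
    using Cmp_hom Zss by (simp add: bar_sub_def)
  then show ?thesis using bar_ob[OF mZ] bar_ob[OF cZ] by simp
qed

text \<open>\<open>bar_tau\<close> is the universal refinement, living in the graph of the
  concatenated sequence; the path morphism of the glued path carries it to the given refinement.
  Both sides are morphisms out of the graph of a sequence and are compared by
  \<open>seq_hom_eqI\<close>.\<close>

lemma path_mor_bar_tau:
  assumes X: "graph X" and y: "y \<in> walks X a b" and xs: "xs \<in> refined X y"
  shows "TA (path_mor \<nu> V X (path_concat a xs)) o[GV] bar_tau \<nu> V T (map (path_seq X) xs) =
    path_mor \<nu> V (TO X) y o[GV]
  seq_mor \<nu> V (map (mt_ob B) (map (path_seq X) xs)) (seq (path_seq (TO X) y)) \<nu> (map (inc X) xs)"
proof -
  let ?x = "path_concat a xs" and ?Zss = "map (path_seq X) xs"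
  let ?p = "path_mor \<nu> V X ?x" and ?BZ = "map (mt_ob B) ?Zss"
  let ?L = "path_mor \<nu> V (TO X) y o[GV] seq_mor \<nu> V ?BZ (seq (path_seq (TO X) y)) \<nu> (map (inc X) xs)"
  let ?off = "\<lambda>i. length (concat (take i ?Zss))"
    and ?sub = "\<lambda>i. subseq_mor \<nu> V (concat (take i ?Zss)) (?Zss ! i) (concat (drop (Suc i) ?Zss))"
  have Zss: "?Zss \<in> lists (seqs V)" by (rule path_seq_Obj_refinement[OF X xs])
  have x: "?x \<in> walks X a b" using path_concat_props[OF y xs] by simp
  have ps: "path_seq X ?x = concat ?Zss" by (rule path_seq_concat[OF y xs])
  note tau = bar_tau[OF Zss]
  have lxs: "length xs = length y - 1" using xs by (simp add: refinements_nth)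
  have yne: "y \<noteq> []" using y by (simp add: paths_def)
  have xi: "xs ! i \<in> walks X (y ! i) (y ! Suc i)" if "i < length xs" for i
    using xs that by (simp add: refinements_nth)
  have px: "path_mor \<nu> V X ?x \<in> hom GV (seq (concat ?Zss)) X" using path_mor_hom[OF X x] by (simp add: ps)
  have y': "y \<in> walks (TO X) a b" using y X by simp
  note py = path_mor_hom[OF T_graph[OF X] y']
  have inc: "map (inc X) xs \<in> hom (seq_cat V) ?BZ (path_seq (TO X) y)"
    using lxs C.t_hom[OF X xi] by (simp add: hom_seq_cat nth_path_seq del: B_simps)
  note m = seq_mor_canon(1)[OF inc]
  \<comment> \<open>Offsets in \<open>bar_tau\<close> are lengths of sequences of homs, those in
    \<open>path_concat_nth\<close> are lengths of paths without their first vertex; both count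
    edges.\<close>
  have off: "?off i = length (concat (map tl (take i xs)))" for i
  proof -
    have "length (concat (map (path_seq X) ws)) = length (concat (map tl ws))" for ws :: "'u list list"
      by (induction ws) auto
    then show ?thesis by (simp add: take_map)
  qed
  have xoff: "?x ! (?off i + j) = xs ! i ! j" "?off i + j < length ?x" if "i < length xs" "j < length (xs ! i)" for i j
    using path_concat_nth[OF y xs that] unfolding off by auto
  have gfun_x: "gfun ?p (\<nu> (?off i + j)) = xs ! i ! j" if "i < length xs" "j < length (xs ! i)" for i j
    using path_mor_simps(1)[OF x xoff(2)[OF that]] xoff(1)[OF that] by simp
  \<comment> \<open>Restricted to its i-th block, the morphism of the glued path is the morphism of
    the i-th piece.\<close>
  have sub: "path_mor \<nu> V X ?x o[GV] ?sub i = path_mor \<nu> V X (xs ! i)" if i: "i < length xs" for i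
  proof -
    have si: "?sub i \<in> hom GV (seq (path_seq X (xs ! i))) (seq (concat ?Zss))" using tau(4)[of i] i by simp
    have ne: "xs ! i \<noteq> []" using xi[OF i] by (simp add: paths_def)
    have lt: "j < length (xs ! i)" if "j \<le> length (xs ! i) - 1" for j using that ne by (cases "xs ! i") auto
    have sf: "gfun (?sub i) (\<nu> j) = \<nu> (?off i + j)" if "j \<le> length (xs ! i) - 1" for j
      using that i by (simp add: subseq_mor_def)
    show ?thesis
    proof (rule seq_hom_eqI[OF GV.Cmp_hom[OF si px] path_mor_hom[OF X xi[OF i]]])
      show "gfun (path_mor \<nu> V X ?x o[GV] ?sub i) (\<nu> j) = gfun (path_mor \<nu> V X (xs ! i)) (\<nu> j)"
        if "j \<le> length (path_seq X (xs ! i))" for j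
        using that gfun_x[OF i lt] path_mor_simps(1)[OF xi[OF i] lt] sf
        by (simp add: graph_cmp(1)[OF si])
      fix j assume "j < length (path_seq X (xs ! i))"
      then have j: "Suc j < length (xs ! i)" by simp
      have xij: "xs ! i ! j \<in> gobj X" "xs ! i ! Suc j \<in> gobj X" using paths_nth[OF xi[OF i]] j by auto
      have "gmap ?p (\<nu> (?off i + j)) (\<nu> (Suc (?off i + j))) = Idt V (ghom X (xs ! i ! j) (xs ! i ! Suc j))"
        using path_mor_simps(2)[OF x, of "?off i + j"] xoff[OF i, of j] xoff[OF i, of "Suc j"] j by simp
      moreover have "gmap (?sub i) (\<nu> j) (\<nu> (Suc j)) = Idt V (ghom X (xs ! i ! j) (xs ! i ! Suc j))"
        using i j by (simp add: subseq_mor_def nth_path_seq)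
      ultimately show "gmap (path_mor \<nu> V X ?x o[GV] ?sub i) (\<nu> j) (\<nu> (Suc j)) = gmap (path_mor \<nu> V X (xs ! i)) (\<nu> j) (\<nu> (Suc j))"
        using j sf[of j] sf[of "Suc j"] path_mor_simps(2)[OF xi[OF i] j] is_graph_hom[OF X xij]
        by (simp add: graph_cmp(2)[OF si])
    qed
  qed
  \<comment> \<open>At \<open>i = length xs\<close> no further piece begins, so the vertex is found
    as the end of the whole path.\<close>
  have offy: "gfun ?p (\<nu> (?off i)) = y ! i" if "i \<le> length xs" for i
  proof (cases "i < length xs")
    case True
    then have "0 < length (xs ! i)" "xs ! i ! 0 = y ! i" using xi[OF True] by (auto simp: paths_iff)
    then show ?thesis using gfun_x[OF True, of 0] by simp
  next
    case False
    then have i: "i = length xs" using that by simp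
    have "length ?x - 1 = length (concat ?Zss)" using arg_cong[OF ps, of length] by simp
    then have "?off i = length ?x - 1" using i by simp
    then show ?thesis using path_mor_ends(2)[OF x] i lxs y by (simp add: paths_iff)
  qed
  note Tpx = T_mor[OF px]
  show ?thesis
  proof (rule seq_hom_eqI[OF GV.Cmp_hom[OF tau(1) Tpx] GV.Cmp_hom[OF m py]])
    show "gfun (TA ?p o[GV] bar_tau \<nu> V T ?Zss) (\<nu> i) =
      gfun ?L (\<nu> i)"
      if "i \<le> length ?BZ" for i
    proof -
      have i: "i \<le> length xs" using that by simp
      then have "i < length y" using lxs yne by (cases y) auto
      then show ?thesis
        using i offy[OF i] tau(2)[of i] path_mor_simps(1)[OF y', of i]
        by (simp add: graph_cmp(1)[OF tau(1)] graph_cmp(1)[OF m] gfun_T[OF px] del: map_map B_simps)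
    qed
    fix i assume "i < length ?BZ"
    then have i: "i < length xs" by simp
    then have iy: "Suc i < length y" using lxs by simp
    have si: "?sub i \<in> hom GV (seq (path_seq X (xs ! i))) (seq (concat ?Zss))" using tau(4)[of i] i by simp
    have sf: "gfun (?sub i) (\<nu> 0) = \<nu> (?off i)" "gfun (?sub i) (\<nu> (length (xs ! i) - 1)) = \<nu> (?off (Suc i))"
      using i concat_take_drop(2)[of i ?Zss] by (simp_all add: subseq_mor_def)
    have "gmap (TA ?p o[GV] bar_tau \<nu> V T ?Zss) (\<nu> i) (\<nu> (Suc i)) =
      gmap (TA ?p) (\<nu> (?off i)) (\<nu> (?off (Suc i))) o[V] gmap (TA (?sub i)) (\<nu> 0) (\<nu> (length (xs ! i) - 1))"
      using i tau(2)[of i] tau(2)[of "Suc i"] tau(3)[of i] by (simp add: graph_cmp(2)[OF tau(1)])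
    also have "\<dots> = gmap (TA (path_mor \<nu> V X ?x o[GV] ?sub i)) (\<nu> 0) (\<nu> (length (xs ! i) - 1))"
      using T_cmp[OF si px, of "\<nu> 0" "\<nu> (length (xs ! i) - 1)"] by (simp add: sf[simplified])
    also have "\<dots> = inc X (xs ! i)" unfolding sub[OF i] inc_def ..
    also have "\<dots> = gmap ?L (\<nu> i) (\<nu> (Suc i))"
      using i lxs C.t_hom[OF X xi[OF i]] path_mor_simps(2)[OF y' iy]
      by (simp add: graph_cmp(2)[OF m] hom_iff del: map_map B_simps)
    finally show "gmap (TA ?p o[GV] bar_tau \<nu> V T ?Zss) (\<nu> i) (\<nu> (Suc i)) =
      gmap ?L (\<nu> i) (\<nu> (Suc i))" .
  qed
qed

text \<open>Naturality of \<mu> at the morphism of the glued path reduces the claim to the graph of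
  the concatenated sequence, where \<open>bar_sub\<close> is defined;
  \<open>path_mor_bar_tau\<close> identifies what comes before the multiplication.\<close>

lemma \<mu>_inc:
  assumes X: "graph X" and y: "y \<in> walks X a b" and xs: "xs \<in> refined X y"
  shows "gmap (mnd_mult T X) a b o[V] (inc (TO X) y o[V] mt_ar B (map (inc X) xs)) =
    inc X (path_concat a xs) o[V] bar_sub \<nu> V T (map (path_seq X) xs)"
proof -
  let ?x = "path_concat a xs" and ?Zss = "map (path_seq X) xs"
  let ?k = "length xs" and ?n = "length ?x - 1"
  let ?S = "seq (concat ?Zss)"
  let ?p = "path_mor \<nu> V X ?x"
  let ?r = "bar_tau \<nu> V T ?Zss"
  let ?T3 = "gmap (TA ?r) (\<nu> 0) (\<nu> ?k)"
  let ?T2 = "gmap (TA (TA ?p)) (\<nu> 0) (\<nu> ?n)"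
  let ?T1 = "gmap (TA ?p) (\<nu> 0) (\<nu> ?n)"
  let ?mS = "gmap (mnd_mult T ?S) (\<nu> 0) (\<nu> ?n)"
  have Zss: "?Zss \<in> lists (seqs V)" by (rule path_seq_Obj_refinement[OF X xs])
  have x: "?x \<in> walks X a b" using path_concat_props[OF y xs] by simp
  have ps: "path_seq X ?x = concat ?Zss" by (rule path_seq_concat[OF y xs])
  have n: "length (concat ?Zss) = ?n" using arg_cong[OF ps, of length] by simp
  note tau = bar_tau[OF Zss]
  have lxs: "?k = length y - 1" using xs by (simp add: refinements_nth)
  have ab: "a \<in> gobj X" "b \<in> gobj X" using paths_ends[OF y] by simp_all
  have px: "path_mor \<nu> V X ?x \<in> hom GV ?S X" using path_mor_hom[OF X x] by (simp add: ps)
  have y': "y \<in> walks (TO X) a b" using y X by simp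
  note py = path_mor_hom[OF T_graph[OF X] y']
  have inc: "map (inc X) xs \<in> hom (seq_cat V) (map (mt_ob B) ?Zss) (path_seq (TO X) y)"
    using lxs C.t_hom[OF X] xs by (auto simp add: hom_seq_cat nth_path_seq refinements_nth simp del: B_simps)
  note m = seq_mor_canon(1)[OF inc]
  have S: "graph ?S" using px by (rule gmor_hom)
  have \<nu>0: "\<nu> 0 \<in> gobj (seq (map (mt_ob B) ?Zss))" "\<nu> ?k \<in> gobj (seq (map (mt_ob B) ?Zss))" by auto
  have \<nu>n: "\<nu> 0 \<in> gobj ?S" "\<nu> ?n \<in> gobj ?S" using n by auto
  have tau_ends: "gfun ?r (\<nu> 0) = \<nu> 0" "gfun ?r (\<nu> ?k) = \<nu> ?n"
    using tau(2)[of 0] tau(2)[of ?k] n by simp_all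
  have mx: "gmap (mnd_mult T X) a b \<in> hom V (ghom (TO (TO X)) a b) (ghom (TO X) a b)"
    using gmor_hom(7)[OF \<mu>_hom[OF X], of a b] ab X by (simp add: \<mu>_fun[OF X])
  have ms: "?mS \<in> hom V (ghom (TO (TO ?S)) (\<nu> 0) (\<nu> ?n)) (ghom (TO ?S) (\<nu> 0) (\<nu> ?n))"
    using gmor_hom(7)[OF \<mu>_hom[OF S], of "\<nu> 0" "\<nu> ?n"] S \<nu>n by (simp add: \<mu>_fun[OF S])
  note Tpx = T_mor[OF px] and TTpx = T_mor[OF T_mor[OF px]]
  have t1: "?T1 \<in> hom V (ghom (TO ?S) (\<nu> 0) (\<nu> ?n)) (ghom (TO X) a b)"
    using T_map[OF px \<nu>n] path_mor_ends[OF x] by simp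
  have t2: "?T2 \<in> hom V (ghom (TO (TO ?S)) (\<nu> 0) (\<nu> ?n)) (ghom (TO (TO X)) a b)"
    using T_map[OF Tpx, of "\<nu> 0" "\<nu> ?n"] \<nu>n S path_mor_ends[OF x] by (simp add: gfun_T[OF px])
  have t3: "?T3 \<in> hom V (ghom (TO (seq (map (mt_ob B) ?Zss))) (\<nu> 0) (\<nu> ?k)) (ghom (TO (TO ?S)) (\<nu> 0) (\<nu> ?n))"
    using T_map[OF tau(1) \<nu>0] tau_ends by simp
  have A: "inc (TO X) y o[V] mt_ar B (map (inc X) xs) =
    ?T2 o[V] ?T3"
  proof -
    have "inc (TO X) y o[V] mt_ar B (map (inc X) xs) =
      gmap (TA (path_mor \<nu> V (TO X) y o[GV] seq_mor \<nu> V (map (mt_ob B) ?Zss) (seq (path_seq (TO X) y)) \<nu> (map (inc X) xs))) (\<nu> 0) (\<nu> ?k)"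
      using T_cmp[OF m py \<nu>0] by (simp add: inc_def bar_ar[OF inc, simplified] lxs)
    also have "\<dots> = gmap (TA (TA ?p o[GV] bar_tau \<nu> V T ?Zss)) (\<nu> 0) (\<nu> ?k)"
      unfolding path_mor_bar_tau[OF X y xs] ..
    also have "\<dots> = ?T2 o[V] ?T3"
      unfolding T_cmp[OF tau(1) Tpx \<nu>0] tau_ends ..
    finally show ?thesis .
  qed
  have N: "gmap (mnd_mult T X) a b o[V] ?T2 =
    ?T1 o[V] ?mS"
    using arg_cong[OF \<mu>_nat[OF px], of "\<lambda>f. gmap f (\<nu> 0) (\<nu> ?n)"] S \<nu>n path_mor_ends[OF x]
    by (simp add: graph_cmp(2)[OF TTpx] graph_cmp(2)[OF \<mu>_hom[OF S]] gfun_T[OF px] gfun_T[OF Tpx] \<mu>_fun[OF S])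
  have "gmap (mnd_mult T X) a b o[V] (inc (TO X) y o[V] mt_ar B (map (inc X) xs)) =
    (gmap (mnd_mult T X) a b o[V] ?T2) o[V] ?T3"
    unfolding A using mx t2 t3 by (simp add: hom_iff assoc)
  also have "\<dots> = inc X ?x o[V] (?mS o[V] ?T3)"
    unfolding N inc_def using t1 ms t3 by (simp add: hom_iff assoc)
  also have "?mS o[V] ?T3 = bar_sub \<nu> V T ?Zss"
    using Zss n by (simp add: bar_sub_def)
  finally show ?thesis .
qed

lemma bar_comparison: "comparison small \<nu> V B T inc"
proof (rule comparison.intro[OF bar_functor_comparison], rule comparison_axioms.intro)
  show "mt_unit B \<in> extensional (Obj V)" "mt_sub B \<in> extensional (lists (seqs V))"
    by (simp_all add: bar_unit_def bar_sub_def)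
  show "mnd_unit T \<in> extensional (Obj GV)" "mnd_mult T \<in> extensional (Obj GV)"
    by (rule N.components_extensional N'.components_extensional)+
  show "mt_unit B Z \<in> hom V Z (mt_ob B [Z])" if "Z \<in> Obj V" for Z using bar_unit_hom[OF that] by simp
  show "mt_sub B Zss \<in> hom V (mt_ob B (map (mt_ob B) Zss)) (mt_ob B (concat Zss))"
    if "Zss \<in> lists (seqs V)" for Zss using bar_sub_hom[OF that] by simp
  show "gmap (mnd_unit T X) a b = inc X [a, b] o[V] mt_unit B (ghom X a b)"
    if "graph X" "a \<in> gobj X" "b \<in> gobj X" for X a b using \<eta>_inc[OF that] by simp
  show "gmap (mnd_mult T X) a b o[V] (inc (TO X) y o[V] mt_ar B (map (inc X) xs)) =
    inc X (path_concat a xs) o[V] mt_sub B (map (path_seq X) xs)"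
    if "graph X" "y \<in> walks X a b" "xs \<in> refined X y" for X y a b xs
    using \<mu>_inc[OF that] by simp
qed (fact \<eta>_hom \<eta>_fun \<mu>_hom \<mu>_fun)+

end

text \<open>The locale constant \<open>inc\<close> of \<open>path_like_monad\<close> as a function
  of the monad, so that comparisons can be stated for all 0-cells at once.\<close>

definition bar_in :: "(nat \<Rightarrow> 'u) \<Rightarrow> ('o, 'a) cat \<Rightarrow> ('u, 'o, 'a) gmonad \<Rightarrow> ('u, 'o) graph \<Rightarrow> 'u list \<Rightarrow> 'a" where
  "bar_in \<nu> V T X x = gmap (far (mnd_fun T) (path_mor \<nu> V X x)) (\<nu> 0) (\<nu> (length x - 1))"

lemma pl_object_comparison:
  assumes "smallness small" "inj \<nu>" "(V, T) \<in> pl_objects small \<nu>"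
  shows "comparison small \<nu> V (bar_multitensor \<nu> V T) T (bar_in \<nu> V T)"
proof -
  interpret path_like_monad small \<nu> V T
    using assms by (intro path_like_monad.intro gcat.intro gcat_axioms.intro
      path_like_monad_axioms.intro) (simp_all add: pl_objects_def)
  have "inc = bar_in \<nu> V T" by (simp add: fun_eq_iff inc_def bar_in_def)
  then show ?thesis using bar_comparison by simp
qed

section \<open>Lax monoidal functors and monad functors\<close>

lemma gobj_push [simp]: "gobj (graph_push H X) = gobj X"
  and ghom_push: "\<lbrakk>a \<in> gobj X; b \<in> gobj X\<rbrakk> \<Longrightarrow> ghom (graph_push H X) a b = fob H (ghom X a b)"
  by (simp_all add: graph_push_def)

lemma path_seq_push:
  assumes "x \<in> walks X a b" shows "path_seq (graph_push H X) x = map (fob H) (path_seq X x)"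
  by (rule nth_equalityI) (simp_all add: nth_path_seq ghom_push paths_nth[OF assms])

context is_functor
begin

lemma push_graph: "is_graph small C X \<Longrightarrow> is_graph small D (graph_push F X)"
  unfolding graph_push_def by (rule is_graph_mk_graph) (auto intro: is_graph_small fob_Obj is_graph_hom)

lemma graph_fun_simps:
  assumes f: "f \<in> hom (graph_cat small C) X Y"
  shows "far (graph_fun small C F) f \<in> hom (graph_cat small D) (graph_push F X) (graph_push F Y)"
    and "gfun (far (graph_fun small C F) f) = gfun f"
    and "\<lbrakk>a \<in> gobj X; b \<in> gobj X\<rbrakk> \<Longrightarrow> gmap (far (graph_fun small C F) f) a b = far F (gmap f a b)"
proof -
  have e: "far (graph_fun small C F) f = mk_gmor (graph_push F X) (graph_push F Y) (gfun f) (\<lambda>a b. far F (gmap f a b))"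
    using f gmor_hom(3,4)[OF f] by (simp add: graph_fun_def hom_iff)
  show "far (graph_fun small C F) f \<in> hom (graph_cat small D) (graph_push F X) (graph_push F Y)"
    unfolding e using push_graph gmor_hom[OF f] far_hom by (intro mk_gmor_hom) (simp_all add: ghom_push)
  show "gfun (far (graph_fun small C F) f) = gfun f"
    using f unfolding e by (simp add: mk_gmor_def graph_hom_iff PiE_def extensional_restrict)
  show "gmap (far (graph_fun small C F) f) a b = far F (gmap f a b)" if "a \<in> gobj X" "b \<in> gobj X"
    unfolding e using that by simp
qed

lemma graph_fun_ob: "is_graph small C X \<Longrightarrow> fob (graph_fun small C F) X = graph_push F X"
  by (simp add: graph_fun_def gcat_simps)

lemma graph_fun_functor: "is_functor (graph_cat small C) (graph_cat small D) (graph_fun small C F)"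
proof (rule is_functorI)
  interpret C: category C by (rule source_category)
  show GC: "category (graph_cat small C)" and GD: "category (graph_cat small D)"
    by (intro category_graph_cat source_category target_category)+
  interpret GC: category "graph_cat small C" by (rule GC)
  interpret GD: category "graph_cat small D" by (rule GD)
  let ?H = "graph_fun small C F" and ?GC = "graph_cat small C" and ?GD = "graph_cat small D"
  show "fob ?H \<in> extensional (Obj ?GC)" "far ?H \<in> extensional (Arr ?GC)" by (simp_all add: graph_fun_def)
  show "fob ?H X \<in> Obj ?GD" if "X \<in> Obj ?GC" for X
    using that push_graph by (simp add: graph_fun_ob gcat_simps)
  show "far ?H f \<in> hom ?GD (fob ?H X) (fob ?H Y)" if f: "f \<in> hom ?GC X Y" for f X Y
    using graph_fun_simps(1)[OF f] gmor_hom(1,2)[OF f] by (simp add: graph_fun_ob)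
  show "far ?H (Idt ?GC X) = Idt ?GD (fob ?H X)" if "X \<in> Obj ?GC" for X
  proof -
    have X: "is_graph small C X" using that by (simp add: gcat_simps)
    have X': "graph_push F X \<in> Obj ?GD" using push_graph[OF X] by (simp add: gcat_simps)
    note i = GC.Idt_hom[OF that]
    show ?thesis unfolding graph_fun_ob[OF X]
      by (rule gmor_eqI[OF graph_fun_simps(1)[OF i] GD.Idt_hom[OF X']])
        (simp_all add: graph_fun_simps(2,3)[OF i] graph_Idt ghom_push far_Idt is_graph_hom[OF X])
  qed
  show "far ?H (g o[?GC] f) = far ?H g o[?GD] far ?H f" if f: "f \<in> hom ?GC X Y" and g: "g \<in> hom ?GC Y Z" for f g X Y Z
  proof (rule gmor_eqI[OF graph_fun_simps(1)[OF GC.Cmp_hom[OF f g]] GD.Cmp_hom[OF graph_fun_simps(1)[OF f] graph_fun_simps(1)[OF g]]])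
    note s = graph_fun_simps(2,3)[OF f] graph_fun_simps(2,3)[OF g] graph_fun_simps(2,3)[OF GC.Cmp_hom[OF f g]]
      graph_cmp[OF f] graph_cmp[OF graph_fun_simps(1)[OF f]] gmor_hom(6)[OF f]
    show "gfun (far ?H (g o[?GC] f)) a = gfun (far ?H g o[?GD] far ?H f) a" if "a \<in> gobj (graph_push F X)" for a
      using that by (simp add: s)
    fix a b assume ab: "a \<in> gobj (graph_push F X)" "b \<in> gobj (graph_push F X)"
    then show "gmap (far ?H (g o[?GC] f)) a b = gmap (far ?H g o[?GD] far ?H f) a b"
      using far_Cmp[OF gmor_hom(7)[OF f, of a b] gmor_hom(7)[OF g]] by (simp add: s)
  qed
qed

lemma path_map_push:
  assumes f: "f \<in> hom (graph_cat small C) X Y" and x: "x \<in> walks X a b"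
  shows "path_map (far (graph_fun small C F) f) x = map (far F) (path_map f x)"
  by (rule nth_equalityI) (simp_all add: nth_path_map graph_fun_simps(3)[OF f] paths_nth[OF x])

lemma seq_map_hom:
  "f \<in> hom (seq_cat C) A B \<Longrightarrow> map (far F) f \<in> hom (seq_cat D) (map (fob F) A) (map (fob F) B)"
  by (auto simp: hom_seq_cat far_hom)

text \<open>The source of the coherence maps of a lax monoidal functor;
  \<open>target_seq_functor\<close> is their target. \<open>nat_trans\<close> requires both to be
  functors.\<close>

lemma source_seq_functor:
  assumes "list_functor D E" shows "is_functor (seq_cat C) D (fcomp (seq_cat C) E (seq_fun C F))"
proof (rule is_functorI)
  interpret E: list_functor D E by (rule assms)
  show SC: "category (seq_cat C)" and "category D" by (intro category_seq_cat source_category target_category)+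
  interpret SC: category "seq_cat C" by (rule SC)
  let ?F = "fcomp (seq_cat C) E (seq_fun C F)"
  have ob: "fob ?F Z = fob E (map (fob F) Z)" if "Z \<in> seqs C" for Z using that by (simp add: seq_fun_def)
  have ar: "far ?F f = far E (map (far F) f)" if "f \<in> hom (seq_cat C) A B" for f A B
    using that by (simp add: seq_fun_def hom_iff)
  show "fob ?F Z \<in> Obj D" if "Z \<in> Obj (seq_cat C)" for Z
  proof -
    have Z: "Z \<in> seqs C" using that by simp
    show ?thesis unfolding ob[OF Z] by (rule E.E_ob[OF map_lists[OF Z fob_Obj]])
  qed
  show "far ?F f \<in> hom D (fob ?F A) (fob ?F B)" if f: "f \<in> hom (seq_cat C) A B" for f A B
  proof -
    have "A \<in> seqs C" "B \<in> seqs C" using SC.hom_Obj[OF f] by simp_all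
    then show ?thesis using E.E_hom'[OF seq_map_hom[OF f]] by (simp only: ob ar[OF f])
  qed
  show "far ?F (Idt (seq_cat C) Z) = Idt D (fob ?F Z)" if "Z \<in> Obj (seq_cat C)" for Z
  proof -
    have Z: "Z \<in> seqs C" using that by simp
    have "map (far F) (map (Idt C) Z) = map (Idt D) (map (fob F) Z)" using Z far_Idt by auto
    then show ?thesis using ar[OF SC.Idt_hom[OF that]] E.E_Idt[OF map_lists[OF Z fob_Obj]]
      by (simp add: ob[OF Z] del: map_map)
  qed
  show "far ?F (g o[seq_cat C] f) = far ?F g o[D] far ?F f"
    if f: "f \<in> hom (seq_cat C) A B" and g: "g \<in> hom (seq_cat C) B K" for f g A B K
  proof -
    have "map (far F) (map2 (Cmp C) g f) = map2 (Cmp D) (map (far F) g) (map (far F) f)"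
    proof (rule nth_equalityI)
      fix i assume i: "i < length (map (far F) (map2 (Cmp C) g f))"
      then have "f ! i \<in> hom C (A ! i) (B ! i)" "g ! i \<in> hom C (B ! i) (K ! i)"
        using f g by (auto simp: hom_seq_cat)
      from far_Cmp[OF this] show "map (far F) (map2 (Cmp C) g f) ! i = map2 (Cmp D) (map (far F) g) (map (far F) f) ! i"
        using i by simp
    qed simp
    then show ?thesis
      using E.E_cmp'[OF seq_map_hom[OF f] seq_map_hom[OF g]]
      unfolding ar[OF SC.Cmp_hom[OF f g]] ar[OF f] ar[OF g] by simp
  qed
qed (simp_all add: fcomp_def)

lemma target_seq_functor:
  assumes "list_functor C E" shows "is_functor (seq_cat C) D (fcomp (seq_cat C) F E)"
proof (rule is_functorI)
  interpret E: list_functor C E by (rule assms)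
  show SC: "category (seq_cat C)" and "category D" by (intro category_seq_cat source_category target_category)+
  interpret SC: category "seq_cat C" by (rule SC)
  let ?F = "fcomp (seq_cat C) F E"
  have ob: "fob ?F Z = fob F (fob E Z)" if "Z \<in> Obj (seq_cat C)" for Z by (simp only: fcomp_simps(1)[OF that])
  have ar: "far ?F f = far F (far E f)" if "f \<in> hom (seq_cat C) A B" for f A B
    using that by (simp add: hom_iff)
  show "fob ?F Z \<in> Obj D" if "Z \<in> Obj (seq_cat C)" for Z
    unfolding ob[OF that] using fob_Obj[OF E.E_ob] that by simp
  show "far ?F f \<in> hom D (fob ?F A) (fob ?F B)" if f: "f \<in> hom (seq_cat C) A B" for f A B
    using far_hom[OF E.E_hom'[OF f]] SC.hom_Obj[OF f] ar[OF f] ob by simp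
  show "far ?F (Idt (seq_cat C) Z) = Idt D (fob ?F Z)" if Z: "Z \<in> Obj (seq_cat C)" for Z
    using ar[OF SC.Idt_hom[OF Z]] E.E_Idt[of Z] Z far_Idt[OF E.E_ob, of Z] ob[OF Z] by simp
  show "far ?F (g o[seq_cat C] f) = far ?F g o[D] far ?F f"
    if f: "f \<in> hom (seq_cat C) A B" and g: "g \<in> hom (seq_cat C) B K" for f g A B K
    using E.E_cmp'[OF f g] far_Cmp[OF E.E_hom'[OF f] E.E_hom'[OF g]]
    unfolding ar[OF SC.Cmp_hom[OF f g]] ar[OF f] ar[OF g] by simp
qed (simp_all add: fcomp_def)

end

section \<open>Coherence data on a functor between two compared pairs\<close>

locale comparison_functor = C: comparison small \<nu> V E T t + D: comparison small \<nu> W F S s + H: is_functor V W H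
  for small :: "'u set \<Rightarrow> bool" and \<nu> :: "nat \<Rightarrow> 'u"
    and V :: "('o, 'a) cat" and E :: "('o, 'a) multitensor" and T :: "('u, 'o, 'a) gmonad" and t
    and W :: "('o, 'a) cat" and F :: "('o, 'a) multitensor" and S :: "('u, 'o, 'a) gmonad" and s
    and H :: "('o, 'a, 'o, 'a) ftor"
begin

abbreviation HO :: "('u, 'o) graph \<Rightarrow> ('u, 'o) graph" where "HO \<equiv> graph_push H"
abbreviation HA :: "('u, 'o, 'a) gmor \<Rightarrow> ('u, 'o, 'a) gmor" where "HA \<equiv> far (graph_fun small V H)"

lemma s_hom:
  assumes "is_graph small V X" "x \<in> walks X a b"
  shows "s (HO X) x \<in> hom W (mt_ob F (map (fob H) (path_seq X x))) (ghom (D.TO (HO X)) a b)"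
  using D.t_hom[OF H.push_graph[OF assms(1)], of x a b] assms by (simp add: path_seq_push)

lemma Ht_hom:
  assumes "is_graph small V X" "x \<in> walks X a b"
  shows "far H (t X x) \<in> hom W (fob H (mt_ob E (path_seq X x))) (fob H (ghom (C.TO X) a b))"
  by (rule H.far_hom[OF C.t_hom[OF assms]])

lemma H_seq: "Z \<in> seqs V \<Longrightarrow> map (fob H) Z \<in> seqs W"
  by (rule map_lists) (auto intro: H.fob_Obj)

text \<open>Every functor keeps the left inverse of \<open>tc\<close>, whereas it need not keep the
  cocones of t. Cancellation after H is therefore confined to canonical paths.\<close>

lemma Htc_cancel:
  assumes "Z \<in> seqs V" "h \<in> hom W d (fob H (mt_ob E Z))" "k \<in> hom W d (fob H (mt_ob E Z))"
    "far H (C.tc Z) o[W] h = far H (C.tc Z) o[W] k"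
  shows "h = k"
proof -
  from C.tc_iso[OF assms(1)] obtain r where r: "r \<in> hom V (C.Tbar Z) (mt_ob E Z)"
    "r o[V] C.tc Z = Idt V (mt_ob E Z)" by (auto simp: is_iso_def)
  note tc = C.tc_hom[OF assms(1)]
  have "far H r o[W] far H (C.tc Z) = Idt W (fob H (mt_ob E Z))"
    using H.far_Cmp[OF tc r(1)] r(2) H.far_Idt[OF C.E_ob[OF assms(1)]] by simp
  then have "l = far H r o[W] (far H (C.tc Z) o[W] l)" if "l \<in> hom W d (fob H (mt_ob E Z))" for l
    using that H.far_hom[OF tc] H.far_hom[OF r(1)] by (simp add: hom_iff flip: D.assoc)
  then show ?thesis using assms(2-4) by metis
qed

end

text \<open>\<open>\<Psi>\<close> is determined by \<open>\<psi>\<close> because the \<open>t X x\<close> form coproduct cocones; conversely \<open>\<psi>\<close> is read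
  off from \<open>\<Psi>\<close> at the graphs of sequences, where \<open>t\<close> is invertible.\<close>

definition corresponds ::
    "('u set \<Rightarrow> bool) \<Rightarrow> ('o, 'a) cat \<Rightarrow> ('o, 'a) multitensor \<Rightarrow> ('u, 'o, 'a) gmonad \<Rightarrow> (('u, 'o) graph \<Rightarrow> 'u list \<Rightarrow> 'a)
     \<Rightarrow> ('o, 'a) cat \<Rightarrow> ('o, 'a) multitensor \<Rightarrow> ('u, 'o, 'a) gmonad \<Rightarrow> (('u, 'o) graph \<Rightarrow> 'u list \<Rightarrow> 'a)
     \<Rightarrow> ('o, 'a, 'o, 'a) ftor \<Rightarrow> ('o list \<Rightarrow> 'a) \<Rightarrow> (('u, 'o) graph \<Rightarrow> ('u, 'o, 'a) gmor) \<Rightarrow> bool" where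
  "corresponds small V E T t W F S s H \<psi> \<Psi> \<longleftrightarrow>
     \<psi> \<in> extensional (seqs V) \<and>
     (\<forall>Z\<in>seqs V. \<psi> Z \<in> hom W (mt_ob F (map (fob H) Z)) (fob H (mt_ob E Z))) \<and>
     \<Psi> \<in> extensional (Obj (graph_cat small V)) \<and>
     (\<forall>X. is_graph small V X \<longrightarrow>
  \<Psi> X \<in> hom (graph_cat small W) (fob (mnd_fun S) (graph_push H X)) (graph_push H (fob (mnd_fun T) X)) \<and>
  gfun (\<Psi> X) = (\<lambda>a\<in>gobj X. a) \<and>
  (\<forall>a b. \<forall>x\<in>walks X a b.
  gmap (\<Psi> X) a b o[W] s (graph_push H X) x = far H (t X x) o[W] \<psi> (path_seq X x)))"

locale corresponding = comparison_functor small \<nu> V E T t W F S s H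
  for small :: "'u set \<Rightarrow> bool" and \<nu> :: "nat \<Rightarrow> 'u"
    and V :: "('o, 'a) cat" and E :: "('o, 'a) multitensor" and T :: "('u, 'o, 'a) gmonad" and t
    and W :: "('o, 'a) cat" and F :: "('o, 'a) multitensor" and S :: "('u, 'o, 'a) gmonad" and s
    and H :: "('o, 'a, 'o, 'a) ftor" +
  fixes \<psi> :: "'o list \<Rightarrow> 'a" and \<Psi> :: "('u, 'o) graph \<Rightarrow> ('u, 'o, 'a) gmor"
  assumes corr: "corresponds small V E T t W F S s H \<psi> \<Psi>"
begin

lemma \<psi>_ext: "\<psi> \<in> extensional (seqs V)"
  and \<psi>_hom: "Z \<in> seqs V \<Longrightarrow> \<psi> Z \<in> hom W (mt_ob F (map (fob H) Z)) (fob H (mt_ob E Z))"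
  and \<Psi>_ext: "\<Psi> \<in> extensional (Obj C.GV)"
  and \<Psi>_hom: "is_graph small V X \<Longrightarrow> \<Psi> X \<in> hom D.GV (D.TO (HO X)) (HO (C.TO X))"
  and \<Psi>_fun: "is_graph small V X \<Longrightarrow> gfun (\<Psi> X) = (\<lambda>a\<in>gobj X. a)"
  and \<Psi>_s: "\<lbrakk>is_graph small V X; x \<in> walks X a b\<rbrakk> \<Longrightarrow>
    gmap (\<Psi> X) a b o[W] s (HO X) x = far H (t X x) o[W] \<psi> (path_seq X x)"
  using corr by (simp_all add: corresponds_def)

lemma \<Psi>_map: "\<lbrakk>is_graph small V X; a \<in> gobj X; b \<in> gobj X\<rbrakk> \<Longrightarrow>
    gmap (\<Psi> X) a b \<in> hom W (ghom (D.TO (HO X)) a b) (fob H (ghom (C.TO X) a b))"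
  using gmor_hom(7)[OF \<Psi>_hom, of X a b] H.push_graph[of small X] by (simp add: \<Psi>_fun ghom_push)

text \<open>The two results differ exactly by the naturality square of \<psi>, placed before H of a
  comparison map. As with the monad laws, this serves both directions.\<close>

lemma coherence_naturality:
  assumes f: "f \<in> hom C.GV X Y" and x: "x \<in> walks X a b"
  shows "gmap (\<Psi> Y o[D.GV] D.TA (HA f)) a b o[W] s (HO X) x =
  far H (t Y (map (gfun f) x)) o[W] (\<psi> (path_seq Y (map (gfun f) x)) o[W] mt_ar F (map (far H) (path_map f x)))"
    and "gmap (HA (C.TA f) o[D.GV] \<Psi> X) a b o[W] s (HO X) x =
  far H (t Y (map (gfun f) x)) o[W] (far H (mt_ar E (path_map f x)) o[W] \<psi> (path_seq X x))"
proof -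
  let ?fx = "map (gfun f) x" and ?l = "\<Psi> Y o[D.GV] D.TA (HA f)" and ?r = "HA (C.TA f) o[D.GV] \<Psi> X" and ?Hf = "map (far H) (path_map f x)"
  note X = gmor_hom(1)[OF f] and Y = gmor_hom(2)[OF f] and fx = path_map_hom[OF f x]
  have a: "a \<in> gobj X" and b: "b \<in> gobj X" using paths_ends[OF x] by simp_all
  have fa: "gfun f a \<in> gobj Y" and fb: "gfun f b \<in> gobj Y" using gmor_hom(6)[OF f] a b by simp_all
  note Hf = H.graph_fun_simps[OF f] and HTf = H.graph_fun_simps[OF C.T_mor[OF f]]
  note PX = \<Psi>_map[OF X a b] and PY = \<Psi>_map[OF Y fa fb] and sX = s_hom[OF X x] and sY = s_hom[OF Y fx(1)]
  note HtX = Ht_hom[OF X x] and HtY = Ht_hom[OF Y fx(1)]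
  note pX = \<psi>_hom[OF path_seq_Obj[OF X x]] and pY = \<psi>_hom[OF path_seq_Obj[OF Y fx(1)]]
  have SHf: "gmap (D.TA (HA f)) a b \<in> hom W (ghom (D.TO (HO X)) a b) (ghom (D.TO (HO Y)) (gfun f a) (gfun f b))"
    using D.T_map[OF Hf(1), of a b] a b by (simp add: Hf(2))
  note FHf = D.E_hom'[OF H.seq_map_hom[OF fx(2)]]
  have 1: "gmap (D.TA (HA f)) a b o[W] s (HO X) x = s (HO Y) ?fx o[W] mt_ar F ?Hf"
    using D.t_nat[OF Hf(1), of x a b] x by (simp add: Hf(2) H.path_map_push[OF f x])
  have "gmap ?l a b = gmap (\<Psi> Y) (gfun f a) (gfun f b) o[W] gmap (D.TA (HA f)) a b"
    using graph_cmp(2)[OF D.T_mor[OF Hf(1)], of a b "\<Psi> Y"] a b H.push_graph[OF X] by (simp add: D.gfun_T[OF Hf(1)] Hf(2))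
  then have "gmap ?l a b o[W] s (HO X) x =
    gmap (\<Psi> Y) (gfun f a) (gfun f b) o[W] (gmap (D.TA (HA f)) a b o[W] s (HO X) x)"
    using PY SHf sX by (simp add: hom_iff D.assoc)
  also have "\<dots> = (gmap (\<Psi> Y) (gfun f a) (gfun f b) o[W] s (HO Y) ?fx) o[W] mt_ar F ?Hf"
    unfolding 1 using PY sY FHf by (simp add: hom_iff D.assoc)
  also have "\<dots> = far H (t Y ?fx) o[W] (\<psi> (path_seq Y ?fx) o[W] mt_ar F ?Hf)"
    unfolding \<Psi>_s[OF Y fx(1)] using HtY pY FHf by (simp add: hom_iff D.assoc)
  finally show "gmap ?l a b o[W] s (HO X) x =
    far H (t Y ?fx) o[W] (\<psi> (path_seq Y ?fx) o[W] mt_ar F ?Hf)" .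
  note Tf = C.T_map[OF f a b]
  note HEf = H.far_hom[OF C.E_hom'[OF fx(2)]]
  have "gmap ?r a b = far H (gmap (C.TA f) a b) o[W] gmap (\<Psi> X) a b"
    using graph_cmp(2)[OF \<Psi>_hom[OF X], of a b "HA (C.TA f)"] a b X H.push_graph[OF X] HTf(3)[of a b] by (simp add: \<Psi>_fun)
  then have "gmap ?r a b o[W] s (HO X) x = far H (gmap (C.TA f) a b) o[W] (gmap (\<Psi> X) a b o[W] s (HO X) x)"
    using PX H.far_hom[OF Tf] sX by (simp add: hom_iff D.assoc)
  also have "\<dots> = (far H (gmap (C.TA f) a b) o[W] far H (t X x)) o[W] \<psi> (path_seq X x)"
    unfolding \<Psi>_s[OF X x] using H.far_hom[OF Tf] HtX pX by (simp add: hom_iff D.assoc)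
  also have "far H (gmap (C.TA f) a b) o[W] far H (t X x) = far H (t Y ?fx) o[W] far H (mt_ar E (path_map f x))"
    using H.far_Cmp[OF C.t_hom[OF X x] Tf] H.far_Cmp[OF C.E_hom'[OF fx(2)] C.t_hom[OF Y fx(1)]] C.t_nat[OF f x] by simp
  also have "(far H (t Y ?fx) o[W] far H (mt_ar E (path_map f x))) o[W] \<psi> (path_seq X x) =
    far H (t Y ?fx) o[W] (far H (mt_ar E (path_map f x)) o[W] \<psi> (path_seq X x))"
    using HtY HEf pX by (simp add: hom_iff D.assoc)
  finally show "gmap ?r a b o[W] s (HO X) x =
    far H (t Y ?fx) o[W] (far H (mt_ar E (path_map f x)) o[W] \<psi> (path_seq X x))" .
qed

lemma coherence_unit:
  assumes X: "is_graph small V X" and a: "a \<in> gobj X" and b: "b \<in> gobj X"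
  shows "gmap (\<Psi> X o[D.GV] D.\<eta> (HO X)) a b =
  far H (t X [a, b]) o[W] (\<psi> [ghom X a b] o[W] mt_unit F (fob H (ghom X a b)))"
    and "gmap (HA (C.\<eta> X)) a b = far H (t X [a, b]) o[W] far H (mt_unit E (ghom X a b))"
proof -
  note HX = H.push_graph[OF X] and x = paths_pair[OF a b]
  have ps: "path_seq X [a, b] = [ghom X a b]" by (simp add: path_seq_def)
  note g = is_graph_hom[OF X a b]
  note P = \<Psi>_map[OF X a b] and sx = s_hom[OF X x, unfolded ps] and Ht = Ht_hom[OF X x, unfolded ps]
    and p = \<psi>_hom[OF path_seq_Obj[OF X x], unfolded ps] and u = D.u_hom[OF H.fob_Obj[OF g]]
  have "gmap (\<Psi> X o[D.GV] D.\<eta> (HO X)) a b = gmap (\<Psi> X) a b o[W] (s (HO X) [a, b] o[W] mt_unit F (fob H (ghom X a b)))"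
    using graph_cmp(2)[OF D.\<eta>_hom[OF HX], of a b "\<Psi> X"] a b HX D.\<eta>_t[OF HX] by (simp add: ghom_push)
  also have "\<dots> = (gmap (\<Psi> X) a b o[W] s (HO X) [a, b]) o[W] mt_unit F (fob H (ghom X a b))"
    using P sx u by (simp add: hom_iff D.assoc)
  also have "\<dots> = far H (t X [a, b]) o[W] (\<psi> [ghom X a b] o[W] mt_unit F (fob H (ghom X a b)))"
    unfolding \<Psi>_s[OF X x] ps using Ht p u by (simp add: hom_iff D.assoc)
  finally show "gmap (\<Psi> X o[D.GV] D.\<eta> (HO X)) a b =
    far H (t X [a, b]) o[W] (\<psi> [ghom X a b] o[W] mt_unit F (fob H (ghom X a b)))" .
  show "gmap (HA (C.\<eta> X)) a b = far H (t X [a, b]) o[W] far H (mt_unit E (ghom X a b))"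
    using H.graph_fun_simps(3)[OF C.\<eta>_hom[OF X] a b] C.\<eta>_t[OF X a b]
      H.far_Cmp[OF C.u_hom[OF g] C.t_hom[OF X x, unfolded ps]] by simp
qed

text \<open>On the cocone of the second iterate of S the two sides of the multiplication law become
  those of the substitution law, followed by H of t. On the second side \<psi> at homs of TX has to
  pass the maps \<open>t X\<close>, which needs its naturality.\<close>

lemma coherence_mult:
  assumes X: "is_graph small V X" and y: "y \<in> walks X a b" and xs: "xs \<in> refined X y"
  defines "Zss \<equiv> map (path_seq X) xs" and "x \<equiv> path_concat a xs"
    and "ss \<equiv> s (D.TO (HO X)) y o[W] mt_ar F (map (s (HO X)) xs)"
  shows "gmap (\<Psi> X o[D.GV] D.\<mu> (HO X)) a b o[W] ss =
  far H (t X x) o[W] (\<psi> (concat Zss) o[W] mt_sub F (map (map (fob H)) Zss))"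
    and "(\<And>f A B. f \<in> hom (seq_cat V) A B \<Longrightarrow> \<psi> B o[W] mt_ar F (map (far H) f) = far H (mt_ar E f) o[W] \<psi> A) \<Longrightarrow>
  gmap (HA (C.\<mu> X) o[D.GV] (\<Psi> (C.TO X) o[D.GV] D.TA (\<Psi> X))) a b o[W] ss =
  far H (t X x) o[W] (far H (mt_sub E Zss) o[W] (\<psi> (map (mt_ob E) Zss) o[W] mt_ar F (map \<psi> Zss)))"
proof -
  let ?e = "\<lambda>x. mt_ob F (map (fob H) (path_seq X x))"
  let ?HZ = "map (map (fob H)) Zss"
  let ?L = "HA (C.\<mu> X) o[D.GV] (\<Psi> (C.TO X) o[D.GV] D.TA (\<Psi> X))"
  let ?EZ = "map (mt_ob E) Zss"
  let ?p = "\<psi> ?EZ o[W] mt_ar F (map \<psi> Zss)"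
  let ?m = "gmap (C.\<mu> X) a b"
  let ?sx = "mt_ar F (map (s (HO X)) xs)"
  have a: "a \<in> gobj X" and b: "b \<in> gobj X" using paths_ends[OF y] by simp_all
  note HX = H.push_graph[OF X] and TX = C.T_graph[OF X]
  note SHX = D.T_graph[OF HX]
  have x: "x \<in> walks X a b" using path_concat_props[OF y xs] by (simp add: x_def)
  have psx: "path_seq X x = concat Zss" using path_seq_concat[OF y xs] by (simp add: x_def Zss_def)
  have xi: "xs ! i \<in> walks X (y ! i) (y ! Suc i)" if "i < length xs" for i
    using xs that by (simp add: refinements_nth)
  have yi: "y ! i \<in> gobj X" "y ! Suc i \<in> gobj X" if "i < length xs" for i
    using xs that paths_nth[OF y] by (auto simp: refinements_nth)
  have lxs: "length xs = length y - 1" using xs by (simp add: refinements_nth)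
  have xin: "\<exists>c d. z \<in> walks X c d" if "z \<in> set xs" for z using that xi by (auto simp: in_set_conv_nth)
  have Zss: "Zss \<in> lists (seqs V)" unfolding Zss_def by (rule path_seq_Obj_refinement[OF X xs])
  have pz: "path_seq (HO X) z = map (fob H) (path_seq X z)" if "z \<in> set xs" for z
    using xin[OF that] path_seq_push[of z X _ _ H] by blast
  have psH: "map (path_seq (HO X)) xs = map (map (fob H)) Zss"
    unfolding Zss_def using pz by simp
  have HZss: "map (map (fob H)) Zss \<in> lists (seqs W)" by (rule map_lists[OF Zss H_seq])
  have mm: "map (mt_ob F) ?HZ = map ?e xs"
    by (simp add: Zss_def)
  have yH: "y \<in> walks (HO X) a b" and xsH: "xs \<in> refined (HO X) y" using y xs by simp_all
  have ys: "y \<in> paths (gobj (D.TO (HO X))) a b" using y HX by simp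
  have ssy: "s (D.TO (HO X)) y \<in> hom W (mt_ob F (path_seq (D.TO (HO X)) y)) (ghom (D.TO (D.TO (HO X))) a b)"
    by (rule D.t_hom[OF SHX ys])
  have ssx: "mt_ar F (map (s (HO X)) xs) \<in> hom W (mt_ob F (map ?e xs)) (mt_ob F (path_seq (D.TO (HO X)) y))"
  proof -
    have "map (\<lambda>x. mt_ob F (path_seq (HO X) x)) xs = map ?e xs"
      using pz by simp
    then show ?thesis using D.tt_hom[OF HX yH xsH] by (simp only:)
  qed
  have sF: "mt_sub F ?HZ \<in> hom W (mt_ob F (map ?e xs)) (mt_ob F (map (fob H) (concat Zss)))"
    using D.\<sigma>_hom[OF HZss] unfolding mm by (simp add: map_concat)
  have sHx: "s (HO X) x \<in> hom W (mt_ob F (map (fob H) (concat Zss))) (ghom (D.TO (HO X)) a b)"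
    using s_hom[OF X x] unfolding psx .
  note P = \<Psi>_map[OF X a b] and Ht = Ht_hom[OF X x, unfolded psx] and pc = \<psi>_hom[OF concat_lists[OF Zss]]
  have mS: "gmap (D.\<mu> (HO X)) a b \<in> hom W (ghom (D.TO (D.TO (HO X))) a b) (ghom (D.TO (HO X)) a b)"
    using D.\<mu>_map[OF HX] a b by simp
  have "gmap (\<Psi> X o[D.GV] D.\<mu> (HO X)) a b = gmap (\<Psi> X) a b o[W] gmap (D.\<mu> (HO X)) a b"
    using graph_cmp(2)[OF D.\<mu>_hom[OF HX], of a b "\<Psi> X"] a b HX SHX by simp
  then have "gmap (\<Psi> X o[D.GV] D.\<mu> (HO X)) a b o[W] ss = gmap (\<Psi> X) a b o[W] (gmap (D.\<mu> (HO X)) a b o[W] ss)"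
    unfolding ss_def using P mS ssy ssx by (simp add: hom_iff D.assoc)
  also have "gmap (D.\<mu> (HO X)) a b o[W] ss = s (HO X) x o[W] mt_sub F ?HZ"
    using D.\<mu>_t[OF HX yH xsH] unfolding psH x_def ss_def .
  also have "gmap (\<Psi> X) a b o[W] \<dots> = (gmap (\<Psi> X) a b o[W] s (HO X) x) o[W] mt_sub F ?HZ"
    using P sHx sF by (simp add: hom_iff D.assoc)
  also have "\<dots> = far H (t X x) o[W] (\<psi> (concat Zss) o[W] mt_sub F ?HZ)"
    unfolding \<Psi>_s[OF X x] psx using Ht pc sF by (simp add: hom_iff D.assoc)
  finally show "gmap (\<Psi> X o[D.GV] D.\<mu> (HO X)) a b o[W] ss =
    far H (t X x) o[W] (\<psi> (concat Zss) o[W] mt_sub F ?HZ)" .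
  assume nat: "\<And>f A B. f \<in> hom (seq_cat V) A B \<Longrightarrow> \<psi> B o[W] mt_ar F (map (far H) f) = far H (mt_ar E f) o[W] \<psi> A"
  note PX = \<Psi>_hom[OF X]
  have aT: "a \<in> gobj (C.TO X)" "b \<in> gobj (C.TO X)" using a b X by simp_all
  have yT: "y \<in> walks (C.TO X) a b" using y X by simp
  note PT = \<Psi>_map[OF TX aT]
  have SP: "gmap (D.TA (\<Psi> X)) a b \<in> hom W (ghom (D.TO (D.TO (HO X))) a b) (ghom (D.TO (HO (C.TO X))) a b)"
    using D.T_map[OF PX, of a b] a b HX by (simp add: \<Psi>_fun[OF X])
  note H\<mu> = H.far_hom[OF C.\<mu>_map[OF X a b]] and sT = s_hom[OF TX yT] and HtT = Ht_hom[OF TX yT]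
    and pT = \<psi>_hom[OF path_seq_Obj[OF TX yT]]
  have pm: "path_map (\<Psi> X) y \<in> hom (seq_cat W) (path_seq (D.TO (HO X)) y) (map (fob H) (path_seq (C.TO X) y))"
    using path_map_hom(2)[OF PX ys] map_gfun_id[OF \<Psi>_fun[OF X] y] path_seq_push[OF yT, of H] by simp
  have SPs: "gmap (D.TA (\<Psi> X)) a b o[W] s (D.TO (HO X)) y = s (HO (C.TO X)) y o[W] mt_ar F (path_map (\<Psi> X) y)"
    using D.t_nat[OF PX ys] map_gfun_id[OF \<Psi>_fun[OF X] y] by simp
  have tx: "map (t X) xs \<in> hom (seq_cat V) ?EZ (path_seq (C.TO X) y)"
    using C.t_hom[OF X xi] lxs by (simp add: hom_seq_cat Zss_def nth_path_seq)
  have EZss: "map (mt_ob E) Zss \<in> seqs V" by (rule map_lists[OF Zss C.E_ob])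
  have F\<psi>: "mt_ar F (map \<psi> Zss) \<in> hom W (mt_ob F (map ?e xs)) (mt_ob F (map (fob H) ?EZ))"
  proof (rule D.E_hom)
    fix i assume "i < length (map \<psi> Zss)"
    then have i: "i < length xs" by (simp add: Zss_def)
    then show "map \<psi> Zss ! i \<in> hom W (map ?e xs ! i) (map (fob H) ?EZ ! i)"
      using \<psi>_hom[OF path_seq_Obj[OF X xi[OF i]]] by (simp add: Zss_def)
  qed (simp_all add: Zss_def)
  note FHt = D.E_hom'[OF H.seq_map_hom[OF tx]] and Fpm = D.E_hom'[OF pm]
  \<comment> \<open>Entry by entry under F this is the defining equation of the correspondence at
    the pieces of the refinement.\<close>
  have FF: "mt_ar F (path_map (\<Psi> X) y) o[W] mt_ar F (map (s (HO X)) xs) = mt_ar F (map (far H) (map (t X) xs)) o[W] mt_ar F (map \<psi> Zss)"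
  proof -
    let ?h = "map (\<lambda>x. far H (t X x) o[W] \<psi> (path_seq X x)) xs"
    have "mt_ar F (path_map (\<Psi> X) y) o[W] mt_ar F (map (s (HO X)) xs) = mt_ar F ?h"
    proof (rule D.E_cmp)
      fix i assume "i < length ?h"
      then have i: "i < length xs" by simp
      show "composite W (path_map (\<Psi> X) y ! i) (map (s (HO X)) xs ! i) (?h ! i)"
        using i lxs s_hom[OF X xi[OF i]] \<Psi>_map[OF X yi[OF i]] \<Psi>_s[OF X xi[OF i]] by (simp add: nth_path_map hom_iff)
    qed (simp_all add: lxs)
    moreover have "mt_ar F (map (far H) (map (t X) xs)) o[W] mt_ar F (map \<psi> Zss) = mt_ar F ?h"
    proof (rule D.E_cmp)
      fix i assume "i < length ?h"
      then have i: "i < length xs" by simp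
      show "composite W (map (far H) (map (t X) xs) ! i) (map \<psi> Zss ! i) (?h ! i)"
        using i Ht_hom[OF X xi[OF i]] \<psi>_hom[OF path_seq_Obj[OF X xi[OF i]]] by (simp add: Zss_def hom_iff)
    qed (simp_all add: Zss_def)
    ultimately show ?thesis by simp
  qed
  have sE: "mt_sub E Zss \<in> hom V (mt_ob E ?EZ) (mt_ob E (concat Zss))" by (rule C.\<sigma>_hom[OF Zss])
  \<comment> \<open>H applied to the formula for \<mu>, with both composites split into their
    factors.\<close>
  have HHH: "far H ?m o[W] (far H (t (C.TO X) y) o[W] far H (mt_ar E (map (t X) xs))) = far H (t X x) o[W] far H (mt_sub E Zss)"
  proof -
    have "gmap (C.\<mu> X) a b o[V] (t (C.TO X) y o[V] mt_ar E (map (t X) xs)) = t X x o[V] mt_sub E Zss"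
      using C.\<mu>_t[OF X y xs] unfolding x_def Zss_def .
    moreover note tT = C.t_hom[OF TX yT] and tt = C.E_hom'[OF tx]
    moreover have "far H (t X x o[V] mt_sub E Zss) = far H (t X x) o[W] far H (mt_sub E Zss)"
      using H.far_Cmp[OF sE C.t_hom[OF X x, unfolded psx]] .
    ultimately show ?thesis
      using H.far_Cmp[OF C.Cmp_hom[OF tt tT] C.\<mu>_map[OF X a b]] H.far_Cmp[OF tt tT] by simp
  qed
  note HEt = H.far_hom[OF C.E_hom'[OF tx]] and pE = \<psi>_hom[OF EZss] and HsE = H.far_hom[OF sE]
  have "gmap ?L a b =
    far H ?m o[W] (gmap (\<Psi> (C.TO X)) a b o[W] gmap (D.TA (\<Psi> X)) a b)"
    using graph_cmp[OF D.GV.Cmp_hom[OF D.T_mor[OF PX] \<Psi>_hom[OF TX]], where g = "HA (C.\<mu> X)"]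
      graph_cmp[OF D.T_mor[OF PX], where g = "\<Psi> (C.TO X)"]
      H.graph_fun_simps(3)[OF C.\<mu>_hom[OF X], of a b] a b X TX HX SHX
    by (simp add: D.gfun_T[OF PX] \<Psi>_fun)
  then have "gmap ?L a b o[W] ss =
    far H ?m o[W] (gmap (\<Psi> (C.TO X)) a b o[W] ((gmap (D.TA (\<Psi> X)) a b o[W] s (D.TO (HO X)) y) o[W] mt_ar F (map (s (HO X)) xs)))"
    unfolding ss_def using H\<mu> PT SP ssy ssx by (simp add: hom_iff D.assoc)
  also have "\<dots> = far H ?m o[W] ((gmap (\<Psi> (C.TO X)) a b o[W] s (HO (C.TO X)) y) o[W]
    (mt_ar F (path_map (\<Psi> X) y) o[W] mt_ar F (map (s (HO X)) xs)))"
    unfolding SPs using H\<mu> PT sT Fpm ssx by (simp add: hom_iff D.assoc)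
  also have "\<dots> = far H ?m o[W] (far H (t (C.TO X) y) o[W]
    ((\<psi> (path_seq (C.TO X) y) o[W] mt_ar F (map (far H) (map (t X) xs))) o[W] mt_ar F (map \<psi> Zss)))"
    unfolding FF \<Psi>_s[OF TX yT] using H\<mu> HtT pT FHt F\<psi> by (simp add: hom_iff D.assoc del: map_map)
  also have "\<dots> = (far H ?m o[W] (far H (t (C.TO X) y) o[W] far H (mt_ar E (map (t X) xs)))) o[W] ?p"
    unfolding nat[OF tx] using H\<mu> HtT HEt pE F\<psi> by (simp add: hom_iff D.assoc del: map_map)
  also have "\<dots> = far H (t X x) o[W] (far H (mt_sub E Zss) o[W] ?p)"
    unfolding HHH using Ht HsE pE F\<psi> by (simp add: hom_iff D.assoc del: map_map)
  finally show "gmap ?L a b o[W] ss =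
    far H (t X x) o[W] (far H (mt_sub E Zss) o[W] ?p)" .
qed

end

context functor_comparison
begin

lemma T_gmor_eqI:
  assumes X: "graph X" and f: "f \<in> hom GV (TO X) Y" and g: "g \<in> hom GV (TO X) Y"
    and 0: "\<And>a. a \<in> gobj X \<Longrightarrow> gfun f a = gfun g a"
    and 1: "\<And>a b x. x \<in> walks X a b \<Longrightarrow> gmap f a b o[V] t X x = gmap g a b o[V] t X x"
  shows "f = g"
proof (rule gmor_eqI[OF f g])
  show "gfun f a = gfun g a" if "a \<in> gobj (TO X)" for a using 0 that X by simp
  fix a b assume ab: "a \<in> gobj (TO X)" "b \<in> gobj (TO X)"
  then have ab': "a \<in> gobj X" "b \<in> gobj X" using X by simp_all
  show "gmap f a b = gmap g a b"
    by (rule T_eqI[OF X ab' _ _ 1]) (use gmor_hom(7)[OF f ab] gmor_hom(7)[OF g ab] 0 ab' in simp_all)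
qed

lemma TT_gmor_eqI:
  assumes X: "graph X" and f: "f \<in> hom GV (TO (TO X)) Y" and g: "g \<in> hom GV (TO (TO X)) Y"
    and 0: "\<And>a. a \<in> gobj X \<Longrightarrow> gfun f a = gfun g a"
    and 1: "\<And>a b y xs. \<lbrakk>y \<in> walks X a b; xs \<in> refined X y\<rbrakk> \<Longrightarrow>
  gmap f a b o[V] (t (TO X) y o[V] mt_ar E (map (t X) xs)) = gmap g a b o[V] (t (TO X) y o[V] mt_ar E (map (t X) xs))"
  shows "f = g"
proof (rule gmor_eqI[OF f g])
  show "gfun f a = gfun g a" if "a \<in> gobj (TO (TO X))" for a using 0 that X by simp
  fix a b assume ab: "a \<in> gobj (TO (TO X))" "b \<in> gobj (TO (TO X))"
  then have ab': "a \<in> gobj X" "b \<in> gobj X" using X by simp_all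
  show "gmap f a b = gmap g a b"
    by (rule TT_eqI[OF X ab' _ _ 1]) (use gmor_hom(7)[OF f ab] gmor_hom(7)[OF g ab] 0 ab' in simp_all)
qed

end

section \<open>Lax monoidal laws, monad functor laws, and uniqueness of corresponding data\<close>

context corresponding
begin

text \<open>The naturality and multiplication laws are tested in W, on the cocones of s at HX, which
  are coproducts by the comparison for W. H is only ever applied to equations.\<close>

lemma monad_functor_of_lax:
  assumes L: "is_lax_monoidal V E W F H \<psi>" shows "is_graph_monad_functor small V T W S H \<Psi>"
proof -
  let ?GH = "graph_fun small V H"
  interpret L: is_lax_monoidal V E W F H \<psi> by (rule L)
  interpret N: nat_trans "seq_cat V" W "fcomp (seq_cat V) (mt_fun F) (seq_fun V H)" "fcomp (seq_cat V) H (mt_fun E)" \<psi>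
    by (rule L.coherence_natural)
  have nat: "\<psi> B o[W] mt_ar F (map (far H) f) = far H (mt_ar E f) o[W] \<psi> A" if f: "f \<in> hom (seq_cat V) A B" for f A B
    using N.naturality[OF f] f by (simp add: hom_iff seq_fun_def)
  note GH = H.graph_fun_functor[of small]
  show ?thesis
  proof (rule is_graph_monad_functor.intro)
    show "is_functor V W H" by (rule H.is_functor_axioms)
    show "nat_over_Set small V \<Psi>" using \<Psi>_fun by (simp add: nat_over_Set_def gcat_simps)
    show "nat_trans C.GV D.GV (fcomp C.GV (mnd_fun S) ?GH) (fcomp C.GV ?GH (mnd_fun T)) \<Psi>"
    proof (rule nat_transI[OF fcomp_functor[OF GH D.T_functor] fcomp_functor[OF C.T_functor GH] \<Psi>_ext])
      show "\<Psi> X \<in> hom D.GV (fob (fcomp C.GV (mnd_fun S) ?GH) X) (fob (fcomp C.GV ?GH (mnd_fun T)) X)"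
        if "X \<in> Obj C.GV" for X using that \<Psi>_hom by (simp add: gcat_simps H.graph_fun_ob)
      fix f X Y assume f: "f \<in> hom C.GV X Y"
      note X = gmor_hom(1)[OF f] and Y = gmor_hom(2)[OF f]
      note Hf = H.graph_fun_simps[OF f] and HTf = H.graph_fun_simps[OF C.T_mor[OF f]]
      have "\<Psi> Y o[D.GV] D.TA (HA f) = HA (C.TA f) o[D.GV] \<Psi> X"
      proof (rule D.T_gmor_eqI[OF H.push_graph[OF X] D.GV.Cmp_hom[OF D.T_mor[OF Hf(1)] \<Psi>_hom[OF Y]] D.GV.Cmp_hom[OF \<Psi>_hom[OF X] HTf(1)]])
        show "gfun (\<Psi> Y o[D.GV] D.TA (HA f)) a = gfun (HA (C.TA f) o[D.GV] \<Psi> X) a" if "a \<in> gobj (HO X)" for a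
          using that gmor_hom(6)[OF f] H.push_graph[OF X] X Y
          by (simp add: graph_cmp(1)[OF D.T_mor[OF Hf(1)]] graph_cmp(1)[OF \<Psi>_hom[OF X]] D.gfun_T[OF Hf(1)] Hf(2) HTf(2) \<Psi>_fun C.gfun_T[OF f])
        fix a b x assume "x \<in> walks (HO X) a b"
        then have x: "x \<in> walks X a b" by simp
        show "gmap (\<Psi> Y o[D.GV] D.TA (HA f)) a b o[W] s (HO X) x = gmap (HA (C.TA f) o[D.GV] \<Psi> X) a b o[W] s (HO X) x"
          using coherence_naturality[OF f x] nat[OF path_map_hom(2)[OF f x]] by simp
      qed
      then show "\<Psi> Y o[D.GV] far (fcomp C.GV (mnd_fun S) ?GH) f = far (fcomp C.GV ?GH (mnd_fun T)) f o[D.GV] \<Psi> X"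
        using f by (simp add: hom_iff)
    qed
  next
    fix X assume "X \<in> Obj C.GV"
    then have X: "is_graph small V X" by (simp add: gcat_simps)
    note HX = H.push_graph[OF X] and H\<eta> = H.graph_fun_simps[OF C.\<eta>_hom[OF X]] and H\<mu> = H.graph_fun_simps[OF C.\<mu>_hom[OF X]]
    have "\<Psi> X o[D.GV] D.\<eta> (HO X) = HA (C.\<eta> X)"
    proof (rule gmor_eqI[OF D.GV.Cmp_hom[OF D.\<eta>_hom[OF HX] \<Psi>_hom[OF X]] H\<eta>(1)])
      show "gfun (\<Psi> X o[D.GV] D.\<eta> (HO X)) a = gfun (HA (C.\<eta> X)) a" if "a \<in> gobj (HO X)" for a
        using that X HX by (simp add: graph_cmp(1)[OF D.\<eta>_hom[OF HX]] H\<eta>(2) \<Psi>_fun)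
      fix a b assume "a \<in> gobj (HO X)" "b \<in> gobj (HO X)"
      then have a: "a \<in> gobj X" and b: "b \<in> gobj X" by simp_all
      show "gmap (\<Psi> X o[D.GV] D.\<eta> (HO X)) a b = gmap (HA (C.\<eta> X)) a b"
        unfolding coherence_unit[OF X a b] L.coherence_unit[OF is_graph_hom[OF X a b]] ..
    qed
    then show "\<Psi> X o[D.GV] D.\<eta> (fob ?GH X) = HA (C.\<eta> X)" by (simp add: H.graph_fun_ob[OF X])
    have "\<Psi> X o[D.GV] D.\<mu> (HO X) = HA (C.\<mu> X) o[D.GV] (\<Psi> (C.TO X) o[D.GV] D.TA (\<Psi> X))"
    proof (rule D.TT_gmor_eqI[OF HX D.GV.Cmp_hom[OF D.\<mu>_hom[OF HX] \<Psi>_hom[OF X]]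
      D.GV.Cmp_hom[OF D.GV.Cmp_hom[OF D.T_mor[OF \<Psi>_hom[OF X]] \<Psi>_hom[OF C.T_graph[OF X]]] H\<mu>(1)]])
      show "gfun (\<Psi> X o[D.GV] D.\<mu> (HO X)) a = gfun (HA (C.\<mu> X) o[D.GV] (\<Psi> (C.TO X) o[D.GV] D.TA (\<Psi> X))) a"
        if "a \<in> gobj (HO X)" for a
        using that X HX D.T_graph[OF HX] C.T_graph[OF X]
        by (simp add: graph_cmp(1)[OF D.\<mu>_hom[OF HX]] graph_cmp(1)[OF D.T_mor[OF \<Psi>_hom[OF X]]]
          graph_cmp(1)[OF D.GV.Cmp_hom[OF D.T_mor[OF \<Psi>_hom[OF X]] \<Psi>_hom[OF C.T_graph[OF X]]]]
          H\<mu>(2) \<Psi>_fun D.gfun_T[OF \<Psi>_hom[OF X]])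
      fix a b y xs assume "y \<in> walks (HO X) a b" "xs \<in> refined (HO X) y"
      then have y: "y \<in> walks X a b" and xs: "xs \<in> refined X y" by simp_all
      show "gmap (\<Psi> X o[D.GV] D.\<mu> (HO X)) a b o[W] (s (D.TO (HO X)) y o[W] mt_ar F (map (s (HO X)) xs)) =
        gmap (HA (C.\<mu> X) o[D.GV] (\<Psi> (C.TO X) o[D.GV] D.TA (\<Psi> X))) a b o[W] (s (D.TO (HO X)) y o[W] mt_ar F (map (s (HO X)) xs))"
        using coherence_mult(1)[OF X y xs] coherence_mult(2)[OF X y xs nat] L.coherence_sub[OF path_seq_Obj_refinement[OF X xs]] by simp
    qed
    then show "\<Psi> X o[D.GV] D.\<mu> (fob ?GH X) = HA (C.\<mu> X) o[D.GV] (\<Psi> (C.TO X) o[D.GV] D.TA (\<Psi> X))"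
      by (simp add: H.graph_fun_ob[OF X])
  qed
qed

text \<open>The equations are read at canonical paths of graphs of sequences, where H of the
  comparison map can be cancelled.\<close>

lemma lax_of_monad_functor:
  assumes M: "is_graph_monad_functor small V T W S H \<Psi>" shows "is_lax_monoidal V E W F H \<psi>"
proof -
  interpret M: is_graph_monad_functor small V T W S H \<Psi> by (rule M)
  interpret N: nat_trans C.GV D.GV "fcomp C.GV (mnd_fun S) (graph_fun small V H)" "fcomp C.GV (graph_fun small V H) (mnd_fun T)" \<Psi>
    by (rule M.coherence_natural)
  interpret SV: category "seq_cat V" by (rule category_seq_cat) (rule C.category_axioms)
  have canon: "C.canon (length Z) \<in> walks (C.seq Z) (\<nu> 0) (\<nu> (length Z))" for Z using C.canon_paths by simp
  have nat: "\<psi> B o[W] mt_ar F (map (far H) f) = far H (mt_ar E f) o[W] \<psi> A" if f: "f \<in> hom (seq_cat V) A B" for f A B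
  proof -
    have A: "A \<in> seqs V" and B: "B \<in> seqs V" using SV.hom_Obj[OF f] by simp_all
    note m = C.seq_mor_canon[OF f]
    have "\<Psi> (C.seq B) o[D.GV] D.TA (HA (seq_mor \<nu> V A (C.seq B) \<nu> f)) = HA (C.TA (seq_mor \<nu> V A (C.seq B) \<nu> f)) o[D.GV] \<Psi> (C.seq A)"
      using N.naturality[OF m(1)] m(1) by (simp add: hom_iff)
    then have eq: "far H (C.tc B) o[W] (\<psi> B o[W] mt_ar F (map (far H) f)) = far H (C.tc B) o[W] (far H (mt_ar E f) o[W] \<psi> A)"
      using coherence_naturality[OF m(1) canon] by (simp add: m(2,3))
    show ?thesis
      by (rule Htc_cancel[OF B D.Cmp_hom[OF D.E_hom'[OF H.seq_map_hom[OF f]] \<psi>_hom[OF B]]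
        D.Cmp_hom[OF \<psi>_hom[OF A] H.far_hom[OF C.E_hom'[OF f]]] eq])
  qed
  show ?thesis
  proof (rule is_lax_monoidal.intro)
    show "is_functor V W H" by (rule H.is_functor_axioms)
    show "nat_trans (seq_cat V) W (fcomp (seq_cat V) (mt_fun F) (seq_fun V H)) (fcomp (seq_cat V) H (mt_fun E)) \<psi>"
    proof (rule nat_transI[OF H.source_seq_functor[OF D.list_functor_axioms] H.target_seq_functor[OF C.list_functor_axioms]])
      show "\<psi> \<in> extensional (Obj (seq_cat V))" using \<psi>_ext by simp
      show "\<psi> Z \<in> hom W (fob (fcomp (seq_cat V) (mt_fun F) (seq_fun V H)) Z) (fob (fcomp (seq_cat V) H (mt_fun E)) Z)"
        if "Z \<in> Obj (seq_cat V)" for Z using \<psi>_hom[of Z] that by (simp add: seq_fun_def)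
      show "\<psi> B o[W] far (fcomp (seq_cat V) (mt_fun F) (seq_fun V H)) f = far (fcomp (seq_cat V) H (mt_fun E)) f o[W] \<psi> A"
        if f: "f \<in> hom (seq_cat V) A B" for f A B
        using nat[OF f] f by (simp add: hom_iff seq_fun_def)
    qed
  next
    fix Z assume Z: "Z \<in> Obj V"
    then have Z1: "[Z] \<in> seqs V" by simp
    note X = C.seq_graph[OF Z1]
    have X': "C.seq [Z] \<in> Obj C.GV" using X by (simp add: gcat_simps)
    have \<nu>: "\<nu> 0 \<in> gobj (C.seq [Z])" "\<nu> 1 \<in> gobj (C.seq [Z])" by auto
    have g: "ghom (C.seq [Z]) (\<nu> 0) (\<nu> 1) = Z" using C.ghom_seq(1)[of 0 "[Z]"] by simp
    have c: "C.canon (length [Z]) = [\<nu> 0, \<nu> 1]" by (simp add: C.canon_def)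
    have HZ: "fob H Z \<in> Obj W" by (rule H.fob_Obj[OF Z])
    have "far H (C.tc [Z]) o[W] (\<psi> [Z] o[W] mt_unit F (fob H Z)) = far H (C.tc [Z]) o[W] far H (mt_unit E Z)"
      using coherence_unit[OF X \<nu>] M.coherence_unit[OF X'] unfolding g c by (simp add: H.graph_fun_ob[OF X])
    then show "\<psi> [Z] o[W] mt_unit F (fob H Z) = far H (mt_unit E Z)"
      using D.Cmp_hom[OF D.u_hom[OF HZ]] \<psi>_hom[OF Z1]
      by (intro Htc_cancel[OF Z1 _ H.far_hom[OF C.u_hom[OF Z]]]) simp_all
  next
    fix Zss assume Zss: "Zss \<in> lists (seqs V)"
    let ?HZ = "map (map (fob H)) Zss"
    let ?F = "map (mt_ob F) ?HZ"
    have cZ: "concat Zss \<in> seqs V" by (rule concat_lists[OF Zss])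
    note X = C.seq_graph[OF cZ]
    have X': "C.seq (concat Zss) \<in> Obj C.GV" using X by (simp add: gcat_simps)
    have "path_seq (C.seq (concat Zss)) (C.canon (length (concat Zss))) = concat Zss" by simp
    from path_split[OF canon this] obtain y xs where y: "y \<in> paths (gobj (C.seq (concat Zss))) (\<nu> 0) (\<nu> (length (concat Zss)))"
      and xs: "xs \<in> refinements (gobj (C.seq (concat Zss))) y" and pc: "path_concat (\<nu> 0) xs = C.canon (length (concat Zss))"
      and ps: "map (path_seq (C.seq (concat Zss))) xs = Zss" by blast
    have EZss: "map (mt_ob E) Zss \<in> seqs V" by (rule map_lists[OF Zss C.E_ob])
    have HZss: "map (map (fob H)) Zss \<in> lists (seqs W)" by (rule map_lists[OF Zss H_seq])
    have F\<psi>: "mt_ar F (map \<psi> Zss) \<in> hom W (mt_ob F ?F) (mt_ob F (map (fob H) (map (mt_ob E) Zss)))"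
      using D.E_map_hom_set[of Zss \<psi> "\<lambda>Z. mt_ob F (map (fob H) Z)" "\<lambda>Z. fob H (mt_ob E Z)"] \<psi>_hom Zss by (auto simp: comp_def)
    have sF: "mt_sub F ?HZ \<in> hom W (mt_ob F ?F) (mt_ob F (map (fob H) (concat Zss)))"
      using D.\<sigma>_hom[OF HZss] by (simp add: map_concat)
    have l: "\<psi> (concat Zss) o[W] mt_sub F ?HZ \<in> hom W (mt_ob F ?F) (fob H (mt_ob E (concat Zss)))"
      by (rule D.Cmp_hom[OF sF \<psi>_hom[OF cZ]])
    have r: "far H (mt_sub E Zss) o[W] (\<psi> (map (mt_ob E) Zss) o[W] mt_ar F (map \<psi> Zss)) \<in> hom W (mt_ob F ?F) (fob H (mt_ob E (concat Zss)))"
      by (rule D.Cmp_hom[OF D.Cmp_hom[OF F\<psi> \<psi>_hom[OF EZss]] H.far_hom[OF C.\<sigma>_hom[OF Zss]]])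
    show "\<psi> (concat Zss) o[W] mt_sub F ?HZ = far H (mt_sub E Zss) o[W] (\<psi> (map (mt_ob E) Zss) o[W] mt_ar F (map \<psi> Zss))"
      by (rule Htc_cancel[OF cZ l r])
        (use coherence_mult(1)[OF X y xs] coherence_mult(2)[OF X y xs nat] M.coherence_mult[OF X'] in
        \<open>simp add: ps pc H.graph_fun_ob[OF X]\<close>)
  qed
qed

lemma lax_iff: "is_lax_monoidal V E W F H \<psi> \<longleftrightarrow> is_graph_monad_functor small V T W S H \<Psi>"
  using monad_functor_of_lax lax_of_monad_functor by blast

lemma \<Psi>_unique: "corresponds small V E T t W F S s H \<psi> \<Psi>' \<Longrightarrow> \<Psi>' = \<Psi>"
proof -
  assume c: "corresponds small V E T t W F S s H \<psi> \<Psi>'"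
  interpret P: corresponding small \<nu> V E T t W F S s H \<psi> \<Psi>' by unfold_locales (rule c)
  show ?thesis
  proof (rule extensionalityI[OF P.\<Psi>_ext \<Psi>_ext])
    fix X assume "X \<in> Obj C.GV"
    then have X: "is_graph small V X" by (simp add: gcat_simps)
    show "\<Psi>' X = \<Psi> X"
      by (rule D.T_gmor_eqI[OF H.push_graph[OF X] P.\<Psi>_hom[OF X] \<Psi>_hom[OF X]])
        (simp_all add: \<Psi>_fun[OF X] P.\<Psi>_fun[OF X] \<Psi>_s[OF X] P.\<Psi>_s[OF X])
  qed
qed

lemma \<psi>_unique: "corresponds small V E T t W F S s H \<psi>' \<Psi> \<Longrightarrow> \<psi>' = \<psi>"
proof -
  assume c: "corresponds small V E T t W F S s H \<psi>' \<Psi>"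
  interpret P: corresponding small \<nu> V E T t W F S s H \<psi>' \<Psi> by unfold_locales (rule c)
  show ?thesis
  proof (rule extensionalityI[OF P.\<psi>_ext \<psi>_ext])
    fix Z assume Z: "Z \<in> seqs V"
    have "C.canon (length Z) \<in> walks (C.seq Z) (\<nu> 0) (\<nu> (length Z))" using C.canon_paths by simp
    from \<Psi>_s[OF C.seq_graph[OF Z] this] P.\<Psi>_s[OF C.seq_graph[OF Z] this]
    show "\<psi>' Z = \<psi> Z" by (intro Htc_cancel[OF Z P.\<psi>_hom[OF Z] \<psi>_hom[OF Z]]) simp
  qed
qed

end

section \<open>Existence of corresponding coherence data\<close>

context comparison_functor
begin

text \<open>Every path is the image of a canonical path under its path morphism, so naturality of
  \<Psi> there spreads the equation from sequences to all graphs.\<close>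

lemma correspondsI_seq:
  assumes \<psi>: "\<psi> \<in> extensional (seqs V)" "\<And>Z. Z \<in> seqs V \<Longrightarrow> \<psi> Z \<in> hom W (mt_ob F (map (fob H) Z)) (fob H (mt_ob E Z))"
    and \<Psi>: "\<Psi> \<in> extensional (Obj C.GV)"
  "\<And>X. is_graph small V X \<Longrightarrow> \<Psi> X \<in> hom D.GV (D.TO (HO X)) (HO (C.TO X))"
  "\<And>X. is_graph small V X \<Longrightarrow> gfun (\<Psi> X) = (\<lambda>a\<in>gobj X. a)"
  "\<And>f X Y. f \<in> hom C.GV X Y \<Longrightarrow> \<Psi> Y o[D.GV] D.TA (HA f) = HA (C.TA f) o[D.GV] \<Psi> X"
    and eq: "\<And>Z. Z \<in> seqs V \<Longrightarrow>
  gmap (\<Psi> (C.seq Z)) (\<nu> 0) (\<nu> (length Z)) o[W] s (HO (C.seq Z)) (C.canon (length Z)) = far H (C.tc Z) o[W] \<psi> Z"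
  shows "corresponds small V E T t W F S s H \<psi> \<Psi>"
  unfolding corresponds_def
proof (intro conjI ballI allI impI)
  fix X a b x assume X: "is_graph small V X" and x: "x \<in> walks X a b"
  let ?Z = "path_seq X x" and ?p = "path_mor \<nu> V X x" and ?n = "length x - 1"
  let ?S = "C.seq ?Z"
  let ?e = "\<nu> 0"
  let ?Pn = "gmap (\<Psi> ?S) ?e (\<nu> ?n)"
  let ?Tp = "gmap (C.TA ?p) ?e (\<nu> ?n)"
  let ?c = "s (HO ?S) (C.canon ?n)"
  have Z: "?Z \<in> seqs V" by (rule path_seq_Obj[OF X x])
  note p = C.path_mor_hom[OF X x] and S = C.seq_graph[OF Z]
  note Hp = H.graph_fun_simps[OF p] and HTp = H.graph_fun_simps[OF C.T_mor[OF p]]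
  have x0: "x \<noteq> []" using x by (simp add: paths_def)
  have pe: "gfun ?p ?e = a" "gfun ?p (\<nu> ?n) = b"
    using C.path_mor_simps(1)[OF x] x x0 by (auto simp: paths_iff)
  have c: "C.canon ?n \<in> walks ?S ?e (\<nu> ?n)" using C.canon_paths by simp
  have \<nu>: "\<nu> 0 \<in> gobj ?S" "\<nu> ?n \<in> gobj ?S" by auto
  have ab: "a \<in> gobj X" "b \<in> gobj X" using paths_ends[OF x] by simp_all
  have HZ: "map (fob H) ?Z \<in> seqs W" by (rule H_seq[OF Z])
  have idH: "map (far H) (map (Idt V) ?Z) = map (Idt W) (map (fob H) ?Z)" using Z H.far_Idt by auto
  note sx = s_hom[OF X x]
  have sc: "?c \<in> hom W (mt_ob F (map (fob H) ?Z)) (ghom (D.TO (HO ?S)) ?e (\<nu> ?n))"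
    using s_hom[OF S c] C.path_seq_canon[of ?Z] by simp
  have SHp: "gmap (D.TA (HA ?p)) ?e (\<nu> ?n) \<in> hom W (ghom (D.TO (HO ?S)) ?e (\<nu> ?n)) (ghom (D.TO (HO X)) a b)"
    using D.T_map[OF Hp(1), of "?e" "\<nu> ?n"] \<nu> by (simp add: Hp(2) pe[simplified])
  \<comment> \<open>The map s at x is obtained from s at the canonical path by naturality along H of
    the path morphism; the factor under F is a list of identities and vanishes.\<close>
  have 1: "gmap (D.TA (HA ?p)) ?e (\<nu> ?n) o[W] ?c = s (HO X) x"
  proof -
    have c': "C.canon ?n \<in> paths (gobj (HO ?S)) ?e (\<nu> ?n)" using c by simp
    have pm: "path_map (HA ?p) (C.canon ?n) = map (Idt W) (map (fob H) ?Z)"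
      unfolding H.path_map_push[OF p c] C.path_mor_simps(4)[OF x] by (rule idH)
    have gm: "map (gfun (HA ?p)) (C.canon ?n) = x" unfolding Hp(2) by (rule C.path_mor_simps(3)[OF x])
    have "gmap (D.TA (HA ?p)) ?e (\<nu> ?n) o[W] ?c = s (HO X) x o[W] Idt W (mt_ob F (map (fob H) ?Z))"
      unfolding D.t_nat[OF Hp(1) c'] pm gm D.E_Idt[OF HZ] ..
    then show ?thesis using sx by (simp add: hom_iff)
  qed
  have PX: "gmap (\<Psi> X) a b \<in> hom W (ghom (D.TO (HO X)) a b) (fob H (ghom (C.TO X) a b))"
    using gmor_hom(7)[OF \<Psi>(2)[OF X], of a b] H.push_graph[OF X] ab X by (simp add: \<Psi>(3)[OF X] ghom_push)
  have PS: "?Pn \<in> hom W (ghom (D.TO (HO ?S)) ?e (\<nu> ?n)) (fob H (ghom (C.TO ?S) ?e (\<nu> ?n)))"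
    using gmor_hom(7)[OF \<Psi>(2)[OF S], of "?e" "\<nu> ?n"] H.push_graph[OF S] \<nu> S by (simp add: \<Psi>(3)[OF S] ghom_push)
  note Tp = C.T_map[OF p \<nu>, unfolded pe]
  note HTp' = H.far_hom[OF Tp]
  have tc: "C.tc ?Z \<in> hom V (mt_ob E ?Z) (ghom (C.TO ?S) ?e (\<nu> ?n))" using C.tc_hom[OF Z] by simp
  have "gmap (\<Psi> X) a b o[W] s (HO X) x = (gmap (\<Psi> X) a b o[W] gmap (D.TA (HA ?p)) ?e (\<nu> ?n)) o[W] ?c"
    unfolding 1[symmetric] using PX SHp sc by (simp add: hom_iff D.assoc)
  also have "gmap (\<Psi> X) a b o[W] gmap (D.TA (HA ?p)) ?e (\<nu> ?n) = gmap (HA (C.TA ?p)) ?e (\<nu> ?n) o[W] ?Pn"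
    using arg_cong[OF \<Psi>(4)[OF p], of "\<lambda>f. gmap f ?e (\<nu> ?n)"] \<nu> S H.push_graph[OF S]
    by (simp add: graph_cmp(2)[OF D.T_mor[OF Hp(1)]] graph_cmp(2)[OF \<Psi>(2)[OF S]] D.gfun_T[OF Hp(1)] Hp(2) pe[simplified] \<Psi>(3)[OF S])
  also have "gmap (HA (C.TA ?p)) ?e (\<nu> ?n) = far H ?Tp"
    using HTp(3)[of "?e" "\<nu> ?n"] \<nu> S by simp
  also have "(far H ?Tp o[W] ?Pn) o[W] ?c =
    far H ?Tp o[W] (?Pn o[W] ?c)"
    using HTp' PS sc by (simp add: hom_iff D.assoc)
  also have "?Pn o[W] ?c = far H (C.tc ?Z) o[W] \<psi> ?Z"
    using eq[OF Z] by simp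
  also have "far H ?Tp o[W] (far H (C.tc ?Z) o[W] \<psi> ?Z) = (far H ?Tp o[W] far H (C.tc ?Z)) o[W] \<psi> ?Z"
    using HTp' H.far_hom[OF tc] \<psi>(2)[OF Z] by (simp add: hom_iff D.assoc)
  also have "far H ?Tp o[W] far H (C.tc ?Z) = far H (t X x)"
    using H.far_Cmp[OF tc Tp] C.t_path_mor[OF X x] by simp
  finally show "gmap (\<Psi> X) a b o[W] s (HO X) x = far H (t X x) o[W] \<psi> ?Z" .
qed (use assms in auto)

text \<open>\<psi> is forced by the equation at canonical paths: it is \<Psi> after s, followed by H
  of the inverse of \<open>tc\<close>. The rest is \<open>correspondsI_seq\<close>.\<close>

lemma \<psi>_exists:
  assumes \<Psi>: "\<Psi> \<in> extensional (Obj C.GV)"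
  "\<And>X. is_graph small V X \<Longrightarrow> \<Psi> X \<in> hom D.GV (D.TO (HO X)) (HO (C.TO X))"
  "\<And>X. is_graph small V X \<Longrightarrow> gfun (\<Psi> X) = (\<lambda>a\<in>gobj X. a)"
  "\<And>f X Y. f \<in> hom C.GV X Y \<Longrightarrow> \<Psi> Y o[D.GV] D.TA (HA f) = HA (C.TA f) o[D.GV] \<Psi> X"
  shows "\<exists>\<psi>. corresponds small V E T t W F S s H \<psi> \<Psi>"
proof -
  have "\<exists>r. r \<in> hom V (C.Tbar Z) (mt_ob E Z) \<and> C.tc Z o[V] r = Idt V (C.Tbar Z)" if "Z \<in> seqs V" for Z
    using C.tc_iso[OF that] by (auto simp: is_iso_def)
  then have "\<forall>Z\<in>seqs V. \<exists>r. r \<in> hom V (C.Tbar Z) (mt_ob E Z) \<and> C.tc Z o[V] r = Idt V (C.Tbar Z)" by blast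
  from bchoice[OF this] obtain r where r: "\<And>Z. Z \<in> seqs V \<Longrightarrow> r Z \<in> hom V (C.Tbar Z) (mt_ob E Z)"
    "\<And>Z. Z \<in> seqs V \<Longrightarrow> C.tc Z o[V] r Z = Idt V (C.Tbar Z)" by blast
  let ?P = "\<lambda>Z. gmap (\<Psi> (C.seq Z)) (\<nu> 0) (\<nu> (length Z)) o[W] s (HO (C.seq Z)) (C.canon (length Z))"
  have P: "?P Z \<in> hom W (mt_ob F (map (fob H) Z)) (fob H (C.Tbar Z))" if Z: "Z \<in> seqs V" for Z
  proof -
    note X = C.seq_graph[OF Z]
    have c: "C.canon (length Z) \<in> walks (C.seq Z) (\<nu> 0) (\<nu> (length Z))" using C.canon_paths by simp
    show ?thesis
      using D.Cmp_hom[OF s_hom[OF X c]] gmor_hom(7)[OF \<Psi>(2)[OF X], of "\<nu> 0" "\<nu> (length Z)"] H.push_graph[OF X] X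
      by (simp add: \<Psi>(3)[OF X] ghom_push)
  qed
  have "corresponds small V E T t W F S s H (\<lambda>Z\<in>seqs V. far H (r Z) o[W] ?P Z) \<Psi>"
  proof (rule correspondsI_seq[OF _ _ \<Psi>])
    show "(\<lambda>Z\<in>seqs V. far H (r Z) o[W] ?P Z) Z \<in> hom W (mt_ob F (map (fob H) Z)) (fob H (mt_ob E Z))"
      if "Z \<in> seqs V" for Z
      using D.Cmp_hom[OF P[OF that] H.far_hom[OF r(1)[OF that]]] that by simp
    fix Z assume Z: "Z \<in> seqs V"
    have T: "C.Tbar Z \<in> Obj V" using C.hom_Obj[OF C.tc_hom[OF Z]] by blast
    have "far H (C.tc Z) o[W] far H (r Z) = Idt W (fob H (C.Tbar Z))"
      using H.far_Cmp[OF r(1)[OF Z] C.tc_hom[OF Z]] r(2)[OF Z] H.far_Idt[OF T] by simp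
    then have "far H (C.tc Z) o[W] (far H (r Z) o[W] ?P Z) = ?P Z"
      using P[OF Z] H.far_hom[OF r(1)[OF Z]] H.far_hom[OF C.tc_hom[OF Z]] by (simp add: hom_iff flip: D.assoc)
    then show "?P Z = far H (C.tc Z) o[W] (\<lambda>Z\<in>seqs V. far H (r Z) o[W] ?P Z) Z" using Z by simp
  qed auto
  then show ?thesis by blast
qed

text \<open>The composites of \<psi> with H of t form a cocone on the summands of S(HX)(a, b), and
  \<Psi> is the induced map, hom by hom. Naturality is a separate matter, settled later together
  with the laws.\<close>

lemma \<Psi>_exists:
  assumes \<psi>: "\<psi> \<in> extensional (seqs V)" "\<And>Z. Z \<in> seqs V \<Longrightarrow> \<psi> Z \<in> hom W (mt_ob F (map (fob H) Z)) (fob H (mt_ob E Z))"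
  shows "\<exists>\<Psi>. corresponds small V E T t W F S s H \<psi> \<Psi>"
proof -
  let ?k = "\<lambda>X a b. SOME h. h \<in> hom W (ghom (D.TO (HO X)) a b) (fob H (ghom (C.TO X) a b)) \<and>
    (\<forall>x\<in>walks X a b. h o[W] s (HO X) x = far H (t X x) o[W] \<psi> (path_seq X x))"
  have k: "?k X a b \<in> hom W (ghom (D.TO (HO X)) a b) (fob H (ghom (C.TO X) a b)) \<and>
    (\<forall>x\<in>walks X a b. ?k X a b o[W] s (HO X) x = far H (t X x) o[W] \<psi> (path_seq X x))"
    if X: "is_graph small V X" and a: "a \<in> gobj X" and b: "b \<in> gobj X" for X a b
  proof -
    note HX = H.push_graph[OF X]
    have g: "fob H (ghom (C.TO X) a b) \<in> Obj W"
      using H.fob_Obj[OF is_graph_hom[OF C.T_graph[OF X]]] a b X by simp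
    have cp: "is_coproduct W (walks X a b) (\<lambda>x. mt_ob F (path_seq (HO X) x)) (ghom (D.TO (HO X)) a b) (s (HO X))"
      using D.t_coproduct[OF HX, of a b] a b by simp
    have f: "far H (t X x) o[W] \<psi> (path_seq X x) \<in> hom W (mt_ob F (path_seq (HO X) x)) (fob H (ghom (C.TO X) a b))"
      if x: "x \<in> walks X a b" for x
      using D.Cmp_hom[OF \<psi>(2)[OF path_seq_Obj[OF X x]] Ht_hom[OF X x]] by (simp add: path_seq_push[OF x])
    have "\<exists>h. h \<in> hom W (ghom (D.TO (HO X)) a b) (fob H (ghom (C.TO X) a b)) \<and>
      (\<forall>x\<in>walks X a b. h o[W] s (HO X) x = far H (t X x) o[W] \<psi> (path_seq X x))"
      using D.coproduct_copair[OF cp g, of "\<lambda>x. far H (t X x) o[W] \<psi> (path_seq X x)", OF f] by blast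
    from someI_ex[OF this] show ?thesis .
  qed
  let ?\<Psi> = "\<lambda>X\<in>Obj C.GV. mk_gmor (D.TO (HO X)) (HO (C.TO X)) (\<lambda>a. a) (?k X)"
  have "corresponds small V E T t W F S s H \<psi> ?\<Psi>"
    unfolding corresponds_def
  proof (intro conjI ballI allI impI)
    fix X assume X: "is_graph small V X"
    then have X': "X \<in> Obj C.GV" by (simp add: gcat_simps)
    note HX = H.push_graph[OF X]
    have "mk_gmor (D.TO (HO X)) (HO (C.TO X)) (\<lambda>a. a) (?k X) \<in> hom D.GV (D.TO (HO X)) (HO (C.TO X))"
      by (rule mk_gmor_hom) (use X HX H.push_graph[OF C.T_graph[OF X]] k[OF X] in \<open>simp_all add: ghom_push\<close>)
    then show "?\<Psi> X \<in> hom D.GV (D.TO (HO X)) (HO (C.TO X))" using X' by simp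
    show "gfun (?\<Psi> X) = (\<lambda>a\<in>gobj X. a)" using X' HX by (simp add: mk_gmor_def)
    show "gmap (?\<Psi> X) a b o[W] s (HO X) x = far H (t X x) o[W] \<psi> (path_seq X x)" if x: "x \<in> walks X a b" for a b x
      using k[OF X, of a b] paths_ends[OF x] X' HX x by simp
  qed (use \<psi> in auto)
  then show ?thesis by blast
qed

end

section \<open>Composites and identities of corresponding data\<close>

lemma push_comp:
  assumes "is_graph small V X" "is_functor V W H" "is_functor W U K"
  shows "graph_push (fcomp V K H) X = graph_push K (graph_push H X)"
proof -
  interpret H: is_functor V W H by fact
  interpret K: is_functor W U K by fact
  interpret KH: is_functor V U "fcomp V K H" by (rule fcomp_functor) fact+
  show ?thesis
    by (rule graph_eqI[OF KH.push_graph[OF assms(1)] K.push_graph[OF H.push_graph[OF assms(1)]]])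
      (simp_all add: ghom_push is_graph_hom[OF assms(1)])
qed

lemma push_fid:
  assumes "category V" "is_graph small V X" shows "graph_push (fid V) X = X"
proof -
  interpret I: is_functor V V "fid V" by (rule fid_functor) fact
  show ?thesis
    by (rule graph_eqI[OF I.push_graph[OF assms(2)] assms(2)]) (simp_all add: ghom_push is_graph_hom[OF assms(2)])
qed

lemma graph_fun_fid:
  assumes "category V" "f \<in> hom (graph_cat small V) X Y" shows "far (graph_fun small V (fid V)) f = f"
proof -
  interpret I: is_functor V V "fid V" by (rule fid_functor) fact
  note X = gmor_hom(1)[OF assms(2)] and Y = gmor_hom(2)[OF assms(2)]
  have "far (graph_fun small V (fid V)) f \<in> hom (graph_cat small V) X Y"
    using I.graph_fun_simps(1)[OF assms(2)] by (simp add: push_fid[OF assms(1) X] push_fid[OF assms(1) Y])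
  then show ?thesis
    by (rule gmor_eqI[OF _ assms(2)])
      (use gmor_hom(7)[OF assms(2)] in \<open>simp_all add: I.graph_fun_simps(2,3)[OF assms(2)] hom_iff\<close>)
qed

text \<open>On the cocone of r, \<Theta> at HX gives K of s after \<kappa>; then K of the equation
  for \<Psi> replaces \<Psi> after s by H of t after \<psi>.\<close>

lemma corresponds_comp:
  assumes c1: "comparison small \<nu> V E T t" and c2: "comparison small \<nu> W F S s" and c3: "comparison small \<nu> U G R r"
    and H: "is_functor V W H" and K: "is_functor W U K"
    and cH: "corresponds small V E T t W F S s H \<psi> \<Psi>" and cK: "corresponds small W F S s U G R r K \<kappa> \<Theta>"
  shows "corresponds small V E T t U G R r (fcomp V K H)
    (\<lambda>Z\<in>seqs V. far K (\<psi> Z) o[U] \<kappa> (map (fob H) Z))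
    (\<lambda>X\<in>Obj (graph_cat small V). far (graph_fun small W K) (\<Psi> X) o[graph_cat small U] \<Theta> (fob (graph_fun small V H) X))"
proof -
  interpret C1: comparison small \<nu> V E T t by (rule c1)
  interpret C2: comparison small \<nu> W F S s by (rule c2)
  interpret C3: comparison small \<nu> U G R r by (rule c3)
  let ?T = "\<lambda>X\<in>Obj C1.GV. far (graph_fun small W K) (\<Psi> X) o[C3.GV] \<Theta> (fob (graph_fun small V H) X)" and ?c = "\<lambda>Z\<in>seqs V. far K (\<psi> Z) o[U] \<kappa> (map (fob H) Z)"
  interpret H: is_functor V W H by (rule H)
  interpret K: is_functor W U K by (rule K)
  interpret KH: is_functor V U "fcomp V K H" by (rule fcomp_functor[OF H K])
  interpret PH: corresponding small \<nu> V E T t W F S s H \<psi> \<Psi> by unfold_locales (rule cH)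
  interpret PK: corresponding small \<nu> W F S s U G R r K \<kappa> \<Theta> by unfold_locales (rule cK)
  show ?thesis unfolding corresponds_def
  proof (intro conjI ballI allI impI)
    fix Z assume Z: "Z \<in> seqs V"
    have "map (fob (fcomp V K H)) Z = map (fob K) (map (fob H) Z)" using Z by auto
    then show "?c Z \<in>
      hom U (mt_ob G (map (fob (fcomp V K H)) Z)) (fob (fcomp V K H) (mt_ob E Z))"
      using C3.Cmp_hom[OF PK.\<psi>_hom[OF PH.H_seq[OF Z]] K.far_hom[OF PH.\<psi>_hom[OF Z]]] Z C1.E_ob[OF Z]
      by (simp del: map_map)
  next
    fix X assume X: "is_graph small V X"
    then have X': "X \<in> Obj C1.GV" by (simp add: gcat_simps)
    note HX = H.push_graph[OF X] and TX = C1.T_graph[OF X]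
    note push = push_comp[OF X H K] push_comp[OF TX H K]
    let ?P = "far (graph_fun small W K) (\<Psi> X) o[C3.GV] \<Theta> (PH.HO X)"
    have e: "?T X = ?P"
      using X' by (simp add: H.graph_fun_ob[OF X])
    note PX = PH.\<Psi>_hom[OF X] and KX = PK.\<Psi>_hom[OF HX]
    note KPX = K.graph_fun_simps[OF PX]
    have P: "?P \<in> hom C3.GV (C3.TO (PK.HO (PH.HO X))) (PK.HO (PH.HO (C1.TO X)))"
      by (rule C3.GV.Cmp_hom[OF KX KPX(1)])
    then show "?T X \<in>
      hom C3.GV (C3.TO (graph_push (fcomp V K H) X)) (graph_push (fcomp V K H) (C1.TO X))"
      unfolding e push .
    have "gfun ?P = gfun (\<Theta> (PH.HO X))"
    proof (rule extensionalityI[of _ "gobj X"])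
      show "gfun ?P \<in> extensional (gobj X)" "gfun (\<Theta> (PH.HO X)) \<in> extensional (gobj X)"
        using P KX C3.gobj_T[OF K.push_graph[OF HX]] by (simp_all add: graph_hom_iff PiE_def)
      show "gfun ?P a = gfun (\<Theta> (PH.HO X)) a" if "a \<in> gobj X" for a
        using that C3.gobj_T[OF K.push_graph[OF HX]] HX
        by (simp add: graph_cmp(1)[OF KX] KPX(2) PK.\<Psi>_fun[OF HX] PH.\<Psi>_fun[OF X])
    qed
    then show "gfun (?T X) = (\<lambda>a\<in>gobj X. a)"
      unfolding e by (simp add: PK.\<Psi>_fun[OF HX])
    fix a b x assume x: "x \<in> walks X a b"
    have ab: "a \<in> gobj X" "b \<in> gobj X" using paths_ends[OF x] by simp_all
    have xH: "x \<in> walks (PH.HO X) a b" using x by simp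
    have psH: "path_seq (PH.HO X) x = map (fob H) (path_seq X x)" by (rule path_seq_push[OF x])
    have Z: "path_seq X x \<in> seqs V" by (rule path_seq_Obj[OF X x])
    have abH: "a \<in> gobj (PH.HO X)" "b \<in> gobj (PH.HO X)" "a \<in> gobj (C2.TO (PH.HO X))" "b \<in> gobj (C2.TO (PH.HO X))" using ab HX by simp_all
    note Km = PK.\<Psi>_map[OF HX abH(1,2)] and KPm = K.far_hom[OF PH.\<Psi>_map[OF X ab]] and rX = PK.s_hom[OF HX xH]
    note Ks = PK.Ht_hom[OF HX xH] and kp = PK.\<psi>_hom[OF PH.H_seq[OF Z]] and Kp = K.far_hom[OF PH.\<psi>_hom[OF Z]]
      and KHt = K.far_hom[OF PH.Ht_hom[OF X x]]
    have "gmap ?P a b = far K (gmap (\<Psi> X) a b) o[U] gmap (\<Theta> (PH.HO X)) a b"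
      using graph_cmp(2)[OF KX, of a b "far (graph_fun small W K) (\<Psi> X)"] ab HX C3.gobj_T[OF K.push_graph[OF HX]]
      by (simp add: KPX(3) PK.\<Psi>_fun[OF HX])
    then have "gmap ?P a b o[U] r (PK.HO (PH.HO X)) x = far K (gmap (\<Psi> X) a b) o[U] (gmap (\<Theta> (PH.HO X)) a b o[U] r (PK.HO (PH.HO X)) x)"
      using Km KPm rX by (simp add: hom_iff C3.assoc)
    also have "\<dots> = (far K (gmap (\<Psi> X) a b) o[U] far K (s (PH.HO X) x)) o[U] \<kappa> (map (fob H) (path_seq X x))"
      unfolding PK.\<Psi>_s[OF HX xH] psH using KPm Ks kp by (simp add: hom_iff C3.assoc psH)
    also have "far K (gmap (\<Psi> X) a b) o[U] far K (s (PH.HO X) x) = far K (far H (t X x)) o[U] far K (\<psi> (path_seq X x))"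
      using K.far_Cmp[OF PH.s_hom[OF X x] PH.\<Psi>_map[OF X ab]] K.far_Cmp[OF PH.\<psi>_hom[OF Z] PH.Ht_hom[OF X x]] PH.\<Psi>_s[OF X x] by simp
    also have "(far K (far H (t X x)) o[U] far K (\<psi> (path_seq X x))) o[U] \<kappa> (map (fob H) (path_seq X x)) =
      far (fcomp V K H) (t X x) o[U] (far K (\<psi> (path_seq X x)) o[U] \<kappa> (map (fob H) (path_seq X x)))"
      using KHt Kp kp C1.t_hom[OF X x] by (simp add: hom_iff C3.assoc)
    finally show "gmap (?T X) a b o[U] r (graph_push (fcomp V K H) X) x =
      far (fcomp V K H) (t X x) o[U] ?c (path_seq X x)"
      unfolding e push using Z by simp
  qed auto
qed

context comparison
begin

definition id_\<psi> :: "'o list \<Rightarrow> 'a" where "id_\<psi> = (\<lambda>Z\<in>seqs V. Idt V (mt_ob E Z))"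
definition id_\<Psi> :: "('u, 'o) graph \<Rightarrow> ('u, 'o, 'a) gmor" where "id_\<Psi> = (\<lambda>X\<in>Obj GV. Idt GV (TO X))"

lemma Idt_T_hom: "graph X \<Longrightarrow> Idt GV (TO X) \<in> hom GV (TO X) (TO X)"
  using GV.Idt_hom[of "TO X"] by (simp add: gcat_simps)

lemma gfun_Idt:
  assumes "graph X" shows "gfun (Idt GV X) = (\<lambda>a\<in>gobj X. a)"
  by (simp add: graph_cat_def mk_gmor_def)

text \<open>Two multitensors compared with one monad: the identity of T is natural, so
  \<open>\<psi>_exists\<close> turns it into coherence data on the identity functor. This is where
  the unit of the equivalence comes from.\<close>

lemma corresponds_same_monad:
  assumes "comparison small \<nu> V F T s" shows "\<exists>\<psi>. corresponds small V E T t V F T s (fid V) \<psi> id_\<Psi>"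
proof -
  interpret D: comparison small \<nu> V F T s by (rule assms)
  interpret H: is_functor V V "fid V" by (rule fid_functor) (rule category_axioms)
  interpret P: comparison_functor small \<nu> V E T t V F T s "fid V" by unfold_locales
  show ?thesis
  proof (rule P.\<psi>_exists)
    show "id_\<Psi> \<in> extensional (Obj GV)" by (simp add: id_\<Psi>_def)
    show "id_\<Psi> X \<in> hom GV (TO (P.HO X)) (P.HO (TO X))" "gfun (id_\<Psi> X) = (\<lambda>a\<in>gobj X. a)" if X: "graph X" for X
      using that Idt_T_hom[OF X] push_fid[OF category_axioms X] push_fid[OF category_axioms T_graph[OF X]]
      by (simp_all add: id_\<Psi>_def gcat_simps gfun_Idt)
    fix f X Y assume f: "f \<in> hom GV X Y"
    note X = gmor_hom(1)[OF f] and Y = gmor_hom(2)[OF f] and Tf = T_mor[OF f]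
    show "id_\<Psi> Y o[GV] TA (P.HA f) = P.HA (TA f) o[GV] id_\<Psi> X"
      using X Y GV.Idt_left[OF Tf] GV.Idt_right[OF Tf]
      by (simp add: id_\<Psi>_def gcat_simps graph_fun_fid[OF category_axioms f] graph_fun_fid[OF category_axioms Tf])
  qed
qed

text \<open>Two monads compared with one multitensor: the identity of E induces graph coherence data
  on the identity functor. This is where the counit comes from.\<close>

lemma corresponds_same_multitensor:
  assumes "comparison small \<nu> V E S s" shows "\<exists>\<Psi>. corresponds small V E T t V E S s (fid V) id_\<psi> \<Psi>"
proof -
  interpret D: comparison small \<nu> V E S s by (rule assms)
  interpret H: is_functor V V "fid V" by (rule fid_functor) (rule category_axioms)
  interpret P: comparison_functor small \<nu> V E T t V E S s "fid V" by unfold_locales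
  show ?thesis
  proof (rule P.\<Psi>_exists)
    show "id_\<psi> Z \<in> hom V (mt_ob E (map (fob (fid V)) Z)) (fob (fid V) (mt_ob E Z))" if "Z \<in> seqs V" for Z
    proof -
      have "map (fob (fid V)) Z = Z" using that by (auto intro!: map_idI)
      then show ?thesis using that E_ob[OF that] Idt_hom[OF E_ob[OF that]] by (simp add: id_\<psi>_def)
    qed
  qed (simp add: id_\<psi>_def)
qed

lemma corresponds_id: "corresponds small V E T t V E T t (fid V) id_\<psi> id_\<Psi>"
proof -
  interpret H: is_functor V V "fid V" by (rule fid_functor) (rule category_axioms)
  show ?thesis unfolding corresponds_def
  proof (intro conjI ballI allI impI)
    show "id_\<psi> Z \<in> hom V (mt_ob E (map (fob (fid V)) Z)) (fob (fid V) (mt_ob E Z))" if "Z \<in> seqs V" for Z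
    proof -
      have "map (fob (fid V)) Z = Z" using that by (auto intro!: map_idI)
      then show ?thesis using that E_ob[OF that] Idt_hom[OF E_ob[OF that]] by (simp add: id_\<psi>_def)
    qed
    fix X assume X: "graph X"
    show "id_\<Psi> X \<in> hom GV (TO (graph_push (fid V) X)) (graph_push (fid V) (TO X))" "gfun (id_\<Psi> X) = (\<lambda>a\<in>gobj X. a)"
      using X Idt_T_hom[OF X] push_fid[OF category_axioms X] push_fid[OF category_axioms T_graph[OF X]]
      by (simp_all add: id_\<Psi>_def gcat_simps gfun_Idt)
    fix a b x assume x: "x \<in> walks X a b"
    note tx = t_hom[OF X x]
    have ab: "a \<in> gobj (TO X)" "b \<in> gobj (TO X)" using paths_ends[OF x] X by simp_all
    show "gmap (id_\<Psi> X) a b o[V] t (graph_push (fid V) X) x = far (fid V) (t X x) o[V] id_\<psi> (path_seq X x)"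
      using X tx path_seq_Obj[OF X x]
      by (simp add: id_\<Psi>_def id_\<psi>_def gcat_simps graph_Idt(2)[OF ab] push_fid[OF category_axioms X] hom_iff)
  qed (simp_all add: id_\<psi>_def id_\<Psi>_def)
qed

end

text \<open>On the cocone of s both sides of the monad transformation law end in K of
  \<open>t X x\<close>, by naturality of \<phi> at \<open>t X x\<close>; what precedes are the two
  sides of the monoidal law at \<open>path_seq X x\<close>. One direction tests on all paths, the
  other cancels at canonical paths.\<close>

lemma trans_iff:
  assumes cH: "corresponding small \<nu> V E T t W F S s H \<psi> \<Psi>" and cK: "corresponding small \<nu> V E T t W F S s K \<kappa> \<Theta>"
  shows "is_monoidal_trans V E W F H \<psi> K \<kappa> \<phi> \<longleftrightarrow> is_graph_monad_trans small V T W S H \<Psi> K \<Theta> \<phi>"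
proof (cases "nat_trans V W H K \<phi>")
  case True
  interpret H: corresponding small \<nu> V E T t W F S s H \<psi> \<Psi> by (rule cH)
  interpret K: corresponding small \<nu> V E T t W F S s K \<kappa> \<Theta> by (rule cK)
  interpret N: nat_trans V W H K \<phi> by (rule True)
  let ?G = "graph_nat small V H K \<phi>"
  have G: "?G X \<in> hom H.D.GV (H.HO X) (K.HO X)" "gfun (?G X) = (\<lambda>a\<in>gobj X. a)"
    "\<lbrakk>a \<in> gobj X; b \<in> gobj X\<rbrakk> \<Longrightarrow> gmap (?G X) a b = \<phi> (ghom X a b)" if X: "is_graph small V X" for X a b
  proof -
    have e: "?G X = mk_gmor (H.HO X) (K.HO X) (\<lambda>a. a) (\<lambda>a b. \<phi> (ghom X a b))"
      using X by (simp add: graph_nat_def gcat_simps)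
    show "?G X \<in> hom H.D.GV (H.HO X) (K.HO X)"
      unfolding e using X H.H.push_graph K.H.push_graph N.component_hom is_graph_hom[OF X]
      by (intro mk_gmor_hom) (simp_all add: ghom_push)
    show "gfun (?G X) = (\<lambda>a\<in>gobj X. a)" unfolding e by (simp add: mk_gmor_def)
    show "\<lbrakk>a \<in> gobj X; b \<in> gobj X\<rbrakk> \<Longrightarrow> gmap (?G X) a b = \<phi> (ghom X a b)" unfolding e by simp
  qed
  have \<phi>Z: "map \<phi> Z \<in> hom (seq_cat W) (map (fob H) Z) (map (fob K) Z)" if "Z \<in> seqs V" for Z
    using that N.component_hom unfolding hom_seq_cat by (auto simp: in_lists_conv_set)
  have L: "gmap (?G (H.C.TO X) o[H.D.GV] \<Psi> X) a b o[W] s (H.HO X) x = far K (t X x) o[W] (\<phi> (mt_ob E (path_seq X x)) o[W] \<psi> (path_seq X x))"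
    if X: "is_graph small V X" and x: "x \<in> walks X a b" for X a b x
  proof -
    have ab: "a \<in> gobj X" "b \<in> gobj X" using paths_ends[OF x] by simp_all
    have abT: "a \<in> gobj (H.C.TO X)" "b \<in> gobj (H.C.TO X)" using ab X by simp_all
    note Z = path_seq_Obj[OF X x] and TX = H.C.T_graph[OF X]
    note p = H.\<Psi>_map[OF X ab] and f = N.component_hom[OF is_graph_hom[OF TX abT]] and sx = H.s_hom[OF X x]
      and Ht = H.Ht_hom[OF X x] and Kt = K.Ht_hom[OF X x] and pz = H.\<psi>_hom[OF Z] and fz = N.component_hom[OF H.C.E_ob[OF Z]]
    have "gmap (?G (H.C.TO X) o[H.D.GV] \<Psi> X) a b = \<phi> (ghom (H.C.TO X) a b) o[W] gmap (\<Psi> X) a b"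
      using graph_cmp(2)[OF H.\<Psi>_hom[OF X], of a b "?G (H.C.TO X)"] ab X H.H.push_graph[OF X]
      by (simp add: H.\<Psi>_fun[OF X] G(3)[OF TX])
    then have "gmap (?G (H.C.TO X) o[H.D.GV] \<Psi> X) a b o[W] s (H.HO X) x = \<phi> (ghom (H.C.TO X) a b) o[W] (gmap (\<Psi> X) a b o[W] s (H.HO X) x)"
      using p f sx by (simp add: hom_iff H.D.assoc)
    also have "\<dots> = (\<phi> (ghom (H.C.TO X) a b) o[W] far H (t X x)) o[W] \<psi> (path_seq X x)"
      unfolding H.\<Psi>_s[OF X x] using f Ht pz by (simp add: hom_iff H.D.assoc)
    also have "\<dots> = far K (t X x) o[W] (\<phi> (mt_ob E (path_seq X x)) o[W] \<psi> (path_seq X x))"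
      unfolding N.naturality[OF H.C.t_hom[OF X x]] using Kt fz pz by (simp add: hom_iff H.D.assoc)
    finally show ?thesis .
  qed
  \<comment> \<open>On this side naturality of s at the graph transformation moves \<phi> under
    F.\<close>
  have R: "gmap (\<Theta> X o[H.D.GV] H.D.TA (?G X)) a b o[W] s (H.HO X) x = far K (t X x) o[W] (\<kappa> (path_seq X x) o[W] mt_ar F (map \<phi> (path_seq X x)))"
    if X: "is_graph small V X" and x: "x \<in> walks X a b" for X a b x
  proof -
    have ab: "a \<in> gobj X" "b \<in> gobj X" using paths_ends[OF x] by simp_all
    note Z = path_seq_Obj[OF X x] and HX = H.H.push_graph[OF X]
    have xH: "x \<in> walks (H.HO X) a b" using x by simp
    note p = K.\<Psi>_map[OF X ab] and sH = H.s_hom[OF X x] and sK = K.s_hom[OF X x]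
      and Kt = K.Ht_hom[OF X x] and kz = K.\<psi>_hom[OF Z] and fz = H.D.E_hom'[OF \<phi>Z[OF Z]]
    have SG: "gmap (H.D.TA (?G X)) a b \<in> hom W (ghom (H.D.TO (H.HO X)) a b) (ghom (H.D.TO (K.HO X)) a b)"
      using H.D.T_map[OF G(1)[OF X], of a b] ab by (simp add: G(2)[OF X])
    have pm: "path_map (?G X) x = map \<phi> (path_seq X x)"
      by (rule nth_equalityI) (simp_all add: nth_path_map nth_path_seq G(3)[OF X] paths_nth[OF x])
    have 1: "gmap (H.D.TA (?G X)) a b o[W] s (H.HO X) x = s (K.HO X) x o[W] mt_ar F (map \<phi> (path_seq X x))"
      using H.D.t_nat[OF G(1)[OF X] xH] pm map_gfun_id[OF G(2)[OF X] x] by simp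
    have "gmap (\<Theta> X o[H.D.GV] H.D.TA (?G X)) a b = gmap (\<Theta> X) a b o[W] gmap (H.D.TA (?G X)) a b"
      using graph_cmp(2)[OF H.D.T_mor[OF G(1)[OF X]], of a b "\<Theta> X"] ab HX
      by (simp add: H.D.gfun_T[OF G(1)[OF X]] G(2)[OF X])
    then have "gmap (\<Theta> X o[H.D.GV] H.D.TA (?G X)) a b o[W] s (H.HO X) x = gmap (\<Theta> X) a b o[W] (gmap (H.D.TA (?G X)) a b o[W] s (H.HO X) x)"
      using p SG sH by (simp add: hom_iff H.D.assoc)
    also have "\<dots> = (gmap (\<Theta> X) a b o[W] s (K.HO X) x) o[W] mt_ar F (map \<phi> (path_seq X x))"
      unfolding 1 using p sK fz by (simp add: hom_iff H.D.assoc)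
    also have "\<dots> = far K (t X x) o[W] (\<kappa> (path_seq X x) o[W] mt_ar F (map \<phi> (path_seq X x)))"
      unfolding K.\<Psi>_s[OF X x] using Kt kz fz by (simp add: hom_iff H.D.assoc)
    finally show ?thesis .
  qed
  show ?thesis
  proof
    assume "is_monoidal_trans V E W F H \<psi> K \<kappa> \<phi>"
    then interpret M: is_monoidal_trans V E W F H \<psi> K \<kappa> \<phi> .
    show "is_graph_monad_trans small V T W S H \<Psi> K \<Theta> \<phi>"
    proof (rule is_graph_monad_trans.intro[OF True])
      fix X assume "X \<in> Obj H.C.GV"
      then have X: "is_graph small V X" by (simp add: gcat_simps)
      note TX = H.C.T_graph[OF X] and HX = H.H.push_graph[OF X]
      show "?G (H.C.TO X) o[H.D.GV] \<Psi> X = \<Theta> X o[H.D.GV] H.D.TA (?G X)"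
      proof (rule H.D.T_gmor_eqI[OF HX H.D.GV.Cmp_hom[OF H.\<Psi>_hom[OF X] G(1)[OF TX]] H.D.GV.Cmp_hom[OF H.D.T_mor[OF G(1)[OF X]] K.\<Psi>_hom[OF X]]])
        show "gfun (?G (H.C.TO X) o[H.D.GV] \<Psi> X) a = gfun (\<Theta> X o[H.D.GV] H.D.TA (?G X)) a" if "a \<in> gobj (H.HO X)" for a
          using that X HX
          by (simp add: graph_cmp(1)[OF H.\<Psi>_hom[OF X]] graph_cmp(1)[OF H.D.T_mor[OF G(1)[OF X]]] H.D.gfun_T[OF G(1)[OF X]] G(2)[OF X] G(2)[OF TX] H.\<Psi>_fun[OF X] K.\<Psi>_fun[OF X])
        fix a b x assume "x \<in> walks (H.HO X) a b"
        then have x: "x \<in> walks X a b" by simp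
        show "gmap (?G (H.C.TO X) o[H.D.GV] \<Psi> X) a b o[W] s (H.HO X) x = gmap (\<Theta> X o[H.D.GV] H.D.TA (?G X)) a b o[W] s (H.HO X) x"
          unfolding L[OF X x] R[OF X x] M.trans_coherence[OF path_seq_Obj[OF X x]] ..
      qed
    qed
  next
    assume "is_graph_monad_trans small V T W S H \<Psi> K \<Theta> \<phi>"
    then interpret M: is_graph_monad_trans small V T W S H \<Psi> K \<Theta> \<phi> .
    show "is_monoidal_trans V E W F H \<psi> K \<kappa> \<phi>"
    proof (rule is_monoidal_trans.intro[OF True])
      fix Z assume Z: "Z \<in> seqs V"
      note X = H.C.seq_graph[OF Z]
      have X': "H.C.seq Z \<in> Obj H.C.GV" using X by (simp add: gcat_simps)
      have x: "H.C.canon (length Z) \<in> walks (H.C.seq Z) (\<nu> 0) (\<nu> (length Z))" using H.C.canon_paths by simp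
      show "\<phi> (mt_ob E Z) o[W] \<psi> Z = \<kappa> Z o[W] mt_ar F (map \<phi> Z)"
      proof (rule K.Htc_cancel[OF Z H.D.Cmp_hom[OF H.\<psi>_hom[OF Z] N.component_hom[OF H.C.E_ob[OF Z]]]
        H.D.Cmp_hom[OF H.D.E_hom'[OF \<phi>Z[OF Z]] K.\<psi>_hom[OF Z]]])
        show "far K (H.C.tc Z) o[W] (\<phi> (mt_ob E Z) o[W] \<psi> Z) = far K (H.C.tc Z) o[W] (\<kappa> Z o[W] mt_ar F (map \<phi> Z))"
          using L[OF X x] R[OF X x] M.trans_coherence[OF X'] by simp
      qed
    qed
  qed
next
  case False
  then show ?thesis
    using is_monoidal_trans.underlying_trans is_graph_monad_trans.underlying_trans by blast
qed

text \<open>The explicit coherence of Gamma, restricted along a coproduct inclusion, passes first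
  through \<psi> and then through H of an inclusion, which is the equation of the correspondence.
  Only the typing of \<psi> enters, so that the laws can be obtained from the correspondence
  afterwards.\<close>

lemma Gam_coherence_corresponds:
  assumes V: "distributive_multitensor small \<nu> V E" and W: "distributive_multitensor small \<nu> W F"
    and H: "is_functor V W H"
    and \<psi>: "\<psi> \<in> extensional (seqs V)" "\<And>Z. Z \<in> seqs V \<Longrightarrow> \<psi> Z \<in> hom W (mt_ob F (map (fob H) Z)) (fob H (mt_ob E Z))"
  shows "corresponds small V E (Gam_monad small V E) (Gam_in V E) W F (Gam_monad small W F) (Gam_in W F) H \<psi>
    (Gam_coherence small V E W F H \<psi>)"
proof -
  interpret C: distributive_multitensor small \<nu> V E by (rule V)
  interpret D: distributive_multitensor small \<nu> W F by (rule W)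
  interpret H: is_functor V W H by (rule H)
  interpret P: comparison_functor small \<nu> V E C.GT C.inc W F D.GT D.inc H
    by (intro comparison_functor.intro C.Gam_comparison D.Gam_comparison H)
  let ?\<Psi> = "Gam_coherence small V E W F H \<psi>"
  show ?thesis unfolding corresponds_def
  proof (intro conjI ballI allI impI)
    fix X assume X: "is_graph small V X"
    note HX = H.push_graph[OF X] and GX = C.Gam_is_graph[OF X]
    let ?A = "\<lambda>x. mt_ob F (path_seq (graph_push H X) x)" and ?B = "\<lambda>x. fob H (mt_ob E (path_seq X x))"
    let ?c = "\<lambda>a b. copair W (walks X a b) ?B (fob H (Gam_hom V E X a b)) (\<lambda>x. far H (C.inc X x))"
    let ?m = "\<lambda>a b. coprod_map W (walks X a b) ?A ?B (\<lambda>x. \<psi> (path_seq X x))"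
    have e: "?\<Psi> X = mk_gmor (D.G (graph_push H X)) (graph_push H (C.G X)) (\<lambda>a. a) (\<lambda>a b. ?c a b o[W] ?m a b)"
      using X by (simp add: Gam_coherence_def gcat_simps)
    note cpA = D.Gam_coproduct(1)[OF HX, unfolded gobj_push Gam_hom_def]
    have cpB: "is_coproduct W (walks X a b) ?B (coprod W (walks X a b) ?B) (coprod_in W (walks X a b) ?B)" for a b
      by (rule D.coproduct_exists[OF C.smallness_axioms D.coproducts C.small_paths[OF is_graph_small[OF X]]])
        (rule H.fob_Obj[OF C.E_ob[OF path_seq_Obj[OF X]]])
    have ob: "fob H (Gam_hom V E X a b) \<in> Obj W" for a b
      by (rule H.fob_Obj[OF C.coproduct_Obj[OF C.Gam_coproduct(2)[OF X]]])
    have c: "?c a b \<in> hom W (coprod W (walks X a b) ?B) (fob H (Gam_hom V E X a b))"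
      "x \<in> walks X a b \<Longrightarrow> ?c a b o[W] coprod_in W (walks X a b) ?B x = far H (C.inc X x)" for a b x
      by (rule D.copair[OF cpB ob H.far_hom[OF C.inc_hom[OF X]]]; assumption)+
    have k: "coprod_in W (walks X a b) ?B x o[W] \<psi> (path_seq X x) \<in> hom W (?A x) (coprod W (walks X a b) ?B)"
      if "x \<in> walks X a b" for a b x
      using D.Cmp_hom[OF \<psi>(2)[OF path_seq_Obj[OF X that]] D.coproduct_hom[OF cpB that]] by (simp add: path_seq_push[OF that])
    have m: "?m a b \<in> hom W (coprod W (walks X a b) ?A) (coprod W (walks X a b) ?B)"
      "x \<in> walks X a b \<Longrightarrow> ?m a b o[W] coprod_in W (walks X a b) ?A x =
      coprod_in W (walks X a b) ?B x o[W] \<psi> (path_seq X x)" for a b x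
      unfolding coprod_map_def by (rule D.copair[OF cpA D.coproduct_Obj[OF cpB] k]; assumption)+
    have cm: "?c a b o[W] ?m a b \<in> hom W (Gam_hom W F (graph_push H X) a b) (fob H (Gam_hom V E X a b))" for a b
      using D.Cmp_hom[OF m(1)[of a b] c(1)[of a b]] by (simp add: Gam_hom_def)
    have "mk_gmor (D.G (graph_push H X)) (graph_push H (C.G X)) (\<lambda>a. a) (\<lambda>a b. ?c a b o[W] ?m a b) \<in> hom D.GV (D.G (graph_push H X)) (graph_push H (C.G X))"
      by (rule mk_gmor_hom[OF D.Gam_is_graph[OF HX] H.push_graph[OF GX]])
        (use cm in \<open>simp_all add: D.ghom_Gam ghom_push C.ghom_Gam\<close>)
    then show "?\<Psi> X \<in> hom D.GV (D.F.TO (graph_push H X)) (graph_push H (C.F.TO X))"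
      unfolding e D.Gam_monad_simps(1)[OF HX] C.Gam_monad_simps(1)[OF X] .
    show "gfun (?\<Psi> X) = (\<lambda>a\<in>gobj X. a)" unfolding e by (simp add: mk_gmor_def)
    fix a b x assume x: "x \<in> walks X a b"
    have ab: "a \<in> gobj X" "b \<in> gobj X" using paths_ends[OF x] by simp_all
    have i: "D.inc (graph_push H X) x = coprod_in W (walks X a b) ?A x"
      using paths_ends[OF x] by (simp add: Gam_in_def)
    note h = c(1)[of a b] m(1)[of a b] D.coproduct_hom[OF cpA x] D.coproduct_hom[OF cpB x] \<psi>(2)[OF path_seq_Obj[OF X x]]
      H.far_hom[OF C.inc_hom[OF X x]]
    have "gmap (?\<Psi> X) a b o[W] D.inc (graph_push H X) x = ?c a b o[W] (?m a b o[W] coprod_in W (walks X a b) ?A x)"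
      unfolding e i using ab h by (simp add: hom_iff D.assoc)
    also have "\<dots> = (?c a b o[W] coprod_in W (walks X a b) ?B x) o[W] \<psi> (path_seq X x)"
      unfolding m(2)[OF x] using h by (simp add: hom_iff D.assoc path_seq_push[OF x])
    also have "?c a b o[W] coprod_in W (walks X a b) ?B x = far H (C.inc X x)"
      by (rule c(2)[OF x])
    finally show "gmap (?\<Psi> X) a b o[W] D.inc (graph_push H X) x = far H (C.inc X x) o[W] \<psi> (path_seq X x)" .
  qed (use \<psi> in \<open>simp_all add: Gam_coherence_def\<close>)
qed

text \<open>For the multitensor of T itself the comparison at a canonical path is an identity, so
  the equation at a sequence is the definition of \<open>bar_coherence\<close>;
  \<open>correspondsI_seq\<close> extends it to all graphs.\<close>

lemma bar_coherence_corresponds: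
  assumes V: "comparison small \<nu> V (bar_multitensor \<nu> V T) T (bar_in \<nu> V T)"
    and W: "comparison small \<nu> W (bar_multitensor \<nu> W S) S (bar_in \<nu> W S)"
    and M: "is_graph_monad_functor small V T W S H \<Psi>"
  shows "corresponds small V (bar_multitensor \<nu> V T) T (bar_in \<nu> V T) W (bar_multitensor \<nu> W S) S (bar_in \<nu> W S) H
    (bar_coherence \<nu> V W S H \<Psi>) \<Psi>"
proof -
  let ?E = "bar_multitensor \<nu> V T" and ?F = "bar_multitensor \<nu> W S"
  interpret C: comparison small \<nu> V ?E T "bar_in \<nu> V T" by (rule V)
  interpret D: comparison small \<nu> W ?F S "bar_in \<nu> W S" by (rule W)
  interpret M: is_graph_monad_functor small V T W S H \<Psi> by (rule M)
  interpret H: is_functor V W H by (rule M.underlying_functor)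
  interpret P: comparison_functor small \<nu> V ?E T "bar_in \<nu> V T" W ?F S "bar_in \<nu> W S" H by unfold_locales
  interpret N: nat_trans C.GV D.GV "fcomp C.GV (mnd_fun S) (graph_fun small V H)" "fcomp C.GV (graph_fun small V H) (mnd_fun T)" \<Psi>
    by (rule M.coherence_natural)
  have \<Psi>: "\<Psi> X \<in> hom D.GV (D.TO (P.HO X)) (P.HO (C.TO X))" "gfun (\<Psi> X) = (\<lambda>a\<in>gobj X. a)" if X: "is_graph small V X" for X
    using N.component_hom[of X] X M.coherence_over_Set by (simp_all add: gcat_simps H.graph_fun_ob nat_over_Set_def)
  \<comment> \<open>The path morphism of the canonical path is the identity of the graph of the
    sequence, and T preserves it.\<close>
  have tc: "C.tc Z = Idt V (mt_ob ?E Z)" and EZ: "mt_ob ?E Z = C.Tbar Z" if Z: "Z \<in> seqs V" for Z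
  proof -
    note X = C.seq_graph[OF Z]
    have X': "C.seq Z \<in> Obj C.GV" using X by (simp add: gcat_simps)
    have x: "C.canon (length Z) \<in> walks (C.seq Z) (\<nu> 0) (\<nu> (length Z))" using C.canon_paths by simp
    have p: "path_mor \<nu> V (C.seq Z) (C.canon (length Z)) = Idt C.GV (C.seq Z)"
    proof (rule C.seq_hom_eqI)
      show "path_mor \<nu> V (C.seq Z) (C.canon (length Z)) \<in> hom C.GV (C.seq Z) (C.seq Z)"
        using C.path_mor_hom[OF X x] by simp
      show "Idt C.GV (C.seq Z) \<in> hom C.GV (C.seq Z) (C.seq Z)" by (rule C.GV.Idt_hom[OF X'])
      fix i
      show "i \<le> length Z \<Longrightarrow> gfun (path_mor \<nu> V (C.seq Z) (C.canon (length Z))) (\<nu> i) = gfun (Idt C.GV (C.seq Z)) (\<nu> i)"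
        using C.path_mor_simps(1)[OF x, of i] by (simp add: C.nth_canon graph_Idt)
      show "i < length Z \<Longrightarrow> gmap (path_mor \<nu> V (C.seq Z) (C.canon (length Z))) (\<nu> i) (\<nu> (Suc i)) =
        gmap (Idt C.GV (C.seq Z)) (\<nu> i) (\<nu> (Suc i))"
        using C.path_mor_simps(2)[OF x, of i] by (simp add: C.nth_canon graph_Idt)
    qed
    show EZ: "mt_ob ?E Z = C.Tbar Z" using Z by (simp add: bar_multitensor_def bar_fun_def)
    show "C.tc Z = Idt V (mt_ob ?E Z)"
      unfolding bar_in_def p C.TF.far_Idt[OF X'] EZ using X by (simp add: graph_Idt)
  qed
  \<comment> \<open>The path morphism of the canonical path in H of the graph of Z is the canonical
    morphism from the graph of HZ, the one that occurs in \<open>bar_coherence\<close>.\<close>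
  have sc: "bar_in \<nu> W S (P.HO (C.seq Z)) (C.canon (length Z)) = gmap (D.TA (seq_push_mor \<nu> V W H Z)) (\<nu> 0) (\<nu> (length Z))"
    if Z: "Z \<in> seqs V" for Z
  proof -
    note X = C.seq_graph[OF Z] and HX = H.push_graph[OF C.seq_graph[OF Z]]
    have x: "C.canon (length Z) \<in> walks (C.seq Z) (\<nu> 0) (\<nu> (length Z))" using C.canon_paths by simp
    then have xH: "C.canon (length Z) \<in> paths (gobj (P.HO (C.seq Z))) (\<nu> 0) (\<nu> (length Z))" by simp
    have HZ: "map (fob H) Z \<in> seqs W" by (rule P.H_seq[OF Z])
    have ps: "path_seq (P.HO (C.seq Z)) (C.canon (length Z)) = map (fob H) Z" using path_seq_push[OF x] by simp
    note pm = D.path_mor_hom[OF HX xH, unfolded ps]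
    have sp: "seq_push_mor \<nu> V W H Z \<in> hom D.GV (D.seq (map (fob H) Z)) (P.HO (C.seq Z))"
      unfolding seq_push_mor_def
    proof (rule D.seq_mor_hom[OF HZ HX])
      show "map (\<lambda>Z. Idt W (fob H Z)) Z ! i \<in> hom W (map (fob H) Z ! i) (ghom (P.HO (C.seq Z)) (\<nu> i) (\<nu> (Suc i)))"
        if "i < length (map (fob H) Z)" for i
        using that Z D.Idt_hom[OF H.fob_Obj, of "Z ! i"] by (simp add: ghom_push C.ghom_seq in_lists_conv_set)
    qed simp
    have "path_mor \<nu> W (P.HO (C.seq Z)) (C.canon (length Z)) = seq_push_mor \<nu> V W H Z"
      by (rule D.seq_hom_eqI[OF pm sp])
        (use D.path_mor_simps(1,2)[OF xH] in \<open>simp_all add: seq_push_mor_def C.nth_canon ghom_push C.ghom_seq\<close>)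
    then show ?thesis by (simp add: bar_in_def)
  qed
  show ?thesis
  proof (rule P.correspondsI_seq)
    have \<psi>: "bar_coherence \<nu> V W S H \<Psi> Z = gmap (\<Psi> (C.seq Z)) (\<nu> 0) (\<nu> (length Z)) o[W] bar_in \<nu> W S (P.HO (C.seq Z)) (C.canon (length Z))"
      if "Z \<in> seqs V" for Z using that sc[OF that] by (simp add: bar_coherence_def)
    have \<psi>h: "bar_coherence \<nu> V W S H \<Psi> Z \<in> hom W (mt_ob ?F (map (fob H) Z)) (fob H (mt_ob ?E Z))" if Z: "Z \<in> seqs V" for Z
    proof -
      note X = C.seq_graph[OF Z]
      have x: "C.canon (length Z) \<in> walks (C.seq Z) (\<nu> 0) (\<nu> (length Z))" using C.canon_paths by simp
      show ?thesis unfolding \<psi>[OF Z] EZ[OF Z]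
        using D.Cmp_hom[OF P.s_hom[OF X x]] gmor_hom(7)[OF \<Psi>(1)[OF X], of "\<nu> 0" "\<nu> (length Z)"] H.push_graph[OF X] X
        by (simp add: \<Psi>(2)[OF X] ghom_push)
    qed
    show "bar_coherence \<nu> V W S H \<Psi> \<in> extensional (seqs V)" by (simp add: bar_coherence_def)
    show "bar_coherence \<nu> V W S H \<Psi> Z \<in> hom W (mt_ob ?F (map (fob H) Z)) (fob H (mt_ob ?E Z))" if "Z \<in> seqs V" for Z
      by (rule \<psi>h[OF that])
    show "gmap (\<Psi> (C.seq Z)) (\<nu> 0) (\<nu> (length Z)) o[W] bar_in \<nu> W S (P.HO (C.seq Z)) (C.canon (length Z)) =
      far H (C.tc Z) o[W] bar_coherence \<nu> V W S H \<Psi> Z" if Z: "Z \<in> seqs V" for Z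
      unfolding tc[OF Z] H.far_Idt[OF C.E_ob[OF Z]] \<psi>[OF Z, symmetric] using \<psi>h[OF Z] by (simp add: hom_iff)
    show "\<Psi> \<in> extensional (Obj C.GV)" by (rule N.components_extensional)
    show "\<Psi> Y o[D.GV] D.TA (P.HA f) = P.HA (C.TA f) o[D.GV] \<Psi> X" if "f \<in> hom C.GV X Y" for f X Y
      using N.naturality[OF that] that by (simp add: hom_iff)
  qed (use \<Psi> in simp_all)
qed

section \<open>2-categories of cells\<close>

lemma nat_trans_component_eqI:
  assumes "nat_trans C D F G \<sigma>" "nat_trans C D F' G' \<tau>" "\<And>a. a \<in> Obj C \<Longrightarrow> \<sigma> a = \<tau> a"
  shows "\<sigma> = \<tau>"
  using extensionalityI[OF nat_trans.components_extensional[OF assms(1)] nat_trans.components_extensional[OF assms(2)]] assms(3)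
  by blast

lemma nat_trans_Idt:
  assumes "is_functor C D F" shows "nat_trans C D F F (\<lambda>a\<in>Obj C. Idt D (fob F a))"
proof -
  interpret is_functor C D F by fact
  interpret C: category C by (rule source_category)
  interpret D: category D by (rule target_category)
  show ?thesis
  proof (rule nat_transI[OF assms assms])
    show "(\<lambda>a\<in>Obj C. Idt D (fob F a)) a \<in> hom D (fob F a) (fob F a)" if "a \<in> Obj C" for a
      using that D.Idt_hom[OF fob_Obj[OF that]] by simp
    show "(\<lambda>a\<in>Obj C. Idt D (fob F a)) b o[D] far F f = far F f o[D] (\<lambda>a\<in>Obj C. Idt D (fob F a)) a"
      if f: "f \<in> hom C a b" for f a b
      using C.hom_Obj[OF f] f by (simp add: hom_iff)
  qed simp
qed

lemma nat_trans_vertical: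
  assumes "nat_trans C D F G \<sigma>" "nat_trans C D G H \<tau>"
  shows "nat_trans C D F H (\<lambda>a\<in>Obj C. \<tau> a o[D] \<sigma> a)"
proof -
  let ?w = "\<lambda>a\<in>Obj C. \<tau> a o[D] \<sigma> a"
  interpret S: nat_trans C D F G \<sigma> by fact
  interpret T: nat_trans C D G H \<tau> by fact
  interpret F: is_functor C D F by (rule S.source_functor)
  interpret G: is_functor C D G by (rule S.target_functor)
  interpret H: is_functor C D H by (rule T.target_functor)
  interpret C: category C by (rule F.source_category)
  interpret D: category D by (rule F.target_category)
  show ?thesis
  proof (rule nat_transI[OF S.source_functor T.target_functor])
    show "?w a \<in> hom D (fob F a) (fob H a)" if "a \<in> Obj C" for a
      using that D.Cmp_hom[OF S.component_hom[OF that] T.component_hom[OF that]] by simp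
    show "?w b o[D] far F f = far H f o[D] ?w a"
      if f: "f \<in> hom C a b" for f a b
    proof -
      have ab: "a \<in> Obj C" "b \<in> Obj C" using C.hom_Obj[OF f] by simp_all
      note h = S.component_hom[OF ab(1)] S.component_hom[OF ab(2)] T.component_hom[OF ab(1)] T.component_hom[OF ab(2)]
        F.far_hom[OF f] G.far_hom[OF f] H.far_hom[OF f]
      have "(\<tau> b o[D] \<sigma> b) o[D] far F f = (\<tau> b o[D] far G f) o[D] \<sigma> a"
        using h S.naturality[OF f] by (simp add: hom_iff D.assoc)
      also have "\<dots> = far H f o[D] (\<tau> a o[D] \<sigma> a)"
        unfolding T.naturality[OF f] using h by (simp add: hom_iff D.assoc)
      finally show ?thesis using ab by simp
    qed
  qed simp
qed

lemma nat_trans_horizontal: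
  assumes "nat_trans C D F G \<sigma>" "nat_trans D E F' G' \<tau>"
  shows "nat_trans C E (fcomp C F' F) (fcomp C G' G) (\<lambda>a\<in>Obj C. far G' (\<sigma> a) o[E] \<tau> (fob F a))"
proof -
  let ?w = "\<lambda>a\<in>Obj C. far G' (\<sigma> a) o[E] \<tau> (fob F a)"
  interpret S: nat_trans C D F G \<sigma> by fact
  interpret T: nat_trans D E F' G' \<tau> by fact
  interpret F: is_functor C D F by (rule S.source_functor)
  interpret G: is_functor C D G by (rule S.target_functor)
  interpret F': is_functor D E F' by (rule T.source_functor)
  interpret G': is_functor D E G' by (rule T.target_functor)
  interpret C: category C by (rule F.source_category)
  interpret D: category D by (rule F.target_category)
  interpret E: category E by (rule F'.target_category)
  show ?thesis
  proof (rule nat_transI[OF fcomp_functor[OF S.source_functor T.source_functor] fcomp_functor[OF S.target_functor T.target_functor]])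
    show "?w a \<in> hom E (fob (fcomp C F' F) a) (fob (fcomp C G' G) a)" if "a \<in> Obj C" for a
      using that E.Cmp_hom[OF T.component_hom[OF F.fob_Obj[OF that]] G'.far_hom[OF S.component_hom[OF that]]] by simp
    show "?w b o[E] far (fcomp C F' F) f =
      far (fcomp C G' G) f o[E] ?w a" if f: "f \<in> hom C a b" for f a b
    proof -
      have ab: "a \<in> Obj C" "b \<in> Obj C" using C.hom_Obj[OF f] by simp_all
      note Fab = F.fob_Obj[OF ab(1)] F.fob_Obj[OF ab(2)]
      note h = G'.far_hom[OF S.component_hom[OF ab(1)]] G'.far_hom[OF S.component_hom[OF ab(2)]]
        T.component_hom[OF Fab(1)] T.component_hom[OF Fab(2)] F'.far_hom[OF F.far_hom[OF f]] G'.far_hom[OF F.far_hom[OF f]]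
        G'.far_hom[OF G.far_hom[OF f]]
      have "(far G' (\<sigma> b) o[E] \<tau> (fob F b)) o[E] far F' (far F f) = (far G' (\<sigma> b) o[E] far G' (far F f)) o[E] \<tau> (fob F a)"
        using h T.naturality[OF F.far_hom[OF f]] by (simp add: hom_iff E.assoc)
      also have "far G' (\<sigma> b) o[E] far G' (far F f) = far G' (far G f) o[E] far G' (\<sigma> a)"
        using G'.far_Cmp[OF F.far_hom[OF f] S.component_hom[OF ab(2)]] G'.far_Cmp[OF S.component_hom[OF ab(1)] G.far_hom[OF f]] S.naturality[OF f] by simp
      also have "(far G' (far G f) o[E] far G' (\<sigma> a)) o[E] \<tau> (fob F a) = far G' (far G f) o[E] (far G' (\<sigma> a) o[E] \<tau> (fob F a))"
        using h by (simp add: hom_iff E.assoc)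
      finally show ?thesis using ab f by (simp add: hom_iff)
    qed
  qed simp
qed

text \<open>What DISTMULT and PLMND have in common: 2-cells are natural transformations between
  underlying functors subject to a predicate P. The laws for 2-cells then hold componentwise, and
  only the laws of 1-cells and the closure properties of P have to be supplied.\<close>

locale cell_system =
  fixes X0 :: "(('o, 'a) cat \<times> 'e) set" and X1 :: "('o, 'a, 'e, 'p) one_cell set"
    and P :: "('o, 'a, 'e, 'p) one_cell \<Rightarrow> ('o, 'a, 'e, 'p) one_cell \<Rightarrow> ('o \<Rightarrow> 'a) \<Rightarrow> bool"
    and id1 and comp1
  assumes X0_category: "A \<in> X0 \<Longrightarrow> category (fst A)"
    and X1_cell: "f \<in> X1 \<Longrightarrow> src f \<in> X0 \<and> tgt f \<in> X0 \<and> is_functor (fst (src f)) (fst (tgt f)) (cell_ftor f)"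
    and id1_cell: "A \<in> X0 \<Longrightarrow> id1 A \<in> X1 \<and> src (id1 A) = A \<and> tgt (id1 A) = A \<and> cell_ftor (id1 A) = fid (fst A)"
    and comp1_cell: "\<lbrakk>f \<in> X1; g \<in> X1; tgt f = src g\<rbrakk> \<Longrightarrow> comp1 g f \<in> X1 \<and> src (comp1 g f) = src f \<and>
  tgt (comp1 g f) = tgt g \<and> cell_ftor (comp1 g f) = fcomp (fst (src f)) (cell_ftor g) (cell_ftor f)"
    and comp1_id: "f \<in> X1 \<Longrightarrow> comp1 (id1 (tgt f)) f = f" "f \<in> X1 \<Longrightarrow> comp1 f (id1 (src f)) = f"
    and comp1_assoc: "\<lbrakk>f \<in> X1; g \<in> X1; h \<in> X1; tgt f = src g; tgt g = src h\<rbrakk> \<Longrightarrow>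
  comp1 (comp1 h g) f = comp1 h (comp1 g f)"
    and P_nat: "\<lbrakk>f \<in> X1; g \<in> X1; src f = src g; tgt f = tgt g; P f g \<phi>\<rbrakk> \<Longrightarrow>
  nat_trans (fst (src f)) (fst (tgt f)) (cell_ftor f) (cell_ftor g) \<phi>"
    and P_id: "f \<in> X1 \<Longrightarrow> P f f (\<lambda>Z\<in>Obj (fst (src f)). Idt (fst (tgt f)) (fob (cell_ftor f) Z))"
    and P_vert: "\<lbrakk>f \<in> X1; g \<in> X1; h \<in> X1; src f = src g; tgt f = tgt g; src g = src h; tgt g = tgt h; P f g \<phi>; P g h \<chi>\<rbrakk> \<Longrightarrow>
  P f h (\<lambda>Z\<in>Obj (fst (src f)). \<chi> Z o[fst (tgt f)] \<phi> Z)"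
    and P_horiz: "\<lbrakk>f \<in> X1; g \<in> X1; f' \<in> X1; g' \<in> X1; src f = src g; tgt f = tgt g; src f' = src g'; tgt f' = tgt g';
  tgt f = src f'; P f g \<phi>; P f' g' \<chi>\<rbrakk> \<Longrightarrow>
  P (comp1 f' f) (comp1 g' g) (\<lambda>Z\<in>Obj (fst (src f)). far (cell_ftor g') (\<phi> Z) o[fst (tgt f')] \<chi> (fob (cell_ftor f) Z))"
begin

definition X2 :: "('o, 'a, 'e, 'p) two_cell set" where
  "X2 = {p. src p \<in> X1 \<and> tgt p \<in> X1 \<and> src (src p) = src (tgt p) \<and> tgt (src p) = tgt (tgt p) \<and> P (src p) (tgt p) (dat p)}"

definition Cells where "Cells = cell_two_cat X0 X1 X2 id1 comp1"

lemma Cells_simps [simp]: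
  "Obj (under Cells) = X0" "Arr (under Cells) = X1" "Dom (under Cells) = src" "Cod (under Cells) = tgt"
  "Idt (under Cells) = id1" "Cmp (under Cells) = comp1"
  "Obj (vert Cells) = X1" "Arr (vert Cells) = X2" "Dom (vert Cells) = src" "Cod (vert Cells) = tgt"
  "Idt (vert Cells) f = Cell f f (\<lambda>Z\<in>Obj (fst (src f)). Idt (fst (tgt f)) (fob (cell_ftor f) Z))"
  "Cmp (vert Cells) q p = Cell (src p) (tgt q) (\<lambda>Z\<in>Obj (fst (src (src p))). dat q Z o[fst (tgt (src p))] dat p Z)"
  "hcmp Cells q p = Cell (comp1 (src q) (src p)) (comp1 (tgt q) (tgt p))
  (\<lambda>Z\<in>Obj (fst (src (src p))).
  far (cell_ftor (tgt q)) (dat p Z) o[fst (tgt (src q))] dat q (fob (cell_ftor (src p)) Z))"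
  by (simp_all add: Cells_def cell_two_cat_def)

lemma horiz_simps [simp]:
  "Obj (horiz Cells) = X0" "Arr (horiz Cells) = X2" "Dom (horiz Cells) p = src (src p)" "Cod (horiz Cells) p = tgt (tgt p)"
  "Idt (horiz Cells) A = Idt (vert Cells) (id1 A)" "Cmp (horiz Cells) = hcmp Cells"
  by (simp_all add: horiz_def del: Cells_simps(11,12,13))

lemma X2D:
  assumes "p \<in> X2"
  shows "src p \<in> X1" "tgt p \<in> X1" "src (tgt p) = src (src p)" "tgt (tgt p) = tgt (src p)" "P (src p) (tgt p) (dat p)"
    and "nat_trans (fst (src (src p))) (fst (tgt (src p))) (cell_ftor (src p)) (cell_ftor (tgt p)) (dat p)"
  using assms P_nat by (simp_all add: X2_def)

lemma vert_Idt: "f \<in> X1 \<Longrightarrow> Idt (vert Cells) f \<in> X2"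
  by (simp add: X2_def P_id)

lemma vert_Cmp:
  assumes "p \<in> X2" "q \<in> X2" "tgt p = src q" shows "Cmp (vert Cells) q p \<in> X2"
proof -
  note a = X2D[OF assms(1)] and b = X2D[OF assms(2)]
  have e: "src (tgt q) = src (src p)" "tgt (tgt q) = tgt (src p)"
    unfolding b(3,4) assms(3)[symmetric] a(3,4) by (rule refl)+
  have "P (src p) (tgt q) (\<lambda>Z\<in>Obj (fst (src (src p))). dat q Z o[fst (tgt (src p))] dat p Z)"
    by (rule P_vert[OF a(1) a(2) b(2) _ _ _ _ a(5) b(5)[folded assms(3)]]) (simp_all only: a(3,4) e)
  then show ?thesis using a(1) b(2) e by (simp add: X2_def)
qed

lemma hcmp_X2:
  assumes "p \<in> X2" "q \<in> X2" "tgt (src p) = src (src q)" shows "hcmp Cells q p \<in> X2"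
proof -
  note a = X2D[OF assms(1)] and b = X2D[OF assms(2)]
  have t: "tgt (tgt p) = src (tgt q)" unfolding a(4) b(3) by (rule assms(3))
  note c = comp1_cell[OF a(1) b(1) assms(3)] and d = comp1_cell[OF a(2) b(2) t]
  have "P (comp1 (src q) (src p)) (comp1 (tgt q) (tgt p)) (\<lambda>Z\<in>Obj (fst (src (src p))).
    far (cell_ftor (tgt q)) (dat p Z) o[fst (tgt (src q))] dat q (fob (cell_ftor (src p)) Z))"
    by (rule P_horiz[OF a(1) a(2) b(1) b(2) _ _ _ _ assms(3) a(5) b(5)]) (simp_all only: a(3,4) b(3,4))
  then show ?thesis using c d a(3) b(4) by (simp add: X2_def)
qed

lemma under_category: "category (under Cells)"
proof
  show "\<lbrakk>f \<in> hom (under Cells) a b; g \<in> hom (under Cells) b c\<rbrakk> \<Longrightarrow> g o[under Cells] f \<in> hom (under Cells) a c" for f g a b c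
    using comp1_cell[of f g] by (simp add: hom_iff)
  show "f \<in> hom (under Cells) a b \<Longrightarrow> Idt (under Cells) b o[under Cells] f = f"
    "f \<in> hom (under Cells) a b \<Longrightarrow> f o[under Cells] Idt (under Cells) a = f" for f a b
    using comp1_id[of f] by (auto simp: hom_iff)
  show "\<lbrakk>f \<in> hom (under Cells) a b; g \<in> hom (under Cells) b c; h \<in> hom (under Cells) c d\<rbrakk>
    \<Longrightarrow> (h o[under Cells] g) o[under Cells] f = h o[under Cells] (g o[under Cells] f)" for f g h a b c d
    using comp1_assoc[of f g h] by (simp add: hom_iff)
qed (use X1_cell id1_cell in \<open>simp_all add: hom_iff\<close>)

text \<open>The data of a 2-cell are a natural transformation, hence extensional, so its components
  on the source category decide.\<close>

lemma dat_eqI: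
  assumes "p \<in> X2" "q \<in> X2" "src p = src q" "tgt p = tgt q"
    and "\<And>Z. Z \<in> Obj (fst (src (src p))) \<Longrightarrow> dat p Z = dat q Z"
  shows "p = q"
  using nat_trans_component_eqI[OF X2D(6)[OF assms(1)] X2D(6)[OF assms(2)[unfolded assms(3)[symmetric]], unfolded assms(3)[symmetric]]] assms(3-5)
  by (cases p; cases q) simp

lemma dat_hom:
  assumes "p \<in> X2" "Z \<in> Obj (fst (src (src p)))"
  shows "dat p Z \<in> hom (fst (tgt (src p))) (fob (cell_ftor (src p)) Z) (fob (cell_ftor (tgt p)) Z)"
  by (rule nat_trans.component_hom[OF X2D(6)[OF assms(1)] assms(2)])

lemma vert_category: "category (vert Cells)"
proof
  show "\<lbrakk>p \<in> hom (vert Cells) a b; q \<in> hom (vert Cells) b c\<rbrakk> \<Longrightarrow> q o[vert Cells] p \<in> hom (vert Cells) a c" for p q a b c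
    using vert_Cmp[of p q] by (simp add: hom_iff)
  show "f \<in> Obj (vert Cells) \<Longrightarrow> Idt (vert Cells) f \<in> hom (vert Cells) f f" for f
    using vert_Idt[of f] by (simp add: hom_iff)
  have W: "category (fst (tgt (src p)))" if "p \<in> X2" for p using X1_cell[OF X2D(1)[OF that]] X0_category by blast
  show "Idt (vert Cells) b o[vert Cells] p = p" if "p \<in> hom (vert Cells) a b" for p a b
  proof -
    have p: "p \<in> X2" "src p = a" "tgt p = b" using that by (simp_all add: hom_iff)
    show ?thesis
      by (rule dat_eqI[OF vert_Cmp[OF p(1) vert_Idt[of b]] p(1)])
        (use p X2D[OF p(1)] category.Idt_left[OF W[OF p(1)] dat_hom[OF p(1)]] in simp_all)
  qed
  show "p o[vert Cells] Idt (vert Cells) a = p" if "p \<in> hom (vert Cells) a b" for p a b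
  proof -
    have p: "p \<in> X2" "src p = a" "tgt p = b" using that by (simp_all add: hom_iff)
    show ?thesis
      by (rule dat_eqI[OF vert_Cmp[OF vert_Idt[of a] p(1)] p(1)])
        (use p X2D[OF p(1)] category.Idt_right[OF W[OF p(1)] dat_hom[OF p(1)]] in simp_all)
  qed
  show "(w o[vert Cells] q) o[vert Cells] p = w o[vert Cells] (q o[vert Cells] p)"
    if "p \<in> hom (vert Cells) a b" "q \<in> hom (vert Cells) b c" "w \<in> hom (vert Cells) c d" for p q w a b c d
  proof -
    have p: "p \<in> X2" "tgt p = src q" and q: "q \<in> X2" "tgt q = src w" and w: "w \<in> X2" using that by (simp_all add: hom_iff)
    have ba: "Cmp (vert Cells) q p \<in> X2" and cb: "Cmp (vert Cells) w q \<in> X2" using vert_Cmp p q w by blast+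
    have s: "src (src q) = src (src p)" "tgt (src q) = tgt (src p)" "src (src w) = src (src p)" "tgt (src w) = tgt (src p)"
      using X2D(3,4)[OF p(1)] X2D(3,4)[OF q(1)] p q by simp_all
    have "(dat w Z o[fst (tgt (src p))] dat q Z) o[fst (tgt (src p))] dat p Z =
      dat w Z o[fst (tgt (src p))] (dat q Z o[fst (tgt (src p))] dat p Z)" if "Z \<in> Obj (fst (src (src p)))" for Z
      using category.Cmp_assoc[OF W[OF p(1)] dat_hom[OF p(1) that]] dat_hom[OF q(1), of Z] dat_hom[OF w, of Z] that s p q
      by simp
    then show ?thesis
      by (intro dat_eqI[OF vert_Cmp[OF p(1) cb] vert_Cmp[OF ba w]]) (use p q s in simp_all)
  qed
qed (use X2D in simp_all)

lemma horiz_category: "category (horiz Cells)"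
proof
  have cl: "src (tgt p) = src (src p)" "tgt (src p) = tgt (tgt p)" if "p \<in> X2" for p using X2D(3,4)[OF that] by simp_all
  show "\<lbrakk>p \<in> hom (horiz Cells) a b; q \<in> hom (horiz Cells) b c\<rbrakk> \<Longrightarrow> q o[horiz Cells] p \<in> hom (horiz Cells) a c" for p q a b c
    using hcmp_X2[of p q] cl[of p] cl[of q] X2D[of p] X2D[of q] comp1_cell[of "src p" "src q"] comp1_cell[of "tgt p" "tgt q"]
    by (simp add: hom_iff)
  show "A \<in> Obj (horiz Cells) \<Longrightarrow> Idt (horiz Cells) A \<in> hom (horiz Cells) A A" for A
    using vert_Idt[of "id1 A"] id1_cell[of A] by (simp add: hom_iff)
  have W: "category (fst (tgt (src p)))" if "p \<in> X2" for p
    using X1_cell[OF X2D(1)[OF that]] X0_category by blast+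
  show "Idt (horiz Cells) b o[horiz Cells] p = p" if "p \<in> hom (horiz Cells) a b" for p a b
  proof -
    have p: "p \<in> X2" "src (src p) = a" "tgt (tgt p) = b" "tgt (src p) = b" using that cl by (simp_all add: hom_iff)
    have b: "b \<in> X0" using X1_cell[OF X2D(1)[OF p(1)]] p by simp
    note i = id1_cell[OF b]
    have ib: "Idt (horiz Cells) b \<in> X2" using vert_Idt[of "id1 b"] i by simp
    have "far (fid (fst b)) (dat p Z) o[fst b] Idt (fst b) (fob (fid (fst b)) (fob (cell_ftor (src p)) Z)) = dat p Z"
      and "fob (cell_ftor (src p)) Z \<in> Obj (fst b)"
      if "Z \<in> Obj (fst a)" for Z
    proof -
      have h: "dat p Z \<in> hom (fst b) (fob (cell_ftor (src p)) Z) (fob (cell_ftor (tgt p)) Z)" using dat_hom[OF p(1)] that p by simp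
      interpret W: category "fst b" using W[OF p(1)] p by simp
      show "fob (cell_ftor (src p)) Z \<in> Obj (fst b)" using W.hom_Obj[OF h] by simp
      then show "far (fid (fst b)) (dat p Z) o[fst b] Idt (fst b) (fob (fid (fst b)) (fob (cell_ftor (src p)) Z)) = dat p Z"
        using h by (simp add: hom_iff)
    qed
    moreover have "hcmp Cells (Idt (horiz Cells) b) p \<in> X2" using hcmp_X2[OF p(1) ib] i p by simp
    ultimately show ?thesis
      using comp1_id(1)[OF X2D(1)[OF p(1)]] comp1_id(1)[OF X2D(2)[OF p(1)]] p i
      by (intro dat_eqI[OF _ p(1)]) simp_all
  qed
  show "p o[horiz Cells] Idt (horiz Cells) a = p" if "p \<in> hom (horiz Cells) a b" for p a b
  proof -
    have p: "p \<in> X2" "src (src p) = a" "tgt (tgt p) = b" "tgt (src p) = b" "src (tgt p) = a" using that cl by (simp_all add: hom_iff)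
    have a: "a \<in> X0" using X1_cell[OF X2D(1)[OF p(1)]] p by simp
    note i = id1_cell[OF a]
    have ia: "Idt (horiz Cells) a \<in> X2" using vert_Idt[of "id1 a"] i by simp
    interpret K: is_functor "fst a" "fst b" "cell_ftor (tgt p)" using X1_cell[OF X2D(2)[OF p(1)]] p by simp
    have "far (cell_ftor (tgt p)) (Idt (fst a) (fob (fid (fst a)) Z)) o[fst b] dat p (fob (fid (fst a)) Z) = dat p Z"
      if Z: "Z \<in> Obj (fst a)" for Z
    proof -
      have h: "dat p Z \<in> hom (fst b) (fob (cell_ftor (src p)) Z) (fob (cell_ftor (tgt p)) Z)" using dat_hom[OF p(1)] that p by simp
      interpret W: category "fst b" using W[OF p(1)] p by simp
      show ?thesis using h Z by (simp add: hom_iff K.far_Idt)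
    qed
    moreover have "hcmp Cells p (Idt (horiz Cells) a) \<in> X2" using hcmp_X2[OF ia p(1)] i p by simp
    ultimately show ?thesis
      using comp1_id(2)[OF X2D(1)[OF p(1)]] comp1_id(2)[OF X2D(2)[OF p(1)]] p i
      by (intro dat_eqI[OF _ p(1)]) simp_all
  qed
  show "(w o[horiz Cells] q) o[horiz Cells] p = w o[horiz Cells] (q o[horiz Cells] p)"
    if "p \<in> hom (horiz Cells) a b" "q \<in> hom (horiz Cells) b c" "w \<in> hom (horiz Cells) c d" for p q w a b c d
  proof -
    have p: "p \<in> X2" "src (src p) = a" "tgt (tgt p) = b" "tgt (src p) = b" "src (tgt p) = a"
      and q: "q \<in> X2" "src (src q) = b" "tgt (tgt q) = c" "tgt (src q) = c" "src (tgt q) = b"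
      and w: "w \<in> X2" "src (src w) = c" "tgt (tgt w) = d" "tgt (src w) = d" "src (tgt w) = c"
      using that cl by (simp_all add: hom_iff)
    have ba: "hcmp Cells q p \<in> X2" and cb: "hcmp Cells w q \<in> X2" using hcmp_X2[OF p(1) q(1)] hcmp_X2[OF q(1) w(1)] p q w by simp_all
    note A = X2D(1,2)[OF p(1)] and B = X2D(1,2)[OF q(1)] and G = X2D(1,2)[OF w(1)]
    have c1: "comp1 (src q) (src p) \<in> X1 \<and> src (comp1 (src q) (src p)) = a \<and> tgt (comp1 (src q) (src p)) = c \<and>
      cell_ftor (comp1 (src q) (src p)) = fcomp (fst a) (cell_ftor (src q)) (cell_ftor (src p))"
      using comp1_cell[OF A(1) B(1)] p q by simp
    have c2: "comp1 (src w) (src q) \<in> X1 \<and> src (comp1 (src w) (src q)) = b \<and> tgt (comp1 (src w) (src q)) = d"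
      "comp1 (tgt w) (tgt q) \<in> X1 \<and> src (comp1 (tgt w) (tgt q)) = b \<and> tgt (comp1 (tgt w) (tgt q)) = d \<and>
      cell_ftor (comp1 (tgt w) (tgt q)) = fcomp (fst b) (cell_ftor (tgt w)) (cell_ftor (tgt q))"
      using comp1_cell[OF B(1) G(1)] comp1_cell[OF B(2) G(2)] q w by simp_all
    have l: "hcmp Cells (hcmp Cells w q) p \<in> X2" and r: "hcmp Cells w (hcmp Cells q p) \<in> X2"
      using hcmp_X2[OF p(1) cb] hcmp_X2[OF ba w(1)] c1 c2 p q w by simp_all
    interpret F: is_functor "fst a" "fst b" "cell_ftor (src p)" using X1_cell[OF A(1)] p by simp
    interpret K: is_functor "fst b" "fst c" "cell_ftor (tgt q)" using X1_cell[OF B(2)] q by simp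
    interpret F': is_functor "fst b" "fst c" "cell_ftor (src q)" using X1_cell[OF B(1)] q by simp
    interpret L: is_functor "fst c" "fst d" "cell_ftor (tgt w)" using X1_cell[OF G(2)] w by simp
    interpret D: category "fst d" by (rule L.target_category)
    let ?F = "cell_ftor (src p)" and ?l = "hcmp Cells (hcmp Cells w q) p" and ?r = "hcmp Cells w (hcmp Cells q p)" and ?G = "cell_ftor (src q)"
    show ?thesis
    proof (simp only: horiz_simps, rule dat_eqI[OF l r])
      show "src ?l = src ?r"
        using comp1_assoc[OF A(1) B(1) G(1)] p q w by simp
      show "tgt ?l = tgt ?r"
        using comp1_assoc[OF A(2) B(2) G(2)] p q w by simp
      fix Z assume "Z \<in> Obj (fst (src (src ?l)))"
      then have Z: "Z \<in> Obj (fst a)" using comp1_cell[OF A(1), of "comp1 (src w) (src q)"] c2 p by simp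
      have h: "dat p Z \<in> hom (fst b) (fob ?F Z) (fob (cell_ftor (tgt p)) Z)" using dat_hom[OF p(1)] Z p by simp
      note FZ = F.fob_Obj[OF Z]
      have h2: "dat q (fob ?F Z) \<in> hom (fst c) (fob ?G (fob ?F Z)) (fob (cell_ftor (tgt q)) (fob ?F Z))"
        using dat_hom[OF q(1)] FZ q by simp
      have h3: "dat w (fob ?G (fob ?F Z)) \<in> hom (fst d) (fob (cell_ftor (src w)) (fob ?G (fob ?F Z))) (fob (cell_ftor (tgt w)) (fob ?G (fob ?F Z)))"
        using dat_hom[OF w(1)] F'.fob_Obj[OF FZ] w by simp
      show "dat ?l Z = dat ?r Z"
        using Z FZ p q w c1 c2 h L.far_Cmp[OF h2 K.far_hom[OF h]] h3 L.far_hom[OF h2] L.far_hom[OF K.far_hom[OF h]]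
        by (simp add: hom_iff D.assoc)
    qed
  qed
qed (use X2D X1_cell in \<open>simp_all add: hom_iff\<close>)

lemma two_category: "two_category Cells"
proof (rule two_category.intro[OF under_category vert_category horiz_category])
  show "Obj (vert Cells) = Arr (under Cells)" by simp
  show "p \<in> hom (vert Cells) f g \<Longrightarrow> Dom (under Cells) f = Dom (under Cells) g \<and> Cod (under Cells) f = Cod (under Cells) g" for p f g
    using X2D[of p] by (auto simp: hom_iff)
  show "\<lbrakk>p \<in> hom (vert Cells) f g; q \<in> hom (vert Cells) f' g'; Cod (under Cells) f = Dom (under Cells) f'\<rbrakk>
    \<Longrightarrow> hcmp Cells q p \<in> hom (vert Cells) (f' o[under Cells] f) (g' o[under Cells] g)" for p q f g f' g'
    using hcmp_X2[of p q] by (auto simp: hom_iff)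
  show "hcmp Cells (Idt (vert Cells) f') (Idt (vert Cells) f) = Idt (vert Cells) (f' o[under Cells] f)"
    if "f \<in> hom (under Cells) A B" "f' \<in> hom (under Cells) B D" for f f' A B D
  proof -
    have f: "f \<in> X1" "src f = A" "tgt f = B" and f': "f' \<in> X1" "src f' = B" "tgt f' = D" using that by (simp_all add: hom_iff)
    note c = comp1_cell[OF f(1) f'(1)]
    interpret F: is_functor "fst A" "fst B" "cell_ftor f" using X1_cell[OF f(1)] f by simp
    interpret G: is_functor "fst B" "fst D" "cell_ftor f'" using X1_cell[OF f'(1)] f' by simp
    interpret D: category "fst D" by (rule G.target_category)
    show ?thesis unfolding Cells_simps(6)
      by (rule dat_eqI[OF hcmp_X2[OF vert_Idt[OF f(1)] vert_Idt[OF f'(1)]] vert_Idt])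
        (use f f' c F.fob_Obj G.fob_Obj in \<open>simp_all add: G.far_Idt\<close>)
  qed
  show "hcmp Cells (q' o[vert Cells] p') (q o[vert Cells] p) = hcmp Cells q' q o[vert Cells] hcmp Cells p' p"
    if "p \<in> hom (vert Cells) f g" "q \<in> hom (vert Cells) g h" "p' \<in> hom (vert Cells) f' g'" "q' \<in> hom (vert Cells) g' h'"
    and fc: "Cod (under Cells) f = Dom (under Cells) f'" for p q p' q' f g h f' g' h'
  proof -
    have p: "p \<in> X2" "src p = f" "tgt p = g" and q: "q \<in> X2" "src q = g" "tgt q = h"
      and p': "p' \<in> X2" "src p' = f'" "tgt p' = g'" and q': "q' \<in> X2" "src q' = g'" "tgt q' = h'"
      using that by (simp_all add: hom_iff)
    have X1: "f \<in> X1" "g \<in> X1" "h \<in> X1" "f' \<in> X1" "g' \<in> X1" "h' \<in> X1"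
      using X2D(1,2)[OF p(1)] X2D(1,2)[OF q(1)] X2D(1,2)[OF p'(1)] X2D(1,2)[OF q'(1)] p q p' q' by simp_all
    have st: "src g = src f" "tgt g = tgt f" "src h = src f" "tgt h = tgt f" "src g' = src f'" "tgt g' = tgt f'" "src h' = src f'" "tgt h' = tgt f'" "tgt f = src f'"
      using X2D(3,4)[OF p(1)] X2D(3,4)[OF q(1)] X2D(3,4)[OF p'(1)] X2D(3,4)[OF q'(1)] p q p' q' fc by simp_all
    have ba: "Cmp (vert Cells) q p \<in> X2" and ba': "Cmp (vert Cells) q' p' \<in> X2"
      using vert_Cmp[OF p(1) q(1)] vert_Cmp[OF p'(1) q'(1)] p q p' q' by simp_all
    have hb: "hcmp Cells q' q \<in> X2" and ha: "hcmp Cells p' p \<in> X2" and hba: "hcmp Cells (Cmp (vert Cells) q' p') (Cmp (vert Cells) q p) \<in> X2"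
      using hcmp_X2[OF q(1) q'(1)] hcmp_X2[OF p(1) p'(1)] hcmp_X2[OF ba ba'] p q p' q' st by simp_all
    note c = comp1_cell[OF X1(1) X1(4)] comp1_cell[OF X1(2) X1(5)] comp1_cell[OF X1(3) X1(6)]
    let ?V = "fst (src f)" and ?W = "fst (tgt f)" and ?U = "fst (tgt f')"
    let ?q = "q' o[vert Cells] p'"
    let ?p = "q o[vert Cells] p"
    let ?l = "hcmp Cells ?q ?p"
    let ?r = "hcmp Cells q' q o[vert Cells] hcmp Cells p' p"
    interpret F: is_functor ?V ?W "cell_ftor f" using X1_cell[OF X1(1)] by simp
    interpret G: is_functor ?V ?W "cell_ftor g" using X1_cell[OF X1(2)] st by simp
    interpret G': is_functor ?W ?U "cell_ftor g'" using X1_cell[OF X1(5)] st by simp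
    interpret H': is_functor ?W ?U "cell_ftor h'" using X1_cell[OF X1(6)] st by simp
    interpret W: category ?W by (rule F.target_category)
    interpret U: category ?U by (rule G'.target_category)
    interpret B': nat_trans ?W ?U "cell_ftor g'" "cell_ftor h'" "dat q'" using X2D(6)[OF q'(1)] q' st by simp
    show ?thesis
    proof (rule dat_eqI[OF hba vert_Cmp[OF ha hb]])
      show "tgt (hcmp Cells p' p) = src (hcmp Cells q' q)" using p q p' q' by simp
      show "src ?l = src ?r"
        and "tgt ?l = tgt ?r" by simp_all
      fix Z assume "Z \<in> Obj (fst (src (src ?l)))"
      then have Z: "Z \<in> Obj ?V" using c p p' st by simp
      note FZ = F.fob_Obj[OF Z] and GZ = G.fob_Obj[OF Z]
      have a: "dat p Z \<in> hom ?W (fob (cell_ftor f) Z) (fob (cell_ftor g) Z)" using dat_hom[OF p(1)] Z p by simp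
      have b: "dat q Z \<in> hom ?W (fob (cell_ftor g) Z) (fob (cell_ftor h) Z)" using dat_hom[OF q(1)] Z q st by simp
      have a': "dat p' (fob (cell_ftor f) Z) \<in> hom ?U (fob (cell_ftor f') (fob (cell_ftor f) Z)) (fob (cell_ftor g') (fob (cell_ftor f) Z))"
        using dat_hom[OF p'(1)] FZ p' st by simp
      note b' = B'.component_hom[OF FZ] B'.component_hom[OF GZ]
      note hb = H'.far_hom[OF b] and hha = H'.far_hom[OF a] and gga = G'.far_hom[OF a]
      have "far (cell_ftor h') (dat q Z o[?W] dat p Z) o[?U] (dat q' (fob (cell_ftor f) Z) o[?U] dat p' (fob (cell_ftor f) Z)) =
        far (cell_ftor h') (dat q Z) o[?U] ((far (cell_ftor h') (dat p Z) o[?U] dat q' (fob (cell_ftor f) Z)) o[?U] dat p' (fob (cell_ftor f) Z))"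
        using H'.far_Cmp[OF a b] hb hha b' a' by (simp add: hom_iff U.assoc)
      \<comment> \<open>Interchange comes down to swapping the two middle factors, by naturality of
        q' at the component of p.\<close>
      also have "far (cell_ftor h') (dat p Z) o[?U] dat q' (fob (cell_ftor f) Z) = dat q' (fob (cell_ftor g) Z) o[?U] far (cell_ftor g') (dat p Z)"
        using B'.naturality[OF a] by simp
      also have "far (cell_ftor h') (dat q Z) o[?U] ((dat q' (fob (cell_ftor g) Z) o[?U] far (cell_ftor g') (dat p Z)) o[?U] dat p' (fob (cell_ftor f) Z)) =
        (far (cell_ftor h') (dat q Z) o[?U] dat q' (fob (cell_ftor g) Z)) o[?U] (far (cell_ftor g') (dat p Z) o[?U] dat p' (fob (cell_ftor f) Z))"
        using hb b' gga a' by (simp add: hom_iff U.assoc)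
      finally show "dat ?l Z = dat ?r Z"
        using Z FZ p q p' q' st c by simp
    qed
  qed
qed

end

text \<open>2-functors that leave underlying categories, functors and transformations alone. On
  2-cells they change only the boundary, so the assumption about 2-cells reduces to passing from P
  to Q.\<close>

locale cell_functor = C: cell_system X0 X1 P id1 comp1 + D: cell_system Y0 Y1 Q id2 comp2
  for X0 :: "(('o, 'a) cat \<times> 'e) set" and X1 :: "('o, 'a, 'e, 'p) one_cell set" and P id1 comp1
    and Y0 :: "(('o, 'a) cat \<times> 'f) set" and Y1 :: "('o, 'a, 'f, 'q) one_cell set" and Q id2 comp2 +
  fixes F0 F1
  assumes F0: "A \<in> X0 \<Longrightarrow> F0 A \<in> Y0 \<and> fst (F0 A) = fst A"
    and F1: "f \<in> X1 \<Longrightarrow> F1 f \<in> Y1 \<and> src (F1 f) = F0 (src f) \<and> tgt (F1 f) = F0 (tgt f) \<and> cell_ftor (F1 f) = cell_ftor f"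
    and F1_id: "A \<in> X0 \<Longrightarrow> F1 (id1 A) = id2 (F0 A)"
    and F1_comp: "\<lbrakk>f \<in> X1; g \<in> X1; tgt f = src g\<rbrakk> \<Longrightarrow> F1 (comp1 g f) = comp2 (F1 g) (F1 f)"
    and F1_P: "\<lbrakk>f \<in> X1; g \<in> X1; src f = src g; tgt f = tgt g; P f g \<phi>\<rbrakk> \<Longrightarrow> Q (F1 f) (F1 g) \<phi>"
begin

definition F2 where "F2 p = Cell (F1 (src p)) (F1 (tgt p)) (dat p)"

lemma F2_simps [simp]: "src (F2 p) = F1 (src p)" "tgt (F2 p) = F1 (tgt p)" "dat (F2 p) = dat p"
  by (simp_all add: F2_def)

lemma F2_X2: "p \<in> C.X2 \<Longrightarrow> F2 p \<in> D.X2"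
  using F1[of "src p"] F1[of "tgt p"] F1_P[of "src p" "tgt p" "dat p"] by (simp add: C.X2_def D.X2_def)

lemma two_functor: "two_functor C.Cells D.Cells (mk_two_ftor C.Cells F0 F1 F2)"
proof (rule two_functor.intro[OF C.two_category D.two_category])
  let ?F = "mk_two_ftor C.Cells F0 F1 F2"
  let ?u = "Ftor (on0 ?F) (on1 ?F)"
  let ?v = "Ftor (on1 ?F) (on2 ?F)"
  let ?h = "Ftor (on0 ?F) (on2 ?F)"
  show "is_functor (under C.Cells) (under D.Cells) ?u"
  proof (rule is_functorI[OF C.under_category D.under_category])
    show "far ?u f \<in> hom (under D.Cells)
      (fob ?u A)
      (fob ?u B)"
      if "f \<in> hom (under C.Cells) A B" for f A B
      using that F1[of f] C.X1_cell[of f] by (auto simp: mk_two_ftor_def hom_iff)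
  qed (use F0 F1_id C.id1_cell F1_comp C.comp1_cell in \<open>simp_all add: mk_two_ftor_def hom_iff\<close>)
  show "is_functor (vert C.Cells) (vert D.Cells) ?v"
  proof (rule is_functorI[OF C.vert_category D.vert_category])
    show "far ?v p \<in> hom (vert D.Cells)
      (fob ?v f)
      (fob ?v g)"
      if "p \<in> hom (vert C.Cells) f g" for p f g
      using that F2_X2[of p] C.X2D(1,2)[of p] by (auto simp: mk_two_ftor_def hom_iff)
    show "far ?v (Idt (vert C.Cells) f) =
      Idt (vert D.Cells) (fob ?v f)"
      if "f \<in> Obj (vert C.Cells)" for f
      using that C.vert_Idt[of f] F1[of f] F0 C.X1_cell[of f] by (simp add: mk_two_ftor_def F2_def)
    show "far ?v (q o[vert C.Cells] p) =
      far ?v q o[vert D.Cells]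
      far ?v p"
      if "p \<in> hom (vert C.Cells) f g" "q \<in> hom (vert C.Cells) g h" for p q f g h
      using that C.vert_Cmp[of p q] F1[of "src p"] F0 C.X1_cell[of "src p"] C.X2D(1)[of p]
      by (simp add: mk_two_ftor_def F2_def hom_iff)
  qed (use F1 in \<open>simp_all add: mk_two_ftor_def\<close>)
  show "is_functor (horiz C.Cells) (horiz D.Cells) ?h"
  proof (rule is_functorI[OF C.horiz_category D.horiz_category])
    show "far ?h p \<in> hom (horiz D.Cells)
      (fob ?h A)
      (fob ?h B)"
      if "p \<in> hom (horiz C.Cells) A B" for p A B
      using that F2_X2[of p] F1[of "src p"] F1[of "tgt p"] C.X2D(1,2)[of p] C.X1_cell[of "src p"] C.X1_cell[of "tgt p"]
      by (auto simp: mk_two_ftor_def hom_iff)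
    show "far ?h (Idt (horiz C.Cells) A) =
      Idt (horiz D.Cells) (fob ?h A)"
      if "A \<in> Obj (horiz C.Cells)" for A
      using that C.vert_Idt[of "id1 A"] F1[of "id1 A"] F0[of A] C.id1_cell[of A] D.id1_cell[of "F0 A"] F1_id[of A]
      by (simp add: mk_two_ftor_def F2_def)
    show "far ?h (q o[horiz C.Cells] p) =
      far ?h q o[horiz D.Cells]
      far ?h p"
      if "p \<in> hom (horiz C.Cells) A B" "q \<in> hom (horiz C.Cells) B D" for p q A B D
    proof -
      have p: "p \<in> C.X2" "tgt (tgt p) = B" and q: "q \<in> C.X2" "src (src q) = B" using that by (simp_all add: hom_iff)
      note A = C.X2D(1-4)[OF p(1)] and B = C.X2D(1-4)[OF q(1)]
      have "hcmp C.Cells q p \<in> C.X2" using C.hcmp_X2[OF p(1) q(1)] A B p q by simp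
      then show ?thesis
        using p q A B F1[OF A(1)] F1[OF B(1)] F1[OF B(2)] F0 C.X1_cell[OF A(1)] C.X1_cell[OF B(1)] F1_comp[OF A(1) B(1)] F1_comp[OF A(2) B(2)]
        by (simp add: mk_two_ftor_def F2_def)
    qed
  qed (use F0 in \<open>simp_all add: mk_two_ftor_def\<close>)
qed

end

text \<open>The components lie over identity functors, so whiskering with them does not change a
  transformation: 2-naturality follows from 1-naturality applied to the source and the target of the
  2-cell.\<close>

lemma cell_natural_iso:
  assumes "cell_functor X0 X1 P id1 comp1 Y0 Y1 Q id2 comp2 F0 F1"
    and "cell_functor X0 X1 P id1 comp1 Y0 Y1 Q id2 comp2 G0 G1"
    and iso: "\<And>A. A \<in> X0 \<Longrightarrow> is_iso (under (cell_system.Cells Y0 Y1 Q id2 comp2)) (F0 A) (G0 A) (\<theta> A)"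
    and \<theta>: "\<And>A. A \<in> X0 \<Longrightarrow> cell_ftor (\<theta> A) = fid (fst A)"
    and nat: "\<And>f. f \<in> X1 \<Longrightarrow> comp2 (\<theta> (tgt f)) (F1 f) = comp2 (G1 f) (\<theta> (src f))"
  shows "two_natural_iso (cell_system.Cells X0 X1 P id1 comp1) (cell_system.Cells Y0 Y1 Q id2 comp2)
    (mk_two_ftor (cell_system.Cells X0 X1 P id1 comp1) F0 F1 (cell_functor.F2 F1))
    (mk_two_ftor (cell_system.Cells X0 X1 P id1 comp1) G0 G1 (cell_functor.F2 G1)) \<theta>"
proof -
  interpret F: cell_functor X0 X1 P id1 comp1 Y0 Y1 Q id2 comp2 F0 F1 by fact
  interpret G: cell_functor X0 X1 P id1 comp1 Y0 Y1 Q id2 comp2 G0 G1 by fact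
  let ?F = "mk_two_ftor F.C.Cells F0 F1 F.F2" and ?G = "mk_two_ftor F.C.Cells G0 G1 G.F2"
  show ?thesis
  proof (rule two_natural_iso.intro[OF F.two_functor G.two_functor])
    show "is_iso (under F.D.Cells) (on0 ?F A) (on0 ?G A) (\<theta> A)"
      if "A \<in> Obj (under F.C.Cells)" for A using iso that by (simp add: mk_two_ftor_def)
    show "\<theta> B o[under F.D.Cells] on1 ?F f = on1 ?G f o[under F.D.Cells] \<theta> A"
      if "f \<in> hom (under F.C.Cells) A B" for f A B using nat[of f] that by (auto simp: mk_two_ftor_def hom_iff)
    fix p A B assume "p \<in> hom (horiz F.C.Cells) A B"
    then have p: "p \<in> F.C.X2" "src (src p) = A" "tgt (tgt p) = B" by (simp_all add: hom_iff)
    note X = F.C.X2D[OF p(1)]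
    have AB: "A \<in> X0" "B \<in> X0" using F.C.X1_cell[OF X(1)] F.C.X1_cell[OF X(2)] p by simp_all
    have tA: "\<theta> A \<in> Y1" "src (\<theta> A) = F0 A" "tgt (\<theta> A) = G0 A" and tB: "\<theta> B \<in> Y1" "src (\<theta> B) = F0 B" "tgt (\<theta> B) = G0 B"
      using iso[OF AB(1)] iso[OF AB(2)] by (simp_all add: is_iso_def hom_iff)
    have st: "src (tgt p) = A" "tgt (src p) = B" using X p by simp_all
    interpret N: nat_trans "fst A" "fst B" "cell_ftor (src p)" "cell_ftor (tgt p)" "dat p" using X(6) p st by simp
    interpret H: is_functor "fst A" "fst B" "cell_ftor (src p)" by (rule N.source_functor)
    interpret K: is_functor "fst A" "fst B" "cell_ftor (tgt p)" by (rule N.target_functor)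
    interpret W: category "fst B" by (rule K.target_category)
    have f: "fst (F0 A) = fst A" "fst (F0 B) = fst B" "fst (G0 A) = fst A" "fst (G0 B) = fst B"
      using F.F0 G.F0 AB by simp_all
    \<comment> \<open>Both whiskerings have the component \<open>dat p Z\<close>: on each side one
      factor is an identity.\<close>
    have e: "(\<lambda>Z\<in>Obj (fst A). far (fid (fst B)) (dat p Z) o[fst B] (\<lambda>Z\<in>Obj (fst B). Idt (fst B) (fob (fid (fst B)) Z)) (fob (cell_ftor (src p)) Z)) =
      (\<lambda>Z\<in>Obj (fst A). far (cell_ftor (tgt p)) ((\<lambda>Z\<in>Obj (fst A). Idt (fst A) (fob (fid (fst A)) Z)) Z) o[fst B] dat p (fob (fid (fst A)) Z))"
    proof (rule restrict_ext)
      fix Z assume Z: "Z \<in> Obj (fst A)"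
      show "far (fid (fst B)) (dat p Z) o[fst B] (\<lambda>Z\<in>Obj (fst B). Idt (fst B) (fob (fid (fst B)) Z)) (fob (cell_ftor (src p)) Z) =
        far (cell_ftor (tgt p)) ((\<lambda>Z\<in>Obj (fst A). Idt (fst A) (fob (fid (fst A)) Z)) Z) o[fst B] dat p (fob (fid (fst A)) Z)"
        using Z H.fob_Obj[OF Z] N.component_hom[OF Z] by (simp add: hom_iff K.far_Idt)
    qed
    show "hcmp F.D.Cells (Idt (vert F.D.Cells) (\<theta> B)) (on2 ?F p) =
      hcmp F.D.Cells (on2 ?G p) (Idt (vert F.D.Cells) (\<theta> A))"
      using p st tA tB f e nat[OF X(1)] nat[OF X(2)] F.F1[OF X(1)] G.F1[OF X(1)] G.F1[OF X(2)] \<theta>[OF AB(1)] \<theta>[OF AB(2)]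
      by (simp add: mk_two_ftor_def F.F2_def G.F2_def)
  qed
qed

section \<open>Lax monoidal functors form a 2-category\<close>

lemma lax_facts:
  assumes "is_lax_monoidal V E W F H \<psi>"
  shows "Z \<in> seqs V \<Longrightarrow> \<psi> Z \<in> hom W (mt_ob F (map (fob H) Z)) (fob H (mt_ob E Z))"
    and "f \<in> hom (seq_cat V) A B \<Longrightarrow> \<psi> B o[W] mt_ar F (map (far H) f) = far H (mt_ar E f) o[W] \<psi> A"
    and "\<psi> \<in> extensional (seqs V)"
proof -
  interpret L: is_lax_monoidal V E W F H \<psi> by fact
  interpret N: nat_trans "seq_cat V" W "fcomp (seq_cat V) (mt_fun F) (seq_fun V H)" "fcomp (seq_cat V) H (mt_fun E)" \<psi>
    by (rule L.coherence_natural)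
  show "Z \<in> seqs V \<Longrightarrow> \<psi> Z \<in> hom W (mt_ob F (map (fob H) Z)) (fob H (mt_ob E Z))"
    using N.component_hom[of Z] by (simp add: seq_fun_def)
  show "f \<in> hom (seq_cat V) A B \<Longrightarrow> \<psi> B o[W] mt_ar F (map (far H) f) = far H (mt_ar E f) o[W] \<psi> A"
    using N.naturality[of f A B] by (simp add: hom_iff seq_fun_def)
  show "\<psi> \<in> extensional (seqs V)" using N.components_extensional by simp
qed

lemma map_fid: "Z \<in> seqs C \<Longrightarrow> map (fob (fid C)) Z = Z" "f \<in> lists (Arr C) \<Longrightarrow> map (far (fid C)) f = f"
  by (auto intro!: map_idI)

lemma (in comparison) lax_id: "is_lax_monoidal V E V E (fid V) id_\<psi>"
proof -
  interpret I: is_functor V V "fid V" by (rule fid_functor) (rule category_axioms)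
  interpret S: category "seq_cat V" by (rule category_seq_cat) (rule category_axioms)
  show ?thesis
  proof (rule is_lax_monoidal.intro)
    show "is_functor V V (fid V)" by (rule I.is_functor_axioms)
    show "nat_trans (seq_cat V) V (fcomp (seq_cat V) (mt_fun E) (seq_fun V (fid V))) (fcomp (seq_cat V) (fid V) (mt_fun E)) id_\<psi>"
    proof (rule nat_transI[OF I.source_seq_functor[OF list_functor_axioms] I.target_seq_functor[OF list_functor_axioms]])
      show "id_\<psi> \<in> extensional (Obj (seq_cat V))" by (simp add: id_\<psi>_def)
      show "id_\<psi> Z \<in> hom V (fob (fcomp (seq_cat V) (mt_fun E) (seq_fun V (fid V))) Z) (fob (fcomp (seq_cat V) (fid V) (mt_fun E)) Z)"
        if "Z \<in> Obj (seq_cat V)" for Z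
        using that Idt_hom[OF E_ob, of Z] E_ob[of Z] map_fid(1)[of Z V] by (simp add: id_\<psi>_def seq_fun_def)
      show "id_\<psi> B o[V] far (fcomp (seq_cat V) (mt_fun E) (seq_fun V (fid V))) f = far (fcomp (seq_cat V) (fid V) (mt_fun E)) f o[V] id_\<psi> A"
        if f: "f \<in> hom (seq_cat V) A B" for f A B
      proof -
        have "A \<in> seqs V" "B \<in> seqs V" "f \<in> lists (Arr V)" using S.hom_Obj[OF f] f by (simp_all add: hom_iff)
        moreover have "mt_ar E f \<in> hom V (mt_ob E A) (mt_ob E B)" by (rule E_hom'[OF f])
        ultimately show ?thesis using map_fid(2)[of f V] by (simp add: id_\<psi>_def seq_fun_def hom_iff)
      qed
    qed
    show "id_\<psi> [Z] o[V] mt_unit E (fob (fid V) Z) = far (fid V) (mt_unit E Z)" if "Z \<in> Obj V" for Z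
      using that u_hom[OF that] by (simp add: id_\<psi>_def hom_iff)
    fix Zss assume Zss: "Zss \<in> lists (seqs V)"
    have m: "map (map (fob (fid V))) Zss = Zss" using Zss map_fid(1) by (auto intro!: map_idI)
    have "map id_\<psi> Zss = map (Idt V) (map (mt_ob E) Zss)" using Zss by (auto simp: id_\<psi>_def)
    then have "mt_ar E (map id_\<psi> Zss) = mt_ar E (map (Idt V) (map (mt_ob E) Zss))" by (simp only:)
    also have "\<dots> = Idt V (mt_ob E (map (mt_ob E) Zss))" by (rule E_Idt[OF map_lists[OF Zss E_ob]])
    finally have i: "mt_ar E (map id_\<psi> Zss) = Idt V (mt_ob E (map (mt_ob E) Zss))" .
    have l: "concat Zss \<in> seqs V" "map (mt_ob E) Zss \<in> seqs V"
      using concat_lists[OF Zss] map_lists[OF Zss E_ob] by simp_all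
    show "id_\<psi> (concat Zss) o[V] mt_sub E (map (map (fob (fid V))) Zss) =
      far (fid V) (mt_sub E Zss) o[V] (id_\<psi> (map (mt_ob E) Zss) o[V] mt_ar E (map id_\<psi> Zss))"
      unfolding m i using \<sigma>_hom[OF Zss] E_ob[OF l(1)] E_ob[OF l(2)] l by (simp add: id_\<psi>_def hom_iff)
  qed
qed

text \<open>For the unit and substitution laws, the law of K is applied first and then K of the law
  of H.\<close>

lemma lax_comp:
  assumes c1: "comparison small \<nu> V E T t" and c2: "comparison small \<nu> W F S s" and c3: "comparison small \<nu> U G R r"
    and L: "is_lax_monoidal V E W F H \<psi>" and M: "is_lax_monoidal W F U G K \<kappa>"
  shows "is_lax_monoidal V E U G (fcomp V K H) (\<lambda>Z\<in>seqs V. far K (\<psi> Z) o[U] \<kappa> (map (fob H) Z))"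
proof -
  interpret C1: comparison small \<nu> V E T t by (rule c1)
  interpret C2: comparison small \<nu> W F S s by (rule c2)
  interpret C3: comparison small \<nu> U G R r by (rule c3)
  interpret L: is_lax_monoidal V E W F H \<psi> by (rule L)
  interpret M: is_lax_monoidal W F U G K \<kappa> by (rule M)
  interpret H: is_functor V W H by (rule L.underlying_functor)
  interpret K: is_functor W U K by (rule M.underlying_functor)
  interpret KH: is_functor V U "fcomp V K H" by (rule fcomp_functor) unfold_locales
  interpret SV: category "seq_cat V" by (rule category_seq_cat) (rule C1.category_axioms)
  note l = lax_facts[OF L] and m = lax_facts[OF M]
  have HZ: "map (fob H) Z \<in> seqs W" if "Z \<in> seqs V" for Z by (rule map_lists[OF that H.fob_Obj])
  have mo: "map (fob (fcomp V K H)) Z = map (fob K) (map (fob H) Z)" if "Z \<in> seqs V" for Z using that by auto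
  have ma: "map (far (fcomp V K H)) f = map (far K) (map (far H) f)" if "f \<in> lists (Arr V)" for f using that by auto
  let ?\<chi> = "\<lambda>Z. far K (\<psi> Z) o[U] \<kappa> (map (fob H) Z)"
  let ?c = "\<lambda>Z\<in>seqs V. ?\<chi> Z"
  show ?thesis
  proof (rule is_lax_monoidal.intro)
    show "is_functor V U (fcomp V K H)" by (rule KH.is_functor_axioms)
    show "nat_trans (seq_cat V) U (fcomp (seq_cat V) (mt_fun G) (seq_fun V (fcomp V K H))) (fcomp (seq_cat V) (fcomp V K H) (mt_fun E))
      ?c"
    proof (rule nat_transI[OF KH.source_seq_functor[OF C3.list_functor_axioms] KH.target_seq_functor[OF C1.list_functor_axioms]])
      show "?c \<in> extensional (Obj (seq_cat V))" by simp
      show "?c Z \<in> hom U (fob (fcomp (seq_cat V) (mt_fun G) (seq_fun V (fcomp V K H))) Z) (fob (fcomp (seq_cat V) (fcomp V K H) (mt_fun E)) Z)"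
        if "Z \<in> Obj (seq_cat V)" for Z
      proof -
        have Z: "Z \<in> seqs V" using that by simp
        show ?thesis using C3.Cmp_hom[OF m(1)[OF HZ[OF Z]] K.far_hom[OF l(1)[OF Z]]] Z C1.E_ob[OF Z] mo[OF Z]
          by (simp add: seq_fun_def del: map_map)
      qed
      fix f A B assume f: "f \<in> hom (seq_cat V) A B"
      have A: "A \<in> seqs V" and B: "B \<in> seqs V" and fA: "f \<in> lists (Arr V)"
        using SV.hom_Obj[OF f] f by (simp_all add: hom_iff)
      note Hf = H.seq_map_hom[OF f]
      note h = K.far_hom[OF l(1)[OF A]] K.far_hom[OF l(1)[OF B]] m(1)[OF HZ[OF A]] m(1)[OF HZ[OF B]]
        C3.E_hom'[OF K.seq_map_hom[OF Hf]] K.far_hom[OF C2.E_hom'[OF Hf]] K.far_hom[OF H.far_hom[OF C1.E_hom'[OF f]]]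
      have "?\<chi> B o[U] mt_ar G (map (far K) (map (far H) f)) = (far K (\<psi> B) o[U] far K (mt_ar F (map (far H) f))) o[U] \<kappa> (map (fob H) A)"
        using h m(2)[OF Hf] by (simp add: hom_iff C3.assoc del: map_map)
      also have "far K (\<psi> B) o[U] far K (mt_ar F (map (far H) f)) = far K (far H (mt_ar E f)) o[U] far K (\<psi> A)"
        using K.far_Cmp[OF C2.E_hom'[OF Hf] l(1)[OF B]] K.far_Cmp[OF l(1)[OF A] H.far_hom[OF C1.E_hom'[OF f]]] l(2)[OF f] by simp
      also have "(far K (far H (mt_ar E f)) o[U] far K (\<psi> A)) o[U] \<kappa> (map (fob H) A) = far K (far H (mt_ar E f)) o[U] ?\<chi> A"
        using h by (simp add: hom_iff C3.assoc)
      finally show "?c B o[U] far (fcomp (seq_cat V) (mt_fun G) (seq_fun V (fcomp V K H))) f =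
        far (fcomp (seq_cat V) (fcomp V K H) (mt_fun E)) f o[U] ?c A"
        using A B fA C1.E_hom'[OF f] ma[OF fA] by (simp add: seq_fun_def hom_iff del: map_map)
    qed
  next
    fix Z assume Z: "Z \<in> Obj V"
    then have Z1: "[Z] \<in> seqs V" by simp
    note HZ' = H.fob_Obj[OF Z] and u = C1.u_hom[OF Z]
    have k: "\<kappa> [fob H Z] \<in> hom U (mt_ob G [fob K (fob H Z)]) (fob K (mt_ob F [fob H Z]))" using m(1)[OF HZ[OF Z1]] by simp
    have p: "\<psi> [Z] \<in> hom W (mt_ob F [fob H Z]) (fob H (mt_ob E [Z]))" using l(1)[OF Z1] by simp
    note uG = C3.u_hom[OF K.fob_Obj[OF HZ']]
    have "(far K (\<psi> [Z]) o[U] \<kappa> [fob H Z]) o[U] mt_unit G (fob K (fob H Z)) = far K (\<psi> [Z]) o[U] far K (mt_unit F (fob H Z))"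
      using K.far_hom[OF p] k uG M.coherence_unit[OF HZ'] by (simp add: hom_iff C3.assoc)
    also have "\<dots> = far K (far H (mt_unit E Z))"
      using K.far_Cmp[OF C2.u_hom[OF HZ'] p] L.coherence_unit[OF Z] by simp
    finally show "?c [Z] o[U] mt_unit G (fob (fcomp V K H) Z) = far (fcomp V K H) (mt_unit E Z)"
      using Z u by (simp add: hom_iff)
  next
    fix Zss assume Zss: "Zss \<in> lists (seqs V)"
    let ?HZ = "map (map (fob H)) Zss"
    let ?F = "map (mt_ob F) ?HZ"
    let ?KH = "map (map (fob K)) ?HZ"
    let ?E = "map (mt_ob E) Zss"
    let ?k = "map \<kappa> ?HZ"
    let ?p = "map \<psi> Zss"
    have cZ: "concat Zss \<in> seqs V" by (rule concat_lists[OF Zss])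
    have EZ: "map (mt_ob E) Zss \<in> seqs V" by (rule map_lists[OF Zss C1.E_ob])
    have HZss: "map (map (fob H)) Zss \<in> lists (seqs W)" by (rule map_lists[OF Zss HZ])
    have KHZss: "map (map (fob K)) ?HZ \<in> lists (seqs U)"
      by (rule map_lists[OF HZss]) (rule map_lists[OF _ K.fob_Obj])
    have mm: "map (map (fob (fcomp V K H))) Zss = map (map (fob K)) ?HZ"
      using Zss mo by auto
    have FHZ: "map (mt_ob F) ?HZ \<in> seqs W" by (rule map_lists[OF HZss C2.E_ob])
    have Zi: "Z \<in> seqs V" if "Z \<in> set Zss" for Z using Zss that by auto
    have \<psi>s: "map \<psi> Zss \<in> hom (seq_cat W) ?F (map (fob H) ?E)"
      unfolding hom_seq_cat using l(1) Zi by simp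
    have \<kappa>s: "map \<kappa> ?HZ \<in> hom (seq_cat U) (map (mt_ob G) ?KH)
      (map (fob K) ?F)"
      unfolding hom_seq_cat using m(1)[OF HZ] Zi by simp
    have G\<chi>: "mt_ar G (map (far K) ?p) o[U] mt_ar G ?k = mt_ar G (map ?\<chi> Zss)"
    proof (rule C3.E_cmp)
      fix i assume "i < length (map ?\<chi> Zss)"
      then have i: "i < length Zss" by simp
      have Z: "Zss ! i \<in> seqs V" using Zi i by simp
      show "composite U (map (far K) ?p ! i) (map \<kappa> ?HZ ! i) (map ?\<chi> Zss ! i)"
        using i K.far_hom[OF l(1)[OF Z]] m(1)[OF HZ[OF Z]] by (simp add: hom_iff)
    qed simp_all
    have HcZ: "map (fob H) (concat Zss) = concat ?HZ" by (simp add: map_concat)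
    have HEZ: "map (fob H) ?E \<in> seqs W" by (rule HZ[OF EZ])
    note sG = C3.\<sigma>_hom[OF KHZss] and sF = C2.\<sigma>_hom[OF HZss] and sE = C1.\<sigma>_hom[OF Zss]
    have sG': "mt_sub G ?KH \<in> hom U (mt_ob G (map (mt_ob G) ?KH))
      (mt_ob G (map (fob K) (concat ?HZ)))"
      using sG by (simp only: map_concat)
    note kc = m(1)[OF concat_lists[OF HZss]] and pc = l(1)[OF cZ, unfolded HcZ]
    note pE = l(1)[OF EZ] and kE = m(1)[OF HEZ] and kF = m(1)[OF FHZ]
    note F\<psi> = C2.E_hom'[OF \<psi>s] and G\<kappa> = C3.E_hom'[OF \<kappa>s] and GK\<psi> = C3.E_hom'[OF K.seq_map_hom[OF \<psi>s]]
    have "(far K (\<psi> (concat Zss)) o[U] \<kappa> (concat ?HZ)) o[U] mt_sub G ?KH =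
      (far K (\<psi> (concat Zss)) o[U] far K (mt_sub F ?HZ)) o[U]
      (\<kappa> ?F o[U] mt_ar G ?k)"
      using K.far_hom[OF pc] kc sG' K.far_hom[OF sF] kF G\<kappa> M.coherence_sub[OF HZss] by (simp add: hom_iff C3.assoc del: map_map)
    also have "far K (\<psi> (concat Zss)) o[U] far K (mt_sub F ?HZ) =
      far K (far H (mt_sub E Zss)) o[U] (far K (\<psi> ?E) o[U] far K (mt_ar F ?p))"
      using K.far_Cmp[OF sF pc] K.far_Cmp[OF C2.Cmp_hom[OF F\<psi> pE] H.far_hom[OF sE]] K.far_Cmp[OF F\<psi> pE] L.coherence_sub[OF Zss]
      by (simp del: map_map)
    also have "(far K (far H (mt_sub E Zss)) o[U] (far K (\<psi> ?E) o[U] far K (mt_ar F ?p))) o[U]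
      (\<kappa> ?F o[U] mt_ar G ?k) =
      far K (far H (mt_sub E Zss)) o[U] (far K (\<psi> ?E) o[U]
      ((far K (mt_ar F ?p) o[U] \<kappa> ?F) o[U] mt_ar G ?k))"
      using K.far_hom[OF H.far_hom[OF sE]] K.far_hom[OF pE] K.far_hom[OF F\<psi>] kF G\<kappa> by (simp add: hom_iff C3.assoc del: map_map)
    \<comment> \<open>The list of all \<psi> is a morphism of sequences, and naturality of \<kappa>
      at it exchanges the two layers.\<close>
    also have "far K (mt_ar F ?p) o[U] \<kappa> ?F =
      \<kappa> (map (fob H) ?E) o[U] mt_ar G (map (far K) ?p)"
      using m(2)[OF \<psi>s] by simp
    also have "far K (far H (mt_sub E Zss)) o[U] (far K (\<psi> ?E) o[U]
      ((\<kappa> (map (fob H) ?E) o[U] mt_ar G (map (far K) ?p)) o[U] mt_ar G ?k)) =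
      far K (far H (mt_sub E Zss)) o[U] (?\<chi> ?E o[U] mt_ar G (map ?\<chi> Zss))"
      unfolding G\<chi>[symmetric]
      using K.far_hom[OF H.far_hom[OF sE]] K.far_hom[OF pE] kE GK\<psi> G\<kappa> by (simp add: hom_iff C3.assoc del: map_map)
    finally have fin: "(far K (\<psi> (concat Zss)) o[U] \<kappa> (concat ?HZ)) o[U] mt_sub G ?KH =
      far K (far H (mt_sub E Zss)) o[U] (?\<chi> ?E o[U] mt_ar G (map ?\<chi> Zss))" .
    have r: "map ?c Zss = map ?\<chi> Zss" using Zi by simp
    have sA: "mt_sub E Zss \<in> Arr V" using sE by (simp add: hom_iff)
    show "?c (concat Zss) o[U] mt_sub G (map (map (fob (fcomp V K H))) Zss) =
      far (fcomp V K H) (mt_sub E Zss) o[U] (?c ?E o[U] mt_ar G (map ?c Zss))"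
      unfolding r mm fcomp_simps(2)[OF sA] using fin cZ EZ HcZ by (simp only: restrict_apply if_True)
  qed
qed

lemma monoidal_trans_id:
  assumes c: "comparison small \<nu> V E T t" and d: "comparison small \<nu> W F S s" and L: "is_lax_monoidal V E W F H \<psi>"
  shows "is_monoidal_trans V E W F H \<psi> H \<psi> (\<lambda>Z\<in>Obj V. Idt W (fob H Z))"
proof -
  interpret C: comparison small \<nu> V E T t by (rule c)
  interpret D: comparison small \<nu> W F S s by (rule d)
  interpret L: is_lax_monoidal V E W F H \<psi> by (rule L)
  interpret H: is_functor V W H by (rule L.underlying_functor)
  show ?thesis
  proof (rule is_monoidal_trans.intro[OF nat_trans_Idt[OF L.underlying_functor]])
    fix Z assume Z: "Z \<in> seqs V"
    have "map (\<lambda>Z\<in>Obj V. Idt W (fob H Z)) Z = map (Idt W) (map (fob H) Z)" using Z by auto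
    then show "(\<lambda>Z\<in>Obj V. Idt W (fob H Z)) (mt_ob E Z) o[W] \<psi> Z = \<psi> Z o[W] mt_ar F (map (\<lambda>Z\<in>Obj V. Idt W (fob H Z)) Z)"
      using C.E_ob[OF Z] lax_facts(1)[OF L Z] D.E_Idt[OF map_lists[OF Z H.fob_Obj]] by (simp add: hom_iff del: map_map)
  qed
qed

lemma monoidal_trans_vertical:
  assumes c: "comparison small \<nu> V E T t" and d: "comparison small \<nu> W F S s"
    and L: "is_lax_monoidal V E W F H \<psi>" "is_lax_monoidal V E W F K \<kappa>" "is_lax_monoidal V E W F J \<iota>"
    and \<phi>: "is_monoidal_trans V E W F H \<psi> K \<kappa> \<phi>" and \<chi>: "is_monoidal_trans V E W F K \<kappa> J \<iota> \<chi>"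
  shows "is_monoidal_trans V E W F H \<psi> J \<iota> (\<lambda>Z\<in>Obj V. \<chi> Z o[W] \<phi> Z)"
proof -
  let ?w = "\<lambda>Z\<in>Obj V. \<chi> Z o[W] \<phi> Z"
  interpret C: comparison small \<nu> V E T t by (rule c)
  interpret D: comparison small \<nu> W F S s by (rule d)
  interpret \<phi>: is_monoidal_trans V E W F H \<psi> K \<kappa> \<phi> by (rule \<phi>)
  interpret \<chi>: is_monoidal_trans V E W F K \<kappa> J \<iota> \<chi> by (rule \<chi>)
  interpret N\<phi>: nat_trans V W H K \<phi> by (rule \<phi>.underlying_trans)
  interpret N\<chi>: nat_trans V W K J \<chi> by (rule \<chi>.underlying_trans)
  show ?thesis
  proof (rule is_monoidal_trans.intro[OF nat_trans_vertical[OF \<phi>.underlying_trans \<chi>.underlying_trans]])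
    fix Z assume Z: "Z \<in> seqs V"
    note EZ = C.E_ob[OF Z]
    have Zi: "z \<in> Obj V" if "z \<in> set Z" for z using Z that by auto
    have m: "mt_ar F (map \<chi> Z) o[W] mt_ar F (map \<phi> Z) = mt_ar F (map ?w Z)"
      by (rule D.E_cmp) (use Zi N\<phi>.component_hom N\<chi>.component_hom in \<open>simp_all add: hom_iff\<close>)
    have F\<phi>: "mt_ar F (map \<phi> Z) \<in> hom W (mt_ob F (map (fob H) Z)) (mt_ob F (map (fob K) Z))"
      and F\<chi>: "mt_ar F (map \<chi> Z) \<in> hom W (mt_ob F (map (fob K) Z)) (mt_ob F (map (fob J) Z))"
      by (rule D.E_map_hom_set, use Zi N\<phi>.component_hom N\<chi>.component_hom in blast)+
    note h = lax_facts(1)[OF L(1) Z] lax_facts(1)[OF L(2) Z] lax_facts(1)[OF L(3) Z] N\<phi>.component_hom[OF EZ] N\<chi>.component_hom[OF EZ]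
    have "(\<chi> (mt_ob E Z) o[W] \<phi> (mt_ob E Z)) o[W] \<psi> Z = (\<chi> (mt_ob E Z) o[W] \<kappa> Z) o[W] mt_ar F (map \<phi> Z)"
      using h F\<phi> \<phi>.trans_coherence[OF Z] by (simp add: hom_iff D.assoc)
    also have "\<dots> = \<iota> Z o[W] (mt_ar F (map \<chi> Z) o[W] mt_ar F (map \<phi> Z))"
      unfolding \<chi>.trans_coherence[OF Z] using h F\<phi> F\<chi> by (simp add: hom_iff D.assoc)
    finally show "?w (mt_ob E Z) o[W] \<psi> Z = \<iota> Z o[W] mt_ar F (map ?w Z)"
      using EZ m by simp
  qed
qed

text \<open>Naturality of \<chi> at \<psi> brings the coherence laws of \<phi> and of \<chi> into
  position, and naturality of \<kappa>' at \<phi> rearranges the outcome.\<close>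

lemma monoidal_trans_horizontal:
  assumes c: "comparison small \<nu> V E T t" and d: "comparison small \<nu> W F S s" and e: "comparison small \<nu> U G R r"
    and L: "is_lax_monoidal V E W F H \<psi>" "is_lax_monoidal V E W F K \<kappa>"
    and L': "is_lax_monoidal W F U G H' \<psi>'" "is_lax_monoidal W F U G K' \<kappa>'"
    and \<phi>: "is_monoidal_trans V E W F H \<psi> K \<kappa> \<phi>" and \<chi>: "is_monoidal_trans W F U G H' \<psi>' K' \<kappa>' \<chi>"
  shows "is_monoidal_trans V E U G (fcomp V H' H) (\<lambda>Z\<in>seqs V. far H' (\<psi> Z) o[U] \<psi>' (map (fob H) Z))
    (fcomp V K' K) (\<lambda>Z\<in>seqs V. far K' (\<kappa> Z) o[U] \<kappa>' (map (fob K) Z))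
    (\<lambda>Z\<in>Obj V. far K' (\<phi> Z) o[U] \<chi> (fob H Z))"
proof -
  let ?w = "\<lambda>Z\<in>Obj V. far K' (\<phi> Z) o[U] \<chi> (fob H Z)"
  interpret C: comparison small \<nu> V E T t by (rule c)
  interpret D: comparison small \<nu> W F S s by (rule d)
  interpret X: comparison small \<nu> U G R r by (rule e)
  interpret \<phi>: is_monoidal_trans V E W F H \<psi> K \<kappa> \<phi> by (rule \<phi>)
  interpret \<chi>: is_monoidal_trans W F U G H' \<psi>' K' \<kappa>' \<chi> by (rule \<chi>)
  interpret N\<phi>: nat_trans V W H K \<phi> by (rule \<phi>.underlying_trans)
  interpret N\<chi>: nat_trans W U H' K' \<chi> by (rule \<chi>.underlying_trans)
  interpret H: is_functor V W H by (rule N\<phi>.source_functor)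
  interpret H': is_functor W U H' by (rule N\<chi>.source_functor)
  interpret K': is_functor W U K' by (rule N\<chi>.target_functor)
  show ?thesis
  proof (rule is_monoidal_trans.intro[OF nat_trans_horizontal[OF \<phi>.underlying_trans \<chi>.underlying_trans]])
    fix Z assume Z: "Z \<in> seqs V"
    let ?H = "map (fob H) Z" and ?K = "map (far K') (map \<phi> Z)"
    note EZ = C.E_ob[OF Z]
    have Zi: "z \<in> Obj V" if "z \<in> set Z" for z using Z that by auto
    have HZ: "map (fob H) Z \<in> seqs W" by (rule map_lists[OF Z H.fob_Obj])
    have KZ: "map (fob K) Z \<in> seqs W"
      by (rule map_lists[OF Z is_functor.fob_Obj[OF N\<phi>.target_functor]])
    note HEZ = H.fob_Obj[OF EZ] and FHZ = D.E_ob[OF HZ]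
    have \<phi>s: "map \<phi> Z \<in> hom (seq_cat W) ?H (map (fob K) Z)"
      unfolding hom_seq_cat using Zi N\<phi>.component_hom by simp
    have \<chi>s: "map \<chi> ?H \<in> hom (seq_cat U) (map (fob H') ?H) (map (fob K') ?H)"
      unfolding hom_seq_cat using Zi N\<chi>.component_hom[OF H.fob_Obj] by simp
    have m: "mt_ar G ?K o[U] mt_ar G (map \<chi> ?H) = mt_ar G (map ?w Z)"
    proof (rule X.E_cmp)
      fix i assume "i < length (map ?w Z)"
      then have i: "i < length Z" by simp
      have z: "Z ! i \<in> Obj V" using Zi i by simp
      show "composite U (map (far K') (map \<phi> Z) ! i) (map \<chi> ?H ! i) (map ?w Z ! i)"
        using i z K'.far_hom[OF N\<phi>.component_hom[OF z]] N\<chi>.component_hom[OF H.fob_Obj[OF z]] by (simp add: hom_iff)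
    qed simp_all
    note p = lax_facts(1)[OF L(1) Z] and k = lax_facts(1)[OF L(2) Z] and p' = lax_facts(1)[OF L'(1) HZ]
      and kH = lax_facts(1)[OF L'(2) HZ] and kK = lax_facts(1)[OF L'(2) KZ]
    note f = N\<phi>.component_hom[OF EZ] and F\<phi> = D.E_hom'[OF \<phi>s] and G\<chi> = X.E_hom'[OF \<chi>s] and GK\<phi> = X.E_hom'[OF K'.seq_map_hom[OF \<phi>s]]
    note g = N\<chi>.component_hom[OF HEZ] and gF = N\<chi>.component_hom[OF FHZ]
    have "(far K' (\<phi> (mt_ob E Z)) o[U] \<chi> (fob H (mt_ob E Z))) o[U] (far H' (\<psi> Z) o[U] \<psi>' ?H) =
      far K' (\<phi> (mt_ob E Z)) o[U] ((\<chi> (fob H (mt_ob E Z)) o[U] far H' (\<psi> Z)) o[U] \<psi>' ?H)"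
      using K'.far_hom[OF f] g H'.far_hom[OF p] p' by (simp add: hom_iff X.assoc del: map_map)
    also have "\<dots> = (far K' (\<phi> (mt_ob E Z)) o[U] far K' (\<psi> Z)) o[U] (\<chi> (mt_ob F ?H) o[U] \<psi>' ?H)"
      unfolding N\<chi>.naturality[OF p] using K'.far_hom[OF f] K'.far_hom[OF p] gF p' by (simp add: hom_iff X.assoc del: map_map)
    also have "far K' (\<phi> (mt_ob E Z)) o[U] far K' (\<psi> Z) = far K' (\<kappa> Z) o[U] far K' (mt_ar F (map \<phi> Z))"
      using K'.far_Cmp[OF p f] K'.far_Cmp[OF F\<phi> k] \<phi>.trans_coherence[OF Z] by simp
    also have "\<chi> (mt_ob F ?H) o[U] \<psi>' ?H = \<kappa>' ?H o[U] mt_ar G (map \<chi> ?H)"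
      by (rule \<chi>.trans_coherence[OF HZ])
    also have "(far K' (\<kappa> Z) o[U] far K' (mt_ar F (map \<phi> Z))) o[U] (\<kappa>' ?H o[U] mt_ar G (map \<chi> ?H)) =
      far K' (\<kappa> Z) o[U] ((far K' (mt_ar F (map \<phi> Z)) o[U] \<kappa>' ?H) o[U] mt_ar G (map \<chi> ?H))"
      using K'.far_hom[OF k] K'.far_hom[OF F\<phi>] kH G\<chi> by (simp add: hom_iff X.assoc del: map_map)
    also have "far K' (mt_ar F (map \<phi> Z)) o[U] \<kappa>' ?H = \<kappa>' (map (fob K) Z) o[U] mt_ar G ?K"
      using lax_facts(2)[OF L'(2) \<phi>s] by simp
    also have "far K' (\<kappa> Z) o[U] ((\<kappa>' (map (fob K) Z) o[U] mt_ar G ?K) o[U] mt_ar G (map \<chi> ?H)) =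
      (far K' (\<kappa> Z) o[U] \<kappa>' (map (fob K) Z)) o[U] (mt_ar G ?K o[U] mt_ar G (map \<chi> ?H))"
      using K'.far_hom[OF k] kK GK\<phi> G\<chi> by (simp add: hom_iff X.assoc del: map_map)
    finally show "?w (mt_ob E Z) o[U] (\<lambda>Z\<in>seqs V. far H' (\<psi> Z) o[U] \<psi>' (map (fob H) Z)) Z =
      (\<lambda>Z\<in>seqs V. far K' (\<kappa> Z) o[U] \<kappa>' (map (fob K) Z)) Z o[U] mt_ar G (map ?w Z)"
      unfolding m using Z EZ by (simp only: restrict_apply if_True)
  qed
qed

text \<open>Laws are pulled back along a map of 1-cells that respects identities and composition and
  is injective on parallel 1-cells. In this way PLMND inherits the axioms of a 2-category from
  DISTMULT along bar.\<close>

lemma cell_system_transfer: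
  assumes Y: "cell_system Y0 Y1 Q id2 comp2"
    and F0: "\<And>A. A \<in> X0 \<Longrightarrow> F0 A \<in> Y0 \<and> fst (F0 A) = fst A"
    and F1: "\<And>f. f \<in> X1 \<Longrightarrow> src f \<in> X0 \<and> tgt f \<in> X0 \<and> F1 f \<in> Y1 \<and> src (F1 f) = F0 (src f) \<and> tgt (F1 f) = F0 (tgt f) \<and>
  cell_ftor (F1 f) = cell_ftor f"
    and inj: "\<And>f g. \<lbrakk>f \<in> X1; g \<in> X1; src f = src g; tgt f = tgt g; F1 f = F1 g\<rbrakk> \<Longrightarrow> f = g"
    and id1: "\<And>A. A \<in> X0 \<Longrightarrow> id1 A \<in> X1 \<and> src (id1 A) = A \<and> tgt (id1 A) = A \<and> F1 (id1 A) = id2 (F0 A)"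
    and comp1: "\<And>f g. \<lbrakk>f \<in> X1; g \<in> X1; tgt f = src g\<rbrakk> \<Longrightarrow> comp1 g f \<in> X1 \<and> src (comp1 g f) = src f \<and>
  tgt (comp1 g f) = tgt g \<and> F1 (comp1 g f) = comp2 (F1 g) (F1 f)"
    and P: "\<And>f g \<phi>. \<lbrakk>f \<in> X1; g \<in> X1; src f = src g; tgt f = tgt g\<rbrakk> \<Longrightarrow> P f g \<phi> \<longleftrightarrow> Q (F1 f) (F1 g) \<phi>"
  shows "cell_functor X0 X1 P id1 comp1 Y0 Y1 Q id2 comp2 F0 F1"
proof -
  interpret D: cell_system Y0 Y1 Q id2 comp2 by (rule Y)
  have id_ftor: "cell_ftor (id1 A) = fid (fst A)" if "A \<in> X0" for A
    using F1[of "id1 A"] id1[OF that] D.id1_cell[of "F0 A"] F0[OF that] by simp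
  have comp_ftor: "cell_ftor (comp1 g f) = fcomp (fst (src f)) (cell_ftor g) (cell_ftor f)" if "f \<in> X1" "g \<in> X1" "tgt f = src g" for f g
    using F1[of "comp1 g f"] comp1[OF that] D.comp1_cell[of "F1 f" "F1 g"] F1[OF that(1)] F1[OF that(2)] F0 that(3) by simp
  have X: "cell_system X0 X1 P id1 comp1"
  proof (rule cell_system.intro)
    show "category (fst A)" if "A \<in> X0" for A using D.X0_category[of "F0 A"] F0[OF that] by simp
    show "src f \<in> X0 \<and> tgt f \<in> X0 \<and> is_functor (fst (src f)) (fst (tgt f)) (cell_ftor f)" if "f \<in> X1" for f
      using D.X1_cell[of "F1 f"] F1[OF that] F0 by simp
    show "id1 A \<in> X1 \<and> src (id1 A) = A \<and> tgt (id1 A) = A \<and> cell_ftor (id1 A) = fid (fst A)" if "A \<in> X0" for A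
      using id1[OF that] id_ftor[OF that] by simp
    show "comp1 g f \<in> X1 \<and> src (comp1 g f) = src f \<and> tgt (comp1 g f) = tgt g \<and>
      cell_ftor (comp1 g f) = fcomp (fst (src f)) (cell_ftor g) (cell_ftor f)" if "f \<in> X1" "g \<in> X1" "tgt f = src g" for f g
      using comp1[OF that] comp_ftor[OF that] by simp
    show "comp1 (id1 (tgt f)) f = f" if f: "f \<in> X1" for f
    proof -
      note i = id1[OF conjunct1[OF conjunct2[OF F1[OF f]]]]
      note c = comp1[OF f conjunct1[OF i]]
      show ?thesis by (rule inj) (use f i c F1[OF f] D.comp1_id(1)[of "F1 f"] in simp_all)
    qed
    show "comp1 f (id1 (src f)) = f" if f: "f \<in> X1" for f
    proof -
      note i = id1[OF conjunct1[OF F1[OF f]]]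
      note c = comp1[OF conjunct1[OF i] f]
      show ?thesis by (rule inj) (use f i c F1[OF f] D.comp1_id(2)[of "F1 f"] in simp_all)
    qed
    show "comp1 (comp1 h g) f = comp1 h (comp1 g f)" if a: "f \<in> X1" "g \<in> X1" "h \<in> X1" "tgt f = src g" "tgt g = src h" for f g h
    proof -
      note gf = comp1[OF a(1,2,4)] and hg = comp1[OF a(2,3,5)]
      have l: "comp1 (comp1 h g) f \<in> X1 \<and> src (comp1 (comp1 h g) f) = src f \<and> tgt (comp1 (comp1 h g) f) = tgt h \<and>
        F1 (comp1 (comp1 h g) f) = comp2 (comp2 (F1 h) (F1 g)) (F1 f)" using comp1[of f "comp1 h g"] hg a by simp
      have r: "comp1 h (comp1 g f) \<in> X1 \<and> src (comp1 h (comp1 g f)) = src f \<and> tgt (comp1 h (comp1 g f)) = tgt h \<and>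
        F1 (comp1 h (comp1 g f)) = comp2 (F1 h) (comp2 (F1 g) (F1 f))" using comp1[of "comp1 g f" h] gf a by simp
      have e: "comp2 (comp2 (F1 h) (F1 g)) (F1 f) = comp2 (F1 h) (comp2 (F1 g) (F1 f))"
        by (rule D.comp1_assoc) (use a F1[OF a(1)] F1[OF a(2)] F1[OF a(3)] in simp_all)
      show ?thesis by (rule inj) (use l r e in simp_all)
    qed
    show "nat_trans (fst (src f)) (fst (tgt f)) (cell_ftor f) (cell_ftor g) \<phi>"
      if a: "f \<in> X1" "g \<in> X1" "src f = src g" "tgt f = tgt g" "P f g \<phi>" for f g \<phi>
      using D.P_nat[of "F1 f" "F1 g" \<phi>] P[OF a(1-4)] a F1[OF a(1)] F1[OF a(2)] F0 by simp
    show "P f f (\<lambda>Z\<in>Obj (fst (src f)). Idt (fst (tgt f)) (fob (cell_ftor f) Z))" if "f \<in> X1" for f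
      using D.P_id[of "F1 f"] P[OF that that] F1[OF that] F0 by simp
    show "P f h (\<lambda>Z\<in>Obj (fst (src f)). \<chi> Z o[fst (tgt f)] \<phi> Z)"
      if a: "f \<in> X1" "g \<in> X1" "h \<in> X1" "src f = src g" "tgt f = tgt g" "src g = src h" "tgt g = tgt h" "P f g \<phi>" "P g h \<chi>" for f g h \<phi> \<chi>
      using D.P_vert[of "F1 f" "F1 g" "F1 h" \<phi> \<chi>] P[OF a(1,2,4,5)] P[OF a(2,3,6,7)] P[OF a(1,3)] a
        F1[OF a(1)] F1[OF a(2)] F1[OF a(3)] F0 by simp
    show "P (comp1 f' f) (comp1 g' g) (\<lambda>Z\<in>Obj (fst (src f)). far (cell_ftor g') (\<phi> Z) o[fst (tgt f')] \<chi> (fob (cell_ftor f) Z))"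
      if a: "f \<in> X1" "g \<in> X1" "f' \<in> X1" "g' \<in> X1" "src f = src g" "tgt f = tgt g" "src f' = src g'" "tgt f' = tgt g'" "tgt f = src f'"
      "P f g \<phi>" "P f' g' \<chi>" for f g f' g' \<phi> \<chi>
    proof -
      have b: "tgt g = src g'" using a by simp
      note c = comp1[OF a(1,3,9)] comp1[OF a(2,4) b]
      show ?thesis
        using D.P_horiz[of "F1 f" "F1 g" "F1 f'" "F1 g'" \<phi> \<chi>] P[OF a(1,2,5,6)] P[OF a(3,4,7,8)] a c
          P[OF conjunct1[OF c(1)] conjunct1[OF c(2)]] F1[OF a(1)] F1[OF a(2)] F1[OF a(3)] F1[OF a(4)] F0 by simp
    qed
  qed
  show ?thesis
    by (rule cell_functor.intro[OF X Y], rule cell_functor_axioms.intro) (use F0 F1 id1 comp1 P in simp_all)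
qed

lemma (in cell_system) cell_functor_id: "cell_functor X0 X1 P id1 comp1 X0 X1 P id1 comp1 (\<lambda>A. A) (\<lambda>f. f)"
  by (rule cell_functor.intro[OF cell_system_axioms cell_system_axioms], rule cell_functor_axioms.intro) simp_all

lemma (in cell_system) two_fid_Cells: "two_fid Cells = mk_two_ftor Cells (\<lambda>A. A) (\<lambda>f. f) (cell_functor.F2 (\<lambda>f. f))"
proof -
  interpret I: cell_functor X0 X1 P id1 comp1 X0 X1 P id1 comp1 "\<lambda>A. A" "\<lambda>f. f" by (rule cell_functor_id)
  show ?thesis unfolding two_fid_def by (rule arg_cong[where f = "mk_two_ftor _ _ _"]) (simp add: fun_eq_iff I.F2_def)
qed

lemma cell_functor_comp:
  assumes F: "cell_functor X0 X1 P id1 comp1 Y0 Y1 Q id2 comp2 F0 F1"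
    and G: "cell_functor Y0 Y1 Q id2 comp2 Z0 Z1 R id3 comp3 G0 G1"
  shows "cell_functor X0 X1 P id1 comp1 Z0 Z1 R id3 comp3 (\<lambda>A. G0 (F0 A)) (\<lambda>f. G1 (F1 f))"
    and "two_fcomp (cell_system.Cells X0 X1 P id1 comp1)
  (mk_two_ftor (cell_system.Cells Y0 Y1 Q id2 comp2) G0 G1 (cell_functor.F2 G1))
  (mk_two_ftor (cell_system.Cells X0 X1 P id1 comp1) F0 F1 (cell_functor.F2 F1)) =
  mk_two_ftor (cell_system.Cells X0 X1 P id1 comp1) (\<lambda>A. G0 (F0 A)) (\<lambda>f. G1 (F1 f)) (cell_functor.F2 (\<lambda>f. G1 (F1 f)))"
proof -
  interpret F: cell_functor X0 X1 P id1 comp1 Y0 Y1 Q id2 comp2 F0 F1 by (rule F)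
  interpret G: cell_functor Y0 Y1 Q id2 comp2 Z0 Z1 R id3 comp3 G0 G1 by (rule G)
  show GF: "cell_functor X0 X1 P id1 comp1 Z0 Z1 R id3 comp3 (\<lambda>A. G0 (F0 A)) (\<lambda>f. G1 (F1 f))"
  proof (rule cell_functor.intro[OF F.C.cell_system_axioms G.D.cell_system_axioms], rule cell_functor_axioms.intro)
    show "R (G1 (F1 f)) (G1 (F1 g)) \<phi>" if a: "f \<in> X1" "g \<in> X1" "src f = src g" "tgt f = tgt g" "P f g \<phi>" for f g \<phi>
      using G.F1_P[OF _ _ _ _ F.F1_P[OF a]] F.F1[OF a(1)] F.F1[OF a(2)] a by simp
    show "G1 (F1 (comp1 g f)) = comp3 (G1 (F1 g)) (G1 (F1 f))" if a: "f \<in> X1" "g \<in> X1" "tgt f = src g" for f g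
      using F.F1_comp[OF a] G.F1_comp[of "F1 f" "F1 g"] F.F1[OF a(1)] F.F1[OF a(2)] a by simp
  qed (use F.F0 F.F1 F.F1_id G.F0 G.F1 G.F1_id in simp_all)
  interpret GF: cell_functor X0 X1 P id1 comp1 Z0 Z1 R id3 comp3 "\<lambda>A. G0 (F0 A)" "\<lambda>f. G1 (F1 f)" by (rule GF)
  show "two_fcomp F.C.Cells (mk_two_ftor F.D.Cells G0 G1 G.F2) (mk_two_ftor F.C.Cells F0 F1 F.F2) =
    mk_two_ftor F.C.Cells (\<lambda>A. G0 (F0 A)) (\<lambda>f. G1 (F1 f)) GF.F2"
    unfolding two_fcomp_def mk_two_ftor_def two_ftor.inject
    by (intro conjI restrict_ext) (simp_all add: F.F0 F.F1 F.F2_X2 G.F2_def GF.F2_def)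
qed

section \<open>The 2-equivalence\<close>

abbreviation dm_P :: "('o, 'a) dm_1 \<Rightarrow> ('o, 'a) dm_1 \<Rightarrow> ('o \<Rightarrow> 'a) \<Rightarrow> bool" where
  "dm_P f g \<phi> \<equiv> is_monoidal_trans (fst (src f)) (snd (src f)) (fst (tgt f)) (snd (tgt f))
     (fst (dat f)) (snd (dat f)) (fst (dat g)) (snd (dat g)) \<phi>"

abbreviation pl_P :: "('u set \<Rightarrow> bool) \<Rightarrow> ('u, 'o, 'a) pl_1 \<Rightarrow> ('u, 'o, 'a) pl_1 \<Rightarrow> ('o \<Rightarrow> 'a) \<Rightarrow> bool" where
  "pl_P small f g \<phi> \<equiv> is_graph_monad_trans small (fst (src f)) (snd (src f)) (fst (tgt f)) (snd (tgt f))
     (fst (dat f)) (snd (dat f)) (fst (dat g)) (snd (dat g)) \<phi>"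

type_synonym ('o, 'a) dm_cat = "(('o, 'a) dm_0, ('o, 'a) dm_1, ('o, 'a) dm_2) two_cat"
type_synonym ('u, 'o, 'a) pl_cat = "(('u, 'o, 'a) pl_0, ('u, 'o, 'a) pl_1, ('u, 'o, 'a) pl_2) two_cat"

abbreviation ftor_cell :: "('o, 'a, 'e, 'p) one_cell \<Rightarrow> bool" where
  "ftor_cell f \<equiv> is_functor (fst (src f)) (fst (tgt f)) (fst (dat f))"

abbreviation lax_cell :: "('o, 'a) dm_1 \<Rightarrow> bool" where
  "lax_cell f \<equiv> is_lax_monoidal (fst (src f)) (snd (src f)) (fst (tgt f)) (snd (tgt f)) (fst (dat f)) (snd (dat f))"

abbreviation monad_cell :: "('u set \<Rightarrow> bool) \<Rightarrow> ('u, 'o, 'a) pl_1 \<Rightarrow> bool" where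
  "monad_cell small g \<equiv> is_graph_monad_functor small (fst (src g)) (snd (src g)) (fst (tgt g)) (snd (tgt g)) (fst (dat g)) (snd (dat g))"

lemma dm_arrows_iff:
  "f \<in> dm_arrows small \<longleftrightarrow> src f \<in> dm_objects small \<and> tgt f \<in> dm_objects small \<and>
     lax_cell f"
  by (cases f; cases "src f"; cases "tgt f"; cases "dat f") (simp add: dm_arrows_def)

lemma pl_arrows_iff:
  "f \<in> pl_arrows small \<nu> \<longleftrightarrow> src f \<in> pl_objects small \<nu> \<and> tgt f \<in> pl_objects small \<nu> \<and>
     monad_cell small f"
  by (cases f; cases "src f"; cases "tgt f"; cases "dat f") (simp add: pl_arrows_def)

lemma dm_id_simps [simp]:
  "src (dm_id A) = A" "tgt (dm_id A) = A"
  "dat (dm_id A) = (fid (fst A), \<lambda>Z\<in>lists (Obj (fst A)). Idt (fst A) (mt_ob (snd A) Z))"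
  by (cases A; simp)+

lemma dm_comp_simps [simp]:
  "src (dm_comp g f) = src f" "tgt (dm_comp g f) = tgt g"
  "dat (dm_comp g f) = (fcomp (fst (src f)) (fst (dat g)) (fst (dat f)),
     \<lambda>Z\<in>lists (Obj (fst (src f))). far (fst (dat g)) (snd (dat f) Z) o[fst (tgt g)] snd (dat g) (map (fob (fst (dat f))) Z))"
  by (cases f; cases g; cases "src f"; cases "tgt g"; cases "dat f"; cases "dat g"; simp)+

lemma pl_id_simps [simp]:
  "src (pl_id small A) = A" "tgt (pl_id small A) = A"
  "dat (pl_id small A) = (fid (fst A), \<lambda>X\<in>Obj (graph_cat small (fst A)). Idt (graph_cat small (fst A)) (fob (mnd_fun (snd A)) X))"
  by (cases A; simp)+

lemma pl_comp_simps [simp]: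
  "src (pl_comp small g f) = src f" "tgt (pl_comp small g f) = tgt g"
  "dat (pl_comp small g f) = (fcomp (fst (src f)) (fst (dat g)) (fst (dat f)),
     \<lambda>X\<in>Obj (graph_cat small (fst (src f))). far (graph_fun small (fst (src g)) (fst (dat g))) (snd (dat f) X)
  o[graph_cat small (fst (tgt g))] snd (dat g) (fob (graph_fun small (fst (src f)) (fst (dat f))) X))"
  by (cases f; cases g; cases "src f"; cases "src g"; cases "tgt g"; cases "dat f"; cases "dat g"; simp)+

lemma bar_simps [simp]:
  "fst (bar_0 \<nu> B) = fst B" "snd (bar_0 \<nu> B) = bar_multitensor \<nu> (fst B) (snd B)"
  "src (bar_1 \<nu> g) = bar_0 \<nu> (src g)" "tgt (bar_1 \<nu> g) = bar_0 \<nu> (tgt g)"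
  "dat (bar_1 \<nu> g) = (fst (dat g), bar_coherence \<nu> (fst (src g)) (fst (tgt g)) (snd (tgt g)) (fst (dat g)) (snd (dat g)))"
  by (cases B; simp)+ (cases g; cases "src g"; cases "tgt g"; cases "dat g"; simp)+

lemma Gam_simps [simp]:
  "fst (Gam_0 small A) = fst A" "snd (Gam_0 small A) = Gam_monad small (fst A) (snd A)"
  "src (Gam_1 small f) = Gam_0 small (src f)" "tgt (Gam_1 small f) = Gam_0 small (tgt f)"
  "dat (Gam_1 small f) = (fst (dat f), Gam_coherence small (fst (src f)) (snd (src f)) (fst (tgt f)) (snd (tgt f)) (fst (dat f)) (snd (dat f)))"
  by (cases A; simp)+ (cases f; cases "src f"; cases "tgt f"; cases "dat f"; simp)+

lemma cell_eqI: "\<lbrakk>src f = src g; tgt f = tgt g; fst (dat f) = fst (dat g); snd (dat f) = snd (dat g)\<rbrakk> \<Longrightarrow> f = g"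
  by (simp add: cell.expand prod_eq_iff)

locale small_graphs = smallness small for small :: "'u set \<Rightarrow> bool" +
  fixes \<nu> :: "nat \<Rightarrow> 'u"
  assumes inj_\<nu>: "inj \<nu>"
begin

text \<open>A relation and not a map: t and s stand for whichever comparisons relate the sources and
  the targets, so that cells between objects of the forms A, Gamma A, bar B and their iterates are
  all treated alike.\<close>

definition matches :: "(('u, 'o) graph \<Rightarrow> 'u list \<Rightarrow> 'a) \<Rightarrow> (('u, 'o) graph \<Rightarrow> 'u list \<Rightarrow> 'a)
    \<Rightarrow> ('o, 'a) dm_1 \<Rightarrow> ('u, 'o, 'a) pl_1 \<Rightarrow> bool" where
  "matches t s f g \<longleftrightarrow> fst (src f) = fst (src g) \<and> fst (tgt f) = fst (tgt g) \<and> fst (dat f) = fst (dat g) \<and>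
     corresponds small (fst (src f)) (snd (src f)) (snd (src g)) t (fst (tgt f)) (snd (tgt f)) (snd (tgt g)) s
  (fst (dat f)) (snd (dat f)) (snd (dat g))"

definition compared :: "(('u, 'o) graph \<Rightarrow> 'u list \<Rightarrow> 'a) \<Rightarrow> ('o, 'a) dm_0 \<Rightarrow> ('u, 'o, 'a) pl_0 \<Rightarrow> bool" where
  "compared t A B \<longleftrightarrow> fst A = fst B \<and> comparison small \<nu> (fst A) (snd A) (snd B) t"

lemma matches_corresponding:
  assumes "compared t (src f) (src g)" "compared s (tgt f) (tgt g)" "matches t s f g"
    and "ftor_cell f"
  shows "corresponding small \<nu> (fst (src f)) (snd (src f)) (snd (src g)) t (fst (tgt f)) (snd (tgt f)) (snd (tgt g)) s
  (fst (dat f)) (snd (dat f)) (snd (dat g))"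
  using assms unfolding compared_def matches_def
  by (blast intro: corresponding.intro comparison_functor.intro corresponding_axioms.intro)

abbreviation \<Gamma>in :: "('o, 'a) dm_0 \<Rightarrow> ('u, 'o) graph \<Rightarrow> 'u list \<Rightarrow> 'a" where "\<Gamma>in A \<equiv> Gam_in (fst A) (snd A)"
abbreviation Bin :: "('u, 'o, 'a) pl_0 \<Rightarrow> ('u, 'o) graph \<Rightarrow> 'u list \<Rightarrow> 'a" where "Bin B \<equiv> bar_in \<nu> (fst B) (snd B)"

abbreviation DM0 :: "('o, 'a) dm_0 set" where "DM0 \<equiv> dm_objects small"
abbreviation DM1 :: "('o, 'a) dm_1 set" where "DM1 \<equiv> dm_arrows small"
abbreviation PL0 :: "('u, 'o, 'a) pl_0 set" where "PL0 \<equiv> pl_objects small \<nu>"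
abbreviation PL1 :: "('u, 'o, 'a) pl_1 set" where "PL1 \<equiv> pl_arrows small \<nu>"

lemma Gam_compared: "A \<in> DM0 \<Longrightarrow> compared (\<Gamma>in A) A (Gam_0 small A)"
  using dm_object_comparison[OF smallness_axioms inj_\<nu>, of "fst A" "snd A"] by (simp add: compared_def)

lemma bar_compared: "B \<in> PL0 \<Longrightarrow> compared (Bin B) (bar_0 \<nu> B) B"
  using pl_object_comparison[OF smallness_axioms inj_\<nu>, of "fst B" "snd B"] by (simp add: compared_def)

lemma Gam_0_pl:
  assumes "A \<in> DM0" shows "Gam_0 small A \<in> PL0"
proof -
  obtain V E where A: "A = (V, E)" by (cases A)
  interpret comparison small \<nu> V E "Gam_monad small V E" "Gam_in V E"
    using Gam_compared[OF assms] A by (simp add: compared_def)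
  show ?thesis using assms monad_of_multitensor bar_distributive T_path_like by (simp add: A pl_objects_def dm_objects_def)
qed

lemma bar_0_dm:
  assumes "B \<in> PL0" shows "bar_0 \<nu> B \<in> DM0"
proof -
  obtain V T where B: "B = (V, T)" by (cases B)
  interpret comparison small \<nu> V "bar_multitensor \<nu> V T" T "bar_in \<nu> V T"
    using bar_compared[OF assms] B by (simp add: compared_def)
  have "is_multitensor V (bar_multitensor \<nu> V T)"
    by (rule multitensor_of_monad) (use assms in \<open>simp add: B pl_objects_def monad_over_Set_def\<close>)
  then show ?thesis using assms E_pres by (simp add: B pl_objects_def dm_objects_def)
qed

text \<open>Every object is compared with its own Gamma; these comparisons supply the premises of
  the lemmas on composites.\<close>

lemma dm_cell_system: "cell_system (DM0 :: ('o, 'a) dm_0 set) (DM1) dm_P dm_id dm_comp"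
proof (rule cell_system.intro)
  have cmp: "comparison small \<nu> (fst A) (snd A) (snd (Gam_0 small A)) (\<Gamma>in A)" if "A \<in> DM0" for A :: "('o, 'a) dm_0"
    using Gam_compared[OF that] by (simp add: compared_def)
  note fn = is_lax_monoidal.underlying_functor
  show "category (fst A)" if "A \<in> DM0" for A :: "('o, 'a) dm_0" using that by (auto simp: dm_objects_def)
  show "src f \<in> DM0 \<and> tgt f \<in> DM0 \<and> ftor_cell f"
    if "f \<in> DM1" for f :: "('o, 'a) dm_1" using that fn by (auto simp: dm_arrows_iff)
  show "dm_id A \<in> DM1 \<and> src (dm_id A) = A \<and> tgt (dm_id A) = A \<and> cell_ftor (dm_id A) = fid (fst A)"
    if "A \<in> DM0" for A :: "('o, 'a) dm_0"
    using that comparison.lax_id[OF cmp[OF that]] unfolding comparison.id_\<psi>_def[OF cmp[OF that]] by (simp add: dm_arrows_iff)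
  show "dm_comp g f \<in> DM1 \<and> src (dm_comp g f) = src f \<and> tgt (dm_comp g f) = tgt g \<and>
    cell_ftor (dm_comp g f) = fcomp (fst (src f)) (cell_ftor g) (cell_ftor f)"
    if "f \<in> DM1" "g \<in> DM1" "tgt f = src g" for f g :: "('o, 'a) dm_1"
    using that lax_comp[OF cmp cmp cmp, of "src f" "src g" "tgt g"] by (simp add: dm_arrows_iff)
  show "dm_comp (dm_id (tgt f)) f = f" if f: "f \<in> DM1" for f :: "('o, 'a) dm_1"
  proof -
    have A: "src f \<in> DM0" "tgt f \<in> DM0" and L: "lax_cell f"
      using f by (simp_all add: dm_arrows_iff)
    interpret C: comparison small \<nu> "fst (src f)" "snd (src f)" "snd (Gam_0 small (src f))" "\<Gamma>in (src f)" by (rule cmp[OF A(1)])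
    interpret D: comparison small \<nu> "fst (tgt f)" "snd (tgt f)" "snd (Gam_0 small (tgt f))" "\<Gamma>in (tgt f)" by (rule cmp[OF A(2)])
    interpret H: is_functor "fst (src f)" "fst (tgt f)" "fst (dat f)" by (rule fn[OF L])
    note l = lax_facts[OF L]
    show ?thesis
    proof (rule cell_eqI)
      show "snd (dat (dm_comp (dm_id (tgt f)) f)) = snd (dat f)"
      proof (rule extensionalityI[of _ "lists (Obj (fst (src f)))"])
        fix Z assume Z: "Z \<in> lists (Obj (fst (src f)))"
        have "map (fob (fst (dat f))) Z \<in> lists (Obj (fst (tgt f)))" by (rule map_lists[OF Z H.fob_Obj])
        then show "snd (dat (dm_comp (dm_id (tgt f)) f)) Z = snd (dat f) Z"
          using Z l(1)[OF Z] by (simp add: hom_iff del: in_lists_conv_set)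
      qed (use l(3) in simp_all)
    qed (simp_all add: fcomp_fid[OF fn[OF L]])
  qed
  show "dm_comp f (dm_id (src f)) = f" if f: "f \<in> DM1" for f :: "('o, 'a) dm_1"
  proof -
    have A: "src f \<in> DM0" and L: "lax_cell f"
      and B: "tgt f \<in> DM0" using f by (simp_all add: dm_arrows_iff)
    interpret C: comparison small \<nu> "fst (src f)" "snd (src f)" "snd (Gam_0 small (src f))" "\<Gamma>in (src f)" by (rule cmp[OF A])
    interpret D: comparison small \<nu> "fst (tgt f)" "snd (tgt f)" "snd (Gam_0 small (tgt f))" "\<Gamma>in (tgt f)" by (rule cmp[OF B])
    interpret H: is_functor "fst (src f)" "fst (tgt f)" "fst (dat f)" by (rule fn[OF L])
    note l = lax_facts[OF L]
    show ?thesis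
    proof (rule cell_eqI)
      show "snd (dat (dm_comp f (dm_id (src f)))) = snd (dat f)"
      proof (rule extensionalityI[of _ "lists (Obj (fst (src f)))"])
        fix Z assume Z: "Z \<in> lists (Obj (fst (src f)))"
        show "snd (dat (dm_comp f (dm_id (src f)))) Z = snd (dat f) Z"
          using Z l(1)[OF Z] H.far_Idt[OF C.E_ob[OF Z]] map_fid(1)[OF Z] by (simp add: hom_iff del: in_lists_conv_set)
      qed (use l(3) in simp_all)
    qed (simp_all add: fcomp_fid[OF fn[OF L]])
  qed
  show "dm_comp (dm_comp h g) f = dm_comp h (dm_comp g f)"
    if a: "f \<in> DM1" "g \<in> DM1" "h \<in> DM1" "tgt f = src g" "tgt g = src h" for f g h :: "('o, 'a) dm_1"
  proof -
    have A: "src f \<in> DM0" "src g \<in> DM0" "src h \<in> DM0" "tgt h \<in> DM0"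
      and L: "is_lax_monoidal (fst (src f)) (snd (src f)) (fst (src g)) (snd (src g)) (fst (dat f)) (snd (dat f))"
      "is_lax_monoidal (fst (src g)) (snd (src g)) (fst (src h)) (snd (src h)) (fst (dat g)) (snd (dat g))"
      "lax_cell h"
      using a by (simp_all add: dm_arrows_iff)
    interpret U: comparison small \<nu> "fst (tgt h)" "snd (tgt h)" "snd (Gam_0 small (tgt h))" "\<Gamma>in (tgt h)" by (rule cmp[OF A(4)])
    interpret F: is_functor "fst (src f)" "fst (src g)" "fst (dat f)" by (rule fn[OF L(1)])
    interpret G: is_functor "fst (src g)" "fst (src h)" "fst (dat g)" by (rule fn[OF L(2)])
    interpret H: is_functor "fst (src h)" "fst (tgt h)" "fst (dat h)" by (rule fn[OF L(3)])
    show ?thesis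
    proof (rule cell_eqI)
      show "snd (dat (dm_comp (dm_comp h g) f)) = snd (dat (dm_comp h (dm_comp g f)))"
      proof (rule extensionalityI[of _ "lists (Obj (fst (src f)))"])
        fix Z assume Z: "Z \<in> lists (Obj (fst (src f)))"
        have FZ: "map (fob (fst (dat f))) Z \<in> lists (Obj (fst (src g)))" by (rule map_lists[OF Z F.fob_Obj])
        have GFZ: "map (fob (fst (dat g))) (map (fob (fst (dat f))) Z) \<in> lists (Obj (fst (src h)))" by (rule map_lists[OF FZ G.fob_Obj])
        have m: "map (fob (fcomp (fst (src f)) (fst (dat g)) (fst (dat f)))) Z = map (fob (fst (dat g))) (map (fob (fst (dat f))) Z)"
          using Z by auto
        note p = lax_facts(1)[OF L(1) Z] and q = lax_facts(1)[OF L(2) FZ] and r = lax_facts(1)[OF L(3) GFZ]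
        have pA: "snd (dat f) Z \<in> Arr (fst (src g))" using p by (simp add: hom_iff)
        show "snd (dat (dm_comp (dm_comp h g) f)) Z = snd (dat (dm_comp h (dm_comp g f))) Z"
          using Z FZ pA m H.far_hom[OF q] H.far_hom[OF G.far_hom[OF p]] r H.far_Cmp[OF q G.far_hom[OF p]] a(4,5)
          by (simp add: hom_iff U.assoc del: in_lists_conv_set map_map)
      qed simp_all
    qed (simp_all add: fcomp_assoc[OF fn[OF L(1)]] a(4))
  qed
  show "nat_trans (fst (src f)) (fst (tgt f)) (cell_ftor f) (cell_ftor g) \<phi>" if "dm_P f g \<phi>" for f g :: "('o, 'a) dm_1" and \<phi>
    by (rule is_monoidal_trans.underlying_trans[OF that])
  show "dm_P f f (\<lambda>Z\<in>Obj (fst (src f)). Idt (fst (tgt f)) (fob (cell_ftor f) Z))" if "f \<in> DM1" for f :: "('o, 'a) dm_1"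
    using that by (intro monoidal_trans_id[OF cmp cmp]) (simp_all add: dm_arrows_iff)
  show "dm_P f h (\<lambda>Z\<in>Obj (fst (src f)). \<chi> Z o[fst (tgt f)] \<phi> Z)"
    if "f \<in> DM1" "g \<in> DM1" "h \<in> DM1" "src f = src g" "tgt f = tgt g" "src g = src h" "tgt g = tgt h"
    "dm_P f g \<phi>" "dm_P g h \<chi>" for f g h :: "('o, 'a) dm_1" and \<phi> \<chi>
    using that by (intro monoidal_trans_vertical[OF cmp cmp]) (simp_all add: dm_arrows_iff)
  show "dm_P (dm_comp f' f) (dm_comp g' g) (\<lambda>Z\<in>Obj (fst (src f)). far (cell_ftor g') (\<phi> Z) o[fst (tgt f')] \<chi> (fob (cell_ftor f) Z))"
    if "f \<in> DM1" "g \<in> DM1" "f' \<in> DM1" "g' \<in> DM1" "src f = src g" "tgt f = tgt g"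
    "src f' = src g'" "tgt f' = tgt g'" "tgt f = src f'" "dm_P f g \<phi>" "dm_P f' g' \<chi>" for f g f' g' :: "('o, 'a) dm_1" and \<phi> \<chi>
    using that monoidal_trans_horizontal[OF cmp cmp cmp, of "src f" "src f'" "tgt f'"] by (simp add: dm_arrows_iff)
qed

section \<open>Calculus of matched 1-cells\<close>

lemma comparedD:
  assumes "compared t A B"
  shows "fst B = fst A" "comparison small \<nu> (fst A) (snd A) (snd B) t"
  using assms unfolding compared_def by auto

lemma matchesD:
  assumes "matches t s f g"
  shows "fst (src g) = fst (src f)" "fst (tgt g) = fst (tgt f)" "fst (dat g) = fst (dat f)"
    and "corresponds small (fst (src f)) (snd (src f)) (snd (src g)) t (fst (tgt f)) (snd (tgt f)) (snd (tgt g)) s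
  (fst (dat f)) (snd (dat f)) (snd (dat g))"
  using assms unfolding matches_def by auto

lemma matches_comp:
  assumes c: "compared t (src f) (src g)" "compared s (tgt f) (tgt g)" "compared r (tgt f') (tgt g')"
    and m: "matches t s f g" "matches s r f' g'" and st: "tgt f = src f'" "tgt g = src g'"
    and H: "ftor_cell f" "ftor_cell f'"
  shows "matches t r (dm_comp f' f) (pl_comp small g' g)"
proof -
  note m1 = matchesD[OF m(1)] and m2 = matchesD[OF m(2)]
  have c2: "comparison small \<nu> (fst (src f')) (snd (src f')) (snd (src g')) s" using comparedD(2)[OF c(2)] st by simp
  show ?thesis
    unfolding matches_def
    using corresponds_comp[OF comparedD(2)[OF c(1)] c2 comparedD(2)[OF c(3)] H(1)[unfolded st(1)] H(2) m1(4)[unfolded st] m2(4)] m1(1-3) m2(1-3) by simp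
qed

lemma matches_id:
  assumes "compared t A B" shows "matches t t (dm_id A) (pl_id small B)"
proof -
  note c = comparedD(2)[OF assms] and e = comparedD(1)[OF assms]
  show ?thesis
    using comparison.corresponds_id[OF c] unfolding comparison.id_\<psi>_def[OF c] comparison.id_\<Psi>_def[OF c]
    by (simp add: matches_def e)
qed

text \<open>Together with \<open>matches_left_unique\<close> this is the method by which all later
  equations of 1-cells are shown: match both sides with a common partner.\<close>

lemma matches_right_unique:
  assumes "compared t (src f) (src g)" "compared s (tgt f) (tgt g)" "matches t s f g" "matches t s f g'"
    and "ftor_cell f" and "src g' = src g" "tgt g' = tgt g"
  shows "g' = g"
proof (rule cell_eqI)
  show "snd (dat g') = snd (dat g)"
    by (rule corresponding.\<Psi>_unique[OF matches_corresponding[OF assms(1,2,3,5)]]) (use matchesD(4)[OF assms(4)] matchesD(1-3)[OF assms(4)] assms(6,7) in simp)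
qed (use matchesD(1-3)[OF assms(3)] matchesD(1-3)[OF assms(4)] assms(6,7) in simp_all)

lemma matches_left_unique:
  assumes "compared t (src f) (src g)" "compared s (tgt f) (tgt g)" "matches t s f g" "matches t s f' g"
    and "ftor_cell f" and "src f' = src f" "tgt f' = tgt f"
  shows "f' = f"
proof (rule cell_eqI)
  have e: "fst (dat f') = fst (dat f)" using matchesD(3)[OF assms(3)] matchesD(3)[OF assms(4)] by simp
  show "snd (dat f') = snd (dat f)"
    by (intro corresponding.\<psi>_unique[OF matches_corresponding[OF assms(1,2,3,5)]]) (use matchesD(4)[OF assms(4)] e assms(6,7) in simp)
qed (use matchesD(3)[OF assms(3)] matchesD(3)[OF assms(4)] assms(6,7) in simp_all)

lemma matches_P:
  assumes "compared t (src f) (src g)" "compared s (tgt f) (tgt g)" "matches t s f g" "matches t s f' g'"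
    and "ftor_cell f" "is_functor (fst (src f)) (fst (tgt f)) (fst (dat f'))"
    and "src f' = src f" "tgt f' = tgt f" "src g' = src g" "tgt g' = tgt g"
  shows "dm_P f f' \<phi> \<longleftrightarrow> pl_P small g g' \<phi>"
proof -
  have c: "compared t (src f') (src g')" "compared s (tgt f') (tgt g')" using assms by simp_all
  have "corresponding small \<nu> (fst (src f)) (snd (src f)) (snd (src g)) t (fst (tgt f)) (snd (tgt f)) (snd (tgt g)) s
    (fst (dat f')) (snd (dat f')) (snd (dat g'))"
    using matches_corresponding[OF c assms(4)] assms(6-10) by simp
  from trans_iff[OF matches_corresponding[OF assms(1,2,3,5)] this] show ?thesis
    using matchesD(1-3)[OF assms(3)] matchesD(3)[OF assms(4)] assms(7-10) by simp
qed

text \<open>Since matching makes no reference to laws, being a 1-cell transfers in both directions;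
  none of the constructed cells has its laws checked by hand.\<close>

lemma matches_arrow_iff:
  assumes "compared t (src f) (src g)" "compared s (tgt f) (tgt g)" "matches t s f g"
    and "src f \<in> dm_objects small" "tgt f \<in> dm_objects small" "src g \<in> pl_objects small \<nu>" "tgt g \<in> pl_objects small \<nu>"
  shows "f \<in> dm_arrows small \<longleftrightarrow> g \<in> pl_arrows small \<nu>"
proof -
  let ?lax = "lax_cell f"
  let ?gmf = "is_graph_monad_functor small (fst (src f)) (snd (src g)) (fst (tgt f)) (snd (tgt g)) (fst (dat f)) (snd (dat g))"
  have "?lax \<longleftrightarrow> ?gmf" if "ftor_cell f"
    by (rule corresponding.lax_iff[OF matches_corresponding[OF assms(1-3) that]])
  then have "?lax \<longleftrightarrow> ?gmf" using is_lax_monoidal.underlying_functor is_graph_monad_functor.underlying_functor by blast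
  moreover have "?gmf \<longleftrightarrow> monad_cell small g"
    using assms(3) by (simp add: matches_def)
  ultimately show ?thesis using assms(4-7) unfolding dm_arrows_iff pl_arrows_iff by blast
qed

text \<open>Supplies the components of the unit and their inverses: cells between two multitensors
  compared with B, matched with the identity of B.\<close>

lemma matches_same_monad:
  assumes "compared t A B" "compared s A' B"
  shows "\<exists>f. src f = A \<and> tgt f = A' \<and> matches t s f (pl_id small B)"
proof -
  have e: "fst B = fst A" "fst A' = fst A" using comparedD(1)[OF assms(1)] comparedD(1)[OF assms(2)] by simp_all
  have c: "comparison small \<nu> (fst A) (snd A) (snd B) t" "comparison small \<nu> (fst A) (snd A') (snd B) s"
    using comparedD(2)[OF assms(1)] comparedD(2)[OF assms(2)] e by simp_all
  obtain \<psi> where "corresponds small (fst A) (snd A) (snd B) t (fst A) (snd A') (snd B) s (fid (fst A)) \<psi>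
    (\<lambda>X\<in>Obj (graph_cat small (fst A)). Idt (graph_cat small (fst A)) (fob (mnd_fun (snd B)) X))"
    using comparison.corresponds_same_monad[OF c] unfolding comparison.id_\<Psi>_def[OF c(1)] by blast
  then have "matches t s (Cell A A' (fid (fst A), \<psi>)) (pl_id small B)" by (simp add: matches_def e)
  then show ?thesis by (intro exI[of _ "Cell A A' (fid (fst A), \<psi>)"]) simp
qed

text \<open>Supplies the components of the counit and their inverses: cells between two monads
  compared with A, matched with the identity of A.\<close>

lemma matches_same_multitensor:
  assumes "compared t A B" "compared s A B'"
  shows "\<exists>g. src g = B \<and> tgt g = B' \<and> matches t s (dm_id A) g"
proof -
  note c = comparedD(2)[OF assms(1)] comparedD(2)[OF assms(2)] and e = comparedD(1)[OF assms(1)] comparedD(1)[OF assms(2)]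
  obtain \<Psi> where "corresponds small (fst A) (snd A) (snd B) t (fst A) (snd A) (snd B') s (fid (fst A))
    (\<lambda>Z\<in>lists (Obj (fst A)). Idt (fst A) (mt_ob (snd A) Z)) \<Psi>"
    using comparison.corresponds_same_multitensor[OF c] unfolding comparison.id_\<psi>_def[OF c(1)] by blast
  then have "matches t s (dm_id A) (Cell B B' (fid (fst A), \<Psi>))" by (simp add: matches_def e)
  then show ?thesis by (intro exI[of _ "Cell B B' (fid (fst A), \<Psi>)"]) simp
qed

section \<open>Gamma and bar as 2-functors\<close>

lemma dm_functor: "f \<in> DM1 \<Longrightarrow> ftor_cell f"
  unfolding dm_arrows_iff by (blast dest: is_lax_monoidal.underlying_functor)

lemma Gam_1_matches:
  fixes f :: "('o, 'a) dm_1"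
  assumes "f \<in> DM1"
  shows "matches (\<Gamma>in (src f)) (\<Gamma>in (tgt f)) f (Gam_1 small f)" and "Gam_1 small f \<in> PL1"
proof -
  have A: "src f \<in> DM0" "tgt f \<in> DM0"
    and L: "lax_cell f"
    using assms by (simp_all add: dm_arrows_iff)
  have D: "distributive_multitensor small \<nu> (fst A) (snd A)" if "A \<in> DM0" for A :: "('o, 'a) dm_0"
    using that smallness_axioms inj_\<nu> by (cases A) (intro distributive_multitensor.intro gcat.intro gcat_axioms.intro
      distributive_multitensor_axioms.intro, simp_all add: dm_objects_def)
  note l = lax_facts[OF L]
  show m: "matches (\<Gamma>in (src f)) (\<Gamma>in (tgt f)) f (Gam_1 small f)"
    using Gam_coherence_corresponds[OF D[OF A(1)] D[OF A(2)] dm_functor[OF assms] l(3) l(1)] by (simp add: matches_def)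
  show "Gam_1 small f \<in> PL1"
    using matches_arrow_iff[OF _ _ m A] assms Gam_compared[OF A(1)] Gam_compared[OF A(2)] Gam_0_pl[OF A(1)] Gam_0_pl[OF A(2)] by simp
qed

lemma bar_1_matches:
  assumes "g \<in> PL1"
  shows "matches (Bin (src g)) (Bin (tgt g)) (bar_1 \<nu> g) g" and "bar_1 \<nu> g \<in> DM1"
proof -
  have B: "src g \<in> PL0" "tgt g \<in> PL0"
    and M: "monad_cell small g"
    using assms by (simp_all add: pl_arrows_iff)
  note c = bar_compared[OF B(1)] bar_compared[OF B(2)]
  show m: "matches (Bin (src g)) (Bin (tgt g)) (bar_1 \<nu> g) g"
    using bar_coherence_corresponds[OF _ _ M] c by (simp add: matches_def compared_def)
  show "bar_1 \<nu> g \<in> DM1"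
    using matches_arrow_iff[OF _ _ m] assms c B bar_0_dm[OF B(1)] bar_0_dm[OF B(2)] by simp
qed

text \<open>bar is injective on parallel 1-cells because a 1-cell of PLMND is determined by the
  partner it is matched with. The equations for identities and composites come from left uniqueness,
  and the transfer then yields the 2-category PLMND and the 2-functor in one go.\<close>

lemma bar_cell_functor:
  "cell_functor (PL0 :: ('u, 'o, 'a) pl_0 set) (PL1) (pl_P small) (pl_id small) (pl_comp small)
    (DM0) (DM1) dm_P dm_id dm_comp (bar_0 \<nu>) (bar_1 \<nu>)"
proof (rule cell_system_transfer[OF dm_cell_system])
  interpret DM: cell_system "DM0 :: ('o, 'a) dm_0 set" DM1 dm_P dm_id dm_comp by (rule dm_cell_system)
  have ob: "src g \<in> PL0" "tgt g \<in> PL0" if "g \<in> PL1" for g :: "('u, 'o, 'a) pl_1"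
    using that by (simp_all add: pl_arrows_iff)
  have cm: "compared (Bin (src g)) (src (bar_1 \<nu> g)) (src g)" "compared (Bin (tgt g)) (tgt (bar_1 \<nu> g)) (tgt g)"
    if "g \<in> PL1" for g :: "('u, 'o, 'a) pl_1" using ob[OF that] bar_compared by simp_all
  have fn: "ftor_cell (bar_1 \<nu> g)" if "g \<in> PL1" for g :: "('u, 'o, 'a) pl_1"
    by (rule dm_functor[OF bar_1_matches(2)[OF that]])
  show "bar_0 \<nu> B \<in> DM0 \<and> fst (bar_0 \<nu> B) = fst B" if "B \<in> PL0" for B :: "('u, 'o, 'a) pl_0"
    using bar_0_dm[OF that] by simp
  show "src g \<in> PL0 \<and> tgt g \<in> PL0 \<and> bar_1 \<nu> g \<in> DM1 \<and> src (bar_1 \<nu> g) = bar_0 \<nu> (src g) \<and>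
    tgt (bar_1 \<nu> g) = bar_0 \<nu> (tgt g) \<and> cell_ftor (bar_1 \<nu> g) = cell_ftor g" if "g \<in> PL1" for g :: "('u, 'o, 'a) pl_1"
    using that bar_1_matches(2)[OF that] by (simp add: pl_arrows_iff)
  show "f = g" if a: "f \<in> PL1" "g \<in> PL1" "src f = src g" "tgt f = tgt g" "bar_1 \<nu> f = bar_1 \<nu> g"
    for f g :: "('u, 'o, 'a) pl_1"
    by (rule matches_right_unique[OF cm[OF a(2)] bar_1_matches(1)[OF a(2)] _ fn[OF a(2)] a(3,4)])
      (use bar_1_matches(1)[OF a(1)] a(3-5) in simp)
  show "pl_id small B \<in> PL1 \<and> src (pl_id small B) = B \<and> tgt (pl_id small B) = B \<and> bar_1 \<nu> (pl_id small B) = dm_id (bar_0 \<nu> B)"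
    if B: "B \<in> PL0" for B :: "('u, 'o, 'a) pl_0"
  proof -
    note c = bar_compared[OF B]
    note m = matches_id[OF c]
    have d: "dm_id (bar_0 \<nu> B) \<in> DM1" using DM.id1_cell[OF bar_0_dm[OF B]] by simp
    have p: "pl_id small B \<in> PL1" using matches_arrow_iff[OF _ _ m] c d B bar_0_dm[OF B] by simp
    moreover have "bar_1 \<nu> (pl_id small B) = dm_id (bar_0 \<nu> B)"
      by (rule matches_left_unique[OF _ _ m _ dm_functor[OF d]]) (use c bar_1_matches(1)[OF p] in simp_all)
    ultimately show ?thesis by simp
  qed
  show "pl_comp small g f \<in> PL1 \<and> src (pl_comp small g f) = src f \<and> tgt (pl_comp small g f) = tgt g \<and>
    bar_1 \<nu> (pl_comp small g f) = dm_comp (bar_1 \<nu> g) (bar_1 \<nu> f)"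
    if a: "f \<in> PL1" "g \<in> PL1" "tgt f = src g" for f g :: "('u, 'o, 'a) pl_1"
  proof -
    note m = matches_comp[OF cm[OF a(1)] cm(2)[OF a(2)] bar_1_matches(1)[OF a(1)] _ _ a(3) fn[OF a(1)] fn[OF a(2)]]
    have m: "matches (Bin (src f)) (Bin (tgt g)) (dm_comp (bar_1 \<nu> g) (bar_1 \<nu> f)) (pl_comp small g f)"
      by (rule m) (use a(3) bar_1_matches(1)[OF a(2)] in simp_all)
    have d: "dm_comp (bar_1 \<nu> g) (bar_1 \<nu> f) \<in> DM1"
      using DM.comp1_cell[OF bar_1_matches(2)[OF a(1)] bar_1_matches(2)[OF a(2)]] a(3) by simp
    have p: "pl_comp small g f \<in> PL1"
      using matches_arrow_iff[OF _ _ m] cm[OF a(1)] cm[OF a(2)] d ob[OF a(1)] ob[OF a(2)]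
        bar_0_dm[OF ob(1)[OF a(1)]] bar_0_dm[OF ob(2)[OF a(2)]] by simp
    moreover have "bar_1 \<nu> (pl_comp small g f) = dm_comp (bar_1 \<nu> g) (bar_1 \<nu> f)"
      by (rule matches_left_unique[OF _ _ m _ dm_functor[OF d]]) (use cm[OF a(1)] cm[OF a(2)] bar_1_matches(1)[OF p] in simp_all)
    ultimately show ?thesis by simp
  qed
  show "pl_P small f g \<phi> \<longleftrightarrow> dm_P (bar_1 \<nu> f) (bar_1 \<nu> g) \<phi>"
    if a: "f \<in> PL1" "g \<in> PL1" "src f = src g" "tgt f = tgt g" for f g :: "('u, 'o, 'a) pl_1" and \<phi>
    by (rule sym, rule matches_P[OF cm[OF a(1)] bar_1_matches(1)[OF a(1)]])
      (use bar_1_matches(1)[OF a(2)] fn[OF a(1)] fn[OF a(2)] a(3,4) in simp_all)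
qed

lemma pl_cell_system: "cell_system (PL0 :: ('u, 'o, 'a) pl_0 set) (PL1) (pl_P small) (pl_id small) (pl_comp small)"
  using bar_cell_functor by (rule cell_functor.axioms(1))

text \<open>Right uniqueness of matching yields preservation of identities and composites: each pair
  of 1-cells to be equated shares a partner in DISTMULT.\<close>

lemma Gam_cell_functor:
  "cell_functor (DM0) (DM1) dm_P dm_id dm_comp
    (PL0 :: ('u, 'o, 'a) pl_0 set) (PL1) (pl_P small) (pl_id small) (pl_comp small) (Gam_0 small) (Gam_1 small)"
proof (rule cell_functor.intro[OF dm_cell_system pl_cell_system], rule cell_functor_axioms.intro)
  interpret DM: cell_system "DM0 :: ('o, 'a) dm_0 set" DM1 dm_P dm_id dm_comp by (rule dm_cell_system)
  have cm: "compared (\<Gamma>in (src f)) (src f) (src (Gam_1 small f))" "compared (\<Gamma>in (tgt f)) (tgt f) (tgt (Gam_1 small f))"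
    if "f \<in> DM1" for f :: "('o, 'a) dm_1" using that Gam_compared unfolding dm_arrows_iff Gam_simps by blast+
  show "Gam_0 small A \<in> PL0 \<and> fst (Gam_0 small A) = fst A" if "A \<in> DM0" for A :: "('o, 'a) dm_0"
    using Gam_0_pl[OF that] by simp
  show "Gam_1 small f \<in> PL1 \<and> src (Gam_1 small f) = Gam_0 small (src f) \<and> tgt (Gam_1 small f) = Gam_0 small (tgt f) \<and>
    cell_ftor (Gam_1 small f) = cell_ftor f" if "f \<in> DM1" for f :: "('o, 'a) dm_1"
    using Gam_1_matches(2)[OF that] by simp
  show "Gam_1 small (dm_id A) = pl_id small (Gam_0 small A)" if A: "A \<in> DM0" for A :: "('o, 'a) dm_0"
  proof -
    have d: "dm_id A \<in> DM1" using DM.id1_cell[OF A] by simp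
    show ?thesis
      by (rule matches_right_unique[OF _ _ matches_id[OF Gam_compared[OF A]] _ dm_functor[OF d]])
        (use Gam_1_matches(1)[OF d] Gam_compared[OF A] in simp_all)
  qed
  show "Gam_1 small (dm_comp g f) = pl_comp small (Gam_1 small g) (Gam_1 small f)"
    if a: "f \<in> DM1" "g \<in> DM1" "tgt f = src g" for f g :: "('o, 'a) dm_1"
  proof -
    have d: "dm_comp g f \<in> DM1" using DM.comp1_cell[OF a] by simp
    note m = matches_comp[OF cm[OF a(1)] cm(2)[OF a(2)] Gam_1_matches(1)[OF a(1)] _ a(3) _ dm_functor[OF a(1)] dm_functor[OF a(2)]]
    have m: "matches (\<Gamma>in (src f)) (\<Gamma>in (tgt g)) (dm_comp g f) (pl_comp small (Gam_1 small g) (Gam_1 small f))"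
      by (rule m) (use a(3) Gam_1_matches(1)[OF a(2)] in simp_all)
    show ?thesis
      by (rule matches_right_unique[OF _ _ m _ dm_functor[OF d]]) (use cm[OF a(1)] cm[OF a(2)] Gam_1_matches(1)[OF d] in simp_all)
  qed
  show "pl_P small (Gam_1 small f) (Gam_1 small g) \<phi>"
    if a: "f \<in> DM1" "g \<in> DM1" "src f = src g" "tgt f = tgt g" and p: "dm_P f g \<phi>" for f g :: "('o, 'a) dm_1" and \<phi>
    by (rule iffD1[OF matches_P[OF cm[OF a(1)] Gam_1_matches(1)[OF a(1)]] p])
      (use Gam_1_matches(1)[OF a(2)] dm_functor[OF a(1)] dm_functor[OF a(2)] a(3,4) in simp_all)
qed

section \<open>The 2-categories and 2-functors of the statement as instances of the cell
  systems\<close>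

lemma DISTMULT_Cells: "DISTMULT small = cell_system.Cells (DM0 :: ('o, 'a) dm_0 set) (DM1) dm_P dm_id dm_comp"
proof -
  interpret DM: cell_system "DM0 :: ('o, 'a) dm_0 set" DM1 dm_P dm_id dm_comp by (rule dm_cell_system)
  have "\<alpha> \<in> dm_two_cells small \<longleftrightarrow> \<alpha> \<in> DM.X2" for \<alpha> :: "('o, 'a) dm_2"
  proof (cases \<alpha>)
    case (Cell f g \<phi>)
    then show ?thesis
      by (cases f; cases g; cases "src f"; cases "tgt f"; cases "dat f"; cases "dat g") (auto simp: dm_two_cells_def DM.X2_def)
  qed
  then have "dm_two_cells small = (DM.X2 :: ('o, 'a) dm_2 set)" by blast
  then show ?thesis by (simp add: DISTMULT_def DM.Cells_def)
qed

lemma PLMND_Cells: "PLMND small \<nu> =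
  cell_system.Cells (PL0 :: ('u, 'o, 'a) pl_0 set) (PL1) (pl_P small) (pl_id small) (pl_comp small)"
proof -
  interpret PL: cell_system "PL0 :: ('u, 'o, 'a) pl_0 set" PL1 "pl_P small" "pl_id small" "pl_comp small"
    by (rule pl_cell_system)
  have "\<alpha> \<in> pl_two_cells small \<nu> \<longleftrightarrow> \<alpha> \<in> PL.X2" for \<alpha> :: "('u, 'o, 'a) pl_2"
  proof (cases \<alpha>)
    case (Cell f g \<phi>)
    then show ?thesis
      by (cases f; cases g; cases "src f"; cases "tgt f"; cases "dat f"; cases "dat g") (auto simp: pl_two_cells_def PL.X2_def)
  qed
  then have "pl_two_cells small \<nu> = (PL.X2 :: ('u, 'o, 'a) pl_2 set)" by blast
  then show ?thesis by (simp add: PLMND_def PL.Cells_def)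
qed

lemma Gamma_mk: "Gamma small =
  mk_two_ftor (DISTMULT small :: ('o, 'a) dm_cat) (Gam_0 small) (Gam_1 small)
    (cell_functor.F2 (Gam_1 small :: _ \<Rightarrow> ('u, 'o, 'a) pl_1))"
proof -
  interpret cell_functor "DM0 :: ('o, 'a) dm_0 set" DM1 dm_P dm_id dm_comp
    "PL0 :: ('u, 'o, 'a) pl_0 set" PL1 "pl_P small" "pl_id small" "pl_comp small" "Gam_0 small" "Gam_1 small"
    by (rule Gam_cell_functor)
  have "Gam_2 small \<alpha> = F2 \<alpha>" for \<alpha> by (cases \<alpha>) (simp add: F2_def)
  then have "Gam_2 small = F2" by (rule ext)
  then show ?thesis by (simp only: Gamma_def)
qed

lemma Bar_mk: "Bar small \<nu> =
  mk_two_ftor (PLMND small \<nu> :: ('u, 'o, 'a) pl_cat) (bar_0 \<nu>) (bar_1 \<nu>)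
    (cell_functor.F2 (bar_1 \<nu>))"
proof -
  interpret cell_functor "PL0 :: ('u, 'o, 'a) pl_0 set" PL1 "pl_P small" "pl_id small" "pl_comp small"
    DM0 DM1 dm_P dm_id dm_comp "bar_0 \<nu>" "bar_1 \<nu>"
    by (rule bar_cell_functor)
  have "bar_2 \<nu> \<alpha> = F2 \<alpha>" for \<alpha> by (cases \<alpha>) (simp add: F2_def)
  then have "bar_2 \<nu> = F2" by (rule ext)
  then show ?thesis by (simp only: Bar_def)
qed

text \<open>The choice is among witnesses of \<open>matches_same_monad\<close> for Gamma A, which is
  compared with A by the coproduct inclusions and with bar of Gamma A by the path-like
  cocone.\<close>

definition dm_iso :: "('o, 'a) dm_0 \<Rightarrow> ('o, 'a) dm_1" where
  "dm_iso A = (SOME f. src f = A \<and> tgt f = bar_0 \<nu> (Gam_0 small A) \<and>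
     matches (\<Gamma>in A) (Bin (Gam_0 small A)) f (pl_id small (Gam_0 small A)))"

text \<open>The choice is among witnesses of \<open>matches_same_multitensor\<close> for bar B,
  which is compared with Gamma of bar B and with B.\<close>

definition pl_iso :: "('u, 'o, 'a) pl_0 \<Rightarrow> ('u, 'o, 'a) pl_1" where
  "pl_iso B = (SOME g. src g = Gam_0 small (bar_0 \<nu> B) \<and> tgt g = B \<and>
     matches (\<Gamma>in (bar_0 \<nu> B)) (Bin B) (dm_id (bar_0 \<nu> B)) g)"

lemma dm_unit:
  "two_natural_iso (DISTMULT small :: ('o, 'a) dm_cat) (DISTMULT small)
    (two_fid (DISTMULT small)) (two_fcomp (DISTMULT small) (Bar small \<nu>) (Gamma small)) dm_iso"
proof -
  interpret DM: cell_system "DM0 :: ('o, 'a) dm_0 set" DM1 dm_P dm_id dm_comp by (rule dm_cell_system)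
  interpret PL: cell_system "PL0 :: ('u, 'o, 'a) pl_0 set" PL1 "pl_P small" "pl_id small" "pl_comp small"
    by (rule pl_cell_system)
  note comp = cell_functor_comp[OF Gam_cell_functor bar_cell_functor]
  have iso: "src (dm_iso A) = A" "tgt (dm_iso A) = bar_0 \<nu> (Gam_0 small A)" "dm_iso A \<in> DM1"
    "matches (\<Gamma>in A) (Bin (Gam_0 small A)) (dm_iso A) (pl_id small (Gam_0 small A))"
    "is_iso (under DM.Cells) A (bar_0 \<nu> (Gam_0 small A)) (dm_iso A)"
    if A: "A \<in> DM0" for A :: "('o, 'a) dm_0"
  proof -
    let ?B = "Gam_0 small A :: ('u, 'o, 'a) pl_0" and ?A = "bar_0 \<nu> (Gam_0 small A :: ('u, 'o, 'a) pl_0)"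
    note B = Gam_0_pl[OF A]
    note A' = bar_0_dm[OF B]
    note c = Gam_compared[OF A] and c' = bar_compared[OF B]
    have i: "src (dm_iso A) = A \<and> tgt (dm_iso A) = ?A \<and> matches (\<Gamma>in A) (Bin ?B) (dm_iso A) (pl_id small ?B)"
      unfolding dm_iso_def by (rule someI_ex) (rule matches_same_monad[OF c c'])
    then show st: "src (dm_iso A) = A" "tgt (dm_iso A) = ?A" and m: "matches (\<Gamma>in A) (Bin ?B) (dm_iso A) (pl_id small ?B)"
      by simp_all
    \<comment> \<open>The inverse: the same construction with the two comparisons exchanged.\<close>
    obtain j where j: "src j = ?A" "tgt j = A" "matches (Bin ?B) (\<Gamma>in A) j (pl_id small ?B)"
      using matches_same_monad[OF c' c] by blast
    note p = conjunct1[OF PL.id1_cell[OF B]]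
    show d: "dm_iso A \<in> DM1"
      by (rule iffD2[OF matches_arrow_iff[OF _ _ m] p]) (use st c c' A A' B in simp_all)
    have dj: "j \<in> DM1"
      by (rule iffD2[OF matches_arrow_iff[OF _ _ j(3)] p]) (use j c c' A A' B in simp_all)
    have pp: "pl_comp small (pl_id small ?B) (pl_id small ?B) = pl_id small ?B" using PL.comp1_id(1)[OF p] by simp
    \<comment> \<open>Both composites of the component and j are matched with a composite of
      identities, hence equal identities by left uniqueness.\<close>
    have "matches (\<Gamma>in A) (\<Gamma>in A) (dm_comp j (dm_iso A)) (pl_comp small (pl_id small ?B) (pl_id small ?B))"
      by (rule matches_comp[OF _ _ _ m j(3) _ _ dm_functor[OF d] dm_functor[OF dj]]) (use st j c c' in simp_all)
    then have 1: "dm_comp j (dm_iso A) = dm_id A"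
      by (intro matches_left_unique[OF _ _ matches_id[OF c] _ dm_functor[OF conjunct1[OF DM.id1_cell[OF A]]]])
        (use st j c pp in simp_all)
    have "matches (Bin ?B) (Bin ?B) (dm_comp (dm_iso A) j) (pl_comp small (pl_id small ?B) (pl_id small ?B))"
      by (rule matches_comp[OF _ _ _ j(3) m _ _ dm_functor[OF dj] dm_functor[OF d]]) (use st j c c' in simp_all)
    then have 2: "dm_comp (dm_iso A) j = dm_id ?A"
      by (intro matches_left_unique[OF _ _ matches_id[OF c'] _ dm_functor[OF conjunct1[OF DM.id1_cell[OF A']]]])
        (use st j c' pp in simp_all)
    show "is_iso (under DM.Cells) A ?A (dm_iso A)"
      unfolding is_iso_def by (intro conjI bexI[of _ j]) (use st j(1,2) d dj 1 2 in \<open>simp_all add: hom_iff\<close>)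
  qed
  \<comment> \<open>Both sides of the naturality square are matched with Gamma of f, composed with
    an identity on one side or the other.\<close>
  have nat: "dm_comp (dm_iso (tgt f)) f = dm_comp (bar_1 \<nu> (Gam_1 small f)) (dm_iso (src f))" if f: "f \<in> DM1" for f :: "('o, 'a) dm_1"
  proof -
    let ?g = "Gam_1 small f :: ('u, 'o, 'a) pl_1"
    have A: "src f \<in> DM0" "tgt f \<in> DM0" using f by (simp_all add: dm_arrows_iff)
    note g = Gam_1_matches[OF f]
    note h = bar_1_matches[OF g(2)]
    note i = iso[OF A(1)] and j = iso[OF A(2)]
    note B = Gam_0_pl[OF A(1)] Gam_0_pl[OF A(2)]
    note c = Gam_compared[OF A(1)] Gam_compared[OF A(2)] bar_compared[OF B(1)] bar_compared[OF B(2)]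
    have 1: "matches (\<Gamma>in (src f)) (Bin (tgt ?g)) (dm_comp (dm_iso (tgt f)) f) ?g"
      using matches_comp[OF _ _ _ g(1) j(4) _ _ dm_functor[OF f] dm_functor[OF j(3)]] c j PL.comp1_id(1)[OF g(2)] by simp
    have 2: "matches (\<Gamma>in (src f)) (Bin (tgt ?g)) (dm_comp (bar_1 \<nu> ?g) (dm_iso (src f))) ?g"
      using matches_comp[where r = "Bin (tgt ?g)" and g' = ?g, OF _ _ _ i(4) _ _ _ dm_functor[OF i(3)] dm_functor[OF h(2)]] h(1) c i PL.comp1_id(2)[OF g(2)] by simp
    have d: "dm_comp (bar_1 \<nu> ?g) (dm_iso (src f)) \<in> DM1" using DM.comp1_cell[OF i(3) h(2)] i by simp
    show ?thesis
      by (rule matches_left_unique[OF _ _ 2 1 dm_functor[OF d]]) (use c i j in simp_all)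
  qed
  show ?thesis
    unfolding Gamma_mk Bar_mk
    unfolding DISTMULT_Cells PLMND_Cells comp(2) DM.two_fid_Cells
  proof (rule cell_natural_iso[OF DM.cell_functor_id comp(1)])
    show "cell_ftor (dm_iso A) = fid (fst A)" if "A \<in> DM0" for A :: "('o, 'a) dm_0"
      using matchesD(3)[OF iso(4)[OF that]] by simp
  qed (use iso(5) nat in simp_all)
qed

lemma pl_counit:
  "two_natural_iso (PLMND small \<nu> :: ('u, 'o, 'a) pl_cat) (PLMND small \<nu>)
    (two_fcomp (PLMND small \<nu>) (Gamma small) (Bar small \<nu>)) (two_fid (PLMND small \<nu>)) pl_iso"
proof -
  interpret DM: cell_system "DM0 :: ('o, 'a) dm_0 set" DM1 dm_P dm_id dm_comp by (rule dm_cell_system)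
  interpret PL: cell_system "PL0 :: ('u, 'o, 'a) pl_0 set" PL1 "pl_P small" "pl_id small" "pl_comp small"
    by (rule pl_cell_system)
  note comp = cell_functor_comp[OF bar_cell_functor Gam_cell_functor]
  have iso: "src (pl_iso B) = Gam_0 small (bar_0 \<nu> B)" "tgt (pl_iso B) = B" "pl_iso B \<in> PL1"
    "matches (\<Gamma>in (bar_0 \<nu> B)) (Bin B) (dm_id (bar_0 \<nu> B)) (pl_iso B)"
    "is_iso (under PL.Cells) (Gam_0 small (bar_0 \<nu> B)) B (pl_iso B)"
    if B: "B \<in> PL0" for B :: "('u, 'o, 'a) pl_0"
  proof -
    let ?A = "bar_0 \<nu> B" and ?B = "Gam_0 small (bar_0 \<nu> B) :: ('u, 'o, 'a) pl_0"
    note A = bar_0_dm[OF B]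
    note B' = Gam_0_pl[OF A]
    note c = bar_compared[OF B] and c' = Gam_compared[OF A]
    have i: "src (pl_iso B) = ?B \<and> tgt (pl_iso B) = B \<and> matches (\<Gamma>in ?A) (Bin B) (dm_id ?A) (pl_iso B)"
      unfolding pl_iso_def by (rule someI_ex) (rule matches_same_multitensor[OF c' c])
    then show st: "src (pl_iso B) = ?B" "tgt (pl_iso B) = B" and m: "matches (\<Gamma>in ?A) (Bin B) (dm_id ?A) (pl_iso B)"
      by simp_all
    \<comment> \<open>Again the inverse arises by exchanging the two comparisons; this time right
      uniqueness shows that the composites are identities.\<close>
    obtain j where j: "src j = B" "tgt j = ?B" "matches (Bin B) (\<Gamma>in ?A) (dm_id ?A) j"
      using matches_same_multitensor[OF c c'] by blast
    note d = conjunct1[OF DM.id1_cell[OF A]]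
    note fd = dm_functor[OF d]
    show p: "pl_iso B \<in> PL1"
      by (rule iffD1[OF matches_arrow_iff[OF _ _ m] d]) (use st c c' A B B' in simp_all)
    have pj: "j \<in> PL1"
      by (rule iffD1[OF matches_arrow_iff[OF _ _ j(3)] d]) (use j c c' A B B' in simp_all)
    have dd: "dm_comp (dm_id ?A) (dm_id ?A) = dm_id ?A" using DM.comp1_id(1)[OF d] by simp
    have "matches (\<Gamma>in ?A) (\<Gamma>in ?A) (dm_comp (dm_id ?A) (dm_id ?A)) (pl_comp small j (pl_iso B))"
      by (rule matches_comp[OF _ _ _ m j(3) _ _ fd fd]) (use st j c c' in simp_all)
    then have 1: "pl_comp small j (pl_iso B) = pl_id small ?B"
      by (intro matches_right_unique[OF _ _ matches_id[OF c'] _ fd]) (use st j c' dd in simp_all)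
    have "matches (Bin B) (Bin B) (dm_comp (dm_id ?A) (dm_id ?A)) (pl_comp small (pl_iso B) j)"
      by (rule matches_comp[OF _ _ _ j(3) m _ _ fd fd]) (use st j c c' in simp_all)
    then have 2: "pl_comp small (pl_iso B) j = pl_id small B"
      by (intro matches_right_unique[OF _ _ matches_id[OF c] _ fd]) (use st j c dd in simp_all)
    show "is_iso (under PL.Cells) ?B B (pl_iso B)"
      unfolding is_iso_def by (intro conjI bexI[of _ j]) (use st j(1,2) p pj 1 2 in \<open>simp_all add: hom_iff\<close>)
  qed
  \<comment> \<open>Here both sides of the square are matched with bar of g.\<close>
  have nat: "pl_comp small (pl_iso (tgt g)) (Gam_1 small (bar_1 \<nu> g)) = pl_comp small g (pl_iso (src g))"
    if g: "g \<in> PL1" for g :: "('u, 'o, 'a) pl_1"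
  proof -
    let ?f = "bar_1 \<nu> g"
    have B: "src g \<in> PL0" "tgt g \<in> PL0" using g by (simp_all add: pl_arrows_iff)
    note f = bar_1_matches[OF g]
    note h = Gam_1_matches[OF f(2)]
    note i = iso[OF B(1)] and j = iso[OF B(2)]
    note A = bar_0_dm[OF B(1)] bar_0_dm[OF B(2)]
    note d = conjunct1[OF DM.id1_cell[OF A(1)]] conjunct1[OF DM.id1_cell[OF A(2)]]
    note c = bar_compared[OF B(1)] bar_compared[OF B(2)] Gam_compared[OF A(1)] Gam_compared[OF A(2)]
    have 1: "matches (\<Gamma>in (src ?f)) (Bin (tgt g)) ?f (pl_comp small (pl_iso (tgt g)) (Gam_1 small ?f))"
      using matches_comp[OF _ _ _ h(1) _ _ _ dm_functor[OF f(2)] dm_functor[OF d(2)]] j c DM.comp1_id(1)[OF f(2)] by simp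
    have 2: "matches (\<Gamma>in (src ?f)) (Bin (tgt g)) ?f (pl_comp small g (pl_iso (src g)))"
      using matches_comp[OF _ _ _ i(4) f(1) _ _ dm_functor[OF d(1)] dm_functor[OF f(2)]] i c DM.comp1_id(2)[OF f(2)] by simp
    show ?thesis
      by (rule matches_right_unique[OF _ _ 2 1 dm_functor[OF f(2)]]) (use c i j in simp_all)
  qed
  show ?thesis
    unfolding Gamma_mk Bar_mk
    unfolding DISTMULT_Cells PLMND_Cells comp(2) PL.two_fid_Cells
  proof (rule cell_natural_iso[OF comp(1) PL.cell_functor_id])
    show "cell_ftor (pl_iso B) = fid (fst B)" if "B \<in> PL0" for B :: "('u, 'o, 'a) pl_0"
      using matchesD(3)[OF iso(4)[OF that]] by simp
  qed (use iso(5) nat in simp_all)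
qed

end

theorem corollary6p5:
  fixes small :: "'u set \<Rightarrow> bool" and \<nu> :: "nat \<Rightarrow> 'u"
  assumes "smallness small" and "inj \<nu>"
  shows "two_equivalence
    (DISTMULT small :: (('o, 'a) dm_0, ('o, 'a) dm_1, ('o, 'a) dm_2) two_cat)
    (PLMND small \<nu>) (Gamma small) (Bar small \<nu>)"
proof -
  interpret small_graphs small \<nu> using assms by (intro small_graphs.intro small_graphs_axioms.intro)
  interpret G: cell_functor "DM0 :: ('o, 'a) dm_0 set" DM1 dm_P dm_id dm_comp
    "PL0 :: ('u, 'o, 'a) pl_0 set" PL1 "pl_P small" "pl_id small" "pl_comp small" "Gam_0 small" "Gam_1 small"
    by (rule Gam_cell_functor)
  interpret B: cell_functor "PL0 :: ('u, 'o, 'a) pl_0 set" PL1 "pl_P small" "pl_id small" "pl_comp small"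
    DM0 DM1 dm_P dm_id dm_comp "bar_0 \<nu>" "bar_1 \<nu>"
    by (rule bar_cell_functor)
  have 1: "two_functor (DISTMULT small :: ('o, 'a) dm_cat) (PLMND small \<nu>) (Gamma small)"
    unfolding Gamma_mk unfolding DISTMULT_Cells PLMND_Cells by (rule G.two_functor)
  have 2: "two_functor (PLMND small \<nu>) (DISTMULT small :: ('o, 'a) dm_cat) (Bar small \<nu>)"
    unfolding Bar_mk unfolding DISTMULT_Cells PLMND_Cells by (rule B.two_functor)
  show ?thesis
    unfolding two_equivalence_def
    using 1 2 two_functor.source_two_category[OF 1] two_functor.source_two_category[OF 2] dm_unit pl_counit by blast
qed

end
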